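(* Let $p\ge 2$ be an integer, $d\ge 1$, and let $f:\mathbb{C}\to\mathbb{C}$ be real analytic with $f(0)\ne0$. Let $X\subseteq\{u:\mathbb{T}^d\to\mathbb{C}\}$ be a Banach space of functions such that the inclusion $C^\omega(\mathbb{T}^d,\mathbb{C})\hookrightarrow X$ is a dense, continuous embedding. If $F:X\to\mathbb{R}$ is a real-analytic functional which respects an inequality under the equation $$-iu_t=\triangle u+u^pf(u),\qquad x\in\mathbb{T}^d,$$ that is, for all solutions $u$ of this equation, $$F(u(t))\ge F(u(t+s)),\qquad s\ge 0,\ t\in\mathbb{R},$$ (for those times at which the solution exists), then $F$ is constant.
   Context: $\mathbb{T}^d=\mathbb{R}^d/\frac{2\pi}{\omega}\mathbb{Z}^d$ for a fixed $\omega\in\mathbb{R}^d$ (nonzero entries) is the torus with period $2\pi/\omega_j$ in the $j$-th coordinate. $C^\omega(\mathbb{T}^d,\mathbb{C})$ denotes the space of real-analytic functions $\mathbb{T}^d\to\mathbb{C}$ with its usual topology. "Real analytic $f:\mathbb{C}\to\mathbb{C}$" means that $f$ may be written as a (convergent) power series in $u$ and its complex conjugate $u^*$. (In particular conserved quantities, and functionals monotone along solutions, are covered by the inequality.) Spatially analytic solutions are considered in the weighted Wiener algebras $A_\nu(\mathbb{T}^d)$, $\nu>1$, i.e. functions with $\sum_{k\in\mathbb{Z}^d}|\hat u(k)|\nu^{|k|}<\infty$, $|k|=|k_1|+\dots+|k_d|$, where $\hat u(k)=\frac{1}{\mathrm{vol}(\mathbb{T}^d)}\int_{\mathbb{T}^d}u(x)e^{-i\omega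 kx}dx$; all such functions are real analytic. *)

theory Defs
  imports "HOL-Analysis.Analysis"
begin

section \<open>Real-analytic maps between normed spaces\<close>

text \<open>
  \<open>A\<close> is an \<open>n\<close>-linear map in the arguments \<open>v 0, \<dots>, v (n - 1)\<close>, bounded by the constant \<open>C\<close>;
  the entries of the sequence \<open>v\<close> from index \<open>n\<close> on are irrelevant padding.
\<close>

definition bounded_multilinear ::
    "nat \<Rightarrow> real \<Rightarrow> ((nat \<Rightarrow> 'a::real_normed_vector) \<Rightarrow> 'b::real_normed_vector) \<Rightarrow> bool"
  where "bounded_multilinear n C A \<longleftrightarrow>
    (\<forall>v w. (\<forall>i<n. v i = w i) \<longrightarrow> A v = A w) \<and>
    (\<forall>v. \<forall>i<n. linear (\<lambda>x. A (v(i := x)))) \<and>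
    (\<forall>v. norm (A v) \<le> C * (\<Prod>i<n. norm (v i)))"

text \<open>
  Normally convergent expansion \<open>F (x + h) = (\<Sum>n. A\<^sub>n (h, \<dots>, h))\<close> near each point \<open>x\<close>. Symmetry of the
  \<open>A\<^sub>n\<close> is not required: symmetrizing changes neither the diagonal values nor the bounds.
\<close>

definition real_analytic :: "('a::real_normed_vector \<Rightarrow> 'b::real_normed_vector) \<Rightarrow> bool"
  where "real_analytic F \<longleftrightarrow>
    (\<forall>x. \<exists>A C r. r > 0 \<and> (\<forall>n. bounded_multilinear n (C n) (A n)) \<and>
       summable (\<lambda>n. C n * r ^ n) \<and>
       (\<forall>h. norm h < r \<longrightarrow> (\<lambda>n. A n (\<lambda>_. h)) sums F (x + h)))"

definition power_series_conj :: "(complex \<Rightarrow> complex) \<Rightarrow> bool"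
  where "power_series_conj f \<longleftrightarrow>
    (\<exists>a :: nat \<Rightarrow> nat \<Rightarrow> complex.
       \<forall>u. ((\<lambda>(m, n). a m n * u ^ m * cnj u ^ n) has_sum f u) UNIV)"


section \<open>Functions on the torus\<close>

text \<open>
  Functions on \<open>\<real>\<^sup>d / (2\<pi>/\<omega>) \<int>\<^sup>d\<close> are represented by periodic functions on \<open>\<real>\<^sup>d\<close>, where
  \<open>d = CARD('d)\<close>. The entries of \<open>\<omega>\<close> are nonzero but may be negative, whence the absolute value
  in the fundamental cell.
\<close>

definition torus_fun :: "real ^ 'd \<Rightarrow> (real ^ 'd \<Rightarrow> complex) \<Rightarrow> bool"
  where "torus_fun \<omega> u \<longleftrightarrow> (\<forall>x j. u (x + axis j (2 * pi / \<omega> $ j)) = u x)"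

definition torus_cell :: "real ^ 'd \<Rightarrow> (real ^ 'd) set"
  where "torus_cell \<omega> = cbox 0 (\<chi> j. 2 * pi / \<bar>\<omega> $ j\<bar>)"

definition analytic_torus :: "real ^ 'd \<Rightarrow> (real ^ 'd \<Rightarrow> complex) set"
  where "analytic_torus \<omega> = {u. torus_fun \<omega> u \<and> real_analytic u}"

definition fourier_coeff :: "real ^ 'd \<Rightarrow> (real ^ 'd \<Rightarrow> complex) \<Rightarrow> int ^ 'd \<Rightarrow> complex"
  where "fourier_coeff \<omega> u k =
    (LINT x:torus_cell \<omega>|lborel.
       u x * exp (- \<i> * of_real (\<Sum>j\<in>UNIV. \<omega> $ j * of_int (k $ j) * x $ j)))
    / of_real (measure lborel (torus_cell \<omega>))"

definition l1_weight :: "real \<Rightarrow> int ^ 'd \<Rightarrow> real"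
  where "l1_weight \<nu> k = \<nu> ^ (\<Sum>j\<in>UNIV. nat \<bar>k $ j\<bar>)"

text \<open>
  Fourier coefficients only see a function almost everywhere; continuity selects the
  representative that is the sum of its Fourier series.
\<close>

definition wiener_algebra :: "real ^ 'd \<Rightarrow> real \<Rightarrow> (real ^ 'd \<Rightarrow> complex) set"
  where "wiener_algebra \<omega> \<nu> =
    {u. torus_fun \<omega> u \<and> continuous_on UNIV u \<and>
        (\<lambda>k. norm (fourier_coeff \<omega> u k) * l1_weight \<nu> k) summable_on UNIV}"

definition wiener_norm :: "real ^ 'd \<Rightarrow> real \<Rightarrow> (real ^ 'd \<Rightarrow> complex) \<Rightarrow> real"
  where "wiener_norm \<omega> \<nu> u = (\<Sum>\<^sub>\<infinity>k. norm (fourier_coeff \<omega> u k) * l1_weight \<nu> k)"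


section \<open>The topology of the space of analytic functions\<close>

text \<open>
  The usual topology of \<open>C\<^sup>\<omega>(\<T>\<^sup>d, \<complex>)\<close> is the locally convex inductive limit, as \<open>\<rho> \<rightarrow> 0\<close>, of the
  Banach spaces of functions with a bounded holomorphic extension to the strip of half-width \<open>\<rho>\<close>,
  with the sup norm on the strip. A convex set is a neighbourhood of zero in the limit iff it
  contains a ball of positive radius of each of these spaces.
\<close>

definition strip :: "real \<Rightarrow> (complex ^ 'd) set"
  where "strip \<rho> = {z. \<forall>j. \<bar>Im (z $ j)\<bar> < \<rho>}"

definition holomorphic_vec :: "(complex ^ 'd \<Rightarrow> complex) \<Rightarrow> (complex ^ 'd) set \<Rightarrow> bool"
  where "holomorphic_vec U S \<longleftrightarrow>
    (\<forall>z\<in>S. \<exists>D. (U has_derivative D) (at z) \<and> (\<forall>c v. D (c *s v) = c * D v))"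

definition strip_ball :: "real ^ 'd \<Rightarrow> real \<Rightarrow> real \<Rightarrow> (real ^ 'd \<Rightarrow> complex) set"
  where "strip_ball \<omega> \<rho> \<epsilon> =
    {u \<in> analytic_torus \<omega>. \<exists>U. holomorphic_vec U (strip \<rho>) \<and>
       (\<forall>x. U (\<chi> j. of_real (x $ j)) = u x) \<and> (\<forall>z\<in>strip \<rho>. norm (U z) \<le> \<epsilon>)}"

definition analytic_nbhd_zero :: "real ^ 'd \<Rightarrow> (real ^ 'd \<Rightarrow> complex) set \<Rightarrow> bool"
  where "analytic_nbhd_zero \<omega> V \<longleftrightarrow>
    (\<forall>u\<in>V. \<forall>v\<in>V. \<forall>a\<in>{0..1}. (\<lambda>x. of_real (1 - a) * u x + of_real a * v x) \<in> V) \<and>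
    (\<forall>\<rho>>0. \<exists>\<epsilon>>0. strip_ball \<omega> \<rho> \<epsilon> \<subseteq> V)"

definition analytic_open :: "real ^ 'd \<Rightarrow> (real ^ 'd \<Rightarrow> complex) set \<Rightarrow> bool"
  where "analytic_open \<omega> W \<longleftrightarrow> W \<subseteq> analytic_torus \<omega> \<and>
    (\<forall>u\<in>W. \<exists>V. analytic_nbhd_zero \<omega> V \<and>
       {v \<in> analytic_torus \<omega>. (\<lambda>x. v x - u x) \<in> V} \<subseteq> W)"

definition analytic_topology :: "real ^ 'd \<Rightarrow> (real ^ 'd \<Rightarrow> complex) topology"
  where "analytic_topology \<omega> = topology (analytic_open \<omega>)"

lemma analytic_nbhd_zero_Int:
  assumes V: "analytic_nbhd_zero \<omega> V" and W: "analytic_nbhd_zero \<omega> W"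
  shows "analytic_nbhd_zero \<omega> (V \<inter> W)"
proof -
  have "\<exists>\<epsilon>>0. strip_ball \<omega> \<rho> \<epsilon> \<subseteq> V \<inter> W" if \<rho>: "\<rho> > 0" for \<rho>
  proof -
    have "\<exists>\<epsilon>>0. strip_ball \<omega> \<rho> \<epsilon> \<subseteq> V" "\<exists>\<epsilon>>0. strip_ball \<omega> \<rho> \<epsilon> \<subseteq> W"
      using V W \<rho> by (simp_all add: analytic_nbhd_zero_def)
    then obtain e1 e2 where e: "e1 > 0" "strip_ball \<omega> \<rho> e1 \<subseteq> V" "e2 > 0" "strip_ball \<omega> \<rho> e2 \<subseteq> W"
      by (elim exE conjE)
    have mono: "strip_ball \<omega> \<rho> a \<subseteq> strip_ball \<omega> \<rho> b" if "a \<le> b" for a b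
    proof
      fix u assume "u \<in> strip_ball \<omega> \<rho> a"
      then obtain U where "u \<in> analytic_torus \<omega>" "holomorphic_vec U (strip \<rho>)"
        "\<forall>x. U (\<chi> j. of_real (x $ j)) = u x" "\<forall>z\<in>strip \<rho>. norm (U z) \<le> a"
        unfolding strip_ball_def mem_Collect_eq by (elim exE conjE)
      moreover from this(4) \<open>a \<le> b\<close> have "\<forall>z\<in>strip \<rho>. norm (U z) \<le> b"
        by (auto intro: order_trans)
      ultimately show "u \<in> strip_ball \<omega> \<rho> b"
        unfolding strip_ball_def mem_Collect_eq by (intro conjI exI[of _ U])
    qed
    have "strip_ball \<omega> \<rho> (min e1 e2) \<subseteq> V \<inter> W"
      using order_trans[OF mono[OF min.cobounded1] e(2)] order_trans[OF mono[OF min.cobounded2] e(4)]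
      by (rule Int_greatest)
    then show ?thesis
      using e(1,3) by (intro exI[of _ "min e1 e2"] conjI) simp_all
  qed
  moreover have "\<forall>u\<in>V \<inter> W. \<forall>v\<in>V \<inter> W. \<forall>a\<in>{0..1}.
      (\<lambda>x. of_real (1 - a) * u x + of_real a * v x) \<in> V \<inter> W"
    using V W unfolding analytic_nbhd_zero_def by (metis (no_types, lifting) Int_iff)
  ultimately show ?thesis
    unfolding analytic_nbhd_zero_def by simp
qed

lemma istopology_analytic_open: "istopology (analytic_open \<omega>)"
  unfolding istopology_def
proof (intro conjI allI impI)
  fix S T assume S: "analytic_open \<omega> S" and T: "analytic_open \<omega> T"
  have "\<exists>V. analytic_nbhd_zero \<omega> V \<and>
      {v \<in> analytic_torus \<omega>. (\<lambda>x. v x - u x) \<in> V} \<subseteq> S \<inter> T" if u: "u \<in> S \<inter> T" for u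
  proof -
    have "\<exists>V. analytic_nbhd_zero \<omega> V \<and> {v \<in> analytic_torus \<omega>. (\<lambda>x. v x - u x) \<in> V} \<subseteq> S"
      "\<exists>V. analytic_nbhd_zero \<omega> V \<and> {v \<in> analytic_torus \<omega>. (\<lambda>x. v x - u x) \<in> V} \<subseteq> T"
      using S T u by (simp_all add: analytic_open_def)
    then obtain V W where VW: "analytic_nbhd_zero \<omega> V" "analytic_nbhd_zero \<omega> W"
      "{v \<in> analytic_torus \<omega>. (\<lambda>x. v x - u x) \<in> V} \<subseteq> S"
      "{v \<in> analytic_torus \<omega>. (\<lambda>x. v x - u x) \<in> W} \<subseteq> T"
      by (elim exE conjE)
    have "{v \<in> analytic_torus \<omega>. (\<lambda>x. v x - u x) \<in> V \<inter> W} \<subseteq> S \<inter> T"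
      using VW(3,4) by auto
    then show ?thesis
      using analytic_nbhd_zero_Int[OF VW(1,2)] by (intro exI conjI)
  qed
  moreover have "S \<inter> T \<subseteq> analytic_torus \<omega>"
    using S by (auto simp: analytic_open_def)
  ultimately show "analytic_open \<omega> (S \<inter> T)"
    unfolding analytic_open_def by simp
next
  fix K assume K: "\<forall>S\<in>K. analytic_open \<omega> S"
  have "\<exists>V. analytic_nbhd_zero \<omega> V \<and>
      {v \<in> analytic_torus \<omega>. (\<lambda>x. v x - u x) \<in> V} \<subseteq> \<Union>K" if u: "u \<in> \<Union>K" for u
  proof -
    obtain S where S: "S \<in> K" "u \<in> S"
      using u by (elim UnionE)
    then have "\<exists>V. analytic_nbhd_zero \<omega> V \<and> {v \<in> analytic_torus \<omega>. (\<lambda>x. v x - u x) \<in> V} \<subseteq> S"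
      using K by (simp add: analytic_open_def)
    then show ?thesis
      using Union_upper[OF S(1)] by (meson order_trans)
  qed
  moreover have "\<Union>K \<subseteq> analytic_torus \<omega>"
    using K by (intro Union_least) (simp add: analytic_open_def)
  ultimately show "analytic_open \<omega> (\<Union>K)"
    unfolding analytic_open_def by simp
qed

lemma openin_analytic_topology: "openin (analytic_topology \<omega>) = analytic_open \<omega>"
  unfolding analytic_topology_def by (rule topology_inverse') (rule istopology_analytic_open)

lemma topspace_analytic_topology: "topspace (analytic_topology \<omega>) = analytic_torus \<omega>"
proof -
  have "analytic_nbhd_zero \<omega> UNIV"
    unfolding analytic_nbhd_zero_def by (auto intro: exI[of _ 1])
  then have "analytic_open \<omega> (analytic_torus \<omega>)"
    unfolding analytic_open_def by (intro conjI ballI exI[of _ UNIV]) simp_all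
  moreover have "S \<subseteq> analytic_torus \<omega>" if "analytic_open \<omega> S" for S
    using that by (simp add: analytic_open_def)
  ultimately show ?thesis
    unfolding topspace_def openin_analytic_topology by (intro equalityI) auto
qed


section \<open>Banach spaces of functions on the torus\<close>

text \<open>
  The Banach space \<open>X \<subseteq> {u : \<T>\<^sup>d \<rightarrow> \<complex>}\<close> is \<open>range fn\<close>, with the norm transported from the type
  \<open>'x\<close>: an element \<open>\<xi> :: 'x\<close> is the function \<open>fn \<xi>\<close>, and \<open>inv fn u\<close> is the function \<open>u \<in> X\<close> as an
  element of \<open>'x\<close>. Only the real-linear structure is used, as real analyticity of functionals on
  \<open>X\<close> refers to it.
\<close>

definition torus_function_space ::
    "real ^ 'd \<Rightarrow> ('x::banach \<Rightarrow> real ^ 'd \<Rightarrow> complex) \<Rightarrow> bool"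
  where "torus_function_space \<omega> fn \<longleftrightarrow>
    (\<forall>x. linear (\<lambda>\<xi>. fn \<xi> x)) \<and> inj fn \<and> (\<forall>\<xi>. torus_fun \<omega> (fn \<xi>))"

definition analytic_dense_embedded ::
    "real ^ 'd \<Rightarrow> ('x::banach \<Rightarrow> real ^ 'd \<Rightarrow> complex) \<Rightarrow> bool"
  where "analytic_dense_embedded \<omega> fn \<longleftrightarrow>
    analytic_torus \<omega> \<subseteq> range fn \<and>
    continuous_map (analytic_topology \<omega>) euclidean (inv fn) \<and>
    closure (inv fn ` analytic_torus \<omega>) = UNIV"


section \<open>The nonlinear Schroedinger equation\<close>

definition partial_deriv :: "'d \<Rightarrow> (real ^ 'd \<Rightarrow> complex) \<Rightarrow> real ^ 'd \<Rightarrow> complex"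
  where "partial_deriv j u x = vector_derivative (\<lambda>h. u (x + axis j h)) (at 0)"

definition laplacian :: "(real ^ 'd \<Rightarrow> complex) \<Rightarrow> real ^ 'd \<Rightarrow> complex"
  where "laplacian u x = (\<Sum>j\<in>UNIV. partial_deriv j (partial_deriv j u) x)"

text \<open>
  Spatially analytic solution on the time interval \<open>J\<close>: a continuous curve in some \<open>A\<^sub>\<nu>\<close>, \<open>\<nu> > 1\<close>,
  that satisfies the equation pointwise, with a one-sided time derivative at an endpoint of \<open>J\<close>
  that belongs to \<open>J\<close>.
\<close>

definition nls_solution ::
    "real ^ 'd \<Rightarrow> nat \<Rightarrow> (complex \<Rightarrow> complex) \<Rightarrow> real set \<Rightarrow> (real \<Rightarrow> real ^ 'd \<Rightarrow> complex) \<Rightarrow> bool"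
  where "nls_solution \<omega> p f J u \<longleftrightarrow> is_interval J \<and>
    (\<exists>\<nu>>1. (\<forall>t\<in>J. u t \<in> wiener_algebra \<omega> \<nu>) \<and>
       (\<forall>t\<in>J. ((\<lambda>s. wiener_norm \<omega> \<nu> (\<lambda>x. u s x - u t x)) \<longlongrightarrow> 0) (at t within J))) \<and>
    (\<forall>t\<in>J. \<forall>x. \<exists>ut. ((\<lambda>s. u s x) has_vector_derivative ut) (at t within J) \<and>
       - \<i> * ut = laplacian (u t) x + u t x ^ p * f (u t x))"

end

theory Submission
  imports Defs
begin

text \<open>
  The functional is tested on solutions that are a small perturbation of a small constant. Put
  \<open>a = f 0\<close> and start from \<open>\<epsilon> c + \<epsilon>\<^sup>p z\<close>, where \<open>c\<close> is a complex number and \<open>z\<close> is a function on the torus.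
  Up to the time \<open>T / \<epsilon>\<^sup>p\<^sup>-\<^sup>1\<close> the solution keeps this form up to a relative error \<open>O(\<epsilon>)\<close>. In the slow
  time \<open>s = \<epsilon>\<^sup>p\<^sup>-\<^sup>1 t\<close> the constant moves by \<open>c' = \<i> a c\<^sup>p\<close>, and \<open>z\<close> moves by the linearized equation
  \<open>z' = \<i> a p c\<^sup>p\<^sup>-\<^sup>1 z\<close>, followed by the free Schroedinger flow at time \<open>t\<close>. The two
  motions do not interfere, because \<open>c\<close> does not depend on \<open>x\<close> and so commutes with the free flow
  (\<open>slow_time_solution\<close>). When \<open>z\<close> is a
  trigonometric polynomial, the free flow returns arbitrarily close to the identity at arbitrarily
  late times (\<open>wflow_recurrence\<close>), so \<open>\<epsilon> \<rightarrow> 0\<close> can be taken along times at which it is invisible.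

  Collecting powers of \<open>\<epsilon>\<close> in \<open>F (\<epsilon> c + \<epsilon>\<^sup>p z)\<close> gives a convergent series \<open>F 0 + Q\<^sub>1 (c, z) \<epsilon> + Q\<^sub>2 (c, z) \<epsilon>\<^sup>2 + \<dots>\<close>
  (\<open>real_analytic_graded_expansion\<close>). If \<open>Q\<^sub>1, \<dots>, Q\<^sub>D\<^sub>-\<^sub>1\<close> vanish, then dividing the inequality for \<open>F\<close> by \<open>\<epsilon>\<^sup>D\<close>
  shows that \<open>Q\<^sub>D\<close> does not increase along the slow flow of \<open>(c, z)\<close> (\<open>leading_term_decreases\<close>). This flow is
  explicit: \<open>c\<^sup>1\<^sup>-\<^sup>p\<close> is affine in \<open>s\<close>, and \<open>z\<close> is a fixed function times \<open>c\<^sup>p\<close>. Unless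
  \<open>a c\<^sup>p\<^sup>-\<^sup>1\<close> is purely imaginary, the orbit exists for all \<open>s \<in> \<real>\<close> and tends to \<open>(0, 0)\<close> both for
  \<open>s \<rightarrow> \<infinity>\<close> and for \<open>s \<rightarrow> -\<infinity>\<close>. A nonincreasing function with the same limit \<open>Q\<^sub>D (0, 0) = 0\<close> at both ends
  vanishes, so \<open>Q\<^sub>D\<close> is zero on every such orbit, and by continuity everywhere. Induction on \<open>D\<close>
  yields \<open>all_terms_vanish\<close>: near the zero of \<open>X\<close>, \<open>F\<close> is constant on the functions in the Wiener algebra.

  It remains to leave the Wiener algebra. Fourier coefficients of an analytic function on the torus decay
  exponentially, so trigonometric polynomials are dense in the analytic functions for their
  inductive limit topology (\<open>wiener_dense_in_analytic\<close>), and hence in \<open>X\<close>. By continuity \<open>F\<close> is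
  constant on a ball of \<open>X\<close>, and by analyticity along lines it is constant.

  Solutions are built in the Wiener algebra with weight \<open>2\<close>, represented by coefficient sequences. There the
  free flow acts isometrically and the nonlinearity is locally Lipschitz, so that in the interaction
  picture the equation is an ordinary differential equation without loss of derivatives.
\<close>

section \<open>Graded expansions of real-analytic maps\<close>

text \<open>
  A nonzero vector forces the bound of a multilinear map to be nonnegative. On the trivial
  space the bounds of the maps of positive degree say nothing about their sign, so they are replaced by zero.
\<close>

lemma bounded_multilinear_nonneg_const:
  fixes A :: "nat \<Rightarrow> (nat \<Rightarrow> 'a::real_normed_vector) \<Rightarrow> 'b::real_normed_vector"
  assumes A: "\<And>n. bounded_multilinear n (C n) (A n)" and C: "summable (\<lambda>n. C n * r ^ n)"
  obtains C' where "\<And>n. bounded_multilinear n (C' n) (A n)" "\<And>n. C' n \<ge> 0"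
    "summable (\<lambda>n. C' n * r ^ n)"
proof (cases "\<exists>a::'a. a \<noteq> 0")
  case True
  then obtain a :: 'a where a: "a \<noteq> 0" by blast
  have "C n \<ge> 0" for n
  proof -
    have "0 \<le> C n * (\<Prod>i<n. norm a)"
      using A[of n] unfolding bounded_multilinear_def by (meson norm_ge_zero order_trans)
    moreover have "norm a ^ n > 0"
      using a by simp
    ultimately show ?thesis
      by (auto simp: zero_le_mult_iff)
  qed
  then show ?thesis
    using that[of C] A C by blast
next
  case False
  then have z: "v = 0" for v :: 'a by blast
  define C' :: "nat \<Rightarrow> real" where "C' n = (if n = 0 then C 0 else 0)" for n
  show ?thesis
  proof (rule that[of C'])
    show "bounded_multilinear n (C' n) (A n)" for n
    proof (cases "n = 0")
      case False
      have "norm (A n v) \<le> 0" for v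
      proof -
        have "norm (A n v) \<le> C n * (\<Prod>i<n. norm (v i))"
          using A[of n] unfolding bounded_multilinear_def by blast
        also have "(\<Prod>i<n. norm (v i)) = 0"
          using False z by (auto intro!: prod_zero bexI[of _ 0])
        finally show ?thesis by simp
      qed
      then show ?thesis
        using A[of n] False unfolding bounded_multilinear_def C'_def by simp
    qed (use A[of 0] in \<open>simp add: C'_def\<close>)
    have "norm (A 0 undefined) \<le> C 0"
      using A[of 0] unfolding bounded_multilinear_def by simp
    then have "C 0 \<ge> 0"
      by (meson norm_ge_zero order_trans)
    then show "C' n \<ge> 0" for n
      by (simp add: C'_def)
    have "summable (\<lambda>n. C' n * r ^ n) = summable (\<lambda>n. 0 :: real)"
      by (rule summable_cong) (auto simp: C'_def eventually_sequentially intro!: exI[of _ 1])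
    then show "summable (\<lambda>n. C' n * r ^ n)"
      by simp
  qed
qed

lemma sum_Pow_insert:
  assumes "finite B" "b \<notin> B"
  shows "sum f (Pow (insert b B)) = sum f (Pow B) + (\<Sum>I\<in>Pow B. f (insert b I))"
proof -
  have "sum f (Pow (insert b B)) = sum f (Pow B) + sum f (insert b ` Pow B)"
    unfolding Pow_insert by (rule sum.union_disjoint) (use assms in auto)
  also have "sum f (insert b ` Pow B) = (\<Sum>I\<in>Pow B. f (insert b I))"
    using assms by (subst sum.reindex) (auto simp: inj_on_def insert_ident)
  finally show ?thesis .
qed

lemma multilinear_add_expand:
  assumes A: "bounded_multilinear n C A"
  shows "A (\<lambda>i. x i + y i) = (\<Sum>I\<in>Pow {..<n}. A (\<lambda>i. if i \<in> I then y i else x i))"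
proof -
  have lin: "linear (\<lambda>u. A (v(i := u)))" if "i < n" for v i
    using A that unfolding bounded_multilinear_def by blast
  have "A (\<lambda>i. if i < m then x i + y i else z i) =
      (\<Sum>I\<in>Pow {..<m}. A (\<lambda>i. if i < m then if i \<in> I then y i else x i else z i))"
    if "m \<le> n" for m z
    using that
  proof (induction m arbitrary: z)
    case (Suc m)
    define v where "v = (\<lambda>i. if i < m then x i + y i else z i)"
    have m: "m < n" using Suc.prems by simp
    have "(\<lambda>i. if i < Suc m then x i + y i else z i) = v(m := x m + y m)"
      by (auto simp: v_def fun_eq_iff less_Suc_eq)
    then have "A (\<lambda>i. if i < Suc m then x i + y i else z i) = A (v(m := x m)) + A (v(m := y m))"
      using linear_add[OF lin[OF m]] by simp
    also have "v(m := x m) = (\<lambda>i. if i < m then x i + y i else (z(m := x m)) i)"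
      by (auto simp: v_def fun_eq_iff)
    also have "v(m := y m) = (\<lambda>i. if i < m then x i + y i else (z(m := y m)) i)"
      by (auto simp: v_def fun_eq_iff)
    finally have eq: "A (\<lambda>i. if i < Suc m then x i + y i else z i) =
       (\<Sum>I\<in>Pow {..<m}. A (\<lambda>i. if i < m then if i \<in> I then y i else x i else (z(m := x m)) i)) +
       (\<Sum>I\<in>Pow {..<m}. A (\<lambda>i. if i < m then if i \<in> I then y i else x i else (z(m := y m)) i))"
      using Suc.IH[of "z(m := x m)"] Suc.IH[of "z(m := y m)"] m by simp
    have 1: "A (\<lambda>i. if i < m then if i \<in> I then y i else x i else (z(m := x m)) i) =
        A (\<lambda>i. if i < Suc m then if i \<in> I then y i else x i else z i)" if "I \<in> Pow {..<m}" for I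
      using that by (intro arg_cong[of _ _ A] ext) (auto simp: less_Suc_eq)
    have 2: "A (\<lambda>i. if i < m then if i \<in> I then y i else x i else (z(m := y m)) i) =
        A (\<lambda>i. if i < Suc m then if i \<in> insert m I then y i else x i else z i)" for I
      by (intro arg_cong[of _ _ A] ext) (auto simp: less_Suc_eq)
    show ?case
      unfolding eq lessThan_Suc
      by (subst sum_Pow_insert) (simp_all only: finite_lessThan lessThan_iff less_irrefl 2 1 cong: sum.cong, simp)
  qed simp
  note this[of n y, OF order_refl]
  moreover have "A (\<lambda>i. if i < n then v i else y i) = A v" for v
    by (rule A[unfolded bounded_multilinear_def, THEN conjunct1, rule_format]) simp
  ultimately show ?thesis by simp
qed

text \<open>
  Homogeneity of the mixed terms in the expansion of \<open>A (x + y, \<dots>, x + y)\<close>: the slots in \<open>I\<close>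
  carry the second vector, which may be scaled differently from the first.
\<close>

lemma multilinear_scale_split:
  assumes A: "bounded_multilinear n C A" and I: "I \<subseteq> {..<n}"
  shows "A (\<lambda>i. if i \<in> I then b *\<^sub>R y else a *\<^sub>R x) =
    (a ^ (n - card I) * b ^ card I) *\<^sub>R A (\<lambda>i. if i \<in> I then y else x)"
proof -
  have lin: "linear (\<lambda>u. A (v(i := u)))" if "i < n" for v i
    using A that unfolding bounded_multilinear_def by blast
  define s where "s i = (if i \<in> I then b else a)" for i
  define w where "w i = (if i \<in> I then y else x)" for i
  have "A (\<lambda>i. if i < m then s i *\<^sub>R w i else w i) = (\<Prod>i<m. s i) *\<^sub>R A w" if "m \<le> n" for m
    using that
  proof (induction m)
    case (Suc m)
    define v where "v = (\<lambda>i. if i < m then s i *\<^sub>R w i else w i)"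
    have m: "m < n" using Suc.prems by simp
    have "(\<lambda>i. if i < Suc m then s i *\<^sub>R w i else w i) = v(m := s m *\<^sub>R w m)"
      by (auto simp: v_def fun_eq_iff less_Suc_eq)
    then have "A (\<lambda>i. if i < Suc m then s i *\<^sub>R w i else w i) = s m *\<^sub>R A (v(m := w m))"
      using linear_scale[OF lin[OF m]] by simp
    also have "v(m := w m) = v"
      by (auto simp: v_def fun_eq_iff)
    finally show ?case
      using Suc by (simp add: v_def)
  qed simp
  from this[of n] have "A (\<lambda>i. if i < n then s i *\<^sub>R w i else w i) = (\<Prod>i<n. s i) *\<^sub>R A w" by simp
  moreover have "A (\<lambda>i. if i < n then s i *\<^sub>R w i else w i) = A (\<lambda>i. if i \<in> I then b *\<^sub>R y else a *\<^sub>R x)"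
    by (rule A[unfolded bounded_multilinear_def, THEN conjunct1, rule_format]) (simp add: s_def w_def)
  moreover have "(\<Prod>i<n. s i) = a ^ (n - card I) * b ^ card I"
  proof -
    have "(\<Prod>i<n. s i) = (\<Prod>i\<in>{..<n} - I. s i) * (\<Prod>i\<in>I. s i)"
      using I by (intro prod.subset_diff) auto
    also have "(\<Prod>i\<in>{..<n} - I. s i) = a ^ (n - card I)"
      using I by (simp add: s_def card_Diff_subset finite_subset)
    also have "(\<Prod>i\<in>I. s i) = b ^ card I"
      by (simp add: s_def)
    finally show ?thesis .
  qed
  ultimately show ?thesis
    by (simp add: w_def[abs_def])
qed

lemma sum_Pow_mult_power:
  fixes a b :: real
  shows "(\<Sum>I\<in>Pow {..<n}. a ^ (n - card I) * b ^ card I) = (a + b) ^ n"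
proof -
  have "(a + b) ^ n = (\<Prod>i<n. b + a)" by (simp add: add.commute)
  also have "\<dots> = (\<Sum>I\<in>Pow {..<n}. (\<Prod>i\<in>I. b) * (\<Prod>i\<in>{..<n} - I. a))"
    by (rule prod_add) simp
  also have "\<dots> = (\<Sum>I\<in>Pow {..<n}. a ^ (n - card I) * b ^ card I)"
    by (intro sum.cong) (auto simp: card_Diff_subset finite_subset)
  finally show ?thesis by simp
qed

text \<open>
  Giving the increments \<open>\<xi>\<close> and \<open>\<eta>\<close> the weights \<open>\<alpha>\<close> and \<open>\<beta>\<close>, the expansion at \<open>x\<close> can be sorted by total
  weight. Expanding each multilinear term into its \<open>2\<^sup>n\<close> mixed terms costs nothing in convergence,
  since \<open>\<parallel>\<xi>\<parallel>\<^sup>n\<^sup>-\<^sup>m \<parallel>\<eta>\<parallel>\<^sup>m\<close> summed over all subsets of the slots is \<open>(\<parallel>\<xi>\<parallel> + \<parallel>\<eta>\<parallel>)\<^sup>n\<close>; absolute convergence then permits any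
  regrouping. The bound \<open>K\<close> is uniform, which later makes the error in truncating uniform on bounded sets.
\<close>

theorem real_analytic_graded_expansion:
  fixes F :: "'a::real_normed_vector \<Rightarrow> 'b::banach" and \<alpha> \<beta> :: nat
  assumes F: "real_analytic F"
  obtains r Q K where "r > 0"
    "\<And>\<xi> \<eta> a. norm \<xi> + norm \<eta> < r \<Longrightarrow> \<bar>a\<bar> \<le> 1 \<Longrightarrow>
       (\<lambda>D. a ^ D *\<^sub>R Q D \<xi> \<eta>) sums F (x + a ^ \<alpha> *\<^sub>R \<xi> + a ^ \<beta> *\<^sub>R \<eta>)"
    "\<And>\<xi> \<eta>. norm \<xi> + norm \<eta> < r \<Longrightarrow> summable (\<lambda>D. norm (Q D \<xi> \<eta>)) \<and> (\<Sum>D. norm (Q D \<xi> \<eta>)) \<le> K"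
    "\<And>D a \<xi> \<eta>. Q D (a ^ \<alpha> *\<^sub>R \<xi>) (a ^ \<beta> *\<^sub>R \<eta>) = a ^ D *\<^sub>R Q D \<xi> \<eta>"
proof -
  obtain A C r where r: "r > 0" and A: "\<And>n. bounded_multilinear n (C n) (A n)"
    and C: "summable (\<lambda>n. C n * r ^ n)"
    and F: "\<And>h. norm h < r \<Longrightarrow> (\<lambda>n. A n (\<lambda>_. h)) sums F (x + h)"
    and C0: "\<And>n. C n \<ge> 0"
  proof -
    obtain A C r where *: "r > 0" "\<And>n. bounded_multilinear n (C n) (A n)"
      "summable (\<lambda>n. C n * r ^ n)" "\<And>h. norm h < r \<Longrightarrow> (\<lambda>n. A n (\<lambda>_. h)) sums F (x + h)"
      using F[unfolded real_analytic_def, THEN spec[of _ x]] by (elim exE conjE) (erule that, erule spec, assumption, simp)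
    show ?thesis
      by (rule bounded_multilinear_nonneg_const[OF *(2,3)], rule that[OF *(1) _ _ *(4)])
  qed
  \<comment> \<open>the index \<open>(n, I)\<close> stands for the mixed term of degree \<open>n\<close> with \<open>\<eta>\<close> in the slots of \<open>I\<close>\<close>
  define idx where "idx = Sigma (UNIV :: nat set) (\<lambda>n. Pow {..<n})"
  define T where "T \<xi> \<eta> = (\<lambda>(n, I). A n (\<lambda>i. if i \<in> I then \<eta> else \<xi>))" for \<xi> \<eta>
  \<comment> \<open>total weight of a mixed term\<close>
  define dg where "dg = (\<lambda>(n, I :: nat set). \<alpha> * (n - card I) + \<beta> * card I)"
  define K where "K = (\<Sum>n. C n * r ^ n)"
  define Q where "Q D \<xi> \<eta> = (\<Sum>\<^sub>\<infinity>j\<in>{j\<in>idx. dg j = D}. T \<xi> \<eta> j)" for D \<xi> \<eta>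
  have T_scale: "T (a ^ \<alpha> *\<^sub>R \<xi>) (a ^ \<beta> *\<^sub>R \<eta>) j = a ^ dg j *\<^sub>R T \<xi> \<eta> j" if "j \<in> idx" for a \<xi> \<eta> j
  proof -
    obtain n I where j: "j = (n, I)" "I \<subseteq> {..<n}"
      using \<open>j \<in> idx\<close> by (auto simp: idx_def)
    show ?thesis
      using multilinear_scale_split[OF A j(2), of "a ^ \<beta>" \<eta> "a ^ \<alpha>" \<xi>]
      by (simp add: T_def dg_def j(1) power_mult power_add)
  qed
  have T_norm: "norm (T \<xi> \<eta> (n, I)) \<le> C n * (norm \<xi> ^ (n - card I) * norm \<eta> ^ card I)"
    if "I \<subseteq> {..<n}" for \<xi> \<eta> n I
  proof -
    have "norm (T \<xi> \<eta> (n, I)) \<le> C n * (\<Prod>i<n. norm (if i \<in> I then \<eta> else \<xi>))"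
      using A[of n] unfolding T_def bounded_multilinear_def by simp
    also have "(\<Prod>i<n. norm (if i \<in> I then \<eta> else \<xi>)) =
        (\<Prod>i\<in>{..<n} - I. norm (if i \<in> I then \<eta> else \<xi>)) * (\<Prod>i\<in>I. norm (if i \<in> I then \<eta> else \<xi>))"
      using that by (intro prod.subset_diff) auto
    also have "\<dots> = norm \<xi> ^ (n - card I) * norm \<eta> ^ card I"
      using that by (simp add: card_Diff_subset finite_subset)
    finally show ?thesis .
  qed
  have T_sum: "(\<Sum>I\<in>Pow {..<n}. norm (T \<xi> \<eta> (n, I))) \<le> C n * r ^ n"
    if "norm \<xi> + norm \<eta> < r" for \<xi> \<eta> n
  proof -
    have "(\<Sum>I\<in>Pow {..<n}. norm (T \<xi> \<eta> (n, I))) \<le>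
        (\<Sum>I\<in>Pow {..<n}. C n * (norm \<xi> ^ (n - card I) * norm \<eta> ^ card I))"
      using T_norm by (intro sum_mono) auto
    also have "\<dots> = C n * (norm \<xi> + norm \<eta>) ^ n"
      by (simp flip: sum_distrib_left add: sum_Pow_mult_power)
    also have "\<dots> \<le> C n * r ^ n"
      using that C0 by (intro mult_left_mono power_mono) auto
    finally show ?thesis .
  qed
  have Cs: "(\<lambda>n. C n * r ^ n) summable_on UNIV"
    using C C0 r by (intro summable_nonneg_imp_summable_on) auto
  have T_abs: "(\<lambda>j. norm (T \<xi> \<eta> j)) summable_on idx" and T_K: "(\<Sum>\<^sub>\<infinity>j\<in>idx. norm (T \<xi> \<eta> j)) \<le> K"
    if \<xi>\<eta>: "norm \<xi> + norm \<eta> < r" for \<xi> \<eta>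
  proof -
    have "(\<lambda>n. \<Sum>I\<in>Pow {..<n}. norm (T \<xi> \<eta> (n, I))) summable_on UNIV"
      by (rule summable_on_comparison_test[OF Cs]) (use T_sum[OF \<xi>\<eta>] in \<open>auto intro!: sum_nonneg\<close>)
    then show *: "(\<lambda>j. norm (T \<xi> \<eta> j)) summable_on idx"
      unfolding idx_def Infinite_Sum.abs_summable_on_Sigma_iff
      by (auto simp: abs_of_nonneg sum_nonneg)
    have "(\<Sum>\<^sub>\<infinity>j\<in>idx. norm (T \<xi> \<eta> j)) = (\<Sum>\<^sub>\<infinity>n. \<Sum>I\<in>Pow {..<n}. norm (T \<xi> \<eta> (n, I)))"
      using infsum_Sigma_banach[OF *[unfolded idx_def]] by (simp add: idx_def)
    also have "\<dots> \<le> (\<Sum>\<^sub>\<infinity>n. C n * r ^ n)"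
      by (intro infsum_mono T_sum[OF \<xi>\<eta>] Cs summable_on_comparison_test[OF Cs] sum_nonneg) auto
    also have "\<dots> = K"
      unfolding K_def
      by (intro infsumI norm_summable_imp_has_sum) (use C C0 r in \<open>auto simp: abs_mult summable_sums\<close>)
    finally show "(\<Sum>\<^sub>\<infinity>j\<in>idx. norm (T \<xi> \<eta> j)) \<le> K" .
  qed
  have T_F: "(T \<xi> \<eta> has_sum F (x + \<xi> + \<eta>)) idx" if \<xi>\<eta>: "norm \<xi> + norm \<eta> < r" for \<xi> \<eta>
  proof -
    have s: "T \<xi> \<eta> summable_on idx"
      using T_abs[OF \<xi>\<eta>] by (rule abs_summable_summable)
    have "((\<lambda>n. \<Sum>I\<in>Pow {..<n}. T \<xi> \<eta> (n, I)) has_sum infsum (T \<xi> \<eta>) idx) UNIV"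
      by (rule has_sum_SigmaD[OF has_sum_infsum[OF s, unfolded idx_def], folded idx_def]) auto
    moreover have "(\<Sum>I\<in>Pow {..<n}. T \<xi> \<eta> (n, I)) = A n (\<lambda>_. \<xi> + \<eta>)" for n
      unfolding T_def using multilinear_add_expand[OF A, of n "\<lambda>_. \<xi>" "\<lambda>_. \<eta>"] by simp
    ultimately have "(\<lambda>n. A n (\<lambda>_. \<xi> + \<eta>)) sums infsum (T \<xi> \<eta>) idx"
      by (simp add: has_sum_imp_sums)
    moreover have "(\<lambda>n. A n (\<lambda>_. \<xi> + \<eta>)) sums F (x + (\<xi> + \<eta>))"
      by (rule F) (use \<xi>\<eta> norm_triangle_ineq[of \<xi> \<eta>] in linarith)
    ultimately have "infsum (T \<xi> \<eta>) idx = F (x + \<xi> + \<eta>)"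
      by (metis add.assoc sums_unique2)
    with s show ?thesis by (simp add: has_sum_iff)
  qed
  \<comment> \<open>the same index set, fibred over the total weight\<close>
  define lev where "lev = Sigma (UNIV :: nat set) (\<lambda>D. {j \<in> idx. dg j = D})"
  have bij: "bij_betw snd lev idx"
    by (rule bij_betwI[of _ _ _ "\<lambda>j. (dg j, j)"]) (auto simp: lev_def)
  have Q_scale: "Q D (a ^ \<alpha> *\<^sub>R \<xi>) (a ^ \<beta> *\<^sub>R \<eta>) = a ^ D *\<^sub>R Q D \<xi> \<eta>" for D a \<xi> \<eta>
  proof -
    have "Q D (a ^ \<alpha> *\<^sub>R \<xi>) (a ^ \<beta> *\<^sub>R \<eta>) = (\<Sum>\<^sub>\<infinity>j\<in>{j\<in>idx. dg j = D}. a ^ D *\<^sub>R T \<xi> \<eta> j)"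
      unfolding Q_def by (intro infsum_cong) (auto simp: T_scale)
    then show ?thesis
      by (simp add: Q_def infsum_scaleR_right)
  qed
  have Q_F: "(\<lambda>D. Q D \<xi> \<eta>) sums F (x + \<xi> + \<eta>)" if \<xi>\<eta>: "norm \<xi> + norm \<eta> < r" for \<xi> \<eta>
  proof -
    have "((\<lambda>j. T \<xi> \<eta> (snd j)) has_sum F (x + \<xi> + \<eta>)) lev"
      using T_F[OF \<xi>\<eta>] has_sum_reindex_bij_betw[OF bij] by fast
    then have "((\<lambda>D. Q D \<xi> \<eta>) has_sum F (x + \<xi> + \<eta>)) UNIV"
      unfolding lev_def
    proof (rule has_sum_SigmaD)
      fix D
      have "T \<xi> \<eta> summable_on {j \<in> idx. dg j = D}"
        by (rule summable_on_subset_banach[OF abs_summable_summable[OF T_abs[OF \<xi>\<eta>]]]) auto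
      then show "((\<lambda>y. T \<xi> \<eta> (snd (D, y))) has_sum Q D \<xi> \<eta>) {j \<in> idx. dg j = D}"
        unfolding Q_def by simp
    qed
    then show ?thesis by (rule has_sum_imp_sums)
  qed
  have Q_abs: "summable (\<lambda>D. norm (Q D \<xi> \<eta>)) \<and> (\<Sum>D. norm (Q D \<xi> \<eta>)) \<le> K"
    if \<xi>\<eta>: "norm \<xi> + norm \<eta> < r" for \<xi> \<eta>
  proof -
    define N where "N D = (\<Sum>\<^sub>\<infinity>j\<in>{j\<in>idx. dg j = D}. norm (T \<xi> \<eta> j))" for D
    have abs: "(\<lambda>j. norm (T \<xi> \<eta> j)) summable_on {j\<in>idx. dg j = D}" for D
      by (rule summable_on_subset_banach[OF T_abs[OF \<xi>\<eta>]]) auto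
    have le: "norm (Q D \<xi> \<eta>) \<le> N D" for D
      unfolding Q_def N_def by (rule norm_infsum_bound[OF abs])
    have "((\<lambda>j. norm (T \<xi> \<eta> (snd j))) has_sum (\<Sum>\<^sub>\<infinity>j\<in>idx. norm (T \<xi> \<eta> j))) lev"
      using has_sum_reindex_bij_betw[OF bij, of "\<lambda>j. norm (T \<xi> \<eta> j)"] has_sum_infsum[OF T_abs[OF \<xi>\<eta>]]
      by fast
    then have "(N has_sum (\<Sum>\<^sub>\<infinity>j\<in>idx. norm (T \<xi> \<eta> j))) UNIV"
      unfolding lev_def
      by (rule has_sum_SigmaD) (use abs in \<open>simp add: N_def\<close>)
    then have N: "N sums (\<Sum>\<^sub>\<infinity>j\<in>idx. norm (T \<xi> \<eta> j))"
      by (rule has_sum_imp_sums)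
    have s: "summable (\<lambda>D. norm (Q D \<xi> \<eta>))"
      by (rule summable_comparison_test'[OF sums_summable[OF N], of 0]) (use le in simp)
    have "(\<Sum>D. norm (Q D \<xi> \<eta>)) \<le> suminf N"
      by (rule suminf_le[OF le s sums_summable[OF N]])
    then show ?thesis
      using s sums_unique[OF N] T_K[OF \<xi>\<eta>] by simp
  qed
  show ?thesis
  proof (rule that[OF r _ Q_abs Q_scale])
    fix \<xi> \<eta> :: 'a and a :: real
    assume \<xi>\<eta>: "norm \<xi> + norm \<eta> < r" and a: "\<bar>a\<bar> \<le> 1"
    have "\<bar>a\<bar> ^ k * norm v \<le> norm v" for k and v :: 'a
      using a by (intro mult_left_le_one_le power_le_one) auto
    then have "norm (a ^ \<alpha> *\<^sub>R \<xi>) \<le> norm \<xi>" "norm (a ^ \<beta> *\<^sub>R \<eta>) \<le> norm \<eta>"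
      by (simp_all add: power_abs)
    with \<xi>\<eta> have "norm (a ^ \<alpha> *\<^sub>R \<xi>) + norm (a ^ \<beta> *\<^sub>R \<eta>) < r"
      by linarith
    from Q_F[OF this] show "(\<lambda>D. a ^ D *\<^sub>R Q D \<xi> \<eta>) sums F (x + a ^ \<alpha> *\<^sub>R \<xi> + a ^ \<beta> *\<^sub>R \<eta>)"
      by (simp add: Q_scale)
  qed auto
qed

text \<open>
  Taking both weights equal to one gives a power series in \<open>a\<close> along each ray, whose coefficients are
  bounded uniformly in the direction; the difference quotient at \<open>x\<close> is therefore bounded.
\<close>

lemma real_analytic_imp_continuous:
  fixes F :: "'a::real_normed_vector \<Rightarrow> 'b::banach"
  assumes F: "real_analytic F"
  shows "isCont F x"
proof (rule real_analytic_graded_expansion[OF F, of x 1 1])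
  fix r :: real and Q :: "nat \<Rightarrow> 'a \<Rightarrow> 'a \<Rightarrow> 'b" and K :: real
  assume r: "r > 0"
    and Q: "\<And>\<xi> \<eta> a. norm \<xi> + norm \<eta> < r \<Longrightarrow> \<bar>a\<bar> \<le> 1 \<Longrightarrow>
       (\<lambda>D. a ^ D *\<^sub>R Q D \<xi> \<eta>) sums F (x + a ^ 1 *\<^sub>R \<xi> + a ^ 1 *\<^sub>R \<eta>)"
    and K: "\<And>\<xi> \<eta>. norm \<xi> + norm \<eta> < r \<Longrightarrow> summable (\<lambda>D. norm (Q D \<xi> \<eta>)) \<and> (\<Sum>D. norm (Q D \<xi> \<eta>)) \<le> K"
  have bound: "norm (F (x + a *\<^sub>R \<xi>) - F x) \<le> a * K" if \<xi>: "norm \<xi> < r" and a: "0 \<le> a" "a \<le> 1" for \<xi> a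
  proof -
    have KQ: "summable (\<lambda>D. norm (Q D \<xi> 0))" "(\<Sum>D. norm (Q D \<xi> 0)) \<le> K"
      using K[of \<xi> 0] \<xi> by auto
    have s1: "(\<lambda>D. a ^ D *\<^sub>R Q D \<xi> 0) sums F (x + a *\<^sub>R \<xi>)"
      using Q[of \<xi> 0 a] \<xi> a by simp
    have s2: "(\<lambda>D. 0 ^ D *\<^sub>R Q D \<xi> 0) sums F x"
      using Q[of \<xi> 0 0] \<xi> by simp
    have le: "norm (a ^ D *\<^sub>R Q D \<xi> 0 - 0 ^ D *\<^sub>R Q D \<xi> 0) \<le> a * norm (Q D \<xi> 0)" for D
    proof (cases D)
      case (Suc m)
      have "a ^ m \<le> 1" using a by (simp add: power_le_one)
      then have "a * a ^ m \<le> a" using a by (simp add: mult_left_le)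
      then show ?thesis using a by (simp add: Suc mult_right_mono abs_mult)
    qed (use a in simp)
    have "norm (F (x + a *\<^sub>R \<xi>) - F x) = norm (\<Sum>D. a ^ D *\<^sub>R Q D \<xi> 0 - 0 ^ D *\<^sub>R Q D \<xi> 0)"
      using sums_unique[OF sums_diff[OF s1 s2]] by simp
    also have "\<dots> \<le> (\<Sum>D. a * norm (Q D \<xi> 0))"
      by (rule norm_suminf_le[OF le summable_mult[OF KQ(1)]])
    also have "\<dots> = a * (\<Sum>D. norm (Q D \<xi> 0))"
      by (rule suminf_mult[OF KQ(1)])
    also have "\<dots> \<le> a * K" using KQ a by (intro mult_left_mono) auto
    finally show ?thesis .
  qed
  have K0: "K \<ge> 0" using bound[of 0 1] r by simp
  \<comment> \<open>\<open>y\<close> lies between \<open>x\<close> and the point at distance \<open>r / 2\<close> in the same direction\<close>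
  have lip: "norm (F y - F x) \<le> 2 * K / r * norm (y - x)" if y: "dist y x < r / 2" for y
  proof (cases "y = x")
    case False
    define n where "n = norm (y - x)"
    have n: "n > 0" "n < r / 2" using False y by (auto simp: n_def dist_norm)
    have "norm (F (x + (2 * n / r) *\<^sub>R ((r / (2 * n)) *\<^sub>R (y - x))) - F x) \<le> 2 * n / r * K"
    proof (rule bound)
      show "norm ((r / (2 * n)) *\<^sub>R (y - x)) < r"
        using n r by (simp add: n_def[symmetric])
    qed (use n r in auto)
    also have "x + (2 * n / r) *\<^sub>R ((r / (2 * n)) *\<^sub>R (y - x)) = y"
      using n r by simp
    finally show ?thesis by (simp add: n_def mult_ac)
  qed simp
  have "((\<lambda>y. norm (F y - F x)) \<longlongrightarrow> 0) (at x)"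
  proof (rule Lim_null_comparison)
    have ev: "eventually (\<lambda>y. dist y x < r / 2) (at x)"
      using r by (intro eventually_at_ball'[THEN eventually_mono, of "r/2"]) (auto simp: dist_commute)
    show "\<forall>\<^sub>F y in at x. norm (norm (F y - F x)) \<le> 2 * K / r * norm (y - x)"
      using ev by eventually_elim (drule lip, simp)
    show "((\<lambda>y. 2 * K / r * norm (y - x)) \<longlongrightarrow> 0) (at x)"
      using r by (auto intro!: tendsto_eq_intros)
  qed
  then show ?thesis
    unfolding isCont_def by (simp add: tendsto_norm_zero_iff LIM_zero_iff)
qed

section \<open>Identity theorems\<close>

text \<open>
  If all lower coefficients vanish, dividing the series by \<open>z\<^sup>m\<close> at its small zeros leaves
  \<open>a\<^sub>m = O(z)\<close>.
\<close>

lemma real_power_series_eq_0: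
  fixes a :: "nat \<Rightarrow> 'a::banach"
  assumes \<rho>: "\<rho> > 0" and sum: "summable (\<lambda>n. \<rho> ^ n * norm (a n))"
    and zero: "\<And>e. e > 0 \<Longrightarrow> \<exists>z. z \<noteq> 0 \<and> \<bar>z\<bar> < e \<and> (\<lambda>n. z ^ n *\<^sub>R a n) sums 0"
  shows "a m = 0"
proof (induction m rule: less_induct)
  case (less m)
  define K where "K = (\<Sum>n. \<rho> ^ n * norm (a n))"
  have bound: "norm (a m) \<le> \<bar>z\<bar> * (K / \<rho> ^ Suc m)"
    if z: "z \<noteq> 0" "\<bar>z\<bar> < \<rho>" and s: "(\<lambda>n. z ^ n *\<^sub>R a n) sums 0" for z
  proof -
    define b where "b n = z ^ n *\<^sub>R a n - (if n = m then z ^ m *\<^sub>R a m else 0)" for n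
    have b: "b sums (0 - z ^ m *\<^sub>R a m)"
      unfolding b_def by (intro sums_diff s) (use sums_single[of m "\<lambda>_. z ^ m *\<^sub>R a m"] in simp)
    have le: "norm (b n) \<le> (\<bar>z\<bar> / \<rho>) ^ Suc m * (\<rho> ^ n * norm (a n))" for n
    proof (cases "n \<le> m")
      case True
      then have "b n = 0" using less[of n] by (cases "n = m") (auto simp: b_def)
      then show ?thesis using \<rho> by simp
    next
      case False
      have "\<bar>z\<bar> ^ n = (\<bar>z\<bar> / \<rho>) ^ n * \<rho> ^ n"
        using \<rho> by (simp add: power_divide)
      also have "\<dots> \<le> (\<bar>z\<bar> / \<rho>) ^ Suc m * \<rho> ^ n"
        using \<rho> z False by (intro mult_right_mono power_decreasing) auto
      finally have "\<bar>z\<bar> ^ n * norm (a n) \<le> (\<bar>z\<bar> / \<rho>) ^ Suc m * \<rho> ^ n * norm (a n)"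
        by (rule mult_right_mono) simp
      then show ?thesis using False by (simp add: b_def power_abs mult.assoc)
    qed
    have "norm (0 - z ^ m *\<^sub>R a m) \<le> (\<Sum>n. (\<bar>z\<bar> / \<rho>) ^ Suc m * (\<rho> ^ n * norm (a n)))"
      using norm_suminf_le[OF le summable_mult[OF sum]] sums_unique[OF b] by simp
    also have "\<dots> = (\<bar>z\<bar> / \<rho>) ^ Suc m * K"
      unfolding K_def by (rule suminf_mult[OF sum])
    finally have "\<bar>z\<bar> ^ m * norm (a m) \<le> \<bar>z\<bar> ^ m * (\<bar>z\<bar> * (K / \<rho> ^ Suc m))"
      by (simp add: power_divide power_abs mult_ac)
    then show ?thesis
      by (rule mult_left_le_imp_le) (use z(1) in simp)
  qed
  have K: "K \<ge> 0"
    unfolding K_def using \<rho> by (intro suminf_nonneg[OF sum]) auto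
  show "a m = 0"
  proof (rule ccontr)
    assume "a m \<noteq> 0"
    define c where "c = K / \<rho> ^ Suc m + 1"
    have c: "c > 0" "K / \<rho> ^ Suc m \<le> c"
      using K \<rho> by (auto simp: c_def intro!: add_nonneg_pos)
    have "min \<rho> (norm (a m) / c) > 0"
      using c \<rho> \<open>a m \<noteq> 0\<close> by simp
    from zero[OF this] obtain z where z: "z \<noteq> 0" "\<bar>z\<bar> < \<rho>" "\<bar>z\<bar> < norm (a m) / c"
      "(\<lambda>n. z ^ n *\<^sub>R a n) sums 0" by auto
    have "norm (a m) \<le> \<bar>z\<bar> * c"
      using bound[OF z(1,2,4)] c(2) by (meson abs_ge_zero mult_left_mono order_trans)
    then show False
      using z(3) c(1) by (simp add: pos_less_divide_eq)
  qed
qed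

text \<open>
  Restricted to the line through \<open>0\<close> and \<open>\<xi>\<close>, the set of parameters around which \<open>F\<close> equals \<open>c\<close> is open by
  definition, and closed by the identity theorem for power series.
\<close>

lemma real_analytic_constant_if_locally_constant:
  fixes F :: "'a::real_normed_vector \<Rightarrow> real"
  assumes F: "real_analytic F" and r: "r > 0" and c: "\<And>\<xi>. norm \<xi> < r \<Longrightarrow> F \<xi> = c"
  shows "F \<xi> = c"
proof -
  define g where "g t = F (t *\<^sub>R \<xi>)" for t
  define S where "S = {t. \<exists>e>0. \<forall>s. \<bar>s - t\<bar> < e \<longrightarrow> g s = c}"
  have "open S"
    unfolding open_dist
  proof
    fix t assume "t \<in> S"
    then obtain e where e: "e > 0" "\<And>s. \<bar>s - t\<bar> < e \<Longrightarrow> g s = c" by (auto simp: S_def)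
    have "y \<in> S" if "dist y t < e / 2" for y
      unfolding S_def mem_Collect_eq
    proof (intro exI[of _ "e/2"] conjI allI impI e(2))
      show "\<bar>s - t\<bar> < e" if "\<bar>s - y\<bar> < e / 2" for s
        using that \<open>dist y t < e / 2\<close> unfolding dist_real_def by linarith
    qed (use e(1) in simp)
    then show "\<exists>e>0. \<forall>y. dist y t < e \<longrightarrow> y \<in> S"
      using e(1) by (intro exI[of _ "e/2"]) auto
  qed
  moreover have "closed S"
    unfolding closed_limpt
  proof (intro allI impI)
    fix t assume lim: "t islimpt S"
    show "t \<in> S"
    proof (rule real_analytic_graded_expansion[OF F, of "t *\<^sub>R \<xi>" 1 1])
      fix r K :: real and Q :: "nat \<Rightarrow> 'a \<Rightarrow> 'a \<Rightarrow> real"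
      assume r: "r > 0"
        and Q: "\<And>\<xi>' \<eta> a. norm \<xi>' + norm \<eta> < r \<Longrightarrow> \<bar>a\<bar> \<le> 1 \<Longrightarrow>
          (\<lambda>D. a ^ D *\<^sub>R Q D \<xi>' \<eta>) sums F (t *\<^sub>R \<xi> + a ^ 1 *\<^sub>R \<xi>' + a ^ 1 *\<^sub>R \<eta>)"
        and K: "\<And>\<xi>' \<eta>. norm \<xi>' + norm \<eta> < r \<Longrightarrow> summable (\<lambda>D. norm (Q D \<xi>' \<eta>)) \<and> (\<Sum>D. norm (Q D \<xi>' \<eta>)) \<le> K"
      define d where "d = r / (2 * (norm \<xi> + 1))"
      have pos: "norm \<xi> + 1 > 0"
        using norm_ge_zero[of \<xi>] by linarith
      then have d: "d > 0" unfolding d_def using r by simp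
      have "norm \<xi> < 2 * (norm \<xi> + 1)"
        using norm_ge_zero[of \<xi>] unfolding distrib_left by linarith
      then have "d * norm \<xi> < d * (2 * (norm \<xi> + 1))"
        using d by (rule mult_strict_left_mono)
      also have "\<dots> = r"
        using pos unfolding d_def by (metis less_irrefl mult_eq_0_iff nonzero_eq_divide_eq zero_neq_numeral)
      finally have nd: "norm (d *\<^sub>R \<xi>) < r"
        using d by simp
      define b where "b D = Q D (d *\<^sub>R \<xi>) 0" for D
      have b: "(\<lambda>D. b D * a ^ D) sums g (t + a * d)" if "\<bar>a\<bar> \<le> 1" for a
        using Q[of "d *\<^sub>R \<xi>" 0 a] nd that by (simp add: b_def g_def algebra_simps)
      \<comment> \<open>coefficients of \<open>g - c\<close> at \<open>t\<close>, in units of \<open>d\<close>\<close>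
      define b' where "b' D = (if D = 0 then b 0 - c else b D)" for D
      have b': "(\<lambda>D. a ^ D *\<^sub>R b' D) sums (g (t + a * d) - c)" if "\<bar>a\<bar> \<le> 1" for a
      proof -
        have "(\<lambda>D. b D * a ^ D - (if D = 0 then c else 0)) sums (g (t + a * d) - c)"
          by (intro sums_diff b that) (use sums_single[of 0 "\<lambda>_. c"] in simp)
        also have "(\<lambda>D. b D * a ^ D - (if D = 0 then c else 0)) = (\<lambda>D. a ^ D *\<^sub>R b' D)"
          by (auto simp: b'_def)
        finally show ?thesis .
      qed
      have "b' m = 0" for m
      proof (rule real_power_series_eq_0[of 1 b'])
        have "summable (\<lambda>D. norm (b D))"
          using K[of "d *\<^sub>R \<xi>" 0] nd by (simp add: b_def[abs_def])
        then show "summable (\<lambda>D. 1 ^ D * norm (b' D))"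
          by (rule summable_comparison_test'[of _ 1]) (simp add: b'_def)
        fix e :: real assume e: "e > 0"
        obtain y where y: "y \<in> S" "y \<noteq> t" "dist y t < min e 1 * d"
          using lim e d unfolding islimpt_approachable by (metis mult_pos_pos min_less_iff_conj zero_less_one)
        define z where "z = (y - t) / d"
        have z: "z \<noteq> 0" "\<bar>z\<bar> < min e 1"
          using y d unfolding z_def dist_real_def abs_divide by (simp, simp only: abs_of_pos pos_divide_less_eq)
        have "g y = c" using y(1) by (auto simp: S_def)
        then have "(\<lambda>D. z ^ D *\<^sub>R b' D) sums 0"
          using b'[of z] z d by (simp add: z_def)
        with z show "\<exists>z. z \<noteq> 0 \<and> \<bar>z\<bar> < e \<and> (\<lambda>D. z ^ D *\<^sub>R b' D) sums 0" by auto
      qed simp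
      then have "g (t + a * d) = c" if "\<bar>a\<bar> \<le> 1" for a
        using sums_unique2[OF b'[OF that], of 0] by simp
      from this[of "(s - t) / d" for s] d have "g s = c" if "\<bar>s - t\<bar> < d" for s
        using that by (simp add: field_simps)
      then show "t \<in> S" using d by (auto simp: S_def)
    qed
  qed
  moreover have "0 \<in> S"
  proof -
    have "g s = c" if "\<bar>s\<bar> < r / (norm \<xi> + 1)" for s
    proof -
      have "norm (s *\<^sub>R \<xi>) \<le> \<bar>s\<bar> * (norm \<xi> + 1)"
        by (simp add: mult_left_mono)
      also have "\<dots> < r"
        using that by (simp add: pos_less_divide_eq add_nonneg_pos)
      finally show ?thesis unfolding g_def by (rule c)
    qed
    moreover have "r / (norm \<xi> + 1) > 0"
      using r by (intro divide_pos_pos add_nonneg_pos) auto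
    ultimately show ?thesis unfolding S_def by auto
  qed
  ultimately have "S = UNIV"
    using clopen by blast
  then have "g 1 = c"
    by (auto simp: S_def set_eq_iff dest!: spec[of _ 1])
  then show ?thesis by (simp add: g_def)
qed

section \<open>Ordinary differential equations on short time intervals\<close>

text \<open>
  Picard iteration for a vector field that vanishes at \<open>0\<close> and is Lipschitz on the ball of radius \<open>R\<close>. Assuming
  \<open>L T \<le> 1/2\<close> makes the integral operator a contraction with factor \<open>1/2\<close>, and together with
  \<open>\<parallel>v\<^sub>0\<parallel> \<le> R/2\<close> it maps the ball to itself, so the solution never leaves the region where the field is controlled.
\<close>

lemma ode_solution_exists:
  fixes H :: "real \<Rightarrow> 'a::banach \<Rightarrow> 'a"
  assumes T: "0 \<le> T" and L: "0 \<le> L" "L * T \<le> 1 / 2"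
    and cont: "\<And>v. continuous_on {0..T} v \<Longrightarrow> (\<And>s. s \<in> {0..T} \<Longrightarrow> norm (v s) \<le> R) \<Longrightarrow>
      continuous_on {0..T} (\<lambda>s. H s (v s))"
    and lip: "\<And>s x y. s \<in> {0..T} \<Longrightarrow> norm x \<le> R \<Longrightarrow> norm y \<le> R \<Longrightarrow> norm (H s x - H s y) \<le> L * norm (x - y)"
    and H0: "\<And>s. s \<in> {0..T} \<Longrightarrow> H s 0 = 0" and v0: "2 * norm v0 \<le> R"
  obtains v where "v 0 = v0" "\<And>s. s \<in> {0..T} \<Longrightarrow> norm (v s) \<le> R"
    "\<And>s. s \<in> {0..T} \<Longrightarrow> (v has_vector_derivative H s (v s)) (at s within {0..T})"
proof -
  have R: "R \<ge> 0"
    using v0 norm_ge_zero[of v0] by linarith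
  \<comment> \<open>curves are extended constantly outside \<open>[0, T]\<close>, to work in the Banach space of bounded continuous functions on \<open>\<real>\<close>\<close>
  define cl where "cl s = max 0 (min T s)" for s :: real
  have cl: "cl s \<in> {0..T}" "continuous_on A cl" for s A
    using T by (auto simp: cl_def[abs_def] intro!: continuous_intros)
  have cl_id: "cl s = s" if "s \<in> {0..T}" for s
    using that by (auto simp: cl_def)
  define S where "S = (PiC UNIV (\<lambda>_. cball 0 R) :: (real \<Rightarrow>\<^sub>C 'a) set)"
  define J where "J w s = v0 + integral {0..cl s} (\<lambda>\<sigma>. H \<sigma> (apply_bcontfun w \<sigma>))" for w s
  have S: "norm (apply_bcontfun w s) \<le> R" if "w \<in> S" for w s
    using that by (auto simp: S_def mem_PiC_iff)
  have contH: "continuous_on {0..T} (\<lambda>\<sigma>. H \<sigma> (apply_bcontfun w \<sigma>))" if "w \<in> S" for w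
    by (intro cont S that) auto
  have intH: "(\<lambda>\<sigma>. H \<sigma> (apply_bcontfun w \<sigma>)) integrable_on {0..cl s}" if "w \<in> S" for w s
    by (intro integrable_continuous_real continuous_on_subset[OF contH[OF that]]) (use cl(1)[of s] in auto)
  have bound: "norm (integral {0..cl s} h) \<le> B * T"
    if "h integrable_on {0..cl s}" "B \<ge> 0" "\<And>\<sigma>. \<sigma> \<in> {0..T} \<Longrightarrow> norm (h \<sigma>) \<le> B" for h :: "real \<Rightarrow> 'a" and B s
  proof -
    have "norm (integral {0..cl s} h) \<le> B * measure lborel (cbox 0 (cl s))"
      by (rule has_integral_bound[OF that(2), of h])
        (use that cl(1)[of s] integrable_integral in \<open>auto\<close>)
    also have "\<dots> \<le> B * T"
      using cl(1)[of s] that(2) by (intro mult_left_mono) auto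
    finally show ?thesis .
  qed
  have J_le: "norm (J w s) \<le> R" if w: "w \<in> S" for w s
  proof -
    have "norm (H \<sigma> (apply_bcontfun w \<sigma>)) \<le> L * R" if "\<sigma> \<in> {0..T}" for \<sigma>
    proof -
      have "norm (H \<sigma> (apply_bcontfun w \<sigma>) - H \<sigma> 0) \<le> L * norm (apply_bcontfun w \<sigma> - 0)"
        using S[OF w] R that by (intro lip) auto
      also have "\<dots> \<le> L * R" using S[OF w] L by (auto intro: mult_left_mono)
      finally show ?thesis using H0[OF that] by simp
    qed
    from bound[OF intH[OF w] _ this, of s] have "norm (integral {0..cl s} (\<lambda>\<sigma>. H \<sigma> (apply_bcontfun w \<sigma>))) \<le> L * R * T"
      using L R by simp
    also have "\<dots> \<le> R / 2"
      using mult_right_mono[OF L(2) R] by (simp add: mult_ac)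
    finally show ?thesis
      using v0 norm_triangle_ineq[of v0 "integral {0..cl s} (\<lambda>\<sigma>. H \<sigma> (apply_bcontfun w \<sigma>))"] unfolding J_def by simp
  qed
  have J_bc: "J w \<in> bcontfun" if w: "w \<in> S" for w
  proof -
    have "continuous_on {0..T} (\<lambda>s. integral {0..s} (\<lambda>\<sigma>. H \<sigma> (apply_bcontfun w \<sigma>)))"
      by (intro indefinite_integral_continuous_1 integrable_continuous_real contH w)
    then have "continuous_on UNIV (\<lambda>s. integral {0..cl s} (\<lambda>\<sigma>. H \<sigma> (apply_bcontfun w \<sigma>)))"
      by (rule continuous_on_compose2) (use cl in auto)
    then have "continuous_on UNIV (J w)"
      unfolding J_def[abs_def] by (intro continuous_intros)
    moreover have "bounded (range (J w))"
      using J_le[OF w] by (auto simp: bounded_iff)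
    ultimately show ?thesis by (simp add: bcontfun_def)
  qed
  define P where "P w = Bcontfun (J w)" for w
  have P: "apply_bcontfun (P w) = J w" if "w \<in> S" for w
    using J_bc[OF that] by (simp add: P_def Bcontfun_inverse)
  have "\<exists>!w\<in>S. P w = w"
  proof (rule Banach_fix[of S "1/2" P])
    show "complete S"
      unfolding complete_eq_closed S_def by (rule closed_PiC) auto
    have "const_bcontfun 0 \<in> S"
      using R by (simp add: S_def mem_PiC_iff const_bcontfun.rep_eq Pi_iff)
    then show "S \<noteq> {}" by blast
    show "P ` S \<subseteq> S"
      using J_le by (auto simp: S_def[of] mem_PiC_iff P)
    show "dist (P x) (P y) \<le> 1 / 2 * dist x y" if x: "x \<in> S" and y: "y \<in> S" for x y
    proof (rule dist_bound)
      fix s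
      have "norm (H \<sigma> (apply_bcontfun x \<sigma>) - H \<sigma> (apply_bcontfun y \<sigma>)) \<le> L * dist x y" if "\<sigma> \<in> {0..T}" for \<sigma>
      proof -
        have "norm (H \<sigma> (apply_bcontfun x \<sigma>) - H \<sigma> (apply_bcontfun y \<sigma>)) \<le> L * norm (apply_bcontfun x \<sigma> - apply_bcontfun y \<sigma>)"
          using S x y that by (intro lip) auto
        also have "\<dots> \<le> L * dist x y"
          using L dist_bounded[of x \<sigma> y] by (intro mult_left_mono) (auto simp: dist_norm)
        finally show ?thesis .
      qed
      from bound[OF integrable_diff[OF intH[OF x] intH[OF y]] _ this, of s]
      have "norm (integral {0..cl s} (\<lambda>\<sigma>. H \<sigma> (apply_bcontfun x \<sigma>) - H \<sigma> (apply_bcontfun y \<sigma>))) \<le> L * dist x y * T"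
        using L by simp
      also have "\<dots> \<le> 1 / 2 * dist x y"
        using mult_right_mono[OF L(2), of "dist x y"] by (simp add: mult_ac)
      finally show "dist (apply_bcontfun (P x) s) (apply_bcontfun (P y) s) \<le> 1 / 2 * dist x y"
        by (simp add: P x y J_def dist_norm integral_diff intH)
    qed
  qed auto
  then obtain w where w: "w \<in> S" "P w = w" by blast
  have w_eq: "apply_bcontfun w s = v0 + integral {0..s} (\<lambda>\<sigma>. H \<sigma> (apply_bcontfun w \<sigma>))" if "s \<in> {0..T}" for s
  proof -
    have "apply_bcontfun w s = J w s"
      by (subst P[OF w(1), symmetric]) (simp only: w(2))
    then show ?thesis
      unfolding J_def cl_id[OF that] .
  qed
  show ?thesis
  proof (rule that[of "apply_bcontfun w"])
    show "apply_bcontfun w 0 = v0" by (subst w_eq) (use T in auto)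
    show "norm (apply_bcontfun w s) \<le> R" for s by (rule S[OF w(1)])
    fix s assume s: "s \<in> {0..T}"
    have "((\<lambda>s. v0 + integral {0..s} (\<lambda>\<sigma>. H \<sigma> (apply_bcontfun w \<sigma>))) has_vector_derivative 0 + H s (apply_bcontfun w s))
        (at s within {0..T})"
      by (intro has_vector_derivative_add has_vector_derivative_const
          integral_has_vector_derivative contH w s)
    then show "(apply_bcontfun w has_vector_derivative H s (apply_bcontfun w s)) (at s within {0..T})"
      unfolding add_0_left by (rule has_vector_derivative_transform[OF s w_eq, rotated]) simp_all
  qed
qed

text \<open>
  Instead of an exponential bound, a factor \<open>2\<close> suffices on the short intervals used here: at the
  point \<open>m\<close> where \<open>\<parallel>\<phi>\<parallel>\<close> is largest, the mean value inequality gives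
  \<open>\<parallel>\<phi> m\<parallel> \<le> \<parallel>\<phi> 0\<parallel> + L T \<parallel>\<phi> m\<parallel> + K T\<close>, and the middle term is absorbed.
\<close>

lemma short_time_gronwall:
  fixes \<phi> :: "real \<Rightarrow> 'a::real_normed_vector"
  assumes deriv: "\<And>s. s \<in> {0..T} \<Longrightarrow> (\<phi> has_vector_derivative \<phi>' s) (at s within {0..T})"
    and bound: "\<And>s. s \<in> {0..T} \<Longrightarrow> norm (\<phi>' s) \<le> L * norm (\<phi> s) + K"
    and L: "L \<ge> 0" "L * T \<le> 1 / 2" and K: "K \<ge> 0" and s: "s \<in> {0..T}"
  shows "norm (\<phi> s) \<le> 2 * (norm (\<phi> 0) + K * T)"
proof -
  have "continuous_on {0..T} \<phi>"
    using deriv by (meson continuous_on_eq_continuous_within has_vector_derivative_continuous)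
  then have "continuous_on {0..T} (\<lambda>s. norm (\<phi> s))"
    by (intro continuous_intros)
  then obtain m where m: "m \<in> {0..T}" "\<And>s. s \<in> {0..T} \<Longrightarrow> norm (\<phi> s) \<le> norm (\<phi> m)"
    using continuous_attains_sup[of "{0..T}" "\<lambda>s. norm (\<phi> s)"] s by auto
  define B where "B = L * norm (\<phi> m) + K"
  have "norm (\<phi> m - \<phi> 0) \<le> B * norm (m - 0)"
  proof (rule differentiable_bound[of "{0..T}" \<phi> "\<lambda>s h. h *\<^sub>R \<phi>' s"])
    show "onorm (\<lambda>h. h *\<^sub>R \<phi>' x) \<le> B" if "x \<in> {0..T}" for x
    proof (rule onorm_le)
      have "norm (\<phi>' x) \<le> B"
        unfolding B_def using bound[OF that] m(2)[OF that] L(1) by (smt (verit) mult_left_mono)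
      then show "norm (h *\<^sub>R \<phi>' x) \<le> B * norm h" for h
        using mult_right_mono[of "norm (\<phi>' x)" B "\<bar>h\<bar>"] by (simp add: mult.commute)
    qed
  qed (use deriv m(1) s in \<open>auto simp: has_vector_derivative_def\<close>)
  also have "\<dots> \<le> B * T"
    using m(1) L K by (intro mult_left_mono) (auto simp: B_def)
  also have "\<dots> = (L * T) * norm (\<phi> m) + K * T"
    by (simp add: B_def algebra_simps)
  also have "\<dots> \<le> 1 / 2 * norm (\<phi> m) + K * T"
    using L(2) by (intro add_right_mono mult_right_mono) auto
  finally have "norm (\<phi> m) \<le> 2 * (norm (\<phi> 0) + K * T)"
    using norm_triangle_ineq2[of "\<phi> m" "\<phi> 0"] by (simp add: field_simps)
  with m(2)[OF s] show ?thesis by linarith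
qed

section \<open>The Wiener algebra as a Banach algebra of coefficient sequences\<close>

lemma l1_weight_pos: "\<nu> > 0 \<Longrightarrow> l1_weight \<nu> k > 0"
  by (simp add: l1_weight_def)

lemma l1_weight_ge_1: "\<nu> \<ge> 1 \<Longrightarrow> l1_weight \<nu> k \<ge> 1"
  by (simp add: l1_weight_def one_le_power)

lemma l1_weight_minus: "l1_weight \<nu> (- k) = l1_weight \<nu> k"
  by (simp add: l1_weight_def)

lemma l1_weight_0 [simp]: "l1_weight \<nu> 0 = 1"
  by (simp add: l1_weight_def)

lemma l1_weight_add_le:
  assumes "\<nu> \<ge> 1"
  shows "l1_weight \<nu> (k + l) \<le> l1_weight \<nu> k * l1_weight \<nu> l"
proof -
  have "(\<Sum>j\<in>UNIV. nat \<bar>(k + l) $ j\<bar>) \<le> (\<Sum>j\<in>UNIV. nat \<bar>k $ j\<bar> + nat \<bar>l $ j\<bar>)"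
    by (intro sum_mono) (simp add: nat_add_distrib[symmetric])
  then have "\<nu> ^ (\<Sum>j\<in>UNIV. nat \<bar>(k + l) $ j\<bar>) \<le> \<nu> ^ (\<Sum>j\<in>UNIV. nat \<bar>k $ j\<bar> + nat \<bar>l $ j\<bar>)"
    using assms by (rule power_increasing)
  then show ?thesis
    by (simp add: l1_weight_def sum.distrib power_add)
qed

lemma has_sum_product:
  fixes f :: "'i \<Rightarrow> 'a::{banach, real_normed_algebra}" and g :: "'j \<Rightarrow> 'a"
  assumes f: "(\<lambda>i. norm (f i)) summable_on A" and g: "(\<lambda>j. norm (g j)) summable_on B"
  shows "(\<lambda>(i, j). norm (f i) * norm (g j)) summable_on A \<times> B"
    and "((\<lambda>(i, j). f i * g j) has_sum infsum f A * infsum g B) (A \<times> B)"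
proof -
  show *: "(\<lambda>(i, j). norm (f i) * norm (g j)) summable_on A \<times> B"
  proof (rule summable_on_SigmaI)
    show "((\<lambda>j. case (i, j) of (i, j) \<Rightarrow> norm (f i) * norm (g j)) has_sum
        norm (f i) * infsum (\<lambda>j. norm (g j)) B) B" for i
      using has_sum_cmult_right[OF has_sum_infsum[OF g]] by simp
    show "(\<lambda>i. norm (f i) * infsum (\<lambda>j. norm (g j)) B) summable_on A"
      by (rule summable_on_cmult_left[OF f])
  qed auto
  show "((\<lambda>(i, j). f i * g j) has_sum infsum f A * infsum g B) (A \<times> B)"
  proof (rule has_sum_SigmaI)
    show "((\<lambda>j. case (i, j) of (i, j) \<Rightarrow> f i * g j) has_sum f i * infsum g B) B" for i
      using has_sum_cmult_right[OF has_sum_infsum[OF abs_summable_summable[OF g]]] by simp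
    show "((\<lambda>i. f i * infsum g B) has_sum infsum f A * infsum g B) A"
      by (rule has_sum_cmult_left[OF has_sum_infsum[OF abs_summable_summable[OF f]]])
    have "(\<lambda>x. norm (case x of (i, j) \<Rightarrow> f i * g j)) summable_on A \<times> B"
      by (rule Infinite_Sum.abs_summable_on_comparison_test'[OF *]) (auto simp: norm_mult_ineq)
    then show "(\<lambda>(i, j). f i * g j) summable_on A \<times> B"
      by (rule abs_summable_summable)
  qed
qed

text \<open>
  Any weight greater than one would do: a weight that grows exponentially dominates the symbol of the
  Laplacian, so that its elements are classical functions, and a single algebra suffices because initial data only
  have to be dense. The product is convolution, that is, pointwise multiplication of the functions.
\<close>

typedef (overloaded) 'd wiener =
  "{c :: int ^ 'd::finite \<Rightarrow> complex. (\<lambda>k. norm (c k) * l1_weight 2 k) summable_on UNIV}"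
  morphisms wcoeff Wiener
  by (intro exI[of _ "\<lambda>_. 0"]) auto

setup_lifting type_definition_wiener

lemma wcoeff_summable: "(\<lambda>k. norm (wcoeff v k) * l1_weight 2 k) summable_on UNIV"
  using wcoeff[of v] by simp

lemma wiener_eqI: "(\<And>k. wcoeff v k = wcoeff w k) \<Longrightarrow> v = w"
  by (simp add: wcoeff_inject[symmetric] fun_eq_iff)

lemma weighted_summable_add:
  fixes c d :: "int ^ 'd \<Rightarrow> complex"
  assumes "(\<lambda>k. norm (c k) * l1_weight 2 k) summable_on UNIV" "(\<lambda>k. norm (d k) * l1_weight 2 k) summable_on UNIV"
  shows "(\<lambda>k. norm (c k + d k) * l1_weight 2 k) summable_on UNIV"
  by (rule summable_on_comparison_test[OF summable_on_add[OF assms]])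
    (auto simp: distrib_right[symmetric] l1_weight_pos less_imp_le norm_triangle_ineq intro!: mult_right_mono)

instantiation wiener :: (finite) real_normed_vector
begin

lift_definition zero_wiener :: "'a wiener" is "\<lambda>_. 0" by simp

lift_definition plus_wiener :: "'a wiener \<Rightarrow> 'a wiener \<Rightarrow> 'a wiener" is "\<lambda>c d k. c k + d k"
  by (rule weighted_summable_add)

lift_definition uminus_wiener :: "'a wiener \<Rightarrow> 'a wiener" is "\<lambda>c k. - c k" by simp

lift_definition minus_wiener :: "'a wiener \<Rightarrow> 'a wiener \<Rightarrow> 'a wiener" is "\<lambda>c d k. c k - d k"
  using weighted_summable_add[of _ "\<lambda>k. - _ k"] by (simp add: fun_eq_iff)

lift_definition scaleR_wiener :: "real \<Rightarrow> 'a wiener \<Rightarrow> 'a wiener" is "\<lambda>a c k. a *\<^sub>R c k"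
  by (simp add: mult.assoc summable_on_cmult_right)

lift_definition norm_wiener :: "'a wiener \<Rightarrow> real" is "\<lambda>c. \<Sum>\<^sub>\<infinity>k. norm (c k) * l1_weight 2 k" .

definition dist_wiener :: "'a wiener \<Rightarrow> 'a wiener \<Rightarrow> real" where "dist_wiener v w = norm (v - w)"

definition sgn_wiener :: "'a wiener \<Rightarrow> 'a wiener" where "sgn_wiener v = inverse (norm v) *\<^sub>R v"

definition uniformity_wiener :: "('a wiener \<times> 'a wiener) filter"
  where "uniformity_wiener = (INF e\<in>{0 <..}. principal {(x, y). dist x y < e})"

definition open_wiener :: "'a wiener set \<Rightarrow> bool"
  where "open_wiener S = (\<forall>x\<in>S. \<forall>\<^sub>F (x', y) in uniformity. x' = x \<longrightarrow> y \<in> S)"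

instance
proof
  fix u v w :: "'a wiener" and a b :: real
  show "u + v + w = u + (v + w)" "u + v = v + u" "0 + u = u" "- u + u = 0" "u - v = u + - v"
    "a *\<^sub>R (u + v) = a *\<^sub>R u + a *\<^sub>R v" "(a + b) *\<^sub>R u = a *\<^sub>R u + b *\<^sub>R u" "a *\<^sub>R b *\<^sub>R u = (a * b) *\<^sub>R u"
    "1 *\<^sub>R u = u"
    by (transfer; auto simp: algebra_simps)+
  show "dist u v = norm (u - v)" "sgn u = inverse (norm u) *\<^sub>R u"
    by (simp_all add: dist_wiener_def sgn_wiener_def)
  show "uniformity = (INF e\<in>{0 <..}. principal {(x, y :: 'a wiener). dist x y < e})"
    by (rule uniformity_wiener_def)
  show "open S = (\<forall>x\<in>S. \<forall>\<^sub>F (x', y) in uniformity. x' = x \<longrightarrow> y \<in> S)" for S :: "'a wiener set"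
    by (rule open_wiener_def)
  show "(norm u = 0) = (u = 0)"
  proof
    assume "norm u = 0"
    have "norm (wcoeff u k) * l1_weight 2 k = 0" for k
      by (rule nonneg_infsum_le_0D[of "\<lambda>k. norm (wcoeff u k) * l1_weight 2 k" UNIV])
        (use \<open>norm u = 0\<close> wcoeff_summable in \<open>auto simp: norm_wiener.rep_eq l1_weight_pos less_imp_le\<close>)
    then have "wcoeff u k = 0" for k
      using l1_weight_pos[of 2 k] by (metis less_irrefl mult_eq_0_iff norm_eq_zero zero_less_numeral)
    then show "u = 0"
      by (intro wiener_eqI) (simp add: zero_wiener.rep_eq)
  qed (simp add: norm_wiener.rep_eq zero_wiener.rep_eq)
  show "norm (u + v) \<le> norm u + norm v"
  proof -
    have "norm (u + v) \<le> (\<Sum>\<^sub>\<infinity>k. norm (wcoeff u k) * l1_weight 2 k + norm (wcoeff v k) * l1_weight 2 k)"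
      unfolding norm_wiener.rep_eq
      by (intro infsum_mono wcoeff_summable summable_on_add)
        (auto simp: plus_wiener.rep_eq distrib_right[symmetric] l1_weight_pos less_imp_le
          intro!: mult_right_mono norm_triangle_ineq)
    also have "\<dots> = norm u + norm v"
      unfolding norm_wiener.rep_eq by (intro infsum_add wcoeff_summable)
    finally show ?thesis .
  qed
  show "norm (a *\<^sub>R u) = \<bar>a\<bar> * norm u"
    unfolding norm_wiener.rep_eq by (simp add: scaleR_wiener.rep_eq mult.assoc infsum_cmult_right')
qed

end

lemma norm_wcoeff_le: "norm (wcoeff v k) * l1_weight 2 k \<le> norm v"
  unfolding norm_wiener.rep_eq
  using finite_sum_le_infsum[OF wcoeff_summable, of "{k}" v] by (simp add: l1_weight_pos less_imp_le)

lemma norm_wcoeff_le': "norm (wcoeff v k) \<le> norm v"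
  using mult_left_mono[OF l1_weight_ge_1[of 2 k], of "norm (wcoeff v k)"] norm_wcoeff_le[of v k] by simp

text \<open>
  Coefficients of a Cauchy sequence converge one by one; bounds on finite partial sums of the weighted
  norm pass to the limit, which controls the whole norm of the difference.
\<close>

instance wiener :: (finite) banach
proof
  fix X :: "nat \<Rightarrow> 'a wiener" assume X: "Cauchy X"
  have "Cauchy (\<lambda>n. wcoeff (X n) k)" for k
  proof (rule metric_CauchyI)
    fix e :: real assume "e > 0"
    then obtain M where M: "\<And>m n. m \<ge> M \<Longrightarrow> n \<ge> M \<Longrightarrow> dist (X m) (X n) < e"
      using X unfolding Cauchy_def by metis
    have "dist (wcoeff (X m) k) (wcoeff (X n) k) < e" if "m \<ge> M" "n \<ge> M" for m n
      using M[OF that] norm_wcoeff_le'[of "X m - X n" k] by (simp add: dist_norm minus_wiener.rep_eq)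
    then show "\<exists>M. \<forall>m\<ge>M. \<forall>n\<ge>M. dist (wcoeff (X m) k) (wcoeff (X n) k) < e" by blast
  qed
  then have "\<exists>c. (\<lambda>n. wcoeff (X n) k) \<longlonglongrightarrow> c" for k
    using Cauchy_convergent convergent_def by metis
  then obtain c where c: "\<And>k. (\<lambda>n. wcoeff (X n) k) \<longlonglongrightarrow> c k" by metis
  have fin: "(\<Sum>k\<in>A. norm (wcoeff (X m) k - c k) * l1_weight 2 k) \<le> e"
    if M: "\<And>m n. m \<ge> M \<Longrightarrow> n \<ge> M \<Longrightarrow> dist (X m) (X n) < e" and m: "m \<ge> M" and A: "finite A" for M m e A
  proof (rule LIMSEQ_le_const2)
    show "(\<lambda>n. \<Sum>k\<in>A. norm (wcoeff (X m) k - wcoeff (X n) k) * l1_weight 2 k) \<longlonglongrightarrow>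
        (\<Sum>k\<in>A. norm (wcoeff (X m) k - c k) * l1_weight 2 k)"
      by (intro tendsto_intros c)
    have "(\<Sum>k\<in>A. norm (wcoeff (X m) k - wcoeff (X n) k) * l1_weight 2 k) \<le> e" if "n \<ge> M" for n
    proof -
      have "(\<Sum>k\<in>A. norm (wcoeff (X m) k - wcoeff (X n) k) * l1_weight 2 k) \<le> norm (X m - X n)"
        unfolding norm_wiener.rep_eq
        using finite_sum_le_infsum[OF wcoeff_summable, of A "X m - X n"] A
        by (simp add: minus_wiener.rep_eq l1_weight_pos less_imp_le)
      then show ?thesis using M[OF m that] by (simp add: dist_norm)
    qed
    then show "\<exists>N. \<forall>n\<ge>N. (\<Sum>k\<in>A. norm (wcoeff (X m) k - wcoeff (X n) k) * l1_weight 2 k) \<le> e" by blast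
  qed
  have sum: "(\<lambda>k. norm (wcoeff (X m) k - c k) * l1_weight 2 k) summable_on UNIV"
    "(\<Sum>\<^sub>\<infinity>k. norm (wcoeff (X m) k - c k) * l1_weight 2 k) \<le> e"
    if M: "\<And>m n. m \<ge> M \<Longrightarrow> n \<ge> M \<Longrightarrow> dist (X m) (X n) < e" and m: "m \<ge> M" for M m e
  proof -
    show *: "(\<lambda>k. norm (wcoeff (X m) k - c k) * l1_weight 2 k) summable_on UNIV"
      by (rule nonneg_bdd_above_summable_on)
        (use fin[OF M m] in \<open>auto simp: l1_weight_pos less_imp_le intro!: bdd_aboveI2\<close>)
    show "(\<Sum>\<^sub>\<infinity>k. norm (wcoeff (X m) k - c k) * l1_weight 2 k) \<le> e"
      by (rule infsum_le_finite_sums[OF *]) (use fin[OF M m] in auto)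
  qed
  obtain M1 where M1: "\<And>m n. m \<ge> M1 \<Longrightarrow> n \<ge> M1 \<Longrightarrow> dist (X m) (X n) < 1"
    using X unfolding Cauchy_def by (metis zero_less_one)
  have "(\<lambda>k. norm (c k) * l1_weight 2 k) summable_on UNIV"
    using weighted_summable_add[OF wcoeff_summable[of "X M1"], of "\<lambda>k. c k - wcoeff (X M1) k"]
      sum(1)[OF M1 order_refl] by (simp add: norm_minus_commute)
  then have C: "wcoeff (Wiener c) = c"
    by (simp add: Wiener_inverse)
  have "X \<longlonglongrightarrow> Wiener c"
  proof (rule metric_LIMSEQ_I)
    fix e :: real assume "e > 0"
    then obtain M where M: "\<And>m n. m \<ge> M \<Longrightarrow> n \<ge> M \<Longrightarrow> dist (X m) (X n) < e / 2"
      using X unfolding Cauchy_def by (metis half_gt_zero)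
    have "dist (X m) (Wiener c) < e" if "m \<ge> M" for m
      using sum(2)[OF M that] \<open>e > 0\<close> by (simp add: dist_norm norm_wiener.rep_eq minus_wiener.rep_eq C)
    then show "\<exists>no. \<forall>n\<ge>no. dist (X n) (Wiener c) < e" by blast
  qed
  then show "convergent X" by (rule convergentI)
qed

text \<open>
  Submultiplicativity of the weight turns the double series of a convolution into a product of two
  series, after the substitution \<open>k = l + m\<close>.
\<close>

lemma convolution_summable:
  fixes c d :: "int ^ 'd \<Rightarrow> complex"
  assumes c: "(\<lambda>k. norm (c k) * l1_weight 2 k) summable_on UNIV" and d: "(\<lambda>k. norm (d k) * l1_weight 2 k) summable_on UNIV"
  shows "(\<lambda>(k, l). norm (c l * d (k - l)) * l1_weight 2 k) summable_on UNIV \<times> UNIV"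
    and "(\<Sum>\<^sub>\<infinity>(k, l)\<in>UNIV \<times> UNIV. norm (c l * d (k - l)) * l1_weight 2 k) \<le>
      (\<Sum>\<^sub>\<infinity>k. norm (c k) * l1_weight 2 k) * (\<Sum>\<^sub>\<infinity>k. norm (d k) * l1_weight 2 k)"
proof -
  have w0: "l1_weight 2 k \<ge> 0" for k :: "int ^ 'd"
    using l1_weight_pos[of 2 k] by simp
  define P where "P = (\<Sum>\<^sub>\<infinity>k. norm (c k) * l1_weight 2 k) * (\<Sum>\<^sub>\<infinity>k. norm (d k) * l1_weight 2 k)"
  have "((\<lambda>(l, m). (norm (c l) * l1_weight 2 l) * (norm (d m) * l1_weight 2 m)) has_sum P) (UNIV \<times> UNIV)"
    unfolding P_def by (rule has_sum_product) (use c d w0 in \<open>simp_all add: abs_mult\<close>)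
  moreover have bij: "bij_betw (\<lambda>(k, l). (l, k - l)) (UNIV \<times> UNIV) (UNIV \<times> (UNIV :: (int ^ 'd) set))"
    by (rule bij_betwI[of _ _ _ "\<lambda>(l, m). (l + m, l)"]) auto
  ultimately have *: "((\<lambda>(k, l). (norm (c l) * l1_weight 2 l) * (norm (d (k - l)) * l1_weight 2 (k - l))) has_sum P) (UNIV \<times> UNIV)"
    using has_sum_reindex_bij_betw[OF bij, of "\<lambda>(l, m). (norm (c l) * l1_weight 2 l) * (norm (d m) * l1_weight 2 m)"]
    by (simp add: case_prod_unfold)
  have le: "norm (c l * d (k - l)) * l1_weight 2 k \<le>
      (norm (c l) * l1_weight 2 l) * (norm (d (k - l)) * l1_weight 2 (k - l))" for k l
    using mult_left_mono[OF l1_weight_add_le[of 2 l "k - l"], of "norm (c l) * norm (d (k - l))"]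
    by (simp add: norm_mult mult_ac)
  show s: "(\<lambda>(k, l). norm (c l * d (k - l)) * l1_weight 2 k) summable_on UNIV \<times> UNIV"
    by (rule summable_on_comparison_test[OF has_sum_imp_summable[OF *]]) (use le w0 in auto)
  have "(\<Sum>\<^sub>\<infinity>(k, l)\<in>UNIV \<times> UNIV. norm (c l * d (k - l)) * l1_weight 2 k) \<le>
      (\<Sum>\<^sub>\<infinity>(k, l)\<in>UNIV \<times> UNIV. (norm (c l) * l1_weight 2 l) * (norm (d (k - l)) * l1_weight 2 (k - l)))"
    by (rule infsum_mono[OF s has_sum_imp_summable[OF *]]) (use le in auto)
  then show "(\<Sum>\<^sub>\<infinity>(k, l)\<in>UNIV \<times> UNIV. norm (c l * d (k - l)) * l1_weight 2 k) \<le>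
      (\<Sum>\<^sub>\<infinity>k. norm (c k) * l1_weight 2 k) * (\<Sum>\<^sub>\<infinity>k. norm (d k) * l1_weight 2 k)"
    using infsumI[OF *] by (simp add: P_def)
qed

lemma convolution_row_summable:
  fixes c d :: "int ^ 'd \<Rightarrow> complex"
  assumes c: "(\<lambda>k. norm (c k) * l1_weight 2 k) summable_on UNIV" and d: "(\<lambda>k. norm (d k) * l1_weight 2 k) summable_on UNIV"
  shows "(\<lambda>l. norm (c l * d (k - l))) summable_on UNIV"
proof -
  have "(\<lambda>l. norm (c l * d (k - l)) * l1_weight 2 k) summable_on UNIV"
    using summable_on_SigmaD1[OF convolution_summable(1)[OF c d], of k] by simp
  then show ?thesis
    using l1_weight_pos[of 2 k] by (simp add: summable_on_cmult_left')
qed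

lemma convolution_abs_summable:
  fixes c d :: "int ^ 'd \<Rightarrow> complex"
  assumes c: "(\<lambda>k. norm (c k) * l1_weight 2 k) summable_on UNIV" and d: "(\<lambda>k. norm (d k) * l1_weight 2 k) summable_on UNIV"
  shows "(\<lambda>(k, l). norm (c l * d (k - l))) summable_on UNIV \<times> UNIV"
  by (rule summable_on_comparison_test[OF convolution_summable(1)[OF c d]])
    (use mult_left_mono[OF l1_weight_ge_1[of 2], of "norm _"] in auto)

instantiation wiener :: (finite) "{comm_ring_1, real_normed_algebra_1}"
begin

lift_definition one_wiener :: "'a wiener" is "\<lambda>k. if k = 0 then 1 else 0"
  by (rule finite_nonzero_values_imp_summable_on) (auto intro: finite_subset[of _ "{0}"])

lift_definition times_wiener :: "'a wiener \<Rightarrow> 'a wiener \<Rightarrow> 'a wiener" is "\<lambda>c d k. \<Sum>\<^sub>\<infinity>l. c l * d (k - l)"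
proof -
  fix c d :: "int ^ 'a \<Rightarrow> complex"
  assume cd: "(\<lambda>k. norm (c k) * l1_weight 2 k) summable_on UNIV" "(\<lambda>k. norm (d k) * l1_weight 2 k) summable_on UNIV"
  show "(\<lambda>k. norm (\<Sum>\<^sub>\<infinity>l. c l * d (k - l)) * l1_weight 2 k) summable_on UNIV"
  proof (rule summable_on_comparison_test)
    show "(\<lambda>k. \<Sum>\<^sub>\<infinity>l. norm (c l * d (k - l)) * l1_weight 2 k) summable_on UNIV"
      by (rule summable_on_Sigma_banach) (rule convolution_summable(1)[OF cd])
    show "norm (\<Sum>\<^sub>\<infinity>l. c l * d (k - l)) * l1_weight 2 k \<le> (\<Sum>\<^sub>\<infinity>l. norm (c l * d (k - l)) * l1_weight 2 k)" for k
      unfolding infsum_cmult_left'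
      using norm_infsum_bound[OF convolution_row_summable[OF cd]] l1_weight_pos[of 2 k] by (intro mult_right_mono) auto
  qed (auto simp: l1_weight_pos less_imp_le)
qed

lemma wcoeff_times_row: "(\<lambda>l. wcoeff v l * wcoeff w (k - l)) summable_on UNIV"
  by (rule abs_summable_summable[OF convolution_row_summable[OF wcoeff_summable wcoeff_summable]])

instance
proof
  fix u v w :: "'a wiener" and a :: real
  show uv: "u * v = v * u" for u v :: "'a wiener"
  proof (rule wiener_eqI)
    fix k
    show "wcoeff (u * v) k = wcoeff (v * u) k"
      unfolding times_wiener.rep_eq
      by (rule infsum_reindex_bij_witness[of UNIV "\<lambda>l. k - l" "\<lambda>l. k - l" UNIV]) auto
  qed
  show distrib: "(u + v) * w = u * w + v * w" for u v w :: "'a wiener"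
    by (rule wiener_eqI)
      (simp add: times_wiener.rep_eq plus_wiener.rep_eq distrib_right infsum_add wcoeff_times_row)
  show "u * (v + w) = u * v + u * w"
    using distrib[of v w u] by (simp add: uv)
  show scale: "a *\<^sub>R u * v = a *\<^sub>R (u * v)" for u v :: "'a wiener"
    by (rule wiener_eqI)
      (simp add: times_wiener.rep_eq scaleR_wiener.rep_eq infsum_scaleR_right)
  show "u * a *\<^sub>R v = a *\<^sub>R (u * v)"
    using scale[of v u] by (simp add: uv)
  show one: "1 * u = u" for u :: "'a wiener"
  proof (rule wiener_eqI)
    fix k
    have "(\<Sum>\<^sub>\<infinity>l. wcoeff 1 l * wcoeff u (k - l)) = (\<Sum>\<^sub>\<infinity>l\<in>{0}. wcoeff u (k - l))"
      by (rule infsum_cong_neutral) (auto simp: one_wiener.rep_eq)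
    then show "wcoeff (1 * u) k = wcoeff u k"
      by (simp add: times_wiener.rep_eq)
  qed
  show "u * 1 = u"
    using one[of u] by (simp add: uv)
  show "(0::'a wiener) \<noteq> 1"
  proof
    assume "(0::'a wiener) = 1"
    then have "wcoeff (0::'a wiener) 0 = wcoeff 1 0" by simp
    then show False by (simp add: zero_wiener.rep_eq one_wiener.rep_eq)
  qed
  show "norm (1::'a wiener) = 1"
  proof -
    have "norm (1::'a wiener) = (\<Sum>\<^sub>\<infinity>k\<in>{0::int ^ 'a}. 1)"
      unfolding norm_wiener.rep_eq by (rule infsum_cong_neutral) (auto simp: one_wiener.rep_eq)
    then show ?thesis by simp
  qed
  show "norm (u * v) \<le> norm u * norm v"
  proof -
    have "norm (u * v) \<le> (\<Sum>\<^sub>\<infinity>k. \<Sum>\<^sub>\<infinity>l. norm (wcoeff u l * wcoeff v (k - l)) * l1_weight 2 k)"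
      unfolding norm_wiener.rep_eq
    proof (intro infsum_mono wcoeff_summable)
      show "(\<lambda>k. \<Sum>\<^sub>\<infinity>l. norm (wcoeff u l * wcoeff v (k - l)) * l1_weight 2 k) summable_on UNIV"
        by (rule summable_on_Sigma_banach) (rule convolution_summable(1)[OF wcoeff_summable wcoeff_summable])
      show "norm (wcoeff (u * v) k) * l1_weight 2 k \<le> (\<Sum>\<^sub>\<infinity>l. norm (wcoeff u l * wcoeff v (k - l)) * l1_weight 2 k)" for k
        unfolding infsum_cmult_left' times_wiener.rep_eq
        using norm_infsum_bound[OF convolution_row_summable[OF wcoeff_summable wcoeff_summable]] l1_weight_pos[of 2 k]
        by (intro mult_right_mono) auto
    qed
    also have "\<dots> = (\<Sum>\<^sub>\<infinity>(k, l)\<in>UNIV \<times> UNIV. norm (wcoeff u l * wcoeff v (k - l)) * l1_weight 2 k)"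
      by (rule infsum_Sigma'_banach) (rule convolution_summable(1)[OF wcoeff_summable wcoeff_summable])
    also have "\<dots> \<le> norm u * norm v"
      unfolding norm_wiener.rep_eq by (rule convolution_summable(2)[OF wcoeff_summable wcoeff_summable])
    finally show ?thesis .
  qed
  show "u * v * w = u * (v * w)"
  proof (rule wiener_eqI)
    fix k
    have "(\<lambda>(l, m). norm (wcoeff u m * wcoeff v (l - m)) * norm w) summable_on UNIV \<times> UNIV"
      using summable_on_cmult_left[OF convolution_abs_summable[OF wcoeff_summable[of u] wcoeff_summable[of v]]]
      by (simp add: case_prod_unfold)
    then have "(\<lambda>x. norm ((\<lambda>(l, m). wcoeff u m * wcoeff v (l - m) * wcoeff w (k - l)) x)) summable_on UNIV \<times> UNIV"
      by (rule Infinite_Sum.abs_summable_on_comparison_test')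
        (auto simp: norm_mult intro!: mult_left_mono norm_wcoeff_le')
    then have s: "(\<lambda>(l, m). wcoeff u m * wcoeff v (l - m) * wcoeff w (k - l)) summable_on UNIV \<times> UNIV"
      by (rule abs_summable_summable)
    have "wcoeff (u * v * w) k = (\<Sum>\<^sub>\<infinity>l. \<Sum>\<^sub>\<infinity>m. wcoeff u m * wcoeff v (l - m) * wcoeff w (k - l))"
      by (simp add: times_wiener.rep_eq infsum_cmult_left')
    also have "\<dots> = (\<Sum>\<^sub>\<infinity>m. \<Sum>\<^sub>\<infinity>l. wcoeff u m * wcoeff v (l - m) * wcoeff w (k - l))"
      by (rule infsum_swap_banach[OF s])
    also have "\<dots> = (\<Sum>\<^sub>\<infinity>m. wcoeff u m * (\<Sum>\<^sub>\<infinity>l. wcoeff v (l - m) * wcoeff w (k - l)))"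
      by (simp add: mult.assoc infsum_cmult_right')
    also have "\<dots> = (\<Sum>\<^sub>\<infinity>m. wcoeff u m * (\<Sum>\<^sub>\<infinity>j. wcoeff v j * wcoeff w (k - m - j)))"
    proof -
      have "(\<Sum>\<^sub>\<infinity>l. wcoeff v (l - m) * wcoeff w (k - l)) = (\<Sum>\<^sub>\<infinity>j. wcoeff v j * wcoeff w (k - m - j))" for m
        by (rule infsum_reindex_bij_witness[of UNIV "\<lambda>j. j + m" "\<lambda>l. l - m" UNIV]) auto
      then show ?thesis by simp
    qed
    also have "\<dots> = wcoeff (u * (v * w)) k"
      by (simp add: times_wiener.rep_eq)
    finally show "wcoeff (u * v * w) k = wcoeff (u * (v * w)) k" .
  qed
qed

end

section \<open>Constants, conjugation and the free Schroedinger flow\<close>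

lemma norm_wiener_le:
  assumes "\<And>k. norm (wcoeff u k) \<le> B * norm (wcoeff v k)"
  shows "norm u \<le> B * norm v"
proof -
  have "norm u \<le> (\<Sum>\<^sub>\<infinity>k. B * (norm (wcoeff v k) * l1_weight 2 k))"
    unfolding norm_wiener.rep_eq
    using mult_right_mono[OF assms less_imp_le[OF l1_weight_pos[of 2]]]
    by (intro infsum_mono wcoeff_summable summable_on_cmult_right) (simp add: mult.assoc)
  then show ?thesis
    by (simp add: norm_wiener.rep_eq infsum_cmult_right')
qed

lemma norm_wiener_cong:
  assumes "\<And>k. norm (wcoeff u k) = norm (wcoeff v k)"
  shows "norm u = norm v"
  by (simp add: norm_wiener.rep_eq assms)

lift_definition wmono :: "int ^ 'd::finite \<Rightarrow> complex \<Rightarrow> 'd wiener" is "\<lambda>j a k. if k = j then a else 0"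
proof -
  fix j :: "int ^ 'd" and a :: complex
  show "(\<lambda>k. norm (if k = j then a else 0) * l1_weight 2 k) summable_on UNIV"
    by (rule finite_nonzero_values_imp_summable_on) (auto intro: finite_subset[of _ "{j}"] split: if_splits)
qed

lemma wcoeff_wmono_times: "wcoeff (wmono j a * v) k = a * wcoeff v (k - j)"
proof -
  have "wcoeff (wmono j a * v) k = (\<Sum>\<^sub>\<infinity>l\<in>{j}. a * wcoeff v (k - l))"
    unfolding times_wiener.rep_eq by (rule infsum_cong_neutral) (auto simp: wmono.rep_eq)
  then show ?thesis by simp
qed

text \<open>
  The constant function \<open>a\<close>; multiplication by it is multiplication by the complex scalar \<open>a\<close>. The type
  carries only the real scalar multiplication of its class, so complex scalars act through this embedding.
\<close>

definition wconst :: "complex \<Rightarrow> 'd::finite wiener" where "wconst = wmono 0"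

lemma wcoeff_wconst_times [simp]: "wcoeff (wconst a * v) k = a * wcoeff v k"
  by (simp add: wconst_def wcoeff_wmono_times)

lemma wcoeff_simps [simp]:
  "wcoeff 0 k = 0" "wcoeff (u + v) k = wcoeff u k + wcoeff v k" "wcoeff (u - v) k = wcoeff u k - wcoeff v k"
  "wcoeff (- u) k = - wcoeff u k" "wcoeff (r *\<^sub>R u) k = r *\<^sub>R wcoeff u k" "wcoeff 1 k = (if k = 0 then 1 else 0)"
  "wcoeff (wconst a) k = (if k = 0 then a else 0)"
  by (simp_all add: zero_wiener.rep_eq plus_wiener.rep_eq minus_wiener.rep_eq uminus_wiener.rep_eq
      scaleR_wiener.rep_eq one_wiener.rep_eq wconst_def wmono.rep_eq)

lemma norm_wmono: "norm (wmono j a) = norm a * l1_weight 2 j"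
proof -
  have "norm (wmono j a) = (\<Sum>\<^sub>\<infinity>k\<in>{j}. norm a * l1_weight 2 k)"
    unfolding norm_wiener.rep_eq by (rule infsum_cong_neutral) (auto simp: wmono.rep_eq)
  then show ?thesis by simp
qed

lemma wconst_simps:
  "wconst 1 = 1" "wconst 0 = 0" "wconst (a + b) = wconst a + wconst b" "wconst (a - b) = wconst a - wconst b"
  "wconst (a * b) = wconst a * wconst b" "wconst (a ^ n) = wconst a ^ n" "wconst (of_real r) * v = r *\<^sub>R v"
  "norm (wconst a) = norm a" "norm (wconst a * v) = norm a * norm v"
proof -
  show *: "wconst (a * b) = wconst a * wconst b" for a b :: complex
    by (rule wiener_eqI) simp
  show 1: "wconst 1 = 1"
    by (rule wiener_eqI) simp
  show "wconst (a ^ n) = wconst a ^ n"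
    by (induction n) (simp_all add: * 1)
  show "norm (wconst a) = norm a"
    by (simp add: wconst_def norm_wmono)
  show "norm (wconst a * v) = norm a * norm v"
    by (simp add: norm_wiener.rep_eq norm_mult mult.assoc infsum_cmult_right')
  show "wconst (of_real r) * v = r *\<^sub>R v"
    by (rule wiener_eqI) (simp add: scaleR_conv_of_real[where 'a = complex])
qed (rule wiener_eqI; simp)+

lemma bounded_linear_wconst: "bounded_linear wconst"
  by (rule bounded_linear_intro[of _ 1])
    (simp_all add: wconst_simps, rule wiener_eqI, simp)

lemma wmono_linear: "wmono j (a + b) = wmono j a + wmono j b" "wmono j (a - b) = wmono j a - wmono j b"
  by (rule wiener_eqI; simp add: wmono.rep_eq)+

definition wtrunc :: "(int ^ 'd) set \<Rightarrow> 'd::finite wiener \<Rightarrow> 'd wiener"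
  where "wtrunc K v = (\<Sum>k\<in>K. wmono k (wcoeff v k))"

lemma wcoeff_sum: "wcoeff (sum f A) k = (\<Sum>i\<in>A. wcoeff (f i) k)"
  by (induction A rule: infinite_finite_induct) auto

lemma wcoeff_wtrunc: "finite K \<Longrightarrow> wcoeff (wtrunc K v) k = (if k \<in> K then wcoeff v k else 0)"
  by (simp add: wtrunc_def wcoeff_sum wmono.rep_eq)

lemma wtrunc_approx:
  assumes "e > 0"
  obtains K where "finite K" "norm (v - wtrunc K v) < e"
proof -
  let ?f = "\<lambda>k. norm (wcoeff v k) * l1_weight 2 k"
  obtain K where K: "finite K" "dist (sum ?f K) (infsum ?f UNIV) \<le> e / 2"
    using infsum_finite_approximation[OF wcoeff_summable, of "e / 2" v] assms by auto
  have "norm (v - wtrunc K v) = infsum ?f (UNIV - K)"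
    unfolding norm_wiener.rep_eq
    by (rule infsum_cong_neutral) (auto simp: wcoeff_wtrunc K)
  also have "\<dots> = infsum ?f UNIV - infsum ?f K"
    by (rule infsum_Diff) (use wcoeff_summable K in auto)
  also have "\<dots> \<le> dist (sum ?f K) (infsum ?f UNIV)"
    using K(1) by (simp add: dist_real_def)
  also have "\<dots> < e"
    using K(2) assms by simp
  finally show ?thesis using that K(1) by blast
qed

text \<open>
  Coefficients of the complex conjugate function.
\<close>

lift_definition wcnj :: "'d::finite wiener \<Rightarrow> 'd wiener" is "\<lambda>c k. cnj (c (- k))"
proof -
  fix c :: "int ^ 'd \<Rightarrow> complex" assume c: "(\<lambda>k. norm (c k) * l1_weight 2 k) summable_on UNIV"
  have "bij_betw uminus UNIV (UNIV :: (int ^ 'd) set)"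
    by (rule bij_betwI[of _ _ _ uminus]) auto
  from summable_on_reindex_bij_betw[OF this, of "\<lambda>k. norm (c k) * l1_weight 2 k"] c
  show "(\<lambda>k. norm (cnj (c (- k))) * l1_weight 2 k) summable_on UNIV"
    by (simp add: l1_weight_minus)
qed

lemma wcnj_diff: "wcnj (u - v) = wcnj u - wcnj v"
  by (rule wiener_eqI) (simp add: wcnj.rep_eq)

lemma norm_wcnj [simp]: "norm (wcnj v) = norm v"
  unfolding norm_wiener.rep_eq
  by (rule infsum_reindex_bij_witness[of UNIV uminus uminus UNIV]) (auto simp: wcnj.rep_eq l1_weight_minus)

lemma wcnj_wconst: "wcnj (wconst a) = wconst (cnj a)"
  by (rule wiener_eqI) (simp add: wcnj.rep_eq)

text \<open>
  The Laplacian acts on the character of index \<open>k\<close> as multiplication by \<open>- freq \<omega> k\<close>.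
\<close>

definition freq :: "real ^ 'd \<Rightarrow> int ^ 'd \<Rightarrow> real"
  where "freq \<omega> k = (\<Sum>j\<in>UNIV. (\<omega> $ j * of_int (k $ j))\<^sup>2)"

text \<open>
  The free Schroedinger group \<open>exp (\<i> t \<triangle>)\<close>. It changes only the phases of the coefficients, hence is isometric.
\<close>

lift_definition wflow :: "real ^ 'd \<Rightarrow> real \<Rightarrow> 'd::finite wiener \<Rightarrow> 'd wiener"
  is "\<lambda>\<omega> t c k. cis (- (freq \<omega> k * t)) * c k"
  by (simp add: norm_mult)

lemma norm_wflow [simp]: "norm (wflow \<omega> t v) = norm v"
  by (rule norm_wiener_cong) (simp add: wflow.rep_eq norm_mult)

lemma wflow_simps:
  "wflow \<omega> t (u + v) = wflow \<omega> t u + wflow \<omega> t v" "wflow \<omega> t (u - v) = wflow \<omega> t u - wflow \<omega> t v"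
  "wflow \<omega> t (wconst a * v) = wconst a * wflow \<omega> t v" "wflow \<omega> t (wconst a) = wconst a"
  "wflow \<omega> s (wflow \<omega> t v) = wflow \<omega> (s + t) v" "wflow \<omega> 0 v = v" "wflow \<omega> t (r *\<^sub>R v) = r *\<^sub>R wflow \<omega> t v"
  "wflow \<omega> t 0 = 0"
proof -
  show "wflow \<omega> s (wflow \<omega> t v) = wflow \<omega> (s + t) v"
    by (rule wiener_eqI) (simp add: wflow.rep_eq cis_mult mult.assoc[symmetric] distrib_left)
  show "wflow \<omega> t (wconst a) = wconst a"
    by (rule wiener_eqI) (simp add: wflow.rep_eq freq_def)
qed (rule wiener_eqI; simp add: wflow.rep_eq distrib_left right_diff_distrib mult.left_commute[where 'a = complex])+

lemma continuous_wmono: "continuous_on A f \<Longrightarrow> continuous_on A (\<lambda>x. wmono j (f x))"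
proof -
  have "bounded_linear (wmono j)"
    by (rule bounded_linear_intro[of _ "l1_weight 2 j"])
      (simp_all add: norm_wmono wmono_linear, rule wiener_eqI, simp add: wmono.rep_eq)
  then show "continuous_on A f \<Longrightarrow> continuous_on A (\<lambda>x. wmono j (f x))"
    by (rule bounded_linear.continuous_on)
qed

text \<open>
  Strong continuity: the phases of finitely many coefficients vary continuously, and the isometry property
  disposes of the remaining ones uniformly in time. The flow is not norm continuous, since the
  frequencies are unbounded.
\<close>

lemma isCont_wflow: "isCont (\<lambda>t. wflow \<omega> t v) t0"
  unfolding continuous_at_eps_delta
proof (intro allI impI)
  fix e :: real assume e: "e > 0"
  obtain K where K: "finite K" "norm (v - wtrunc K v) < e / 3"
    using wtrunc_approx[of "e / 3"] e by auto
  define w where "w = wtrunc K v"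
  have "wflow \<omega> t w = (\<Sum>k\<in>K. wmono k (cis (- (freq \<omega> k * t)) * wcoeff v k))" for t
    by (rule wiener_eqI) (auto simp: w_def wflow.rep_eq wcoeff_wtrunc K(1) wcoeff_sum wmono.rep_eq)
  moreover have "continuous_on UNIV (\<lambda>t. \<Sum>k\<in>K. wmono k (cis (- (freq \<omega> k * t)) * wcoeff v k))"
    by (intro continuous_on_sum continuous_wmono continuous_intros)
  ultimately have "isCont (\<lambda>t. wflow \<omega> t w) t0"
    by (simp add: continuous_on_eq_continuous_at)
  then obtain d where d: "d > 0" "\<And>t. dist t t0 < d \<Longrightarrow> dist (wflow \<omega> t w) (wflow \<omega> t0 w) < e / 3"
    using e unfolding continuous_at_eps_delta by (metis zero_less_divide_iff zero_less_numeral)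
  have "dist (wflow \<omega> t v) (wflow \<omega> t0 v) < e" if "dist t t0 < d" for t
  proof -
    have "dist (wflow \<omega> t v) (wflow \<omega> t w) < e / 3" "dist (wflow \<omega> t0 w) (wflow \<omega> t0 v) < e / 3"
      using K(2) by (simp_all add: dist_norm w_def flip: wflow_simps(2) add: norm_minus_commute)
    with d(2)[OF that] show ?thesis
      using dist_triangle[of "wflow \<omega> t v" "wflow \<omega> t0 v" "wflow \<omega> t w"]
        dist_triangle[of "wflow \<omega> t w" "wflow \<omega> t0 v" "wflow \<omega> t0 w"] by linarith
  qed
  then show "\<exists>d>0. \<forall>t'. dist t' t0 < d \<longrightarrow> dist (wflow \<omega> t' v) (wflow \<omega> t0 v) < e"
    using d(1) by blast
qed

lemma tendsto_wflow:
  assumes f: "(f \<longlongrightarrow> a) G" and g: "(g \<longlongrightarrow> v) G"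
  shows "((\<lambda>s. wflow \<omega> (f s) (g s)) \<longlongrightarrow> wflow \<omega> a v) G"
proof -
  have "((\<lambda>s. wflow \<omega> (f s) (g s - v)) \<longlongrightarrow> 0) G"
    by (rule Lim_null_comparison[of _ "\<lambda>s. norm (g s - v)"]) (use g in \<open>auto intro!: tendsto_norm_zero LIM_zero\<close>)
  moreover have "((\<lambda>s. wflow \<omega> (f s) v) \<longlongrightarrow> wflow \<omega> a v) G"
    using isCont_tendsto_compose[OF isCont_wflow f] .
  ultimately have "((\<lambda>s. wflow \<omega> (f s) (g s - v) + wflow \<omega> (f s) v) \<longlongrightarrow> 0 + wflow \<omega> a v) G"
    by (rule tendsto_add)
  then show ?thesis by (simp flip: wflow_simps(1))
qed

lemma continuous_on_wflow:
  "continuous_on A f \<Longrightarrow> continuous_on A g \<Longrightarrow> continuous_on A (\<lambda>s. wflow \<omega> (f s) (g s))"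
  by (auto simp: continuous_on_def intro: tendsto_wflow)

lemma norm_cis_minus_1_le: "norm (cis s - 1) \<le> \<bar>s\<bar>"
proof -
  have "norm (cis s - cis 0) \<le> 1 * norm (s - 0)"
  proof (rule differentiable_bound[of UNIV cis "\<lambda>s h. h *\<^sub>R (\<i> * cis s)"])
    show "(cis has_derivative (\<lambda>h. h *\<^sub>R (\<i> * cis x))) (at x within UNIV)" for x
      unfolding cis_conv_exp has_vector_derivative_def[symmetric]
      by (auto intro!: derivative_eq_intros has_vector_derivative_real_field simp: scaleR_conv_of_real)
    show "onorm (\<lambda>h. h *\<^sub>R (\<i> * cis x)) \<le> 1" for x
      by (rule onorm_le) (simp add: norm_mult)
  qed auto
  then show ?thesis by simp
qed

text \<open>
  The flow of a trigonometric polynomial is a motion on a finite-dimensional torus, and simultaneous Diophantine approximation of the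
  finitely many frequencies (in units of \<open>2 \<pi> / L\<close>) provides an integer multiple of \<open>L\<close> that is almost a common period.
\<close>

lemma wflow_recurrence:
  assumes K: "finite K" "\<And>k. k \<notin> K \<Longrightarrow> wcoeff v k = 0" and L: "L > 0" and e: "e > 0"
  obtains T where "T \<ge> L" "norm (wflow \<omega> T v - v) < e"
proof -
  obtain h where h: "bij_betw h {..<card K} K"
    using ex_bij_betw_nat_finite[OF K(1)] unfolding atLeast0LessThan by blast
  define N where "N = nat \<lceil>2 * pi * norm v / e\<rceil> + 1"
  have N: "N > 0" "2 * pi * norm v / e < real N"
    using real_nat_ceiling_ge[of "2 * pi * norm v / e"] by (simp_all add: N_def)
  show ?thesis
  proof (rule Dirichlet_approx_simult[OF N(1), where n = "card K" and \<theta> = "\<lambda>i. L * freq \<omega> (h i) / (2 * pi)"])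
  fix q :: int and p :: "nat \<Rightarrow> int"
  assume q: "0 < q" and p: "\<And>i. i < card K \<Longrightarrow> \<bar>real_of_int q * (L * freq \<omega> (h i) / (2 * pi)) - real_of_int (p i)\<bar> < 1 / real N"
  define T where "T = real_of_int q * L"
  have close: "norm (cis (- (freq \<omega> k * T)) - 1) \<le> 2 * pi / real N" if "k \<in> K" for k
  proof -
    have "k \<in> h ` {..<card K}"
      using that bij_betw_imp_surj_on[OF h] by simp
    then obtain i where i: "i < card K" "k = h i"
      by auto
    define s where "s = real_of_int q * (L * freq \<omega> (h i) / (2 * pi)) - real_of_int (p i)"
    have "- (freq \<omega> k * T) = - (2 * pi * s) + 2 * pi * real_of_int (- p i)"
      by (simp add: s_def T_def i(2) field_simps)
    then have "cis (- (freq \<omega> k * T)) = cis (- (2 * pi * s)) * cis (2 * pi * real_of_int (- p i))"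
      by (simp add: cis_mult)
    also have "cis (2 * pi * real_of_int (- p i)) = 1"
      by (rule cis_multiple_2pi) simp
    finally have "norm (cis (- (freq \<omega> k * T)) - 1) \<le> \<bar>- (2 * pi * s)\<bar>"
      using norm_cis_minus_1_le[of "- (2 * pi * s)"] by simp
    also have "\<dots> = 2 * pi * \<bar>s\<bar>"
      by (simp add: abs_mult)
    also have "\<dots> \<le> 2 * pi * (1 / real N)"
      using p[OF i(1)] unfolding s_def by (intro mult_left_mono) auto
    also have "\<dots> = 2 * pi / real N"
      by simp
    finally show ?thesis .
  qed
  show thesis
  proof (rule that[of T])
    show "T \<ge> L"
      using q L by (simp add: T_def)
    have "norm (wcoeff (wflow \<omega> T v - v) k) \<le> 2 * pi / real N * norm (wcoeff v k)" for k
    proof (cases "k \<in> K")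
      case True
      have "wcoeff (wflow \<omega> T v - v) k = (cis (- (freq \<omega> k * T)) - 1) * wcoeff v k"
        by (simp add: wflow.rep_eq left_diff_distrib)
      then show ?thesis
        using mult_right_mono[OF close[OF True], of "norm (wcoeff v k)"] by (simp add: norm_mult)
    qed (simp add: wflow.rep_eq K(2))
    then have "norm (wflow \<omega> T v - v) \<le> 2 * pi / real N * norm v"
      by (rule norm_wiener_le)
    also have "\<dots> < e"
      using N e by (simp add: field_simps)
    finally show "norm (wflow \<omega> T v - v) < e" .
  qed
  qed
qed

section \<open>Fourier coefficients and trigonometric series on the torus\<close>

definition phase :: "real ^ 'd \<Rightarrow> int ^ 'd \<Rightarrow> real ^ 'd \<Rightarrow> real"
  where "phase \<omega> k x = (\<Sum>j\<in>UNIV. \<omega> $ j * of_int (k $ j) * x $ j)"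

lemma phase_simps:
  "phase \<omega> k (x + y) = phase \<omega> k x + phase \<omega> k y" "phase \<omega> k (r *\<^sub>R x) = r * phase \<omega> k x"
  "phase \<omega> (k + l) x = phase \<omega> k x + phase \<omega> l x" "phase \<omega> (- k) x = - phase \<omega> k x"
  "phase \<omega> (k - l) x = phase \<omega> k x - phase \<omega> l x"
  "phase \<omega> 0 x = 0" "phase \<omega> k 0 = 0" "phase \<omega> k (axis j r) = \<omega> $ j * of_int (k $ j) * r"
proof -
  have "phase \<omega> k (axis j r) = (\<Sum>i\<in>{j}. \<omega> $ i * of_int (k $ i) * r)"
    unfolding phase_def by (rule sum.mono_neutral_cong_right) (auto simp: axis_def)
  then show "phase \<omega> k (axis j r) = \<omega> $ j * of_int (k $ j) * r" by simp
qed (simp_all add: phase_def algebra_simps sum.distrib sum_distrib_left sum_subtractf sum_negf)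

lemma continuous_on_phase [continuous_intros]:
  "continuous_on A f \<Longrightarrow> continuous_on A (\<lambda>x. phase \<omega> k (f x))"
  unfolding phase_def by (intro continuous_intros)

text \<open>
  The cell has side lengths \<open>2 \<pi> / \<bar>\<omega>\<^sub>j\<bar>\<close>, while periodicity is stated for \<open>2 \<pi> / \<omega>\<^sub>j\<close>, which may be negative.
\<close>

lemma torus_fun_period:
  assumes u: "torus_fun \<omega> u"
  shows "u (x + axis j (2 * pi / \<bar>\<omega> $ j\<bar>)) = u x"
proof (cases "\<omega> $ j \<ge> 0")
  case False
  have "u (x + axis j (2 * pi / \<bar>\<omega> $ j\<bar>)) = u (x + axis j (2 * pi / \<bar>\<omega> $ j\<bar>) + axis j (2 * pi / \<omega> $ j))"
    using u by (simp add: torus_fun_def)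
  also have "x + axis j (2 * pi / \<bar>\<omega> $ j\<bar>) + axis j (2 * pi / \<omega> $ j) = x"
    using False by (simp add: vec_eq_iff axis_def)
  finally show ?thesis .
qed (use u in \<open>simp add: torus_fun_def\<close>)

lemma torus_fun_character:
  assumes "\<And>j. \<omega> $ j \<noteq> 0"
  shows "torus_fun \<omega> (\<lambda>x. cis (phase \<omega> k x))"
  unfolding torus_fun_def
proof (intro allI)
  fix x j
  have "phase \<omega> k (x + axis j (2 * pi / \<omega> $ j)) = phase \<omega> k x + 2 * pi * of_int (k $ j)"
    using assms[of j] by (simp add: phase_simps field_simps)
  then have "cis (phase \<omega> k (x + axis j (2 * pi / \<omega> $ j))) = cis (phase \<omega> k x) * cis (2 * pi * of_int (k $ j))"
    by (simp only: cis_mult)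
  also have "cis (2 * pi * of_int (k $ j)) = 1"
    by (rule cis_multiple_2pi) simp
  finally show "cis (phase \<omega> k (x + axis j (2 * pi / \<omega> $ j))) = cis (phase \<omega> k x)" by simp
qed

text \<open>
  Translation invariance of the integral over the torus. The shifted cell differs from the cell by a slab
  added at the top and a slab removed at the bottom, and by periodicity both have the same integral. All
  four boxes are pieces of their union \<open>D\<close>.
\<close>

lemma cell_integral_shift:
  fixes g :: "real ^ 'd \<Rightarrow> complex"
  assumes cont: "continuous_on UNIV g" and tor: "torus_fun \<omega> g" and \<omega>: "\<omega> $ i \<noteq> 0"
    and s: "0 \<le> s" "s \<le> 2 * pi / \<bar>\<omega> $ i\<bar>"
  shows "integral (torus_cell \<omega>) (\<lambda>x. g (x + axis i s)) = integral (torus_cell \<omega>) g"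
proof -
  define L where "L = 2 * pi / \<bar>\<omega> $ i\<bar>"
  define b :: "real ^ 'd" where "b = (\<chi> j. 2 * pi / \<bar>\<omega> $ j\<bar>)"
  have bi: "b $ i = L" by (simp add: b_def L_def)
  have b0: "b $ j \<ge> 0" for j by (simp add: b_def)
  have cell: "torus_cell \<omega> = cbox 0 b" by (simp add: torus_cell_def b_def)
  have L: "0 \<le> L" "s \<le> L" using s \<omega> by (auto simp: L_def)
  define D where "D = cbox 0 (b + axis i s)"
  have int: "g integrable_on cbox u v" for u v
    by (intro integrable_continuous continuous_on_subset[OF cont]) auto
  have shift: "integral (cbox u v) (\<lambda>x. g (x + c)) = integral (cbox (u + c) (v + c)) g" for u v c
    using integral_shift_cbox[of "u + c" c "v + c" g] by simp
  have split: "integral D g = integral (D \<inter> {x. x $ i \<le> c}) g + integral (D \<inter> {x. x $ i \<ge> c}) g" for c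
    using integral_split[OF int, of "axis i 1" 0 "b + axis i s" c]
    by (simp add: D_def inner_axis' inner_axis axis_in_Basis_iff)
  have D1: "D \<inter> {x. x $ i \<le> L} = cbox 0 b"
    using s(1) L(1) b0 by (auto simp: D_def mem_box_cart axis_def bi split: if_splits) (smt (verit) bi)+
  have D2: "D \<inter> {x. x $ i \<ge> L} = cbox (axis i L) (b + axis i s)"
    using L(1) by (auto simp: D_def mem_box_cart axis_def bi split: if_splits) (smt (verit))+
  have D3: "D \<inter> {x. x $ i \<ge> s} = cbox (axis i s) (b + axis i s)"
    using s(1) by (auto simp: D_def mem_box_cart axis_def split: if_splits) (smt (verit))+
  define b' where "b' = (\<chi> j. if j = i then s else b $ j)"
  have D4: "D \<inter> {x. x $ i \<le> s} = cbox 0 b'"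
    using L s(1) b0 by (auto simp: D_def b'_def mem_box_cart axis_def bi split: if_splits) (smt (verit) bi)+
  have b'L: "b' + axis i L = b + axis i s"
    by (simp add: vec_eq_iff b'_def axis_def bi)
  have "integral (cbox 0 b') g = integral (cbox 0 b') (\<lambda>x. g (x + axis i L))"
    using torus_fun_period[OF tor] by (simp add: L_def)
  also have "\<dots> = integral (cbox (axis i L) (b + axis i s)) g"
    by (simp add: shift b'L)
  finally have top: "integral (cbox 0 b') g = integral (cbox (axis i L) (b + axis i s)) g" .
  have "integral (cbox 0 b) (\<lambda>x. g (x + axis i s)) = integral (cbox (axis i s) (b + axis i s)) g"
    by (simp add: shift)
  then show ?thesis
    using split[of L] split[of s] top by (simp add: cell D1 D2 D3 D4)
qed

lemma measure_torus_cell_pos: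
  assumes "\<And>j. \<omega> $ j \<noteq> 0"
  shows "measure lborel (torus_cell \<omega>) > 0"
  unfolding torus_cell_def
  by (subst content_pos_lt_eq) (use assms in \<open>auto simp: Basis_vec_def inner_axis\<close>)

text \<open>
  Shifting a nontrivial character by half of its period in a coordinate \<open>i\<close> with \<open>k\<^sub>i \<noteq> 0\<close> changes its sign, but not its integral.
\<close>

lemma cell_integral_character:
  assumes \<omega>: "\<And>j. \<omega> $ j \<noteq> 0"
  shows "integral (torus_cell \<omega>) (\<lambda>x. cis (phase \<omega> k x)) =
    (if k = 0 then of_real (measure lborel (torus_cell \<omega>)) else 0)"
proof (cases "k = 0")
  case True
  then show ?thesis
    by (simp add: phase_simps torus_cell_def scaleR_conv_of_real)
next
  case False
  then obtain i where i: "k $ i \<noteq> 0" by (auto simp: vec_eq_iff)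
  define s where "s = (2 * pi / \<bar>\<omega> $ i\<bar>) * (1 / (2 * \<bar>of_int (k $ i)\<bar>))"
  have ki: "1 \<le> \<bar>real_of_int (k $ i)\<bar>"
    using i by linarith
  then have "1 / (2 * \<bar>real_of_int (k $ i)\<bar>) \<le> 1"
    by (simp add: field_simps)
  then have s: "0 \<le> s" "s \<le> 2 * pi / \<bar>\<omega> $ i\<bar>"
    using mult_left_mono[of "1 / (2 * \<bar>real_of_int (k $ i)\<bar>)" 1 "2 * pi / \<bar>\<omega> $ i\<bar>"] by (auto simp: s_def)
  have "\<omega> $ i * of_int (k $ i) * s = pi * (sgn (\<omega> $ i) * sgn (of_int (k $ i)))"
    using \<omega>[of i] i by (simp add: s_def field_simps sgn_div_norm)
  moreover have "sgn (\<omega> $ i) * sgn (real_of_int (k $ i)) \<in> {1, -1}"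
    using \<omega>[of i] i by (auto simp: sgn_if)
  ultimately have half: "cis (\<omega> $ i * of_int (k $ i) * s) = -1"
    by (auto simp: complex_eq_iff)
  have "integral (torus_cell \<omega>) (\<lambda>x. cis (phase \<omega> k x)) =
      integral (torus_cell \<omega>) (\<lambda>x. cis (phase \<omega> k (x + axis i s)))"
    by (rule cell_integral_shift[symmetric, OF _ torus_fun_character[OF \<omega>] \<omega> s]) (intro continuous_intros)
  also have "(\<lambda>x. cis (phase \<omega> k (x + axis i s))) = (\<lambda>x. - cis (phase \<omega> k x))"
    unfolding phase_simps by (simp add: cis_mult[symmetric] half)
  finally have "2 * integral (torus_cell \<omega>) (\<lambda>x. cis (phase \<omega> k x)) = 0"
    by simp
  with False show ?thesis by simp
qed

text \<open>
  For continuous functions the Lebesgue integral is the gauge integral, for which convergence of integrals and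
  translations are more convenient.
\<close>

lemma fourier_coeff_continuous:
  assumes "continuous_on UNIV u"
  shows "fourier_coeff \<omega> u k =
    integral (torus_cell \<omega>) (\<lambda>x. u x * cis (- phase \<omega> k x)) / of_real (measure lborel (torus_cell \<omega>))"
proof -
  have "set_integrable lborel (torus_cell \<omega>) (\<lambda>x. u x * cis (- phase \<omega> k x))"
    unfolding set_integrable_def torus_cell_def
    by (intro borel_integrable_compact continuous_intros continuous_on_subset[OF assms]) auto
  from set_borel_integral_eq_integral(2)[OF this] show ?thesis
    by (simp add: fourier_coeff_def phase_def cis_conv_exp)
qed

lemma cell_integrable:
  assumes "continuous_on UNIV u"
  shows "(\<lambda>x. u x * cis (- phase \<omega> k x)) integrable_on torus_cell \<omega>"
  unfolding torus_cell_def
  by (intro integrable_continuous continuous_intros continuous_on_subset[OF assms]) auto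

lemma fourier_coeff_diff:
  assumes "continuous_on UNIV u" "continuous_on UNIV v"
  shows "fourier_coeff \<omega> (\<lambda>x. u x - v x) k = fourier_coeff \<omega> u k - fourier_coeff \<omega> v k"
  unfolding fourier_coeff_continuous[OF continuous_on_diff[OF assms]]
    fourier_coeff_continuous[OF assms(1)] fourier_coeff_continuous[OF assms(2)] left_diff_distrib
    integral_diff[OF cell_integrable[OF assms(1)] cell_integrable[OF assms(2)]]
  by (rule diff_divide_distrib)

lemma norm_fourier_coeff_le:
  assumes \<omega>: "\<And>j. \<omega> $ j \<noteq> 0" and u: "continuous_on UNIV u" and B: "\<And>x. norm (u x) \<le> B"
  shows "norm (fourier_coeff \<omega> u k) \<le> B"
proof -
  have B0: "B \<ge> 0" by (rule order_trans[OF norm_ge_zero B])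
  have "norm (integral (torus_cell \<omega>) (\<lambda>x. u x * cis (- phase \<omega> k x))) \<le> B * measure lborel (torus_cell \<omega>)"
    unfolding torus_cell_def
    by (rule has_integral_bound[OF B0, of "\<lambda>x. u x * cis (- phase \<omega> k x)"])
      (use cell_integrable[OF u, of \<omega> k] B in \<open>auto simp: torus_cell_def norm_mult integrable_integral\<close>)
  then show ?thesis
    using measure_torus_cell_pos[OF \<omega>]
    by (simp add: fourier_coeff_continuous[OF u] norm_divide pos_divide_le_eq)
qed

lemma fourier_coeff_character_sum:
  assumes \<omega>: "\<And>j. \<omega> $ j \<noteq> 0" and K: "finite K"
  shows "fourier_coeff \<omega> (\<lambda>x. \<Sum>l\<in>K. c l * cis (phase \<omega> l x)) k = (if k \<in> K then c k else 0)"
proof -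
  let ?m = "of_real (measure lborel (torus_cell \<omega>)) :: complex"
  have m: "?m \<noteq> 0" using measure_torus_cell_pos[OF \<omega>] by simp
  have int: "(\<lambda>x. cis (phase \<omega> l x)) integrable_on torus_cell \<omega>" for l
    unfolding torus_cell_def by (intro integrable_continuous continuous_intros)
  have eq: "(\<lambda>x. (\<Sum>l\<in>K. c l * cis (phase \<omega> l x)) * cis (- phase \<omega> k x)) =
      (\<lambda>x. \<Sum>l\<in>K. c l * cis (phase \<omega> (l - k) x))"
    by (simp add: sum_distrib_right mult.assoc cis_mult phase_simps)
  have "integral (torus_cell \<omega>) (\<lambda>x. (\<Sum>l\<in>K. c l * cis (phase \<omega> l x)) * cis (- phase \<omega> k x)) =
      (\<Sum>l\<in>K. integral (torus_cell \<omega>) (\<lambda>x. c l * cis (phase \<omega> (l - k) x)))"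
    unfolding eq by (intro integral_sum K integrable_on_mult_right int)
  also have "\<dots> = (\<Sum>l\<in>K. if l = k then c k * ?m else 0)"
    using cell_integral_character[OF \<omega>] by (intro sum.cong) auto
  also have "\<dots> = (if k \<in> K then c k * ?m else 0)"
    using K by (simp add: sum.delta)
  finally have int_eq: "integral (torus_cell \<omega>) (\<lambda>x. (\<Sum>l\<in>K. c l * cis (phase \<omega> l x)) * cis (- phase \<omega> k x)) =
      (if k \<in> K then c k * ?m else 0)" .
  have "continuous_on UNIV (\<lambda>x. \<Sum>l\<in>K. c l * cis (phase \<omega> l x))"
    by (intro continuous_intros)
  from fourier_coeff_continuous[OF this, of \<omega> k] show ?thesis
    using m by (simp add: int_eq)
qed

definition trig_series :: "real ^ 'd \<Rightarrow> (int ^ 'd \<Rightarrow> complex) \<Rightarrow> real ^ 'd \<Rightarrow> complex"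
  where "trig_series \<omega> c x = (\<Sum>\<^sub>\<infinity>k. c k * cis (phase \<omega> k x))"

lemma trig_series_has_sum:
  assumes "(\<lambda>k. norm (c k)) summable_on UNIV"
  shows "((\<lambda>k. c k * cis (phase \<omega> k x)) has_sum trig_series \<omega> c x) UNIV"
  unfolding trig_series_def
  by (rule has_sum_infsum[OF abs_summable_summable]) (use assms in \<open>simp add: norm_mult\<close>)

lemma norm_trig_series_le:
  assumes "(\<lambda>k. norm (c k)) summable_on UNIV"
  shows "norm (trig_series \<omega> c x) \<le> (\<Sum>\<^sub>\<infinity>k. norm (c k))"
  unfolding trig_series_def
  using norm_infsum_bound[of "\<lambda>k. c k * cis (phase \<omega> k x)" UNIV] assms by (simp add: norm_mult)

lemma trig_series_diff:
  assumes "(\<lambda>k. norm (c k)) summable_on UNIV" "(\<lambda>k. norm (d k)) summable_on UNIV"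
  shows "trig_series \<omega> (\<lambda>k. c k - d k) x = trig_series \<omega> c x - trig_series \<omega> d x"
proof -
  have "((\<lambda>k. c k * cis (phase \<omega> k x) + - (d k * cis (phase \<omega> k x))) has_sum
      (trig_series \<omega> c x + - trig_series \<omega> d x)) UNIV"
    by (intro has_sum_add has_sum_uminusI trig_series_has_sum assms)
  then show ?thesis
    unfolding trig_series_def[of _ "\<lambda>k. c k - d k"] by (intro infsumI) (simp add: left_diff_distrib)
qed

definition cutoff :: "'i set \<Rightarrow> ('i \<Rightarrow> complex) \<Rightarrow> 'i \<Rightarrow> complex"
  where "cutoff K c k = (if k \<in> K then c k else 0)"

lemma trig_series_cutoff:
  assumes "finite K"
  shows "trig_series \<omega> (cutoff K c) x = (\<Sum>k\<in>K. c k * cis (phase \<omega> k x))"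
proof -
  have "trig_series \<omega> (cutoff K c) x = (\<Sum>\<^sub>\<infinity>k\<in>K. c k * cis (phase \<omega> k x))"
    unfolding trig_series_def by (rule infsum_cong_neutral) (auto simp: cutoff_def)
  then show ?thesis using assms by simp
qed

lemma cutoff_tail_small:
  fixes c :: "'i \<Rightarrow> complex" and w :: "'i \<Rightarrow> real"
  assumes c: "(\<lambda>k. norm (c k) * w k) summable_on UNIV" and e: "e > 0"
  obtains K where "finite K" "(\<lambda>k. norm (c k - cutoff K c k) * w k) summable_on UNIV"
    "(\<Sum>\<^sub>\<infinity>k. norm (c k - cutoff K c k) * w k) < e"
proof -
  let ?f = "\<lambda>k. norm (c k) * w k"
  obtain K where K: "finite K" "dist (sum ?f K) (infsum ?f UNIV) \<le> e / 2"
    using infsum_finite_approximation[OF c, of "e / 2"] e by auto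
  have "(?f has_sum (infsum ?f UNIV - infsum ?f K)) (UNIV - K)"
    by (rule has_sum_Diff[OF has_sum_infsum[OF c] has_sum_infsum]) (use K in auto)
  moreover have "((\<lambda>k. norm (c k - cutoff K c k) * w k) has_sum S) UNIV = (?f has_sum S) (UNIV - K)" for S
    by (rule has_sum_cong_neutral) (auto simp: cutoff_def)
  ultimately have hs: "((\<lambda>k. norm (c k - cutoff K c k) * w k) has_sum (infsum ?f UNIV - infsum ?f K)) UNIV"
    by blast
  have "infsum ?f UNIV - infsum ?f K \<le> dist (sum ?f K) (infsum ?f UNIV)"
    using K(1) by (simp add: dist_real_def)
  also have "\<dots> < e" using K(2) e by simp
  finally show ?thesis
    using that[OF K(1)] hs by (simp add: has_sum_iff)
qed

lemma trig_series_uniform_approx: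
  assumes c: "(\<lambda>k. norm (c k)) summable_on UNIV" and e: "e > 0"
  obtains K where "finite K" "\<And>x. norm (trig_series \<omega> c x - (\<Sum>k\<in>K. c k * cis (phase \<omega> k x))) < e"
    "\<And>k. norm (c k - cutoff K c k) < e"
proof -
  have c': "(\<lambda>k. norm (c k) * 1) summable_on UNIV" using c by simp
  obtain K where K: "finite K" "(\<lambda>k. norm (c k - cutoff K c k) * 1) summable_on UNIV"
    "(\<Sum>\<^sub>\<infinity>k. norm (c k - cutoff K c k) * 1) < e"
    by (rule cutoff_tail_small[OF c' e])
  have cK: "(\<lambda>k. norm (cutoff K c k)) summable_on UNIV"
    by (rule finite_nonzero_values_imp_summable_on) (auto intro: finite_subset[OF _ K(1)] simp: cutoff_def)
  show ?thesis
  proof (rule that[OF K(1)])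
    fix x
    have "norm (trig_series \<omega> (\<lambda>k. c k - cutoff K c k) x) < e"
      using norm_trig_series_le[of "\<lambda>k. c k - cutoff K c k" \<omega> x] K(2,3) by simp
    then show "norm (trig_series \<omega> c x - (\<Sum>k\<in>K. c k * cis (phase \<omega> k x))) < e"
      by (simp add: trig_series_diff[OF c cK] trig_series_cutoff[OF K(1)])
  next
    fix k
    show "norm (c k - cutoff K c k) < e"
      using finite_sum_le_infsum[OF K(2), of "{k}"] K(3) by simp
  qed
qed

lemma continuous_on_trig_series:
  assumes c: "(\<lambda>k. norm (c k)) summable_on UNIV"
  shows "continuous_on UNIV (trig_series \<omega> c)"
proof (rule uniform_limit_theorem)
  define X where "X n = (SOME K. finite K \<and>
    (\<forall>x. norm (trig_series \<omega> c x - (\<Sum>k\<in>K. c k * cis (phase \<omega> k x))) < inverse (real (Suc n))))" for n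
  have X: "finite (X n) \<and> (\<forall>x. norm (trig_series \<omega> c x - (\<Sum>k\<in>X n. c k * cis (phase \<omega> k x))) < inverse (real (Suc n)))" for n
  proof -
    have "\<exists>K. finite K \<and> (\<forall>x. norm (trig_series \<omega> c x - (\<Sum>k\<in>K. c k * cis (phase \<omega> k x))) < inverse (real (Suc n)))"
    proof (rule trig_series_uniform_approx[OF c, of "inverse (real (Suc n))" \<omega>])
      fix K assume "finite K" "\<And>x. norm (trig_series \<omega> c x - (\<Sum>k\<in>K. c k * cis (phase \<omega> k x))) < inverse (real (Suc n))"
      then show ?thesis by blast
    qed simp
    then show ?thesis unfolding X_def by (rule someI_ex)
  qed
  show "\<forall>\<^sub>F n in sequentially. continuous_on UNIV (\<lambda>x. \<Sum>k\<in>X n. c k * cis (phase \<omega> k x))"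
    by (intro always_eventually allI continuous_intros)
  show "uniform_limit UNIV (\<lambda>n x. \<Sum>k\<in>X n. c k * cis (phase \<omega> k x)) (trig_series \<omega> c) sequentially"
  proof (rule uniform_limitI)
    fix e :: real assume "e > 0"
    with LIMSEQ_inverse_real_of_nat have "\<forall>\<^sub>F n in sequentially. inverse (real (Suc n)) < e"
      by (rule order_tendstoD)
    then show "\<forall>\<^sub>F n in sequentially. \<forall>x\<in>UNIV. dist (\<Sum>k\<in>X n. c k * cis (phase \<omega> k x)) (trig_series \<omega> c x) < e"
      by eventually_elim (use X in \<open>auto simp: dist_norm norm_minus_commute intro: less_trans\<close>)
  qed
qed simp

lemma torus_fun_trig_series:
  assumes "\<And>j. \<omega> $ j \<noteq> 0"
  shows "torus_fun \<omega> (trig_series \<omega> c)"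
  using torus_fun_character[OF assms] by (simp add: torus_fun_def trig_series_def)

text \<open>
  Orthogonality of characters settles finite sums. Both sides change by at most \<open>\<epsilon>\<close> when the series is
  replaced by a finite section that is uniformly \<open>\<epsilon>\<close>-close.
\<close>

theorem fourier_coeff_trig_series:
  assumes \<omega>: "\<And>j. \<omega> $ j \<noteq> 0" and c: "(\<lambda>k. norm (c k)) summable_on UNIV"
  shows "fourier_coeff \<omega> (trig_series \<omega> c) k = c k"
proof -
  have "norm (fourier_coeff \<omega> (trig_series \<omega> c) k - c k) \<le> 0 + e" if e: "e > 0" for e
  proof (rule trig_series_uniform_approx[OF c, of "e / 2" \<omega>])
    fix K
    define w where "w x = (\<Sum>k\<in>K. c k * cis (phase \<omega> k x))" for x
    assume K: "finite K" and near: "\<And>x. norm (trig_series \<omega> c x - (\<Sum>k\<in>K. c k * cis (phase \<omega> k x))) < e / 2"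
      and k: "\<And>k. norm (c k - cutoff K c k) < e / 2"
    have le: "norm (trig_series \<omega> c x - w x) \<le> e / 2" for x
      unfolding w_def by (rule less_imp_le[OF near])
    have contw: "continuous_on UNIV w"
      unfolding w_def[abs_def] by (intro continuous_intros)
    note contu = continuous_on_trig_series[OF c, of \<omega>]
    have "norm (fourier_coeff \<omega> (\<lambda>x. trig_series \<omega> c x - w x) k) \<le> e / 2"
      by (rule norm_fourier_coeff_le[OF \<omega>]) (rule continuous_on_diff[OF contu contw], rule le)
    moreover have "fourier_coeff \<omega> w k = cutoff K c k"
      unfolding w_def[abs_def] by (simp add: fourier_coeff_character_sum[OF \<omega> K] cutoff_def)
    ultimately have "norm (fourier_coeff \<omega> (trig_series \<omega> c) k - cutoff K c k) \<le> e / 2"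
      by (simp add: fourier_coeff_diff[OF contu contw])
    with k[of k] show ?thesis
      using norm_triangle_ineq4[of "fourier_coeff \<omega> (trig_series \<omega> c) k - cutoff K c k" "c k - cutoff K c k"]
      by simp
  qed (use e in simp)
  then have "norm (fourier_coeff \<omega> (trig_series \<omega> c) k - c k) \<le> 0"
    by (rule field_le_epsilon)
  then show ?thesis by simp
qed

section \<open>Trigonometric series with exponential weight are analytic\<close>

definition l1_deg :: "int ^ 'd \<Rightarrow> real" where "l1_deg k = real (\<Sum>j\<in>UNIV. nat \<bar>k $ j\<bar>)"

text \<open>
  Chosen such that the phase of index \<open>k\<close> is Lipschitz in \<open>x\<close> with constant \<open>freq_bound \<omega> * l1_deg k\<close>. The summand \<open>1\<close> ensures positivity.
\<close>

definition freq_bound :: "real ^ 'd \<Rightarrow> real" where "freq_bound \<omega> = (\<Sum>j\<in>UNIV. \<bar>\<omega> $ j\<bar>) + 1"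

lemma l1_deg_nonneg [simp]: "l1_deg k \<ge> 0"
  by (simp add: l1_deg_def)

lemma freq_bound_pos: "freq_bound \<omega> > 0"
  unfolding freq_bound_def by (intro add_nonneg_pos sum_nonneg) auto

lemma l1_weight_exp: "l1_weight (exp s) k = exp (s * l1_deg k)"
  by (simp add: l1_weight_def l1_deg_def exp_of_nat2_mult[symmetric] del: of_nat_sum)

definition cphase :: "real ^ 'd \<Rightarrow> int ^ 'd \<Rightarrow> complex ^ 'd \<Rightarrow> complex"
  where "cphase \<omega> k z = (\<Sum>j\<in>UNIV. of_real (\<omega> $ j) * of_int (k $ j) * z $ j)"

lemma sum_phase_le:
  assumes "\<And>j. a j \<le> (b::real)" "\<And>j. a j \<ge> 0" "b \<ge> 0"
  shows "(\<Sum>j\<in>UNIV. \<bar>\<omega> $ j\<bar> * \<bar>of_int (k $ j)\<bar> * a j) \<le> freq_bound \<omega> * l1_deg k * b"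
proof -
  have "(\<Sum>j\<in>UNIV. \<bar>\<omega> $ j\<bar> * \<bar>of_int (k $ j)\<bar> * a j) \<le> (\<Sum>j\<in>UNIV. freq_bound \<omega> * \<bar>of_int (k $ j)\<bar> * b)"
  proof (intro sum_mono mult_mono assms(1) mult_nonneg_nonneg assms(2))
    fix j
    have "\<bar>\<omega> $ j\<bar> \<le> (\<Sum>j\<in>UNIV. \<bar>\<omega> $ j\<bar>)"
      by (rule member_le_sum) auto
    then show "\<bar>\<omega> $ j\<bar> \<le> freq_bound \<omega>" by (simp add: freq_bound_def)
  qed (use freq_bound_pos[of \<omega>] in auto)
  also have "\<dots> = freq_bound \<omega> * l1_deg k * b"
    by (simp add: l1_deg_def sum_distrib_left sum_distrib_right)
  finally show ?thesis .
qed

lemma abs_phase_le: "\<bar>phase \<omega> k h\<bar> \<le> freq_bound \<omega> * l1_deg k * norm h"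
proof -
  have "\<bar>phase \<omega> k h\<bar> \<le> (\<Sum>j\<in>UNIV. \<bar>\<omega> $ j\<bar> * \<bar>of_int (k $ j)\<bar> * \<bar>h $ j\<bar>)"
    unfolding phase_def by (rule order_trans[OF sum_abs]) (simp add: abs_mult)
  also have "\<dots> \<le> freq_bound \<omega> * l1_deg k * norm h"
    by (rule sum_phase_le) (auto simp: component_le_norm_cart)
  finally show ?thesis .
qed

lemma norm_cphase_le: "norm (cphase \<omega> k z) \<le> freq_bound \<omega> * l1_deg k * norm z"
proof -
  have "norm (cphase \<omega> k z) \<le> (\<Sum>j\<in>UNIV. \<bar>\<omega> $ j\<bar> * \<bar>of_int (k $ j)\<bar> * norm (z $ j))"
    unfolding cphase_def by (rule order_trans[OF norm_sum]) (simp add: norm_mult)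
  also have "\<dots> \<le> freq_bound \<omega> * l1_deg k * norm z"
    by (rule sum_phase_le) (auto simp: Finite_Cartesian_Product.norm_nth_le)
  finally show ?thesis .
qed

lemma abs_Im_cphase_le:
  assumes "z \<in> strip \<rho>" "\<rho> > 0"
  shows "\<bar>Im (cphase \<omega> k z)\<bar> \<le> freq_bound \<omega> * l1_deg k * \<rho>"
proof -
  have "Im (cphase \<omega> k z) = (\<Sum>j\<in>UNIV. \<omega> $ j * of_int (k $ j) * Im (z $ j))"
    by (simp add: cphase_def Im_sum mult.assoc)
  then have "\<bar>Im (cphase \<omega> k z)\<bar> \<le> (\<Sum>j\<in>UNIV. \<bar>\<omega> $ j\<bar> * \<bar>of_int (k $ j)\<bar> * \<bar>Im (z $ j)\<bar>)"
    by (simp only:) (rule order_trans[OF sum_abs], simp add: abs_mult)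
  also have "\<dots> \<le> freq_bound \<omega> * l1_deg k * \<rho>"
    by (rule sum_phase_le) (use assms in \<open>auto simp: strip_def less_imp_le\<close>)
  finally show ?thesis .
qed

lemma cphase_simps:
  "cphase \<omega> k (z + w) = cphase \<omega> k z + cphase \<omega> k w" "cphase \<omega> k (r *\<^sub>R z) = of_real r * cphase \<omega> k z"
  "cphase \<omega> k (a *s z) = a * cphase \<omega> k z"
  "cphase \<omega> k (\<chi> j. of_real (x $ j)) = of_real (phase \<omega> k x)"
  by (simp_all add: cphase_def phase_def algebra_simps sum.distrib sum_distrib_left scaleR_conv_of_real[where 'a = complex])

lemma exp_has_sum:
  fixes z :: "'a::{banach, real_normed_field}"
  shows "((\<lambda>n. z ^ n / fact n) has_sum exp z) UNIV"
proof (rule norm_summable_imp_has_sum)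
  show "(\<lambda>n. z ^ n / fact n) sums exp z"
    using exp_converges[of z] by (simp add: scaleR_conv_of_real divide_inverse mult.commute)
  show "summable (\<lambda>n. norm (z ^ n / fact n))"
    using summable_norm_exp[of z] by (simp add: norm_divide norm_power norm_mult norm_inverse divide_inverse mult.commute)
qed

lemma summable_imp_abs_summable_weight:
  assumes "\<nu> \<ge> 1" "(\<lambda>k. norm (c k) * l1_weight \<nu> k) summable_on UNIV"
  shows "(\<lambda>k. norm (c k)) summable_on UNIV"
  by (rule summable_on_comparison_test[OF assms(2)])
    (use mult_left_mono[OF l1_weight_ge_1[OF assms(1)], of "norm _"] in auto)

text \<open>
  Expanding each character in an exponential series gives a double series in the order \<open>n\<close> and the index
  \<open>k\<close>. Its absolute sum at radius \<open>r\<close> is \<open>\<Sum>k. \<bar>c\<^sub>k\<bar> exp (\<Omega> \<bar>k\<bar> r)\<close>, which is the weighted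
  norm when \<open>exp (\<Omega> r) = \<nu>\<close>; exchanging the summations produces the Taylor series at any point \<open>x\<close>, with the same radius everywhere.
\<close>

theorem real_analytic_trig_series:
  fixes c :: "int ^ 'd \<Rightarrow> complex"
  assumes \<nu>: "\<nu> > 1" and c: "(\<lambda>k. norm (c k) * l1_weight \<nu> k) summable_on UNIV"
  shows "real_analytic (trig_series \<omega> c)"
  unfolding real_analytic_def
proof
  fix x
  define \<Omega> where "\<Omega> = freq_bound \<omega>"
  define r where "r = ln \<nu> / \<Omega>"
  define A where "A n v = (\<Sum>\<^sub>\<infinity>k. c k * cis (phase \<omega> k x) * (\<Prod>i<n. \<i> * of_real (phase \<omega> k (v i))) / fact n)"
    for n and v :: "nat \<Rightarrow> real ^ 'd"
  define B where "B n k = norm (c k) * ((\<Omega> * l1_deg k) ^ n / fact n)" for n k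
  define C where "C n = (\<Sum>\<^sub>\<infinity>k. B n k)" for n
  have \<Omega>: "\<Omega> > 0" unfolding \<Omega>_def by (rule freq_bound_pos)
  have r: "r > 0" unfolding r_def using \<Omega> \<nu> by simp
  have "exp (\<Omega> * r) = \<nu>" using \<Omega> \<nu> by (simp add: r_def)
  then have weight: "l1_weight \<nu> k = exp (\<Omega> * l1_deg k * r)" for k :: "int ^ 'd"
    using l1_weight_exp[of "\<Omega> * r" k] by (simp add: mult_ac)
  have D: "(\<lambda>(k, n). B n k * r ^ n) summable_on UNIV \<times> UNIV"
  proof (rule summable_on_SigmaI)
    show "((\<lambda>n. case (k, n) of (k, n) \<Rightarrow> B n k * r ^ n) has_sum norm (c k) * l1_weight \<nu> k) UNIV" for k
      unfolding weight using has_sum_cmult_right[OF exp_has_sum[of "\<Omega> * l1_deg k * r"], of "norm (c k)"]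
      by (simp add: B_def power_mult_distrib mult_ac)
  qed (use c \<Omega> r in \<open>auto simp: B_def\<close>)
  then have D': "(\<lambda>(n, k). B n k * r ^ n) summable_on UNIV \<times> UNIV"
    using summable_on_swap[of "\<lambda>(n, k). B n k * r ^ n" UNIV UNIV] by simp
  have B0: "B n k \<ge> 0" for n k
    using \<Omega> by (simp add: B_def)
  have B: "B n summable_on UNIV" for n
  proof -
    have "(\<lambda>k. B n k * r ^ n) summable_on UNIV"
      using summable_on_SigmaD1[OF D', of n] by simp
    then show ?thesis using r by (simp add: summable_on_cmult_left')
  qed
  have C: "summable (\<lambda>n. C n * r ^ n)"
    using summable_on_Sigma_banach[OF D'] by (auto simp: infsum_cmult_left' C_def intro: summable_on_imp_summable)
  have dom: "norm (c k * cis (phase \<omega> k x) * (\<Prod>i<n. \<i> * of_real (phase \<omega> k (v i))) / fact n) \<le> B n k * (\<Prod>i<n. norm (v i))"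
    for n k v
  proof -
    have "(\<Prod>i<n. \<bar>phase \<omega> k (v i)\<bar>) \<le> (\<Prod>i<n. \<Omega> * l1_deg k * norm (v i))"
      by (rule prod_mono) (auto simp: \<Omega>_def abs_phase_le)
    also have "\<dots> = (\<Omega> * l1_deg k) ^ n * (\<Prod>i<n. norm (v i))"
      by (simp add: prod.distrib)
    finally have "norm (c k) * (\<Prod>i<n. \<bar>phase \<omega> k (v i)\<bar>) / fact n \<le>
        norm (c k) * ((\<Omega> * l1_deg k) ^ n * (\<Prod>i<n. norm (v i))) / fact n"
      by (intro divide_right_mono mult_left_mono) auto
    then show ?thesis
      by (simp add: B_def norm_mult norm_divide prod_norm[symmetric] mult_ac)
  qed
  have abs: "(\<lambda>k. norm (c k * cis (phase \<omega> k x) * (\<Prod>i<n. \<i> * of_real (phase \<omega> k (v i))) / fact n)) summable_on UNIV" for n v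
    by (rule Infinite_Sum.abs_summable_on_comparison_test'[OF summable_on_cmult_left[OF B] dom])
  have mult: "bounded_multilinear n (C n) (A n)" for n
    unfolding bounded_multilinear_def
  proof (intro conjI allI impI)
    show "A n v = A n w" if "\<forall>i<n. v i = w i" for v w
      unfolding A_def using that by (intro infsum_cong) simp
    show "norm (A n v) \<le> C n * (\<Prod>i<n. norm (v i))" for v
    proof -
      have "norm (A n v) \<le> (\<Sum>\<^sub>\<infinity>k. B n k * (\<Prod>i<n. norm (v i)))"
        unfolding A_def by (rule order_trans[OF norm_infsum_bound[OF abs] infsum_mono[OF abs summable_on_cmult_left[OF B] dom]])
      then show ?thesis by (simp add: C_def infsum_cmult_left')
    qed
    fix v :: "nat \<Rightarrow> real ^ 'd" and i assume i: "i < n"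
    define t where "t k y = c k * cis (phase \<omega> k x) * (\<Prod>j<n. \<i> * of_real (phase \<omega> k ((v(i := y)) j))) / fact n" for k y
    have t: "t k y = of_real (phase \<omega> k y) * (c k * cis (phase \<omega> k x) * \<i> * (\<Prod>j\<in>{..<n} - {i}. \<i> * of_real (phase \<omega> k (v j))) / fact n)" for k y
    proof -
      have "(\<Prod>j<n. \<i> * of_real (phase \<omega> k ((v(i := y)) j))) =
          \<i> * of_real (phase \<omega> k y) * (\<Prod>j\<in>{..<n} - {i}. \<i> * complex_of_real (phase \<omega> k ((v(i := y)) j)))"
        using i by (subst prod.remove[of _ i]) auto
      also have "(\<Prod>j\<in>{..<n} - {i}. \<i> * complex_of_real (phase \<omega> k ((v(i := y)) j))) = (\<Prod>j\<in>{..<n} - {i}. \<i> * of_real (phase \<omega> k (v j)))"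
        by (rule prod.cong) auto
      finally show ?thesis by (simp add: t_def)
    qed
    have s: "(\<lambda>k. t k y) summable_on UNIV" for y
      unfolding t_def by (rule abs_summable_summable[OF abs])
    have "linear (\<lambda>y. \<Sum>\<^sub>\<infinity>k. t k y)"
    proof (rule linearI)
      show "(\<Sum>\<^sub>\<infinity>k. t k (y + z)) = (\<Sum>\<^sub>\<infinity>k. t k y) + (\<Sum>\<^sub>\<infinity>k. t k z)" for y z
        by (subst infsum_add[OF s s, symmetric]) (simp add: t phase_simps distrib_right add_divide_distrib)
      show "(\<Sum>\<^sub>\<infinity>k. t k (b *\<^sub>R y)) = b *\<^sub>R (\<Sum>\<^sub>\<infinity>k. t k y)" for b y
        by (subst infsum_scaleR_right[symmetric]) (simp add: t phase_simps scaleR_conv_of_real[where 'a = complex] mult.assoc)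
    qed
    then show "linear (\<lambda>y. A n (v(i := y)))"
      by (simp add: A_def t_def)
  qed
  have sums: "(\<lambda>n. A n (\<lambda>_. h)) sums trig_series \<omega> c (x + h)" if h: "norm h < r" for h
  proof -
    define G where "G = (\<lambda>(k, n). c k * cis (phase \<omega> k x) * ((\<i> * of_real (phase \<omega> k h)) ^ n / fact n))"
    have le: "norm (G (k, n)) \<le> B n k * r ^ n" for k n
    proof -
      have "norm (G (k, n)) \<le> B n k * norm h ^ n"
        using dom[where k = k and n = n and v = "\<lambda>_. h"] by (simp add: G_def)
      also have "\<dots> \<le> B n k * r ^ n"
        using h B0 by (intro mult_left_mono power_mono) auto
      finally show ?thesis .
    qed
    have "(\<lambda>x. norm (G x)) summable_on UNIV \<times> UNIV"
      by (rule Infinite_Sum.abs_summable_on_comparison_test'[OF D]) (use le in auto)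
    then have Gs: "G summable_on UNIV \<times> UNIV" by (rule abs_summable_summable)
    have "((\<lambda>k. c k * cis (phase \<omega> k x) * exp (\<i> * of_real (phase \<omega> k h))) has_sum infsum G (UNIV \<times> UNIV)) UNIV"
    proof (rule has_sum_SigmaD[OF has_sum_infsum[OF Gs]])
      show "((\<lambda>n. G (k, n)) has_sum c k * cis (phase \<omega> k x) * exp (\<i> * of_real (phase \<omega> k h))) UNIV" for k
        unfolding G_def prod.case by (rule has_sum_cmult_right[OF exp_has_sum])
    qed
    moreover have "c k * cis (phase \<omega> k x) * exp (\<i> * of_real (phase \<omega> k h)) = c k * cis (phase \<omega> k (x + h))" for k
      by (simp add: phase_simps cis_mult[symmetric] cis_conv_exp[of "phase \<omega> k h"])
    ultimately have eq: "infsum G (UNIV \<times> UNIV) = trig_series \<omega> c (x + h)"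
      by (simp add: trig_series_def infsumI)
    have Gs': "((\<lambda>(n, k). G (k, n)) has_sum trig_series \<omega> c (x + h)) (UNIV \<times> UNIV)"
      using has_sum_infsum[OF Gs] has_sum_swap[of G] unfolding eq by blast
    have "((\<lambda>n. A n (\<lambda>_. h)) has_sum trig_series \<omega> c (x + h)) UNIV"
    proof (rule has_sum_SigmaD[OF Gs'])
      show "((\<lambda>k. case (n, k) of (n, k) \<Rightarrow> G (k, n)) has_sum A n (\<lambda>_. h)) UNIV" for n
        using has_sum_infsum[OF abs_summable_summable[OF abs[where n = n and v = "\<lambda>_. h"]]] by (simp add: G_def A_def)
    qed
    then show ?thesis by (rule has_sum_imp_sums)
  qed
  show "\<exists>A C r. r > 0 \<and> (\<forall>n. bounded_multilinear n (C n) (A n)) \<and> summable (\<lambda>n. C n * r ^ n) \<and>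
       (\<forall>h. norm h < r \<longrightarrow> (\<lambda>n. A n (\<lambda>_. h)) sums trig_series \<omega> c (x + h))"
    using r mult C sums by (intro exI[of _ A] exI[of _ C] exI[of _ r]) auto
qed

text \<open>
  The same series converges on the complex strip of half-width \<open>\<rho>\<close> if the growth \<open>exp (\<Omega> \<bar>k\<bar> \<rho>)\<close> of the
  characters stays below the weight, and the sum is then bounded by the weighted norm. A third of the maximal width is used: one third
  pays for the character itself, and the other two for the polynomial factors and the exponential in the remainder of its
  first-order Taylor expansion, so that the series can be differentiated termwise. The width
  depends on \<open>\<omega>\<close> and \<open>\<nu>\<close> only, and the bound is linear in the norm; this is what continuity with respect
  to the inductive limit topology requires.
\<close>

theorem trig_series_in_strip_ball:
  assumes \<omega>: "\<And>j. \<omega> $ j \<noteq> 0" and \<nu>: "\<nu> > 1"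
  obtains \<rho> where "\<rho> > 0" "\<And>c \<epsilon>. (\<lambda>k. norm (c k) * l1_weight \<nu> k) summable_on UNIV \<Longrightarrow>
    (\<Sum>\<^sub>\<infinity>k. norm (c k) * l1_weight \<nu> k) \<le> \<epsilon> \<Longrightarrow> trig_series \<omega> c \<in> strip_ball \<omega> \<rho> \<epsilon>"
proof -
  define \<Omega> where "\<Omega> = freq_bound \<omega>"
  define \<rho> where "\<rho> = ln \<nu> / (3 * \<Omega>)"
  have \<Omega>: "\<Omega> > 0" unfolding \<Omega>_def by (rule freq_bound_pos)
  have \<rho>: "\<rho> > 0" unfolding \<rho>_def using \<Omega> \<nu> by simp
  have "exp (\<Omega> * (3 * \<rho>)) = \<nu>" using \<Omega> \<nu> by (simp add: \<rho>_def)
  then have weight: "l1_weight \<nu> k = exp (\<Omega> * l1_deg k * \<rho>) * exp (\<Omega> * l1_deg k * \<rho>) * exp (\<Omega> * l1_deg k * \<rho>)" for k :: "int ^ 'a"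
    using l1_weight_exp[of "\<Omega> * (3 * \<rho>)" k] by (simp add: exp_add[symmetric] algebra_simps)
  have ge1: "exp (\<Omega> * l1_deg k * \<rho>) \<ge> 1" for k :: "int ^ 'a"
    using \<Omega> \<rho> by simp
  have mem: "trig_series \<omega> c \<in> strip_ball \<omega> \<rho> \<epsilon>"
    if c: "(\<lambda>k. norm (c k) * l1_weight \<nu> k) summable_on UNIV"
      and le: "(\<Sum>\<^sub>\<infinity>k. norm (c k) * l1_weight \<nu> k) \<le> \<epsilon>" for c \<epsilon>
  proof -
    define E where "E k z = exp (\<i> * cphase \<omega> k z)" for k z
    define U where "U z = (\<Sum>\<^sub>\<infinity>k. c k * E k z)" for z
    have E_le: "norm (E k z) \<le> exp (\<Omega> * l1_deg k * \<rho>)" if "z \<in> strip \<rho>" for k z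
      unfolding E_def using abs_Im_cphase_le[OF that \<rho>, of \<omega> k] by (simp add: \<Omega>_def)
    have E_le': "norm (E k z) \<le> l1_weight \<nu> k" if "z \<in> strip \<rho>" for k z
    proof -
      have "exp (\<Omega> * l1_deg k * \<rho>) * 1 * 1 \<le> l1_weight \<nu> k"
        unfolding weight using ge1[of k] by (intro mult_mono) auto
      with E_le[OF that, of k] show ?thesis by simp
    qed
    have abs: "(\<lambda>k. norm (c k * E k z)) summable_on UNIV" if "z \<in> strip \<rho>" for z
      by (rule Infinite_Sum.abs_summable_on_comparison_test'[OF c])
        (auto simp: norm_mult intro!: mult_left_mono E_le'[OF that])
    have U_le: "norm (U z) \<le> \<epsilon>" if "z \<in> strip \<rho>" for z
    proof -
      have "norm (U z) \<le> (\<Sum>\<^sub>\<infinity>k. norm (c k * E k z))"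
        unfolding U_def by (rule norm_infsum_bound[OF abs[OF that]])
      also have "\<dots> \<le> (\<Sum>\<^sub>\<infinity>k. norm (c k) * l1_weight \<nu> k)"
        by (rule infsum_mono[OF abs[OF that] c]) (auto simp: norm_mult intro!: mult_left_mono E_le'[OF that])
      finally show ?thesis using le by simp
    qed
    define M where "M = (\<Sum>\<^sub>\<infinity>k. norm (c k) * l1_weight \<nu> k)"
    have M0: "M \<ge> 0" unfolding M_def using \<nu> by (intro infsum_nonneg mult_nonneg_nonneg) (auto simp: l1_weight_def)
    have "\<exists>D. (U has_derivative D) (at z) \<and> (\<forall>a v. D (a *s v) = a * D v)" if z: "z \<in> strip \<rho>" for z
    proof -
      \<comment> \<open>derivative of the \<open>k\<close>-th term at \<open>z\<close> in the direction \<open>v\<close>\<close>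
      define d where "d k v = c k * E k z * (\<i> * cphase \<omega> k v)" for k v
      define D where "D v = (\<Sum>\<^sub>\<infinity>k. d k v)" for v
      have d_le: "norm (d k v) \<le> norm (c k) * l1_weight \<nu> k * (norm v / \<rho>)" for k v
      proof -
        have "1 + \<Omega> * l1_deg k * \<rho> \<le> exp (\<Omega> * l1_deg k * \<rho>)" by (rule exp_ge_add_one_self)
        then have "\<Omega> * l1_deg k * \<rho> \<le> exp (\<Omega> * l1_deg k * \<rho>)" by linarith
        then have q: "\<Omega> * l1_deg k \<le> exp (\<Omega> * l1_deg k * \<rho>) / \<rho>"
          using \<rho> by (simp add: pos_le_divide_eq)
        have "norm (E k z) * norm (cphase \<omega> k v) \<le> exp (\<Omega> * l1_deg k * \<rho>) * (exp (\<Omega> * l1_deg k * \<rho>) / \<rho> * norm v)"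
          using E_le[OF z, of k] norm_cphase_le[of \<omega> k v] mult_right_mono[OF q, of "norm v"]
          by (intro mult_mono) (auto simp: \<Omega>_def)
        also have "\<dots> = exp (\<Omega> * l1_deg k * \<rho>) * exp (\<Omega> * l1_deg k * \<rho>) * 1 * (norm v / \<rho>)"
          by simp
        also have "\<dots> \<le> l1_weight \<nu> k * (norm v / \<rho>)"
          unfolding weight using ge1[of k] \<rho> by (intro mult_right_mono mult_left_mono) auto
        finally have "norm (E k z) * norm (cphase \<omega> k v) \<le> l1_weight \<nu> k * (norm v / \<rho>)" .
        from mult_left_mono[OF this, of "norm (c k)"] show ?thesis
          by (simp add: d_def norm_mult mult.assoc)
      qed
      have d_abs: "(\<lambda>k. norm (d k v)) summable_on UNIV" for v
        by (rule Infinite_Sum.abs_summable_on_comparison_test'[OF summable_on_cmult_left[OF c] d_le])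
      have ds: "(\<lambda>k. d k v) summable_on UNIV" for v
        by (rule abs_summable_summable[OF d_abs])
      have "bounded_linear D"
      proof (rule bounded_linear_intro)
        show "D (v + w) = D v + D w" for v w
          unfolding D_def by (subst infsum_add[OF ds ds, symmetric]) (simp add: d_def cphase_simps algebra_simps)
        show "D (b *\<^sub>R v) = b *\<^sub>R D v" for b v
          unfolding D_def by (subst infsum_scaleR_right[symmetric]) (simp add: d_def cphase_simps scaleR_conv_of_real[where 'a = complex] mult_ac)
        show "norm (D v) \<le> norm v * (M / \<rho>)" for v
        proof -
          have "norm (D v) \<le> (\<Sum>\<^sub>\<infinity>k. norm (c k) * l1_weight \<nu> k * (norm v / \<rho>))"
            unfolding D_def by (rule order_trans[OF norm_infsum_bound[OF d_abs] infsum_mono[OF d_abs summable_on_cmult_left[OF c] d_le]])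
          also have "\<dots> = norm v * (M / \<rho>)"
            unfolding M_def infsum_cmult_left' by simp
          finally show ?thesis .
        qed
      qed
      moreover have quad: "norm (U y - U z - D (y - z)) \<le> M * (2 / \<rho>\<^sup>2) * (norm (y - z))\<^sup>2"
        if y: "y \<in> strip \<rho>" "norm (y - z) < \<rho>" for y
      proof -
        define w where "w = y - z"
        have yw: "y = z + w" by (simp add: w_def)
        have tm: "norm (c k * E k y - c k * E k z - d k w) \<le> norm (c k) * l1_weight \<nu> k * (2 / \<rho>\<^sup>2 * (norm w)\<^sup>2)" for k
        proof -
          define \<zeta> where "\<zeta> = \<i> * cphase \<omega> k w"
          define q where "q = \<Omega> * l1_deg k"
          have q0: "q \<ge> 0" using \<Omega> by (simp add: q_def)
          have \<zeta>: "norm \<zeta> \<le> q * norm w"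
            using norm_cphase_le[of \<omega> k w] by (simp add: \<zeta>_def norm_mult q_def \<Omega>_def)
          also have "\<dots> \<le> q * \<rho>"
            using y(2) q0 by (intro mult_left_mono) (auto simp: w_def)
          finally have re: "\<bar>Re \<zeta>\<bar> \<le> q * \<rho>"
            using abs_Re_le_cmod[of \<zeta>] by linarith
          have "norm (exp \<zeta> - (\<Sum>i\<le>1. \<zeta> ^ i / fact i)) \<le> exp \<bar>Re \<zeta>\<bar> * (norm \<zeta> ^ Suc 1) / fact 1"
            by (rule Taylor_exp)
          then have "norm (exp \<zeta> - 1 - \<zeta>) \<le> exp \<bar>Re \<zeta>\<bar> * (norm \<zeta>)\<^sup>2"
            by (simp add: power2_eq_square algebra_simps)
          also have "\<dots> \<le> exp (q * \<rho>) * (q * norm w)\<^sup>2"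
            using re \<zeta> by (intro mult_mono power_mono) auto
          also have "\<dots> = exp (q * \<rho>) * ((q * \<rho>)\<^sup>2 / \<rho>\<^sup>2 * (norm w)\<^sup>2)"
            using \<rho> by (simp add: power_mult_distrib)
          also have "\<dots> \<le> exp (q * \<rho>) * (2 * exp (q * \<rho>) / \<rho>\<^sup>2 * (norm w)\<^sup>2)"
          proof -
            have "1 + q * \<rho> + (q * \<rho>)\<^sup>2 / 2 \<le> exp (q * \<rho>)"
              using q0 \<rho> by (intro exp_lower_Taylor_quadratic) auto
            moreover have "0 \<le> q * \<rho>" using q0 \<rho> by simp
            ultimately have "(q * \<rho>)\<^sup>2 \<le> 2 * exp (q * \<rho>)" by linarith
            then show ?thesis using \<rho> by (intro mult_left_mono mult_right_mono divide_right_mono) auto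
          qed
          finally have ex: "norm (exp \<zeta> - 1 - \<zeta>) \<le> exp (q * \<rho>) * (2 * exp (q * \<rho>) / \<rho>\<^sup>2 * (norm w)\<^sup>2)" .
          have Ey: "E k y = E k z * exp \<zeta>"
            by (simp add: E_def yw cphase_simps \<zeta>_def distrib_left exp_add)
          have "c k * E k y - c k * E k z - d k w = c k * (E k z * (exp \<zeta> - 1 - \<zeta>))"
            unfolding Ey d_def \<zeta>_def by (simp add: algebra_simps)
          then have "norm (c k * E k y - c k * E k z - d k w) = norm (c k) * (norm (E k z) * norm (exp \<zeta> - 1 - \<zeta>))"
            by (simp add: norm_mult)
          also have "\<dots> \<le> norm (c k) * (exp (q * \<rho>) * (exp (q * \<rho>) * (2 * exp (q * \<rho>) / \<rho>\<^sup>2 * (norm w)\<^sup>2)))"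
            using E_le[OF z, of k] ex by (intro mult_left_mono mult_mono) (auto simp: q_def)
          also have "\<dots> = norm (c k) * l1_weight \<nu> k * (2 / \<rho>\<^sup>2 * (norm w)\<^sup>2)"
            by (simp add: weight q_def)
          finally show ?thesis .
        qed
        have hs: "((\<lambda>k. c k * E k y - c k * E k z - d k w) has_sum (U y - U z - D w)) UNIV"
        proof -
          have "((\<lambda>k. c k * E k y + - (c k * E k z) + - d k w) has_sum (U y + - U z + - D w)) UNIV"
            unfolding U_def D_def
            by (intro has_sum_add has_sum_uminusI has_sum_infsum abs_summable_summable[OF abs] y(1) z ds)
          then show ?thesis by simp
        qed
        have ts: "(\<lambda>k. norm (c k * E k y - c k * E k z - d k w)) summable_on UNIV"
          by (rule Infinite_Sum.abs_summable_on_comparison_test'[OF summable_on_cmult_left[OF c] tm])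
        have "norm (U y - U z - D w) \<le> (\<Sum>\<^sub>\<infinity>k. norm (c k) * l1_weight \<nu> k * (2 / \<rho>\<^sup>2 * (norm w)\<^sup>2))"
          using order_trans[OF norm_infsum_bound[OF ts] infsum_mono[OF ts summable_on_cmult_left[OF c] tm]]
          by (simp add: infsumI[OF hs])
        also have "\<dots> = M * (2 / \<rho>\<^sup>2) * (norm w)\<^sup>2"
          unfolding M_def infsum_cmult_left' by (simp only: mult.assoc)
        finally show ?thesis by (simp only: w_def)
      qed
      have "(U has_derivative D) (at z)"
        unfolding has_derivative_at_alt
      proof (intro conjI allI impI)
        show "bounded_linear D" by fact
        fix e :: real assume e: "e > 0"
        define m where "m = (MIN j. \<rho> - \<bar>Im (z $ j)\<bar>)"
        have m: "m > 0" "\<And>j. m \<le> \<rho> - \<bar>Im (z $ j)\<bar>"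
          using z by (auto simp: m_def strip_def)
        define B where "B = M * (2 / \<rho>\<^sup>2) + 1"
        have B: "B > 0" unfolding B_def using M0 \<rho> by (intro add_nonneg_pos) auto
        show "\<exists>d>0. \<forall>y. norm (y - z) < d \<longrightarrow> norm (U y - U z - D (y - z)) \<le> e * norm (y - z)"
        proof (intro exI[of _ "min (min m \<rho>) (e / B)"] conjI allI impI)
          show "min (min m \<rho>) (e / B) > 0" using m \<rho> e B by simp
          fix y assume y: "norm (y - z) < min (min m \<rho>) (e / B)"
          have ys: "y \<in> strip \<rho>"
            unfolding strip_def
          proof (intro CollectI allI)
            fix j
            have "\<bar>Im (y $ j)\<bar> \<le> \<bar>Im (z $ j)\<bar> + \<bar>Im ((y - z) $ j)\<bar>" by simp
            also have "\<bar>Im ((y - z) $ j)\<bar> \<le> norm (y - z)"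
              using abs_Im_le_cmod[of "(y - z) $ j"] Finite_Cartesian_Product.norm_nth_le[of "y - z" j] by linarith
            finally show "\<bar>Im (y $ j)\<bar> < \<rho>" using y m(2)[of j] by linarith
          qed
          have "norm (U y - U z - D (y - z)) \<le> M * (2 / \<rho>\<^sup>2) * (norm (y - z))\<^sup>2"
            using y by (intro quad ys) auto
          also have "\<dots> \<le> B * (norm (y - z))\<^sup>2"
            by (intro mult_right_mono) (auto simp: B_def)
          also have "\<dots> = (B * norm (y - z)) * norm (y - z)"
            by (simp add: power2_eq_square)
          also have "\<dots> \<le> e * norm (y - z)"
            using y B by (intro mult_right_mono) (auto simp: pos_less_divide_eq mult.commute)
          finally show "norm (U y - U z - D (y - z)) \<le> e * norm (y - z)" .
        qed
      qed
      moreover have "D (a *s v) = a * D v" for a v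
        unfolding D_def by (subst infsum_cmult_right'[symmetric]) (simp add: d_def cphase_simps mult_ac)
      ultimately show ?thesis by blast
    qed
    then have "holomorphic_vec U (strip \<rho>)"
      by (simp add: holomorphic_vec_def)
    moreover have "U (\<chi> j. of_real (x $ j)) = trig_series \<omega> c x" for x
      by (simp add: U_def E_def trig_series_def cphase_simps cis_conv_exp)
    moreover have "trig_series \<omega> c \<in> analytic_torus \<omega>"
      unfolding analytic_torus_def
      using real_analytic_trig_series[OF \<nu> c] torus_fun_trig_series[OF \<omega>] by simp
    ultimately show ?thesis
      unfolding strip_ball_def using U_le by blast
  qed
  show ?thesis by (rule that[OF \<rho> mem])
qed

section \<open>Evaluation of coefficient sequences as functions on the torus\<close>

definition wev :: "real ^ 'd \<Rightarrow> 'd::finite wiener \<Rightarrow> real ^ 'd \<Rightarrow> complex"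
  where "wev \<omega> v = trig_series \<omega> (wcoeff v)"

lemma wcoeff_abs_summable: "(\<lambda>k. norm (wcoeff v k)) summable_on UNIV"
  by (rule summable_imp_abs_summable_weight[of 2]) (use wcoeff_summable in auto)

lemma wev_has_sum: "((\<lambda>k. wcoeff v k * cis (phase \<omega> k x)) has_sum wev \<omega> v x) UNIV"
  unfolding wev_def by (rule trig_series_has_sum[OF wcoeff_abs_summable])

lemma wev_linear:
  "wev \<omega> (u + v) x = wev \<omega> u x + wev \<omega> v x" "wev \<omega> (u - v) x = wev \<omega> u x - wev \<omega> v x"
  "wev \<omega> (r *\<^sub>R v) x = r *\<^sub>R wev \<omega> v x" "wev \<omega> 0 x = 0"
proof -
  show add: "wev \<omega> (u + v) x = wev \<omega> u x + wev \<omega> v x" for u v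
    by (rule has_sum_unique[OF wev_has_sum])
      (use has_sum_add[OF wev_has_sum wev_has_sum] in \<open>simp add: distrib_right\<close>)
  show scale: "wev \<omega> (r *\<^sub>R v) x = r *\<^sub>R wev \<omega> v x" for r v
    by (rule has_sum_unique[OF wev_has_sum])
      (use has_sum_scaleR[OF wev_has_sum] in \<open>simp add: mult.assoc\<close>)
  show "wev \<omega> (u - v) x = wev \<omega> u x - wev \<omega> v x"
    using add[of u "- v"] scale[of "-1" v] by simp
  show "wev \<omega> 0 x = 0"
    using scale[of 0 0] by simp
qed

lemma norm_wev_le: "norm (wev \<omega> v x) \<le> norm v"
proof -
  have "norm (wev \<omega> v x) \<le> (\<Sum>\<^sub>\<infinity>k. norm (wcoeff v k))"
    unfolding wev_def by (rule norm_trig_series_le[OF wcoeff_abs_summable])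
  also have "\<dots> \<le> norm v"
    unfolding norm_wiener.rep_eq
    by (intro infsum_mono wcoeff_abs_summable wcoeff_summable)
      (use mult_left_mono[OF l1_weight_ge_1[of 2], of "norm _"] in auto)
  finally show ?thesis .
qed

lemma bounded_linear_wev: "bounded_linear (\<lambda>v. wev \<omega> v x)"
  by (rule bounded_linear_intro[of _ 1]) (simp_all add: wev_linear norm_wev_le)

text \<open>
  Characters are multiplicative in the index, so the product of two absolutely convergent series regroups into
  the convolution.
\<close>

lemma wev_mult: "wev \<omega> (u * v) x = wev \<omega> u x * wev \<omega> v x"
proof -
  define f g where "f k = wcoeff u k * cis (phase \<omega> k x)" and "g k = wcoeff v k * cis (phase \<omega> k x)" for k
  have fg: "infsum f UNIV = wev \<omega> u x" "infsum g UNIV = wev \<omega> v x"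
    unfolding f_def[abs_def] g_def[abs_def] by (rule infsumI[OF wev_has_sum])+
  have "((\<lambda>(l, m). f l * g m) has_sum wev \<omega> u x * wev \<omega> v x) (UNIV \<times> UNIV)"
    unfolding fg[symmetric]
    by (rule has_sum_product) (simp_all add: f_def g_def norm_mult wcoeff_abs_summable)
  moreover have bij: "bij_betw (\<lambda>(k, l). (l, k - l)) (UNIV \<times> UNIV) (UNIV \<times> (UNIV :: (int ^ 'a) set))"
    by (rule bij_betwI[of _ _ _ "\<lambda>(l, m). (l + m, l)"]) auto
  ultimately have "((\<lambda>(k, l). f l * g (k - l)) has_sum wev \<omega> u x * wev \<omega> v x) (UNIV \<times> UNIV)"
    using has_sum_reindex_bij_betw[OF bij, of "\<lambda>(l, m). f l * g m"] by (simp add: case_prod_unfold)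
  then have "((\<lambda>k. wcoeff (u * v) k * cis (phase \<omega> k x)) has_sum wev \<omega> u x * wev \<omega> v x) UNIV"
  proof (rule has_sum_SigmaD)
    fix k
    have "((\<lambda>l. wcoeff u l * wcoeff v (k - l) * cis (phase \<omega> k x)) has_sum wcoeff (u * v) k * cis (phase \<omega> k x)) UNIV"
      unfolding times_wiener.rep_eq by (intro has_sum_cmult_left has_sum_infsum wcoeff_times_row)
    also have "(\<lambda>l. wcoeff u l * wcoeff v (k - l) * cis (phase \<omega> k x)) = (\<lambda>l. f l * g (k - l))"
    proof
      fix l
      have "cis (phase \<omega> k x) = cis (phase \<omega> l x) * cis (phase \<omega> (k - l) x)"
        by (simp add: cis_mult phase_simps)
      then show "wcoeff u l * wcoeff v (k - l) * cis (phase \<omega> k x) = f l * g (k - l)"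
        by (simp add: f_def g_def mult_ac)
    qed
    finally show "((\<lambda>y. case (k, y) of (k, l) \<Rightarrow> f l * g (k - l)) has_sum wcoeff (u * v) k * cis (phase \<omega> k x)) UNIV"
      by simp
  qed
  then show ?thesis
    by (rule has_sum_unique[OF wev_has_sum])
qed

lemma wev_wconst: "wev \<omega> (wconst a) x = a"
proof (rule has_sum_unique[OF wev_has_sum])
  show "((\<lambda>k. wcoeff (wconst a) k * cis (phase \<omega> k x)) has_sum a) UNIV"
    by (rule has_sum_finite_neutralI[of "{0}"]) (auto simp: phase_simps)
qed

lemma wev_power: "wev \<omega> (u ^ n) x = wev \<omega> u x ^ n"
proof (induction n)
  case 0
  show ?case using wev_wconst[of \<omega> 1 x] by (simp add: wconst_simps)
qed (simp add: wev_mult)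

lemma wev_wcnj: "wev \<omega> (wcnj v) x = cnj (wev \<omega> v x)"
proof (rule has_sum_unique[OF wev_has_sum])
  have "((\<lambda>k. cnj (wcoeff v k * cis (phase \<omega> k x))) has_sum cnj (wev \<omega> v x)) UNIV"
    by (rule has_sum_cnj_iff[THEN iffD2, OF wev_has_sum])
  also have "?this \<longleftrightarrow> ((\<lambda>k. wcoeff (wcnj v) k * cis (phase \<omega> k x)) has_sum cnj (wev \<omega> v x)) UNIV"
    by (rule has_sum_reindex_bij_witness[of UNIV uminus uminus UNIV]) (auto simp: wcnj.rep_eq phase_simps cis_cnj)
  finally show "((\<lambda>k. wcoeff (wcnj v) k * cis (phase \<omega> k x)) has_sum cnj (wev \<omega> v x)) UNIV" .
qed

lemma wev_in_wiener_algebra: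
  assumes \<omega>: "\<And>j. \<omega> $ j \<noteq> 0"
  shows "wev \<omega> v \<in> wiener_algebra \<omega> 2" "wiener_norm \<omega> 2 (wev \<omega> v) = norm v"
proof -
  have fc: "fourier_coeff \<omega> (wev \<omega> v) k = wcoeff v k" for k
    unfolding wev_def by (rule fourier_coeff_trig_series[OF \<omega> wcoeff_abs_summable])
  show "wev \<omega> v \<in> wiener_algebra \<omega> 2"
    unfolding wiener_algebra_def mem_Collect_eq fc unfolding wev_def
    by (intro conjI torus_fun_trig_series[OF \<omega>] continuous_on_trig_series wcoeff_abs_summable wcoeff_summable)
  show "wiener_norm \<omega> 2 (wev \<omega> v) = norm v"
    by (simp add: wiener_norm_def fc norm_wiener.rep_eq)
qed

text \<open>
  A common bound for the size of first-order symbols. Its fourth power bounds the square of the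
  symbol of the Laplacian, the worst factor that occurs when the flow is differentiated in time.
\<close>

definition growth :: "real ^ 'd \<Rightarrow> int ^ 'd \<Rightarrow> real" where "growth \<omega> k = 1 + freq_bound \<omega> * l1_deg k"

lemma growth_ge_1: "growth \<omega> k \<ge> 1"
  using freq_bound_pos[of \<omega>] by (simp add: growth_def)

lemma power_le_fact_exp: "x \<ge> 0 \<Longrightarrow> x ^ n \<le> fact n * exp (x::real)"
proof -
  assume "x \<ge> 0"
  then have "(\<Sum>i\<in>{n}. x ^ i / fact i) \<le> exp x"
    by (intro finite_sum_le_has_sum[OF exp_has_sum]) auto
  then show ?thesis by (simp add: field_simps)
qed

lemma growth_power4_le: obtains B where "B \<ge> 0" "\<And>k. growth \<omega> k ^ 4 \<le> B * l1_weight 2 k"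
proof -
  define \<kappa> where "\<kappa> = max 1 (freq_bound \<omega> / ln 2)"
  define B where "B = \<kappa> ^ 4 * (fact 4 * exp 1)"
  have \<kappa>: "\<kappa> \<ge> 1" by (simp add: \<kappa>_def)
  have B: "B \<ge> 0" using \<kappa> by (simp add: B_def)
  have "growth \<omega> k ^ 4 \<le> B * l1_weight 2 k" for k :: "int ^ 'a"
  proof -
    define y where "y = ln 2 * l1_deg k"
    have y: "y \<ge> 0" by (simp add: y_def)
    have "freq_bound \<omega> * l1_deg k = freq_bound \<omega> / ln 2 * y"
      by (simp add: y_def)
    also have "\<dots> \<le> \<kappa> * y"
      using y by (intro mult_right_mono) (auto simp: \<kappa>_def)
    finally have "growth \<omega> k \<le> \<kappa> * (1 + y)"
      using \<kappa> by (simp add: growth_def distrib_left)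
    then have "growth \<omega> k ^ 4 \<le> (\<kappa> * (1 + y)) ^ 4"
      using growth_ge_1[of \<omega> k] by (intro power_mono) auto
    also have "\<dots> = \<kappa> ^ 4 * (1 + y) ^ 4" by (rule power_mult_distrib)
    also have "\<dots> \<le> \<kappa> ^ 4 * (fact 4 * exp (1 + y))"
      using \<kappa> y by (intro mult_left_mono power_le_fact_exp) auto
    also have "\<dots> = B * exp y" by (simp add: B_def exp_add)
    also have "exp y = l1_weight 2 k"
      using l1_weight_exp[of "ln 2" k] by (simp add: y_def)
    finally show ?thesis .
  qed
  with B show ?thesis by (rule that)
qed

lemma abs_freq_component_le: "\<bar>\<omega> $ j * of_int (k $ j)\<bar> \<le> growth \<omega> k"
  using abs_phase_le[of \<omega> k "axis j 1"] by (simp add: phase_simps growth_def)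

lemma freq_nonneg: "freq \<omega> k \<ge> 0"
  by (simp add: freq_def sum_nonneg)

lemma freq_le: "freq \<omega> k \<le> growth \<omega> k ^ 2"
proof -
  have "freq \<omega> k \<le> (\<Sum>j\<in>UNIV. \<bar>\<omega> $ j\<bar> * \<bar>of_int (k $ j)\<bar> * (freq_bound \<omega> * l1_deg k))"
    unfolding freq_def
  proof (rule sum_mono)
    fix j
    have "(\<omega> $ j * of_int (k $ j))\<^sup>2 = (\<bar>\<omega> $ j\<bar> * \<bar>of_int (k $ j)\<bar>) * \<bar>\<omega> $ j * of_int (k $ j)\<bar>"
      by (simp add: power2_eq_square abs_mult[symmetric])
    also have "\<dots> \<le> (\<bar>\<omega> $ j\<bar> * \<bar>of_int (k $ j)\<bar>) * (freq_bound \<omega> * l1_deg k)"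
      using abs_phase_le[of \<omega> k "axis j 1"] by (intro mult_left_mono) (simp_all add: phase_simps)
    finally show "(\<omega> $ j * of_int (k $ j))\<^sup>2 \<le> \<bar>\<omega> $ j\<bar> * \<bar>of_int (k $ j)\<bar> * (freq_bound \<omega> * l1_deg k)" .
  qed
  also have "\<dots> \<le> freq_bound \<omega> * l1_deg k * (freq_bound \<omega> * l1_deg k)"
    using freq_bound_pos[of \<omega>] by (intro sum_phase_le) auto
  also have "\<dots> \<le> growth \<omega> k ^ 2"
    unfolding power2_eq_square using freq_bound_pos[of \<omega>] by (intro mult_mono) (auto simp: growth_def)
  finally show ?thesis .
qed

text \<open>
  Evaluation at a point, its derivatives in space, and the Laplacian at a point are all pairings of the coefficients with a
  sequence dominated by the weight.
\<close>

definition wpair :: "(int ^ 'd \<Rightarrow> complex) \<Rightarrow> 'd::finite wiener \<Rightarrow> complex"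
  where "wpair m v = (\<Sum>\<^sub>\<infinity>k. m k * wcoeff v k)"

lemma wpair_abs_summable:
  assumes "\<And>k. norm (m k) \<le> B * l1_weight 2 k"
  shows "(\<lambda>k. norm (m k * wcoeff v k)) summable_on UNIV"
  by (rule Infinite_Sum.abs_summable_on_comparison_test'[OF summable_on_cmult_right[OF wcoeff_summable, of B v]])
    (use mult_right_mono[OF assms, of "norm (wcoeff v _)"] in \<open>simp add: norm_mult mult_ac\<close>)

lemma wpair_has_sum:
  assumes "\<And>k. norm (m k) \<le> B * l1_weight 2 k"
  shows "((\<lambda>k. m k * wcoeff v k) has_sum wpair m v) UNIV"
  unfolding wpair_def by (rule has_sum_infsum[OF abs_summable_summable[OF wpair_abs_summable[OF assms]]])

lemma norm_wpair_le:
  assumes "\<And>k. norm (m k) \<le> B * l1_weight 2 k"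
  shows "norm (wpair m v) \<le> B * norm v"
proof -
  have "norm (wpair m v) \<le> (\<Sum>\<^sub>\<infinity>k. norm (m k * wcoeff v k))"
    unfolding wpair_def by (rule norm_infsum_bound[OF wpair_abs_summable[OF assms]])
  also have "\<dots> \<le> (\<Sum>\<^sub>\<infinity>k. B * (norm (wcoeff v k) * l1_weight 2 k))"
    by (rule infsum_mono[OF wpair_abs_summable[OF assms] summable_on_cmult_right[OF wcoeff_summable]])
      (use mult_right_mono[OF assms, of "norm (wcoeff v _)"] in \<open>simp add: norm_mult mult_ac\<close>)
  also have "\<dots> = B * norm v"
    by (simp add: norm_wiener.rep_eq infsum_cmult_right')
  finally show ?thesis .
qed

lemma norm_cis_quadratic: "norm (cis s - 1 - \<i> * of_real s) \<le> s\<^sup>2"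
proof -
  have "norm (exp (\<i> * of_real s) - (\<Sum>i\<le>1. (\<i> * of_real s) ^ i / fact i)) \<le>
      exp \<bar>Re (\<i> * of_real s)\<bar> * (norm (\<i> * of_real s) ^ Suc 1) / fact 1"
    by (rule Taylor_exp)
  then show ?thesis
    by (simp add: cis_conv_exp norm_mult power2_eq_square algebra_simps)
qed

text \<open>
  The derivative as a limit of difference quotients, in the form in which an isometric group can be applied to the quotients.
\<close>

lemma has_vector_derivative_quotient:
  fixes f :: "real \<Rightarrow> 'a::real_normed_vector"
  shows "(f has_vector_derivative d) (at t within S) \<longleftrightarrow>
    ((\<lambda>s. (1 / (s - t)) *\<^sub>R (f s - f t)) \<longlongrightarrow> d) (at t within S)"
proof -
  have "((\<lambda>s. norm ((1 / norm (s - t)) *\<^sub>R (f s - (f t + (s - t) *\<^sub>R d)))) \<longlongrightarrow> 0) (at t within S) \<longleftrightarrow>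
      ((\<lambda>s. norm ((1 / (s - t)) *\<^sub>R (f s - f t) - d)) \<longlongrightarrow> 0) (at t within S)"
  proof (rule Lim_cong_within)
    fix s assume "s \<noteq> t"
    have "(1 / (s - t)) *\<^sub>R (f s - f t) - d = (1 / (s - t)) *\<^sub>R (f s - (f t + (s - t) *\<^sub>R d))"
      using \<open>s \<noteq> t\<close> by (simp add: scaleR_right_diff_distrib scaleR_right_distrib)
    then show "norm ((1 / norm (s - t)) *\<^sub>R (f s - (f t + (s - t) *\<^sub>R d))) = norm ((1 / (s - t)) *\<^sub>R (f s - f t) - d)"
      by simp
  qed auto
  then show ?thesis
    unfolding has_vector_derivative_def has_derivative_within
    by (simp only: tendsto_norm_zero_iff LIM_zero_iff) (auto intro: bounded_linear_scaleR_left)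
qed

text \<open>
  One lemma for derivatives in space and in time: \<open>\<theta> k\<close> is \<open>\<omega>\<^sub>j k\<^sub>j\<close> for the former, and the symbol
  \<open>- freq \<omega> k\<close> of the Laplacian for the latter. The second-order remainder of \<open>exp (\<i> \<theta> s)\<close> is at most \<open>(\<theta> s)\<^sup>2\<close>, which is why the domination involves \<open>1 + \<theta>\<^sup>2\<close>.
\<close>

lemma wpair_oscillation_derivative:
  fixes \<theta> :: "int ^ 'd \<Rightarrow> real"
  assumes m: "\<And>k. norm (m k) * (1 + (\<theta> k)\<^sup>2) \<le> B * l1_weight 2 k"
  shows "((\<lambda>s. wpair (\<lambda>k. m k * cis (\<theta> k * s)) v) has_vector_derivative wpair (\<lambda>k. m k * (\<i> * of_real (\<theta> k))) v) (at 0)"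
proof -
  have m0: "norm (m k) \<le> B * l1_weight 2 k" for k
  proof -
    have "norm (m k) * 1 \<le> norm (m k) * (1 + (\<theta> k)\<^sup>2)" by (intro mult_left_mono) auto
    then show ?thesis using m[of k] by simp
  qed
  have m1: "norm (m k * (\<i> * of_real (\<theta> k))) \<le> B * l1_weight 2 k" for k
  proof -
    have "\<bar>\<theta> k\<bar> \<le> 1 + (\<theta> k)\<^sup>2"
      using sum_squares_bound[of "\<bar>\<theta> k\<bar>" 1] by simp
    then have "norm (m k) * \<bar>\<theta> k\<bar> \<le> norm (m k) * (1 + (\<theta> k)\<^sup>2)" by (intro mult_left_mono) auto
    then show ?thesis using m[of k] by (simp add: norm_mult)
  qed
  let ?f = "\<lambda>s. wpair (\<lambda>k. m k * cis (\<theta> k * s)) v"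
  let ?d = "wpair (\<lambda>k. m k * (\<i> * of_real (\<theta> k))) v"
  have quad: "norm (?f s - ?f 0 - s *\<^sub>R ?d) \<le> s\<^sup>2 * B * norm v" for s
  proof -
    define e where "e k = m k * cis (\<theta> k * s) - m k - of_real s * (m k * (\<i> * of_real (\<theta> k)))" for k
    have e: "norm (e k) \<le> s\<^sup>2 * B * l1_weight 2 k" for k
    proof -
      have "e k = m k * (cis (\<theta> k * s) - 1 - \<i> * of_real (\<theta> k * s))"
        by (simp add: e_def algebra_simps)
      then have "norm (e k) \<le> norm (m k) * (\<theta> k * s)\<^sup>2"
        using norm_cis_quadratic[of "\<theta> k * s"] by (simp only: norm_mult) (intro mult_left_mono; simp)
      also have "\<dots> \<le> s\<^sup>2 * (norm (m k) * (1 + (\<theta> k)\<^sup>2))"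
        by (simp add: power_mult_distrib algebra_simps)
      also have "\<dots> \<le> s\<^sup>2 * (B * l1_weight 2 k)"
        by (intro mult_left_mono m) auto
      finally show ?thesis by simp
    qed
    have "((\<lambda>k. m k * cis (\<theta> k * s) * wcoeff v k + - (m k * wcoeff v k) + - (s *\<^sub>R (m k * (\<i> * of_real (\<theta> k)) * wcoeff v k)))
        has_sum (?f s + - wpair m v + - (s *\<^sub>R ?d))) UNIV"
      by (intro has_sum_add has_sum_uminusI has_sum_scaleR wpair_has_sum[where B = B] m0 m1)
        (simp add: norm_mult m0)
    moreover have "m k * cis (\<theta> k * s) * wcoeff v k + - (m k * wcoeff v k) + - (s *\<^sub>R (m k * (\<i> * of_real (\<theta> k)) * wcoeff v k)) = e k * wcoeff v k" for k
      by (simp add: e_def scaleR_conv_of_real algebra_simps)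
    ultimately have "wpair e v = ?f s + - wpair m v + - (s *\<^sub>R ?d)"
      unfolding wpair_def[of e] by (intro infsumI) (simp only:)
    then show ?thesis
      using norm_wpair_le[OF e, of v] by (simp add: mult.assoc)
  qed
  have B0: "0 \<le> B * norm v"
    using norm_wpair_le[OF m0, of v] norm_ge_zero order_trans by blast
  show ?thesis
    unfolding has_vector_derivative_quotient
  proof (rule tendstoI)
    fix e :: real assume e: "e > 0"
    define d where "d = e / (B * norm v + 1)"
    have d: "d > 0" unfolding d_def using e B0 by (intro divide_pos_pos) auto
    have "dist ((1 / (s - 0)) *\<^sub>R (?f s - ?f 0)) ?d < e" if "s \<noteq> 0" "dist s 0 < d" for s
    proof -
      have "(1 / (s - 0)) *\<^sub>R (?f s - ?f 0) - ?d = (1 / s) *\<^sub>R (?f s - ?f 0 - s *\<^sub>R ?d)"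
        using that by (simp add: algebra_simps)
      then have "dist ((1 / (s - 0)) *\<^sub>R (?f s - ?f 0)) ?d = norm (?f s - ?f 0 - s *\<^sub>R ?d) / \<bar>s\<bar>"
        unfolding dist_norm by (simp add: divide_inverse_commute)
      also have "\<dots> \<le> (s\<^sup>2 * B * norm v) / \<bar>s\<bar>"
        by (intro divide_right_mono quad) auto
      also have "\<dots> = \<bar>s\<bar> * (B * norm v)"
        using that by (simp add: power2_eq_square abs_if)
      also have "\<dots> \<le> \<bar>s\<bar> * (B * norm v + 1)" by (intro mult_left_mono) auto
      also have "\<dots> < e"
        using that B0 by (simp add: d_def pos_less_divide_eq add_nonneg_pos)
      finally show ?thesis .
    qed
    then show "\<forall>\<^sub>F s in at 0. dist ((1 / (s - 0)) *\<^sub>R (?f s - ?f 0)) ?d < e"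
      unfolding eventually_at using d by auto
  qed
qed

section \<open>Solutions in the interaction picture\<close>

lemma wev_eq_wpair: "wev \<omega> v x = wpair (\<lambda>k. cis (phase \<omega> k x)) v"
  by (simp add: wev_def trig_series_def wpair_def mult.commute)

lemma growth_dominated:
  fixes \<omega> :: "real ^ 'd"
  obtains B where "\<And>k. 1 + (freq \<omega> k)\<^sup>2 \<le> B * l1_weight 2 k"
    "\<And>j k. 1 + (\<omega> $ j * of_int (k $ j))\<^sup>2 \<le> B * l1_weight 2 k"
    "\<And>j k. \<bar>\<omega> $ j * of_int (k $ j)\<bar> * (1 + (\<omega> $ j * of_int (k $ j))\<^sup>2) \<le> B * l1_weight 2 k"
proof (rule growth_power4_le[of \<omega>])
  fix B assume B: "\<And>k. growth \<omega> k ^ 4 \<le> B * l1_weight 2 k"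
  have p: "growth \<omega> k ^ n \<le> B * l1_weight 2 k" if "n \<le> 4" for n k
    using power_increasing[OF that growth_ge_1[of \<omega> k]] B[of k] by linarith
  have 1: "1 \<le> B * l1_weight 2 k" for k :: "int ^ 'd"
    using p[of 0 k] by simp
  show ?thesis
  proof (rule that[of "2 * B"])
    show "1 + (freq \<omega> k)\<^sup>2 \<le> 2 * B * l1_weight 2 k" for k
    proof -
      have "(freq \<omega> k)\<^sup>2 \<le> (growth \<omega> k ^ 2)\<^sup>2"
        by (intro power_mono freq_le freq_nonneg)
      also have "\<dots> = growth \<omega> k ^ 4" by (simp add: power_mult[symmetric])
      finally show ?thesis using p[of 4 k] 1[of k] by simp
    qed
    show *: "1 + (\<omega> $ j * of_int (k $ j))\<^sup>2 \<le> 2 * B * l1_weight 2 k" for j k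
    proof -
      have "\<bar>\<omega> $ j * of_int (k $ j)\<bar>\<^sup>2 \<le> growth \<omega> k ^ 2"
        by (intro power_mono abs_freq_component_le) auto
      then show ?thesis using p[of 2 k] 1[of k] by simp
    qed
    show "\<bar>\<omega> $ j * of_int (k $ j)\<bar> * (1 + (\<omega> $ j * of_int (k $ j))\<^sup>2) \<le> 2 * B * l1_weight 2 k" for j k
    proof -
      define q where "q = \<bar>\<omega> $ j * of_int (k $ j)\<bar>"
      have q: "0 \<le> q" "q \<le> growth \<omega> k"
        using abs_freq_component_le[of \<omega> j k] by (simp_all add: q_def)
      have "q * (1 + q\<^sup>2) = q ^ 1 + q ^ 3"
        by (simp add: power2_eq_square power3_eq_cube distrib_left)
      also have "\<dots> \<le> growth \<omega> k ^ 1 + growth \<omega> k ^ 3"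
        by (intro add_mono power_mono q)
      also have "\<dots> \<le> 2 * B * l1_weight 2 k"
        using p[of 1 k] p[of 3 k] by simp
      finally show ?thesis by (simp add: q_def)
    qed
  qed
qed

lemma partial_deriv_wev:
  "partial_deriv j (wev \<omega> v) = (\<lambda>x. wpair (\<lambda>k. cis (phase \<omega> k x) * (\<i> * of_real (\<omega> $ j * of_int (k $ j)))) v)"
proof (rule growth_dominated[of \<omega>])
  fix B assume B: "\<And>j k. 1 + (\<omega> $ j * of_int (k $ j))\<^sup>2 \<le> B * l1_weight 2 k"
  show ?thesis
  proof
    fix x
    have "((\<lambda>h. wpair (\<lambda>k. cis (phase \<omega> k x) * cis (\<omega> $ j * of_int (k $ j) * h)) v) has_vector_derivative
        wpair (\<lambda>k. cis (phase \<omega> k x) * (\<i> * of_real (\<omega> $ j * of_int (k $ j)))) v) (at 0)"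
      by (rule wpair_oscillation_derivative[where B = B]) (use B in simp)
    then show "partial_deriv j (wev \<omega> v) x = wpair (\<lambda>k. cis (phase \<omega> k x) * (\<i> * of_real (\<omega> $ j * of_int (k $ j)))) v"
      unfolding partial_deriv_def wev_eq_wpair phase_simps cis_mult[symmetric]
      by (rule vector_derivative_at)
  qed
qed

lemma has_sum_finite_sum:
  fixes f :: "'j \<Rightarrow> 'i \<Rightarrow> 'a::topological_comm_monoid_add"
  assumes "finite J" "\<And>j. j \<in> J \<Longrightarrow> (f j has_sum s j) A"
  shows "((\<lambda>i. \<Sum>j\<in>J. f j i) has_sum (\<Sum>j\<in>J. s j)) A"
  using assms by (induction J rule: finite_induct) (auto intro: has_sum_add)

lemma laplacian_wev:
  "laplacian (wev \<omega> v) x = wpair (\<lambda>k. cis (phase \<omega> k x) * - of_real (freq \<omega> k)) v"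
proof (rule growth_dominated[of \<omega>])
  fix B assume B: "\<And>j k. 1 + (\<omega> $ j * of_int (k $ j))\<^sup>2 \<le> B * l1_weight 2 k"
    "\<And>j k. \<bar>\<omega> $ j * of_int (k $ j)\<bar> * (1 + (\<omega> $ j * of_int (k $ j))\<^sup>2) \<le> B * l1_weight 2 k"
  define m where "m j k = cis (phase \<omega> k x) * (\<i> * of_real (\<omega> $ j * of_int (k $ j))) * (\<i> * of_real (\<omega> $ j * of_int (k $ j)))" for j k
  have second: "partial_deriv j (partial_deriv j (wev \<omega> v)) x = wpair (m j) v" for j
  proof -
    have "((\<lambda>h. wpair (\<lambda>k. cis (phase \<omega> k x) * (\<i> * of_real (\<omega> $ j * of_int (k $ j))) * cis (\<omega> $ j * of_int (k $ j) * h)) v)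
        has_vector_derivative wpair (m j) v) (at 0)"
      unfolding m_def
      by (rule wpair_oscillation_derivative[where B = B]) (use B(2) in \<open>simp add: norm_mult abs_mult\<close>)
    moreover have "(\<lambda>h. partial_deriv j (wev \<omega> v) (x + axis j h)) =
        (\<lambda>h. wpair (\<lambda>k. cis (phase \<omega> k x) * (\<i> * of_real (\<omega> $ j * of_int (k $ j))) * cis (\<omega> $ j * of_int (k $ j) * h)) v)"
      unfolding partial_deriv_wev phase_simps cis_mult[symmetric] by (simp add: mult_ac)
    ultimately show ?thesis
      unfolding partial_deriv_def[of j "partial_deriv j (wev \<omega> v)"] by (simp add: vector_derivative_at)
  qed
  have mB: "norm (m j k) \<le> B * l1_weight 2 k" for j k
    using B(1)[of j k] by (simp add: m_def norm_mult power2_eq_square abs_mult[symmetric])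
  have "((\<lambda>k. \<Sum>j\<in>UNIV. m j k * wcoeff v k) has_sum (\<Sum>j\<in>UNIV. wpair (m j) v)) UNIV"
    by (intro has_sum_finite_sum wpair_has_sum[where B = B] mB) auto
  moreover have "(\<Sum>j\<in>UNIV. m j k * wcoeff v k) = cis (phase \<omega> k x) * - of_real (freq \<omega> k) * wcoeff v k" for k
    by (simp add: m_def freq_def sum_distrib_left sum_distrib_right sum_negf power2_eq_square mult_ac)
  ultimately show ?thesis
    unfolding laplacian_def second wpair_def[of "\<lambda>k. cis (phase \<omega> k x) * - of_real (freq \<omega> k)"]
    by (intro infsumI[symmetric]) (simp only:)
qed

lemma wev_wflow_derivative:
  "((\<lambda>s. wev \<omega> (wflow \<omega> s v) x) has_vector_derivative \<i> * laplacian (wev \<omega> (wflow \<omega> t v)) x) (at t)"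
proof (rule growth_dominated[of \<omega>])
  fix B assume B: "\<And>k. 1 + (freq \<omega> k)\<^sup>2 \<le> B * l1_weight 2 k"
  define w where "w = wflow \<omega> t v"
  have "((\<lambda>h. wpair (\<lambda>k. cis (phase \<omega> k x) * cis (- freq \<omega> k * h)) w) has_vector_derivative
      wpair (\<lambda>k. cis (phase \<omega> k x) * (\<i> * of_real (- freq \<omega> k))) w) (at 0)"
    by (rule wpair_oscillation_derivative[where B = B]) (use B in simp)
  moreover have "wpair (\<lambda>k. cis (phase \<omega> k x) * cis (- freq \<omega> k * h)) w = wev \<omega> (wflow \<omega> h w) x" for h
    by (simp add: wev_eq_wpair wpair_def wflow.rep_eq mult_ac)
  moreover have "wpair (\<lambda>k. cis (phase \<omega> k x) * (\<i> * of_real (- freq \<omega> k))) w = \<i> * laplacian (wev \<omega> w) x"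
  proof -
    have "wpair (\<lambda>k. cis (phase \<omega> k x) * (\<i> * of_real (- freq \<omega> k))) w =
        (\<Sum>\<^sub>\<infinity>k. \<i> * (cis (phase \<omega> k x) * - of_real (freq \<omega> k) * wcoeff w k))"
      unfolding wpair_def by (rule infsum_cong) simp
    then show ?thesis
      unfolding laplacian_wev by (simp only: wpair_def infsum_cmult_right')
  qed
  ultimately have "((\<lambda>h. wev \<omega> (wflow \<omega> h w) x) has_vector_derivative \<i> * laplacian (wev \<omega> w) x) (at (t - t))"
    by simp
  then have "((\<lambda>h. wev \<omega> (wflow \<omega> h w) x) \<circ> (\<lambda>s. s - t) has_vector_derivative 1 *\<^sub>R (\<i> * laplacian (wev \<omega> w) x)) (at t)"
    by (intro vector_diff_chain_at) (auto intro!: derivative_eq_intros)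
  then show ?thesis
    by (simp add: o_def w_def wflow_simps)
qed

text \<open>
  The product rule for \<open>exp (\<i> t \<triangle>) V(t)\<close> at a point \<open>x\<close>. The group is not differentiable in norm, but its value
  at a point is; the part where \<open>V\<close> varies only needs strong continuity, applied to difference quotients.
\<close>

lemma wev_wflow_product_derivative:
  assumes V: "(V has_vector_derivative V') (at t within S)"
  shows "((\<lambda>s. wev \<omega> (wflow \<omega> s (V s)) x) has_vector_derivative
    (\<i> * laplacian (wev \<omega> (wflow \<omega> t (V t))) x + wev \<omega> (wflow \<omega> t V') x)) (at t within S)"
proof -
  have "((\<lambda>s. wflow \<omega> s ((1 / (s - t)) *\<^sub>R (V s - V t))) \<longlongrightarrow> wflow \<omega> t V') (at t within S)"
    using V unfolding has_vector_derivative_quotient by (intro tendsto_wflow tendsto_ident_at)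
  then have "((\<lambda>s. wev \<omega> (wflow \<omega> s ((1 / (s - t)) *\<^sub>R (V s - V t))) x) \<longlongrightarrow> wev \<omega> (wflow \<omega> t V') x) (at t within S)"
    by (rule bounded_linear.tendsto[OF bounded_linear_wev])
  then have "((\<lambda>s. wev \<omega> (wflow \<omega> s (V s - V t)) x) has_vector_derivative wev \<omega> (wflow \<omega> t V') x) (at t within S)"
    unfolding has_vector_derivative_quotient by (simp add: wflow_simps wev_linear)
  from has_vector_derivative_add[OF has_vector_derivative_at_within[OF wev_wflow_derivative] this]
  have "((\<lambda>s. wev \<omega> (wflow \<omega> s (V t)) x + wev \<omega> (wflow \<omega> s (V s - V t)) x) has_vector_derivative
    (\<i> * laplacian (wev \<omega> (wflow \<omega> t (V t))) x + wev \<omega> (wflow \<omega> t V') x)) (at t within S)" .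
  then show ?thesis
    by (simp flip: wev_linear(1) wflow_simps(1))
qed

text \<open>
  In the variable \<open>V(t) = exp (-\<i> t \<triangle>) u(t)\<close> the equation has no unbounded term left, and a differentiable
  curve \<open>V\<close> in the Wiener algebra gives back a classical solution.
\<close>

theorem nls_solution_of_mild:
  assumes \<omega>: "\<And>j. \<omega> $ j \<noteq> 0"
    and N: "\<And>w x. wev \<omega> (N w) x = wev \<omega> w x ^ p * f (wev \<omega> w x)"
    and V: "\<And>t. t \<in> {0..T} \<Longrightarrow>
      (V has_vector_derivative wflow \<omega> (- t) (wconst \<i> * N (wflow \<omega> t (V t)))) (at t within {0..T})"
  shows "nls_solution \<omega> p f {0..T} (\<lambda>t. wev \<omega> (wflow \<omega> t (V t)))"
  unfolding nls_solution_def
proof (intro conjI exI[of _ "2 :: real"] ballI allI)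
  show "is_interval {0..T}" by (rule is_interval_cc)
  show "(2::real) > 1" by simp
  fix t assume t: "t \<in> {0..T}"
  show "wev \<omega> (wflow \<omega> t (V t)) \<in> wiener_algebra \<omega> 2"
    by (rule wev_in_wiener_algebra[OF \<omega>])
  have "(V \<longlongrightarrow> V t) (at t within {0..T})"
    using has_vector_derivative_continuous[OF V[OF t]] by (simp add: continuous_within)
  then have "((\<lambda>s. wflow \<omega> s (V s)) \<longlongrightarrow> wflow \<omega> t (V t)) (at t within {0..T})"
    by (intro tendsto_wflow tendsto_ident_at)
  then have "((\<lambda>s. norm (wflow \<omega> s (V s) - wflow \<omega> t (V t))) \<longlongrightarrow> 0) (at t within {0..T})"
    by (intro tendsto_norm_zero LIM_zero)
  moreover have "wiener_norm \<omega> 2 (\<lambda>x. wev \<omega> u x - wev \<omega> v x) = norm (u - v)" for u v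
  proof -
    have "(\<lambda>x. wev \<omega> u x - wev \<omega> v x) = wev \<omega> (u - v)"
      by (simp add: fun_eq_iff wev_linear)
    then show ?thesis using wev_in_wiener_algebra(2)[OF \<omega>, of "u - v"] by simp
  qed
  ultimately show "((\<lambda>s. wiener_norm \<omega> 2 (\<lambda>x. wev \<omega> (wflow \<omega> s (V s)) x - wev \<omega> (wflow \<omega> t (V t)) x)) \<longlongrightarrow> 0)
      (at t within {0..T})" by simp
  fix x
  define U where "U = wflow \<omega> t (V t)"
  have "wev \<omega> (wflow \<omega> t (wflow \<omega> (- t) (wconst \<i> * N U))) x = \<i> * (wev \<omega> U x ^ p * f (wev \<omega> U x))"
    by (simp add: wflow_simps wev_mult wev_wconst N)
  then have "- \<i> * (\<i> * laplacian (wev \<omega> U) x + wev \<omega> (wflow \<omega> t (wflow \<omega> (- t) (wconst \<i> * N U))) x) =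
      laplacian (wev \<omega> U) x + wev \<omega> U x ^ p * f (wev \<omega> U x)"
    by (simp add: algebra_simps)
  with wev_wflow_product_derivative[OF V[OF t], of \<omega> x]
  show "\<exists>ut. ((\<lambda>s. wev \<omega> (wflow \<omega> s (V s)) x) has_vector_derivative ut) (at t within {0..T}) \<and>
      - \<i> * ut = laplacian (wev \<omega> (wflow \<omega> t (V t))) x + wev \<omega> (wflow \<omega> t (V t)) x ^ p * f (wev \<omega> (wflow \<omega> t (V t)) x)"
    unfolding U_def by blast
qed

section \<open>The nonlinearity on the Wiener algebra\<close>

lemma norm_power_diff_le:
  fixes x y :: "'a::real_normed_algebra_1"
  assumes x: "norm x \<le> \<rho>" and y: "norm y \<le> \<rho>"
  shows "norm (x ^ m - y ^ m) \<le> real m * \<rho> ^ (m - 1) * norm (x - y)"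
proof (induction m)
  case (Suc m)
  have \<rho>: "\<rho> \<ge> 0" using x norm_ge_zero[of x] by linarith
  have "x ^ Suc m - y ^ Suc m = x * (x ^ m - y ^ m) + (x - y) * y ^ m"
    by (simp add: algebra_simps)
  then have "norm (x ^ Suc m - y ^ Suc m) \<le> norm x * norm (x ^ m - y ^ m) + norm (x - y) * norm (y ^ m)"
    by (metis norm_mult_ineq norm_triangle_mono)
  also have "\<dots> \<le> \<rho> * (real m * \<rho> ^ (m - 1) * norm (x - y)) + norm (x - y) * \<rho> ^ m"
    using x \<rho> Suc.IH y by (intro add_mono mult_mono order_trans[OF norm_power_ineq] power_mono) auto
  also have "\<rho> * (real m * \<rho> ^ (m - 1) * norm (x - y)) = real m * \<rho> ^ m * norm (x - y)"
    by (cases m) simp_all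
  finally show ?case by (simp add: algebra_simps)
qed simp

lemma norm_monomial_le:
  assumes "norm x \<le> \<rho>"
  shows "norm (x ^ m * wcnj x ^ n) \<le> \<rho> ^ (m + n)"
proof -
  have "norm (x ^ m * wcnj x ^ n) \<le> norm x ^ m * norm (wcnj x) ^ n"
    by (intro order_trans[OF norm_mult_ineq] mult_mono norm_power_ineq) auto
  also have "\<dots> = norm x ^ (m + n)" by (simp add: power_add)
  also have "\<dots> \<le> \<rho> ^ (m + n)" using assms by (intro power_mono) auto
  finally show ?thesis .
qed

lemma norm_monomial_diff_le:
  assumes x: "norm x \<le> \<rho>" and y: "norm y \<le> \<rho>" and m: "m > 0"
  shows "norm (x ^ m * wcnj x ^ n - y ^ m * wcnj y ^ n) \<le> real (m + n) * \<rho> ^ (m + n - 1) * norm (x - y)"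
proof -
  have \<rho>: "\<rho> \<ge> 0" using x norm_ge_zero[of x] by linarith
  have "x ^ m * wcnj x ^ n - y ^ m * wcnj y ^ n = (x ^ m - y ^ m) * wcnj x ^ n + y ^ m * (wcnj x ^ n - wcnj y ^ n)"
    by (simp add: algebra_simps)
  then have "norm (x ^ m * wcnj x ^ n - y ^ m * wcnj y ^ n) \<le>
      norm (x ^ m - y ^ m) * norm (wcnj x ^ n) + norm (y ^ m) * norm (wcnj x ^ n - wcnj y ^ n)"
    by (metis norm_mult_ineq norm_triangle_mono)
  also have "\<dots> \<le> (real m * \<rho> ^ (m - 1) * norm (x - y)) * \<rho> ^ n + \<rho> ^ m * (real n * \<rho> ^ (n - 1) * norm (x - y))"
  proof (intro add_mono mult_mono)
    show "norm (x ^ m - y ^ m) \<le> real m * \<rho> ^ (m - 1) * norm (x - y)"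
      by (rule norm_power_diff_le[OF x y])
    show "norm (wcnj x ^ n - wcnj y ^ n) \<le> real n * \<rho> ^ (n - 1) * norm (x - y)"
      using norm_power_diff_le[of "wcnj x" \<rho> "wcnj y" n] x y by (simp add: wcnj_diff[symmetric])
    show "norm (wcnj x ^ n) \<le> \<rho> ^ n" "norm (y ^ m) \<le> \<rho> ^ m"
      using x y by (auto intro!: order_trans[OF norm_power_ineq] power_mono)
  qed (use \<rho> in auto)
  also have "\<dots> = real (m + n) * \<rho> ^ (m + n - 1) * norm (x - y)"
  proof -
    have e1: "\<rho> ^ (m - 1) * \<rho> ^ n = \<rho> ^ (m + n - 1)"
      using m by (simp add: power_add[symmetric])
    have e2: "\<rho> ^ m * (real n * \<rho> ^ (n - 1)) = real n * \<rho> ^ (m + n - 1)"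
      using m by (cases n) (simp_all add: power_add[symmetric] mult.left_commute)
    have "(real m * \<rho> ^ (m - 1) * norm (x - y)) * \<rho> ^ n + \<rho> ^ m * (real n * \<rho> ^ (n - 1) * norm (x - y)) =
        real m * (\<rho> ^ (m - 1) * \<rho> ^ n) * norm (x - y) + (\<rho> ^ m * (real n * \<rho> ^ (n - 1))) * norm (x - y)"
      by (simp only: mult_ac)
    then show ?thesis
      unfolding e1 e2 by (simp add: distrib_right)
  qed
  finally show ?thesis .
qed

text \<open>
  Convergence at the number \<open>\<bar>\<rho>\<bar>\<close> is unconditional, hence absolute.
\<close>

lemma power_series_conj_coefficients:
  assumes a: "\<And>u. ((\<lambda>(m, n). a m n * u ^ m * cnj u ^ n) has_sum f u) UNIV"
  shows "(\<lambda>(m, n). norm (a m n) * \<rho> ^ (m + n)) summable_on UNIV" "a 0 0 = f 0"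
proof -
  have "(\<lambda>(m, n). a m n * of_real \<bar>\<rho>\<bar> ^ m * cnj (of_real \<bar>\<rho>\<bar>) ^ n) summable_on UNIV"
    using a by (rule has_sum_imp_summable)
  then have "(\<lambda>x. norm ((\<lambda>(m, n). a m n * of_real \<bar>\<rho>\<bar> ^ m * cnj (of_real \<bar>\<rho>\<bar>) ^ n) x)) summable_on UNIV"
    by (subst (asm) summable_on_iff_abs_summable_on_complex)
  then have "(\<lambda>(m, n). norm (a m n) * \<bar>\<rho>\<bar> ^ (m + n)) summable_on UNIV"
    by (simp add: case_prod_unfold norm_mult norm_power power_add mult.assoc)
  then have "(\<lambda>x. norm ((\<lambda>(m, n). norm (a m n) * \<rho> ^ (m + n)) x)) summable_on UNIV"
    by (simp add: case_prod_unfold abs_mult power_abs)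
  then show "(\<lambda>(m, n). norm (a m n) * \<rho> ^ (m + n)) summable_on UNIV"
    by (rule abs_summable_summable)
  have "((\<lambda>(m, n). a m n * 0 ^ m * cnj 0 ^ n) has_sum a 0 0) UNIV"
    by (rule has_sum_finite_neutralI[of "{(0, 0)}"]) auto
  with a[of 0] show "a 0 0 = f 0"
    using has_sum_unique by blast
qed

text \<open>
  Substituting an element of the Banach algebra into the power series of \<open>u\<^sup>p f(u)\<close> splits off the leading term \<open>f(0) u\<^sup>p\<close>; every
  other monomial has degree at least \<open>p + 1\<close>, so on the ball of radius \<open>\<rho> \<le> 1\<close> its Lipschitz constant is
  smaller by a factor \<open>\<rho>\<close>. The remainder \<open>R\<close> acts on constants as on numbers, so spatially constant
  solutions stay constant.
\<close>

theorem wiener_nonlinearity: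
  fixes f :: "complex \<Rightarrow> complex" and \<omega> :: "real ^ 'd"
  assumes f: "power_series_conj f" and p: "p \<ge> 1"
  obtains R :: "'d wiener \<Rightarrow> 'd wiener" and K
  where "K \<ge> 0" "\<And>w x. wev \<omega> (wconst (f 0) * w ^ p + R w) x = wev \<omega> w x ^ p * f (wev \<omega> w x)"
    "\<And>b. R (wconst b) = wconst (b ^ p * f b - f 0 * b ^ p)"
    "\<And>\<rho> u v. norm u \<le> \<rho> \<Longrightarrow> norm v \<le> \<rho> \<Longrightarrow> \<rho> \<le> 1 \<Longrightarrow> norm (R u - R v) \<le> K * \<rho> ^ p * norm (u - v)"
    "R 0 = 0"
proof -
  obtain a where a: "\<And>u. ((\<lambda>(m, n). a m n * u ^ m * cnj u ^ n) has_sum f u) UNIV"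
    using f unfolding power_series_conj_def by blast
  note as = power_series_conj_coefficients(1)[OF a]
  have a0: "a 0 0 = f 0" by (rule power_series_conj_coefficients(2)[OF a])
  define I where "I = UNIV - {(0 :: nat, 0 :: nat)}"
  define t where "t w = (\<lambda>(m, n). wconst (a m n) * (w ^ (p + m) * wcnj w ^ n))" for w :: "'d wiener"
  define R where "R w = infsum (t w) I" for w
  have t_norm: "norm (t w (m, n)) \<le> norm w ^ p * (norm (a m n) * norm w ^ (m + n))" for w m n
  proof -
    have "norm (t w (m, n)) = norm (a m n) * norm (w ^ (p + m) * wcnj w ^ n)"
      by (simp only: t_def prod.case wconst_simps(9))
    also have "\<dots> \<le> norm (a m n) * norm w ^ (p + m + n)"
      by (intro mult_left_mono norm_monomial_le) auto
    finally show ?thesis by (simp add: power_add mult_ac)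
  qed
  have t_abs: "(\<lambda>x. norm (t w x)) summable_on UNIV" for w
    by (rule Infinite_Sum.abs_summable_on_comparison_test'[OF summable_on_cmult_right[OF as[of "norm w"], of "norm w ^ p"]])
      (use t_norm in auto)
  have t_sum: "(t w has_sum R w) I" for w
    unfolding R_def by (rule has_sum_infsum[OF summable_on_subset_banach[OF abs_summable_summable[OF t_abs]]]) auto
  have t_all: "(t w has_sum (wconst (f 0) * w ^ p + R w)) UNIV" for w
  proof -
    have "(t w has_sum (t w (0, 0) + R w)) (insert (0, 0) I)"
      by (rule has_sum_insert[OF _ t_sum]) (simp add: I_def)
    moreover have "insert (0, 0) I = UNIV" by (auto simp: I_def)
    ultimately show ?thesis by (simp add: t_def a0)
  qed
  define K where "K = (\<Sum>\<^sub>\<infinity>(m, n)\<in>I. norm (a m n) * real (p + m + n))"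
  have K_sum: "(\<lambda>(m, n). norm (a m n) * real (p + m + n)) summable_on I"
  proof -
    have "(\<lambda>(m, n). real p * (norm (a m n) * 2 ^ (m + n))) summable_on UNIV"
      using summable_on_cmult_right[OF as[of 2], of "real p"] by (simp add: case_prod_unfold)
    then have "(\<lambda>(m, n). real p * (norm (a m n) * 2 ^ (m + n))) summable_on I"
      by (rule summable_on_subset_banach) auto
    then show ?thesis
    proof (rule summable_on_comparison_test)
      have "real (p + m + n) \<le> real p * 2 ^ (m + n)" for m n
      proof -
        have "p + (m + n) \<le> p * (1 + (m + n))" using p by (cases p) auto
        also have "\<dots> \<le> p * 2 ^ (m + n)"
          using self_le_ge2_pow[of 2 "m + n"] less_exp[of "m + n"] by (intro mult_le_mono2) linarith
        finally have "real (p + (m + n)) \<le> real (p * 2 ^ (m + n))"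
          by (simp only: of_nat_le_iff)
        then show ?thesis by (simp add: add.assoc)
      qed
      from mult_left_mono[OF this, of "norm (a _ _)"]
      show "(case x of (m, n) \<Rightarrow> norm (a m n) * real (p + m + n)) \<le> (case x of (m, n) \<Rightarrow> real p * (norm (a m n) * 2 ^ (m + n)))" for x
        by (cases x) (simp add: mult_ac)
    qed auto
  qed
  show ?thesis
  proof (rule that[of K R])
    show "K \<ge> 0"
      unfolding K_def by (rule infsum_nonneg) auto
    show "wev \<omega> (wconst (f 0) * w ^ p + R w) x = wev \<omega> w x ^ p * f (wev \<omega> w x)" for w x
    proof (rule has_sum_unique)
      show "((\<lambda>y. wev \<omega> (t w y) x) has_sum wev \<omega> (wconst (f 0) * w ^ p + R w) x) UNIV"
        by (rule has_sum_bounded_linear[OF bounded_linear_wev t_all])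
      have "(\<lambda>y. wev \<omega> (t w y) x) = (\<lambda>y. wev \<omega> w x ^ p * (case y of (m, n) \<Rightarrow> a m n * wev \<omega> w x ^ m * cnj (wev \<omega> w x) ^ n))"
        by (auto simp: t_def wev_mult wev_wconst wev_power wev_wcnj power_add mult_ac)
      then show "((\<lambda>y. wev \<omega> (t w y) x) has_sum wev \<omega> w x ^ p * f (wev \<omega> w x)) UNIV"
        using has_sum_cmult_right[OF a] by simp
    qed
    show "R (wconst b) = wconst (b ^ p * f b - f 0 * b ^ p)" for b
    proof -
      have "t (wconst b) = (\<lambda>y. wconst (b ^ p * (case y of (m, n) \<Rightarrow> a m n * b ^ m * cnj b ^ n)))"
        by (auto simp: t_def wcnj_wconst wconst_simps power_add mult_ac)
      then have "(t (wconst b) has_sum wconst (b ^ p * f b)) UNIV"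
        using has_sum_bounded_linear[OF bounded_linear_wconst has_sum_cmult_right[OF a, of "b ^ p" b]] by simp
      with t_all[of "wconst b"] have "wconst (f 0) * wconst b ^ p + R (wconst b) = wconst (b ^ p * f b)"
        by (rule has_sum_unique)
      then show ?thesis
        by (simp add: wconst_simps algebra_simps)
    qed
    show "R 0 = 0"
    proof -
      have "t 0 = (\<lambda>_. 0)" using p by (auto simp: t_def fun_eq_iff power_0_left)
      then show ?thesis by (simp add: R_def)
    qed
    fix \<rho> and u v :: "'d wiener"
    assume u: "norm u \<le> \<rho>" and v: "norm v \<le> \<rho>" and \<rho>: "\<rho> \<le> 1"
    have \<rho>0: "\<rho> \<ge> 0" using u norm_ge_zero[of u] by linarith
    have le: "norm (t u x - t v x) \<le> (case x of (m, n) \<Rightarrow> norm (a m n) * real (p + m + n)) * (\<rho> ^ p * norm (u - v))"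
      if "x \<in> I" for x
    proof -
      obtain m n where x: "x = (m, n)" by (cases x)
      with that have mn: "m + n > 0" by (auto simp: I_def)
      have "norm (t u x - t v x) = norm (a m n) * norm (u ^ (p + m) * wcnj u ^ n - v ^ (p + m) * wcnj v ^ n)"
        by (simp only: x t_def prod.case right_diff_distrib[symmetric] wconst_simps(9))
      also have "\<dots> \<le> norm (a m n) * (real (p + m + n) * \<rho> ^ (p + m + n - 1) * norm (u - v))"
        using norm_monomial_diff_le[OF u v, of "p + m" n] p by (intro mult_left_mono) auto
      also have "\<dots> \<le> norm (a m n) * (real (p + m + n) * \<rho> ^ p * norm (u - v))"
        using mn \<rho> \<rho>0 by (intro mult_left_mono mult_right_mono power_decreasing) auto
      finally show ?thesis by (simp add: x mult_ac)
    qed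
    have K': "(\<lambda>x. (case x of (m, n) \<Rightarrow> norm (a m n) * real (p + m + n)) * (\<rho> ^ p * norm (u - v))) summable_on I"
      by (rule summable_on_cmult_left[OF K_sum])
    have abs: "(\<lambda>x. norm (t u x - t v x)) summable_on I"
      by (rule Infinite_Sum.abs_summable_on_comparison_test'[OF K' le])
    have "((\<lambda>x. t u x + - t v x) has_sum (R u + - R v)) I"
      by (intro has_sum_add has_sum_uminusI t_sum)
    then have "R u - R v = infsum (\<lambda>x. t u x - t v x) I"
      by (simp add: infsumI)
    then have "norm (R u - R v) \<le> infsum (\<lambda>x. norm (t u x - t v x)) I"
      using norm_infsum_bound[OF abs] by simp
    also have "\<dots> \<le> infsum (\<lambda>x. (case x of (m, n) \<Rightarrow> norm (a m n) * real (p + m + n)) * (\<rho> ^ p * norm (u - v))) I"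
      by (rule infsum_mono[OF abs K' le])
    also have "\<dots> = K * (\<rho> ^ p * norm (u - v))"
      unfolding K_def by (rule infsum_cmult_left')
    finally show "norm (R u - R v) \<le> K * \<rho> ^ p * norm (u - v)"
      by (simp add: mult.assoc)
  qed
qed

section \<open>Slow dynamics near spatially constant solutions\<close>

lemma power_second_order_remainder:
  fixes B :: real
  shows "\<exists>C\<ge>0. \<forall>x y :: 'a::{comm_ring_1, real_normed_algebra_1}. norm x \<le> B \<longrightarrow> norm (x + y) \<le> B \<longrightarrow>
    norm ((x + y) ^ n - x ^ n - of_nat n * x ^ (n - 1) * y) \<le> C * (norm y)\<^sup>2"
proof (induction n)
    case 0
    show ?case by (intro exI[of _ 0]) simp
  next
    case (Suc n)
    then obtain C where C: "C \<ge> 0" "\<And>x y :: 'a. norm x \<le> B \<Longrightarrow> norm (x + y) \<le> B \<Longrightarrow>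
      norm ((x + y) ^ n - x ^ n - of_nat n * x ^ (n - 1) * y) \<le> C * (norm y)\<^sup>2" by blast
    show ?case
    proof (intro exI[of _ "\<bar>B\<bar> * C + real n * \<bar>B\<bar> ^ (n - 1)"] conjI allI impI)
      show "\<bar>B\<bar> * C + real n * \<bar>B\<bar> ^ (n - 1) \<ge> 0" using C(1) by simp
      fix x y :: 'a assume xy: "norm x \<le> B" "norm (x + y) \<le> B"
      have B: "B \<ge> 0" using xy(1) norm_ge_zero[of x] by linarith
      define E where "E = (x + y) ^ n - x ^ n - of_nat n * x ^ (n - 1) * y"
      have xn: "of_nat n * x ^ (n - 1) * x = of_nat n * x ^ n"
        by (cases n) (simp_all add: mult_ac)
      have "(x + y) * E = (x + y) ^ Suc n - x ^ Suc n - x ^ n * y - (of_nat n * x ^ (n - 1) * x) * y - of_nat n * x ^ (n - 1) * y * y"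
        by (simp add: E_def algebra_simps)
      then have "(x + y) ^ Suc n - x ^ Suc n - of_nat (Suc n) * x ^ (Suc n - 1) * y = (x + y) * E + of_nat n * x ^ (n - 1) * (y * y)"
        unfolding xn by (simp add: algebra_simps)
      then have "norm ((x + y) ^ Suc n - x ^ Suc n - of_nat (Suc n) * x ^ (Suc n - 1) * y) \<le>
          norm (x + y) * norm E + norm (of_nat n * x ^ (n - 1)) * norm (y * y)"
        by (metis norm_mult_ineq norm_triangle_mono)
      also have "\<dots> \<le> B * (C * (norm y)\<^sup>2) + (real n * B ^ (n - 1)) * (norm y * norm y)"
      proof (intro add_mono mult_mono)
        show "norm E \<le> C * (norm y)\<^sup>2" unfolding E_def by (rule C(2)[OF xy])
        have "norm (of_nat n * x ^ (n - 1)) \<le> norm (of_nat n :: 'a) * norm (x ^ (n - 1))" by (rule norm_mult_ineq)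
        also have "\<dots> \<le> real n * B ^ (n - 1)"
          using xy(1) by (intro mult_mono) (auto intro!: order_trans[OF norm_power_ineq] power_mono)
        finally show "norm (of_nat n * x ^ (n - 1)) \<le> real n * B ^ (n - 1)" .
      qed (use xy B in \<open>auto intro: norm_mult_ineq\<close>)
      also have "\<dots> = (\<bar>B\<bar> * C + real n * \<bar>B\<bar> ^ (n - 1)) * (norm y)\<^sup>2"
        using B by (simp add: power2_eq_square distrib_right)
      finally show "norm ((x + y) ^ Suc n - x ^ Suc n - of_nat (Suc n) * x ^ (Suc n - 1) * y) \<le>
        (\<bar>B\<bar> * C + real n * \<bar>B\<bar> ^ (n - 1)) * (norm y)\<^sup>2" .
    qed
qed

text \<open>
  The data produced by \<open>wiener_nonlinearity\<close>, fixed for the rest of the dynamics.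
\<close>

locale wiener_nls =
  fixes \<omega> :: "real ^ 'd" and p :: nat and f :: "complex \<Rightarrow> complex"
    and R :: "'d wiener \<Rightarrow> 'd wiener" and K :: real
  assumes \<omega>: "\<And>j. \<omega> $ j \<noteq> 0" and p: "p \<ge> 2" and K: "K \<ge> 0"
    and eval: "\<And>w x. wev \<omega> (wconst (f 0) * w ^ p + R w) x = wev \<omega> w x ^ p * f (wev \<omega> w x)"
    and R_const: "\<And>b. R (wconst b) = wconst (b ^ p * f b - f 0 * b ^ p)"
    and R_lipschitz: "\<And>\<rho> u v. norm u \<le> \<rho> \<Longrightarrow> norm v \<le> \<rho> \<Longrightarrow> \<rho> \<le> 1 \<Longrightarrow> norm (R u - R v) \<le> K * \<rho> ^ p * norm (u - v)"
    and R_0: "R 0 = 0"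
begin

definition a :: complex where "a = f 0"

text \<open>
  After the scaling \<open>u = \<epsilon> x\<close> and division by \<open>\<epsilon>\<^sup>p\<close>, the remainder of the nonlinearity is of order \<open>\<epsilon>\<close>,
  as \<open>rem_lipschitz\<close> makes precise; \<open>rem_const\<close> is its restriction to constants and \<open>field\<close> the whole scaled nonlinearity.
\<close>

definition rem :: "real \<Rightarrow> 'd wiener \<Rightarrow> 'd wiener" where "rem \<epsilon> x = (1 / \<epsilon> ^ p) *\<^sub>R R (\<epsilon> *\<^sub>R x)"

definition rem_const :: "real \<Rightarrow> complex \<Rightarrow> complex"
  where "rem_const \<epsilon> b = ((of_real \<epsilon> * b) ^ p * f (of_real \<epsilon> * b) - a * (of_real \<epsilon> * b) ^ p) / of_real (\<epsilon> ^ p)"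

lemma rem_lipschitz:
  assumes "0 < \<epsilon>" "\<epsilon> * B \<le> 1" "norm x \<le> B" "norm y \<le> B"
  shows "norm (rem \<epsilon> x - rem \<epsilon> y) \<le> \<epsilon> * (K * B ^ p) * norm (x - y)"
proof -
  have "norm (R (\<epsilon> *\<^sub>R x) - R (\<epsilon> *\<^sub>R y)) \<le> K * (\<epsilon> * B) ^ p * norm (\<epsilon> *\<^sub>R x - \<epsilon> *\<^sub>R y)"
    using assms by (intro R_lipschitz) (auto intro: mult_left_mono)
  also have "\<dots> = \<epsilon> ^ p * (\<epsilon> * (K * B ^ p) * norm (x - y))"
    using assms(1) by (simp add: power_mult_distrib flip: scaleR_right_diff_distrib)
  finally have "1 / \<epsilon> ^ p * norm (R (\<epsilon> *\<^sub>R x) - R (\<epsilon> *\<^sub>R y)) \<le> 1 / \<epsilon> ^ p * (\<epsilon> ^ p * (\<epsilon> * (K * B ^ p) * norm (x - y)))"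
    using assms(1) by (intro mult_left_mono) auto
  then show ?thesis
    using assms(1) by (simp add: rem_def flip: scaleR_right_diff_distrib)
qed

lemma rem_0: "rem \<epsilon> 0 = 0"
  by (simp add: rem_def R_0)

lemma wconst_scaleR: "r *\<^sub>R wconst b = wconst (of_real r * b)"
  by (simp flip: wconst_simps(7) wconst_simps(5))

lemma rem_wconst: "rem \<epsilon> (wconst b) = wconst (rem_const \<epsilon> b)"
  by (simp add: rem_def rem_const_def wconst_scaleR R_const a_def divide_inverse mult.commute)

lemma rem_const_lipschitz:
  assumes "0 < \<epsilon>" "\<epsilon> * B \<le> 1" "norm x \<le> B" "norm y \<le> B"
  shows "norm (rem_const \<epsilon> x - rem_const \<epsilon> y) \<le> \<epsilon> * (K * B ^ p) * norm (x - y)"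
  using rem_lipschitz[OF assms(1,2), of "wconst x" "wconst y"] assms(3,4)
  by (simp add: rem_wconst wconst_simps flip: wconst_simps(4))

lemma rem_const_0: "rem_const \<epsilon> 0 = 0"
  using p by (simp add: rem_const_def power_0_left)

definition field :: "real \<Rightarrow> 'd wiener \<Rightarrow> 'd wiener" where "field \<epsilon> x = wconst a * x ^ p + rem \<epsilon> x"

definition lip :: "real \<Rightarrow> real" where "lip B = norm a * (real p * B ^ (p - 1)) + K * B ^ p"

lemma field_lipschitz:
  assumes "0 < \<epsilon>" "\<epsilon> \<le> 1" "\<epsilon> * B \<le> 1" "norm x \<le> B" "norm y \<le> B"
  shows "norm (field \<epsilon> x - field \<epsilon> y) \<le> lip B * norm (x - y)"
proof -
  have B: "B \<ge> 0" using assms(4) norm_ge_zero[of x] by linarith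
  have "field \<epsilon> x - field \<epsilon> y = wconst a * (x ^ p - y ^ p) + (rem \<epsilon> x - rem \<epsilon> y)"
    by (simp add: field_def right_diff_distrib)
  then have "norm (field \<epsilon> x - field \<epsilon> y) \<le> norm a * norm (x ^ p - y ^ p) + norm (rem \<epsilon> x - rem \<epsilon> y)"
    by (metis norm_triangle_ineq wconst_simps(9))
  also have "\<dots> \<le> norm a * (real p * B ^ (p - 1) * norm (x - y)) + 1 * (K * B ^ p) * norm (x - y)"
    using K B assms(2) by (intro add_mono mult_left_mono norm_power_diff_le assms order_trans[OF rem_lipschitz[OF assms(1,3,4,5)]] mult_right_mono) auto
  also have "\<dots> = lip B * norm (x - y)"
    by (simp add: lip_def algebra_simps)
  finally show ?thesis .
qed

lemma field_0: "field \<epsilon> 0 = 0"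
  using p by (simp add: field_def rem_0 power_0_left)

lemma field_wconst: "field \<epsilon> (wconst b) = wconst (a * b ^ p + rem_const \<epsilon> b)"
  by (simp add: field_def rem_wconst wconst_simps)

lemma lip_nonneg: "B \<ge> 0 \<Longrightarrow> lip B \<ge> 0"
  using K by (simp add: lip_def)

text \<open>
  The equation in slow time \<open>s\<close> and in the interaction picture. The free flow runs at the fast time \<open>q s\<close>. Being
  isometric, it does not affect the Lipschitz constant, so the length of the existence interval does not depend on \<open>\<epsilon>\<close>.
\<close>

lemma scaled_solution_exists:
  assumes \<epsilon>: "0 < \<epsilon>" "\<epsilon> \<le> 1" "\<epsilon> * B \<le> 1" and T: "0 \<le> T" "lip B * T \<le> 1 / 2" and v0: "2 * norm v0 \<le> B"
  obtains v where "v 0 = v0" "\<And>s. s \<in> {0..T} \<Longrightarrow> norm (v s) \<le> B"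
    "\<And>s. s \<in> {0..T} \<Longrightarrow> (v has_vector_derivative wflow \<omega> (- (q * s)) (wconst \<i> * field \<epsilon> (wflow \<omega> (q * s) (v s)))) (at s within {0..T})"
proof -
  have B: "B \<ge> 0" using v0 norm_ge_zero[of v0] by linarith
  have contf: "continuous_on (cball 0 B) (field \<epsilon>)"
    by (rule lipschitz_on_continuous_on[of "lip B"])
      (use field_lipschitz[OF \<epsilon>] lip_nonneg[OF B] in \<open>auto simp: lipschitz_on_def dist_norm\<close>)
  show ?thesis
  proof (rule ode_solution_exists[of T "lip B" B "\<lambda>s x. wflow \<omega> (- (q * s)) (wconst \<i> * field \<epsilon> (wflow \<omega> (q * s) x))" v0])
    show "continuous_on {0..T} (\<lambda>s. wflow \<omega> (- (q * s)) (wconst \<i> * field \<epsilon> (wflow \<omega> (q * s) (v s))))"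
      if v: "continuous_on {0..T} v" "\<And>s. s \<in> {0..T} \<Longrightarrow> norm (v s) \<le> B" for v
      by (intro continuous_on_wflow continuous_on_mult continuous_on_const continuous_on_compose2[OF contf] v(1))
        (auto intro!: continuous_intros simp: v(2))
    show "norm (wflow \<omega> (- (q * s)) (wconst \<i> * field \<epsilon> (wflow \<omega> (q * s) x)) - wflow \<omega> (- (q * s)) (wconst \<i> * field \<epsilon> (wflow \<omega> (q * s) y)))
        \<le> lip B * norm (x - y)" if "norm x \<le> B" "norm y \<le> B" for s x y
    proof -
      have "norm (wflow \<omega> (- (q * s)) (wconst \<i> * field \<epsilon> (wflow \<omega> (q * s) x)) - wflow \<omega> (- (q * s)) (wconst \<i> * field \<epsilon> (wflow \<omega> (q * s) y)))
          = norm (field \<epsilon> (wflow \<omega> (q * s) x) - field \<epsilon> (wflow \<omega> (q * s) y))"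
        by (simp add: wconst_simps flip: wflow_simps(2) right_diff_distrib)
      also have "\<dots> \<le> lip B * norm (wflow \<omega> (q * s) x - wflow \<omega> (q * s) y)"
        using that by (intro field_lipschitz \<epsilon>) auto
      finally show ?thesis by (simp flip: wflow_simps(2))
    qed
  qed (use T v0 lip_nonneg[OF B] that in \<open>auto simp: wflow_simps field_0\<close>)
qed

lemma scaled_const_solution_exists:
  assumes \<epsilon>: "0 < \<epsilon>" "\<epsilon> \<le> 1" "\<epsilon> * B \<le> 1" and T: "0 \<le> T" "lip B * T \<le> 1 / 2" and v0: "2 * norm v0 \<le> B"
  obtains v where "v 0 = v0" "\<And>s. s \<in> {0..T} \<Longrightarrow> norm (v s) \<le> B"
    "\<And>s. s \<in> {0..T} \<Longrightarrow> (v has_vector_derivative \<i> * (a * v s ^ p + rem_const \<epsilon> (v s))) (at s within {0..T})"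
proof -
  have B: "B \<ge> 0" using v0 norm_ge_zero[of v0] by linarith
  have lip: "norm ((a * x ^ p + rem_const \<epsilon> x) - (a * y ^ p + rem_const \<epsilon> y)) \<le> lip B * norm (x - y)"
    if "norm x \<le> B" "norm y \<le> B" for x y
    using field_lipschitz[OF \<epsilon>, of "wconst x" "wconst y"] that
    unfolding field_wconst wconst_simps(4)[symmetric] wconst_simps(8) by blast
  have contf: "continuous_on (cball 0 B) (\<lambda>b. a * b ^ p + rem_const \<epsilon> b)"
    by (rule lipschitz_on_continuous_on[of "lip B"])
      (use lip lip_nonneg[OF B] in \<open>auto simp: lipschitz_on_def dist_norm\<close>)
  show ?thesis
  proof (rule ode_solution_exists[of T "lip B" B "\<lambda>s b. \<i> * (a * b ^ p + rem_const \<epsilon> b)" v0])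
    show "continuous_on {0..T} (\<lambda>s. \<i> * (a * v s ^ p + rem_const \<epsilon> (v s)))"
      if v: "continuous_on {0..T} v" "\<And>s. s \<in> {0..T} \<Longrightarrow> norm (v s) \<le> B" for v
      by (intro continuous_on_mult continuous_on_const continuous_on_compose2[OF contf v(1)]) (auto simp: v(2))
    show "norm (\<i> * (a * x ^ p + rem_const \<epsilon> x) - \<i> * (a * y ^ p + rem_const \<epsilon> y)) \<le> lip B * norm (x - y)"
      if "norm x \<le> B" "norm y \<le> B" for x y
      using lip[OF that] by (simp add: norm_mult flip: right_diff_distrib)
  qed (use T v0 lip_nonneg[OF B] that p in \<open>auto simp: rem_const_0 power_0_left\<close>)
qed


text \<open>
  Two successive comparisons. The exact spatially constant solution \<open>c'\<close> is within \<open>O(\<epsilon>)\<close> of the solution \<open>c\<close> of the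
  truncated equation. The deviation of \<open>v\<close> from \<open>c'\<close>, divided by its initial size \<open>\<delta> = \<epsilon>\<^sup>p\<^sup>-\<^sup>1\<close>, satisfies the
  linearized equation up to a quadratic term of size \<open>\<delta> \<le> \<epsilon>\<close> and a remainder of size \<open>\<epsilon>\<close>. Measuring the deviation
  from \<open>c'\<close> rather than from \<open>c\<close> is essential, because \<open>c' - c\<close> may be much larger than \<open>\<delta>\<close>. The free flow drops out
  of the linearized equation, since multiplication by the constant \<open>c'\<^sup>p\<^sup>-\<^sup>1\<close> commutes with it.
\<close>

lemma slow_time_error:
  assumes M: "M > 0" and T: "T \<ge> 0" "lip (4 * M) * T \<le> 1 / 2"
    and c: "\<And>s. s \<in> {0..T} \<Longrightarrow> norm (c s) \<le> M"
      "\<And>s. s \<in> {0..T} \<Longrightarrow> (c has_vector_derivative \<i> * a * c s ^ p) (at s within {0..T})"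
    and z: "\<And>s. s \<in> {0..T} \<Longrightarrow> norm (z s) \<le> M"
      "\<And>s. s \<in> {0..T} \<Longrightarrow> (z has_vector_derivative wconst (\<i> * a * of_nat p * c s ^ (p - 1)) * z s) (at s within {0..T})"
  obtains C where "C \<ge> 0" "\<And>\<epsilon> q v c'. 0 < \<epsilon> \<Longrightarrow> \<epsilon> \<le> 1 \<Longrightarrow> \<epsilon> * (4 * M) \<le> 1 \<Longrightarrow>
      v 0 = wconst (c 0) + \<epsilon> ^ (p - 1) *\<^sub>R z 0 \<Longrightarrow> (\<And>s. s \<in> {0..T} \<Longrightarrow> norm (v s) \<le> 4 * M) \<Longrightarrow>
      (\<And>s. s \<in> {0..T} \<Longrightarrow> (v has_vector_derivative wflow \<omega> (- (q * s)) (wconst \<i> * field \<epsilon> (wflow \<omega> (q * s) (v s)))) (at s within {0..T})) \<Longrightarrow>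
      c' 0 = c 0 \<Longrightarrow> (\<And>s. s \<in> {0..T} \<Longrightarrow> norm (c' s) \<le> 4 * M) \<Longrightarrow>
      (\<And>s. s \<in> {0..T} \<Longrightarrow> (c' has_vector_derivative \<i> * (a * c' s ^ p + rem_const \<epsilon> (c' s))) (at s within {0..T})) \<Longrightarrow>
      \<forall>s\<in>{0..T}. norm (c' s - c s) \<le> C * \<epsilon> \<and> norm ((1 / \<epsilon> ^ (p - 1)) *\<^sub>R (v s - wconst (c' s)) - z s) \<le> C * \<epsilon>"
proof -
  define B where "B = 4 * M"
  have B: "B > 0" "M \<le> B" using M by (auto simp: B_def)
  define L where "L = lip B"
  have L: "L \<ge> 0" using B lip_nonneg by (simp add: L_def)
  have LT: "L * T \<le> 1 / 2" using T by (simp add: L_def B_def)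
  have pk: "p - 1 \<ge> 1" "p = Suc (p - 1)" using p by auto
  have ap: "norm a * (real p * B ^ (p - 1)) \<le> L"
    unfolding L_def lip_def using K B by simp
  obtain C2 where C2: "C2 \<ge> 0" "\<And>x y :: 'd wiener. norm x \<le> B \<Longrightarrow> norm (x + y) \<le> B \<Longrightarrow>
    norm ((x + y) ^ p - x ^ p - of_nat p * x ^ (p - 1) * y) \<le> C2 * (norm y)\<^sup>2"
    using power_second_order_remainder[where ?'a = "'d wiener" and B = B and n = p] by blast
  define C1 where "C1 = 2 * (K * B ^ p * B * T)"
  define D where "D = norm a * real p * (real (p - 1) * B ^ (p - 1 - 1)) * C1 * M + norm a * C2 * (2 * M)\<^sup>2 + K * B ^ p * (2 * M)"
  have C10: "C1 \<ge> 0" using K B T by (simp add: C1_def)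
  have D0: "D \<ge> 0" using C10 C2(1) K B M by (simp add: D_def)
  show ?thesis
  proof (rule that[of "max C1 (2 * D * T)"])
    show "max C1 (2 * D * T) \<ge> 0" using C10 by simp
    fix \<epsilon> q :: real and v :: "real \<Rightarrow> 'd wiener" and c' :: "real \<Rightarrow> complex"
    assume \<epsilon>: "0 < \<epsilon>" "\<epsilon> \<le> 1" "\<epsilon> * (4 * M) \<le> 1"
      and v0: "v 0 = wconst (c 0) + \<epsilon> ^ (p - 1) *\<^sub>R z 0" and vB: "\<And>s. s \<in> {0..T} \<Longrightarrow> norm (v s) \<le> 4 * M"
      and v: "\<And>s. s \<in> {0..T} \<Longrightarrow> (v has_vector_derivative wflow \<omega> (- (q * s)) (wconst \<i> * field \<epsilon> (wflow \<omega> (q * s) (v s)))) (at s within {0..T})"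
      and c0: "c' 0 = c 0" and cB: "\<And>s. s \<in> {0..T} \<Longrightarrow> norm (c' s) \<le> 4 * M"
      and c': "\<And>s. s \<in> {0..T} \<Longrightarrow> (c' has_vector_derivative \<i> * (a * c' s ^ p + rem_const \<epsilon> (c' s))) (at s within {0..T})"
    define \<delta> where "\<delta> = \<epsilon> ^ (p - 1)"
    have \<delta>: "0 < \<delta>" "\<delta> \<le> \<epsilon>"
      using \<epsilon> pk(1) power_decreasing[of 1 "p - 1" \<epsilon>] by (auto simp: \<delta>_def)
    have \<epsilon>B: "\<epsilon> * B \<le> 1" using \<epsilon>(3) by (simp add: B_def)
    have e1: "norm (c' s - c s) \<le> C1 * \<epsilon>" if s: "s \<in> {0..T}" for s
    proof -
      have "norm (c' s - c s) \<le> 2 * (norm (c' 0 - c 0) + \<epsilon> * (K * B ^ p * B) * T)"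
      proof (rule short_time_gronwall[OF _ _ L LT _ s])
        show "((\<lambda>s. c' s - c s) has_vector_derivative \<i> * (a * c' s ^ p + rem_const \<epsilon> (c' s)) - \<i> * a * c s ^ p) (at s within {0..T})"
          if "s \<in> {0..T}" for s
          by (intro has_vector_derivative_diff c' c that)
        show "0 \<le> \<epsilon> * (K * B ^ p * B)" using \<epsilon> K B by simp
        show "norm (\<i> * (a * c' s ^ p + rem_const \<epsilon> (c' s)) - \<i> * a * c s ^ p) \<le> L * norm (c' s - c s) + \<epsilon> * (K * B ^ p * B)"
          if s: "s \<in> {0..T}" for s
        proof -
          have nB: "norm (c' s) \<le> B" "norm (c s) \<le> B"
            using cB[OF s] c(1)[OF s] M by (auto simp: B_def)
          have "\<i> * (a * c' s ^ p + rem_const \<epsilon> (c' s)) - \<i> * a * c s ^ p = \<i> * (a * (c' s ^ p - c s ^ p)) + \<i> * (rem_const \<epsilon> (c' s) - rem_const \<epsilon> 0)"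
            by (simp add: rem_const_0 algebra_simps)
          then have "norm (\<i> * (a * c' s ^ p + rem_const \<epsilon> (c' s)) - \<i> * a * c s ^ p) \<le>
              norm a * norm (c' s ^ p - c s ^ p) + norm (rem_const \<epsilon> (c' s) - rem_const \<epsilon> 0)"
            by (simp only:) (rule order_trans[OF norm_triangle_ineq], simp add: norm_mult)
          also have "\<dots> \<le> norm a * (real p * B ^ (p - 1) * norm (c' s - c s)) + \<epsilon> * (K * B ^ p) * norm (c' s - 0)"
            using nB B by (intro add_mono mult_left_mono norm_power_diff_le rem_const_lipschitz[OF \<epsilon>(1) \<epsilon>B]) auto
          also have "\<dots> \<le> L * norm (c' s - c s) + \<epsilon> * (K * B ^ p) * B"
          proof (intro add_mono mult_left_mono)
            show "norm a * (real p * B ^ (p - 1) * norm (c' s - c s)) \<le> L * norm (c' s - c s)"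
              using mult_right_mono[OF ap, of "norm (c' s - c s)"] by (simp add: mult.assoc)
          qed (use nB \<epsilon> K B in auto)
          finally show ?thesis by (simp add: mult.assoc)
        qed
      qed
      then show ?thesis by (simp add: c0 C1_def mult_ac)
    qed
    define d where "d s = v s - wconst (c' s)" for s
    define d' where "d' s = wflow \<omega> (- (q * s)) (wconst \<i> * (field \<epsilon> (wflow \<omega> (q * s) (v s)) - field \<epsilon> (wconst (c' s))))" for s
    have d: "(d has_vector_derivative d' s) (at s within {0..T})" if s: "s \<in> {0..T}" for s
    proof -
      have wd: "((\<lambda>s. wconst (c' s) :: 'd wiener) has_vector_derivative wconst (\<i> * (a * c' s ^ p + rem_const \<epsilon> (c' s)))) (at s within {0..T})"
        by (rule bounded_linear.has_vector_derivative[OF bounded_linear_wconst c'[OF s]])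
      have we: "wconst (\<i> * (a * c' s ^ p + rem_const \<epsilon> (c' s))) = wflow \<omega> (- (q * s)) (wconst \<i> * field \<epsilon> (wconst (c' s)))"
        unfolding field_wconst wconst_simps(5)[symmetric] wflow_simps(4) ..
      show ?thesis
        unfolding d_def[abs_def] d'_def right_diff_distrib wflow_simps(2)
        by (intro has_vector_derivative_diff v[OF s] wd[unfolded we])
    qed
    have dflow: "wflow \<omega> t (v s) = wconst (c' s) + wflow \<omega> t (d s)" for t s
      by (simp add: d_def wflow_simps)
    \<comment> \<open>a priori bound: the deviation at most doubles\<close>
    have d_le: "norm (d s) \<le> \<delta> * (2 * M)" if s: "s \<in> {0..T}" for s
    proof -
      have "norm (d s) \<le> 2 * (norm (d 0) + 0 * T)"
      proof (rule short_time_gronwall[OF d _ L LT order_refl s])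
        show "norm (d' s) \<le> L * norm (d s) + 0" if s: "s \<in> {0..T}" for s
        proof -
          have "norm (d' s) = norm (field \<epsilon> (wflow \<omega> (q * s) (v s)) - field \<epsilon> (wconst (c' s)))"
            by (simp add: d'_def wconst_simps)
          also have "\<dots> \<le> lip B * norm (wflow \<omega> (q * s) (v s) - wconst (c' s))"
            using vB[OF s] cB[OF s] by (intro field_lipschitz \<epsilon> \<epsilon>B) (auto simp: B_def wconst_simps)
          finally show ?thesis by (simp add: dflow L_def)
        qed
      qed
      also have "\<dots> = \<delta> * (2 * norm (z 0))"
        using v0 c0 \<delta> by (simp add: d_def \<delta>_def)
      also have "\<dots> \<le> \<delta> * (2 * M)"
        using z(1)[of 0] T \<delta> by (intro mult_left_mono) auto
      finally show ?thesis .
    qed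
    define z' where "z' s = (1 / \<delta>) *\<^sub>R d s" for s
    have dz: "d s = \<delta> *\<^sub>R z' s" for s using \<delta> by (simp add: z'_def)
    have z'_le: "norm (z' s) \<le> 2 * M" if "s \<in> {0..T}" for s
      using d_le[OF that] \<delta> by (simp add: z'_def divide_inverse mult.commute) (simp add: field_simps)
    \<comment> \<open>defect of the rescaled deviation \<open>z'\<close> in the equation linearized at \<open>c'\<close>\<close>
    define err where "err s = (1 / \<delta>) *\<^sub>R d' s - wconst (\<i> * a * of_nat p * c' s ^ (p - 1)) * z' s" for s
    have err: "norm (err s) \<le> \<epsilon> * (norm a * C2 * (2 * M)\<^sup>2 + K * B ^ p * (2 * M))" if s: "s \<in> {0..T}" for s
    proof -
      define x :: "'d wiener" where "x = wconst (c' s)"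
      define y where "y = wflow \<omega> (q * s) (d s)"
      have xy: "norm x \<le> B" "norm (x + y) \<le> B" "wflow \<omega> (q * s) (v s) = x + y"
        using cB[OF s] vB[OF s] dflow[of "q * s" s] norm_wflow[of \<omega> "q * s" "v s"]
        by (simp_all add: x_def y_def B_def wconst_simps)
      have ny: "norm y = \<delta> * norm (z' s)" using \<delta> by (simp add: y_def dz)
      define E where "E = (x + y) ^ p - x ^ p - of_nat p * x ^ (p - 1) * y"
      define G where "G = rem \<epsilon> (x + y) - rem \<epsilon> x"
      have split: "field \<epsilon> (x + y) - field \<epsilon> x = wconst a * E + G + wconst (a * of_nat p * c' s ^ (p - 1)) * y"
      proof -
        have "wconst (a * of_nat p * c' s ^ (p - 1)) = wconst a * (of_nat p * x ^ (p - 1))"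
        proof -
          have "wconst (of_nat p) = (of_nat p :: 'd wiener)"
            by (induction p) (simp_all add: wconst_simps)
          then show ?thesis by (simp add: wconst_simps x_def mult.assoc)
        qed
        then show ?thesis
          by (simp add: field_def E_def G_def algebra_simps)
      qed
      have "d' s = wflow \<omega> (- (q * s)) (wconst \<i> * (wconst a * E + G)) + wconst (\<i> * (a * of_nat p * c' s ^ (p - 1))) * d s"
        unfolding d'_def xy(3) x_def[symmetric] split distrib_left[of "wconst \<i>" "wconst a * E + G"] wflow_simps(1) wconst_simps(5)[of \<i>]
          mult.assoc[of "wconst \<i>"] wflow_simps(3)
        by (simp add: y_def wflow_simps)
      then have "err s = (1 / \<delta>) *\<^sub>R wflow \<omega> (- (q * s)) (wconst \<i> * (wconst a * E + G))"
        by (simp add: err_def z'_def scaleR_right_distrib mult.assoc)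
      then have "norm (err s) = 1 / \<delta> * norm (wconst a * E + G)"
        using \<delta> by (simp add: wconst_simps)
      also have "\<dots> \<le> 1 / \<delta> * (norm a * (C2 * (norm y)\<^sup>2) + \<epsilon> * (K * B ^ p) * norm y)"
      proof (intro mult_left_mono order_trans[OF norm_triangle_ineq] add_mono)
        show "norm (wconst a * E) \<le> norm a * (C2 * (norm y)\<^sup>2)"
          unfolding wconst_simps(9) E_def by (intro mult_left_mono C2 xy) auto
        show "norm G \<le> \<epsilon> * (K * B ^ p) * norm y"
          unfolding G_def using rem_lipschitz[OF \<epsilon>(1) \<epsilon>B xy(2,1)] by simp
      qed (use \<delta> in auto)
      also have "\<dots> = norm a * C2 * (norm (z' s))\<^sup>2 * \<delta> + \<epsilon> * (K * B ^ p) * norm (z' s)"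
        using \<delta> by (simp add: ny power2_eq_square field_simps)
      also have "\<dots> \<le> norm a * C2 * (2 * M)\<^sup>2 * \<epsilon> + \<epsilon> * (K * B ^ p) * (2 * M)"
        using z'_le[OF s] \<delta> C2(1) K B \<epsilon> by (intro add_mono mult_mono mult_left_mono power_mono) auto
      finally show ?thesis by (simp add: algebra_simps)
    qed
    have e2: "norm (z' s - z s) \<le> 2 * D * T * \<epsilon>" if s: "s \<in> {0..T}" for s
    proof -
      have "norm (z' s - z s) \<le> 2 * (norm (z' 0 - z 0) + \<epsilon> * D * T)"
      proof (rule short_time_gronwall[OF _ _ L LT _ s])
        show "((\<lambda>s. z' s - z s) has_vector_derivative (1 / \<delta>) *\<^sub>R d' s - wconst (\<i> * a * of_nat p * c s ^ (p - 1)) * z s) (at s within {0..T})"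
          if "s \<in> {0..T}" for s
          unfolding z'_def
          by (intro has_vector_derivative_diff z that bounded_linear.has_vector_derivative[OF bounded_linear_scaleR_right] d)
        show "0 \<le> \<epsilon> * D" using \<epsilon> D0 by simp
        show "norm ((1 / \<delta>) *\<^sub>R d' s - wconst (\<i> * a * of_nat p * c s ^ (p - 1)) * z s) \<le> L * norm (z' s - z s) + \<epsilon> * D"
          if s: "s \<in> {0..T}" for s
        proof -
          have nB: "norm (c' s) \<le> B" "norm (c s) \<le> B"
            using cB[OF s] c(1)[OF s] M by (auto simp: B_def)
          have eq: "(1 / \<delta>) *\<^sub>R d' s - wconst (\<i> * a * of_nat p * c s ^ (p - 1)) * z s =
              wconst (\<i> * a * of_nat p * c' s ^ (p - 1)) * (z' s - z s) +
              (wconst (\<i> * a * of_nat p * (c' s ^ (p - 1) - c s ^ (p - 1))) * z s + err s)"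
            unfolding err_def right_diff_distrib wconst_simps(4) left_diff_distrib by simp
          have "norm (wconst (\<i> * a * of_nat p * c' s ^ (p - 1)) * (z' s - z s)) \<le> L * norm (z' s - z s)"
          proof -
            have "norm a * (real p * norm (c' s) ^ (p - 1)) \<le> norm a * (real p * B ^ (p - 1))"
              using nB by (intro mult_left_mono power_mono) auto
            then have "norm (\<i> * a * of_nat p * c' s ^ (p - 1)) \<le> L"
              using ap by (simp add: norm_mult norm_power mult.assoc)
            then show ?thesis
              unfolding wconst_simps(9) by (intro mult_right_mono) auto
          qed
          moreover have "norm (wconst (\<i> * a * of_nat p * (c' s ^ (p - 1) - c s ^ (p - 1))) * z s) \<le>
              \<epsilon> * (norm a * real p * (real (p - 1) * B ^ (p - 1 - 1)) * C1 * M)"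
          proof -
            have "norm (c' s ^ (p - 1) - c s ^ (p - 1)) \<le> real (p - 1) * B ^ (p - 1 - 1) * norm (c' s - c s)"
              by (rule norm_power_diff_le[OF nB])
            also have "\<dots> \<le> real (p - 1) * B ^ (p - 1 - 1) * (C1 * \<epsilon>)"
              using B e1[OF s] by (intro mult_left_mono) auto
            finally have "norm a * real p * norm (c' s ^ (p - 1) - c s ^ (p - 1)) * norm (z s) \<le>
                norm a * real p * (real (p - 1) * B ^ (p - 1 - 1) * (C1 * \<epsilon>)) * M"
              using z(1)[OF s] B C10 \<epsilon> by (intro mult_mono) auto
            then show ?thesis
              unfolding wconst_simps(9) norm_mult by (simp add: mult_ac)
          qed
          ultimately show ?thesis
            unfolding eq using err[OF s]
            by (intro order_trans[OF norm_triangle_ineq] add_mono order_trans[OF norm_triangle_ineq[of "wconst (\<i> * a * of_nat p * (c' s ^ (p - 1) - c s ^ (p - 1))) * z s"]])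
              (auto simp: D_def distrib_left)
        qed
      qed
      moreover have "z' 0 = z 0"
        using v0 c0 \<delta> by (simp add: z'_def d_def \<delta>_def)
      ultimately show ?thesis by (simp add: mult_ac)
    qed
    show "\<forall>s\<in>{0..T}. norm (c' s - c s) \<le> max C1 (2 * D * T) * \<epsilon> \<and>
        norm ((1 / \<epsilon> ^ (p - 1)) *\<^sub>R (v s - wconst (c' s)) - z s) \<le> max C1 (2 * D * T) * \<epsilon>"
    proof (intro ballI conjI)
      fix s assume s: "s \<in> {0..T}"
      show "norm (c' s - c s) \<le> max C1 (2 * D * T) * \<epsilon>"
        by (rule order_trans[OF e1[OF s]]) (use \<epsilon> in \<open>auto intro: mult_right_mono\<close>)
      show "norm ((1 / \<epsilon> ^ (p - 1)) *\<^sub>R (v s - wconst (c' s)) - z s) \<le> max C1 (2 * D * T) * \<epsilon>"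
        using order_trans[OF e2[OF s] mult_right_mono[OF max.cobounded2[of "2 * D * T" C1]]] \<epsilon>
        by (simp add: z'_def d_def \<delta>_def)
    qed
  qed
qed

text \<open>
  Undoing the scaling: on the time interval of length \<open>T / \<epsilon>\<^sup>p\<^sup>-\<^sup>1\<close> there is a solution that starts
  at \<open>\<epsilon> c + \<epsilon>\<^sup>p z\<close>. At the end of the interval, \<open>c\<close> and \<open>z\<close> have followed the slow flow up to \<open>O(\<epsilon>)\<close>, and the free flow has acted on \<open>z\<close> only.
\<close>

lemma slow_time_solution:
  assumes M: "M > 0" and T: "T \<ge> 0" "lip (4 * M) * T \<le> 1 / 2"
    and c: "\<And>s. s \<in> {0..T} \<Longrightarrow> norm (c s) \<le> M"
      "\<And>s. s \<in> {0..T} \<Longrightarrow> (c has_vector_derivative \<i> * a * c s ^ p) (at s within {0..T})"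
    and z: "\<And>s. s \<in> {0..T} \<Longrightarrow> norm (z s) \<le> M"
      "\<And>s. s \<in> {0..T} \<Longrightarrow> (z has_vector_derivative wconst (\<i> * a * of_nat p * c s ^ (p - 1)) * z s) (at s within {0..T})"
  shows "\<exists>C\<ge>0. \<forall>\<epsilon>. 0 < \<epsilon> \<longrightarrow> \<epsilon> \<le> 1 \<longrightarrow> \<epsilon> * (4 * M) \<le> 1 \<longrightarrow>
    (\<exists>u c' z'. nls_solution \<omega> p f {0..T / \<epsilon> ^ (p - 1)} u \<and> u 0 = wev \<omega> (wconst (of_real \<epsilon> * c 0) + \<epsilon> ^ p *\<^sub>R z 0) \<and>
      u (T / \<epsilon> ^ (p - 1)) = wev \<omega> (wconst (of_real \<epsilon> * c') + \<epsilon> ^ p *\<^sub>R wflow \<omega> (T / \<epsilon> ^ (p - 1)) z') \<and>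
      norm (c' - c T) \<le> C * \<epsilon> \<and> norm (z' - z T) \<le> C * \<epsilon>)"
proof (rule slow_time_error[OF M T c z])
  fix C
  assume C0: "C \<ge> 0" and C: "\<And>\<epsilon> q v c'. 0 < \<epsilon> \<Longrightarrow> \<epsilon> \<le> 1 \<Longrightarrow> \<epsilon> * (4 * M) \<le> 1 \<Longrightarrow>
      v 0 = wconst (c 0) + \<epsilon> ^ (p - 1) *\<^sub>R z 0 \<Longrightarrow> (\<And>s. s \<in> {0..T} \<Longrightarrow> norm (v s) \<le> 4 * M) \<Longrightarrow>
      (\<And>s. s \<in> {0..T} \<Longrightarrow> (v has_vector_derivative wflow \<omega> (- (q * s)) (wconst \<i> * field \<epsilon> (wflow \<omega> (q * s) (v s)))) (at s within {0..T})) \<Longrightarrow>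
      c' 0 = c 0 \<Longrightarrow> (\<And>s. s \<in> {0..T} \<Longrightarrow> norm (c' s) \<le> 4 * M) \<Longrightarrow>
      (\<And>s. s \<in> {0..T} \<Longrightarrow> (c' has_vector_derivative \<i> * (a * c' s ^ p + rem_const \<epsilon> (c' s))) (at s within {0..T})) \<Longrightarrow>
      \<forall>s\<in>{0..T}. norm (c' s - c s) \<le> C * \<epsilon> \<and> norm ((1 / \<epsilon> ^ (p - 1)) *\<^sub>R (v s - wconst (c' s)) - z s) \<le> C * \<epsilon>"
  show ?thesis
  proof (intro exI[of _ C] conjI allI impI C0)
    fix \<epsilon> :: real assume \<epsilon>: "0 < \<epsilon>" "\<epsilon> \<le> 1" "\<epsilon> * (4 * M) \<le> 1"
    define \<delta> where "\<delta> = \<epsilon> ^ (p - 1)"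
    have \<delta>: "0 < \<delta>" "\<delta> \<le> 1" using \<epsilon> by (auto simp: \<delta>_def power_le_one)
    have \<epsilon>p: "\<epsilon> ^ p = \<epsilon> * \<delta>" using p by (simp add: \<delta>_def flip: power_Suc)
    \<comment> \<open>fast time elapsed per unit of slow time\<close>
    define q where "q = 1 / \<delta>"
    have start: "2 * norm (wconst (c 0) + \<delta> *\<^sub>R z 0) \<le> 4 * M" "2 * norm (c 0) \<le> 4 * M"
    proof -
      have "norm (wconst (c 0) + \<delta> *\<^sub>R z 0) \<le> norm (c 0) + \<delta> * norm (z 0)"
        using \<delta> by (intro order_trans[OF norm_triangle_ineq]) (simp add: wconst_simps)
      also have "\<dots> \<le> M + 1 * M"
        using c(1)[of 0] z(1)[of 0] T \<delta> M by (intro add_mono mult_mono) auto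
      finally show "2 * norm (wconst (c 0) + \<delta> *\<^sub>R z 0) \<le> 4 * M" by simp
      show "2 * norm (c 0) \<le> 4 * M" using c(1)[of 0] T M by simp
    qed
    show "\<exists>u c' z'. nls_solution \<omega> p f {0..T / \<epsilon> ^ (p - 1)} u \<and> u 0 = wev \<omega> (wconst (of_real \<epsilon> * c 0) + \<epsilon> ^ p *\<^sub>R z 0) \<and>
      u (T / \<epsilon> ^ (p - 1)) = wev \<omega> (wconst (of_real \<epsilon> * c') + \<epsilon> ^ p *\<^sub>R wflow \<omega> (T / \<epsilon> ^ (p - 1)) z') \<and>
      norm (c' - c T) \<le> C * \<epsilon> \<and> norm (z' - z T) \<le> C * \<epsilon>"
    proof (rule scaled_solution_exists[OF \<epsilon> T start(1), where q = q], rule scaled_const_solution_exists[OF \<epsilon> T start(2)])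
      fix v :: "real \<Rightarrow> 'd wiener" and c' :: "real \<Rightarrow> complex"
      assume v: "v 0 = wconst (c 0) + \<delta> *\<^sub>R z 0" "\<And>s. s \<in> {0..T} \<Longrightarrow> norm (v s) \<le> 4 * M"
        "\<And>s. s \<in> {0..T} \<Longrightarrow> (v has_vector_derivative wflow \<omega> (- (q * s)) (wconst \<i> * field \<epsilon> (wflow \<omega> (q * s) (v s)))) (at s within {0..T})"
        and c': "c' 0 = c 0" "\<And>s. s \<in> {0..T} \<Longrightarrow> norm (c' s) \<le> 4 * M"
        "\<And>s. s \<in> {0..T} \<Longrightarrow> (c' has_vector_derivative \<i> * (a * c' s ^ p + rem_const \<epsilon> (c' s))) (at s within {0..T})"
      from C[OF \<epsilon> v(1)[unfolded \<delta>_def] v(2,3) c'] T(1)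
      have close: "norm (c' T - c T) \<le> C * \<epsilon>" "norm ((1 / \<delta>) *\<^sub>R (v T - wconst (c' T)) - z T) \<le> C * \<epsilon>"
        by (auto simp: \<delta>_def)
      define V where "V t = \<epsilon> *\<^sub>R v (\<delta> * t)" for t
      define N where "N w = wconst (f 0) * w ^ p + R w" for w
      have sol: "nls_solution \<omega> p f {0..T / \<delta>} (\<lambda>t. wev \<omega> (wflow \<omega> t (V t)))"
      proof (rule nls_solution_of_mild[OF \<omega>, where N = N])
        show "wev \<omega> (N w) x = wev \<omega> w x ^ p * f (wev \<omega> w x)" for w x
          unfolding N_def by (rule eval)
        fix t assume t: "t \<in> {0..T / \<delta>}"
        have dt: "\<delta> * t \<in> {0..T}" using t \<delta> by (auto simp: pos_le_divide_eq mult.commute)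
        have d1: "((\<lambda>t. \<delta> * t) has_vector_derivative \<delta>) (at t within {0..T / \<delta>})"
          by (auto intro!: derivative_eq_intros)
        have d2: "(\<lambda>t. \<delta> * t) ` {0..T / \<delta>} \<subseteq> {0..T}"
          using \<delta> by (auto simp: pos_le_divide_eq mult.commute)
        have "(v \<circ> (\<lambda>t. \<delta> * t) has_vector_derivative
            \<delta> *\<^sub>R wflow \<omega> (- (q * (\<delta> * t))) (wconst \<i> * field \<epsilon> (wflow \<omega> (q * (\<delta> * t)) (v (\<delta> * t))))) (at t within {0..T / \<delta>})"
          by (rule vector_diff_chain_within[OF d1 has_vector_derivative_within_subset[OF v(3)[OF dt] d2]])
        moreover have "q * (\<delta> * t) = t" using \<delta> by (simp add: q_def)
        ultimately have "((\<lambda>t. v (\<delta> * t)) has_vector_derivative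
            \<delta> *\<^sub>R wflow \<omega> (- t) (wconst \<i> * field \<epsilon> (wflow \<omega> t (v (\<delta> * t))))) (at t within {0..T / \<delta>})"
          by (simp only: o_def)
        then have "(V has_vector_derivative
            \<epsilon> *\<^sub>R \<delta> *\<^sub>R wflow \<omega> (- t) (wconst \<i> * field \<epsilon> (wflow \<omega> t (v (\<delta> * t))))) (at t within {0..T / \<delta>})"
          unfolding V_def[abs_def] by (rule bounded_linear.has_vector_derivative[OF bounded_linear_scaleR_right])
        also have "\<epsilon> *\<^sub>R \<delta> *\<^sub>R wflow \<omega> (- t) (wconst \<i> * field \<epsilon> (wflow \<omega> t (v (\<delta> * t)))) =
            wflow \<omega> (- t) (wconst \<i> * (\<epsilon> ^ p *\<^sub>R field \<epsilon> (wflow \<omega> t (v (\<delta> * t)))))"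
          by (simp add: \<epsilon>p wflow_simps)
        also have "\<epsilon> ^ p *\<^sub>R field \<epsilon> (wflow \<omega> t (v (\<delta> * t))) = N (wflow \<omega> t (V t))"
          using \<epsilon> by (simp add: field_def rem_def N_def V_def wflow_simps a_def scaleR_right_distrib scaleR_power)
        finally show "(V has_vector_derivative wflow \<omega> (- t) (wconst \<i> * N (wflow \<omega> t (V t)))) (at t within {0..T / \<delta>})" .
      qed
      define z' where "z' = (1 / \<delta>) *\<^sub>R (v T - wconst (c' T))"
      have vT: "v T = wconst (c' T) + \<delta> *\<^sub>R z'"
        using \<delta> by (simp add: z'_def)
      have "wflow \<omega> (T / \<delta>) (V (T / \<delta>)) = wconst (of_real \<epsilon> * c' T) + \<epsilon> ^ p *\<^sub>R wflow \<omega> (T / \<delta>) z'"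
        using \<delta> by (simp add: V_def vT wflow_simps scaleR_right_distrib \<epsilon>p wconst_scaleR)
      moreover have "wflow \<omega> 0 (V 0) = wconst (of_real \<epsilon> * c 0) + \<epsilon> ^ p *\<^sub>R z 0"
        by (simp add: V_def v(1) wflow_simps scaleR_right_distrib \<epsilon>p wconst_scaleR)
      ultimately show ?thesis
        using sol close unfolding \<delta>_def[symmetric] z'_def[symmetric]
        by (intro exI[of _ "\<lambda>t. wev \<omega> (wflow \<omega> t (V t))"] exI[of _ "c' T"] exI[of _ z'] conjI) simp_all
    qed
  qed
qed

end

section \<open>Monotonicity of the leading term\<close>

text \<open>
  Here \<open>\<Psi>\<close> is the functional \<open>F\<close> read on functions, and \<open>Q D c z\<close> is the coefficient of \<open>\<epsilon>\<^sup>D\<close> in its value at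
  \<open>\<epsilon> c + \<epsilon>\<^sup>p z\<close>. The homogeneity \<open>Q_scale\<close> reduces
  statements about arbitrary \<open>c\<close> and \<open>z\<close> to the region of convergence.
\<close>

locale monotone_functional = wiener_nls \<omega> p f R K
  for \<omega> :: "real ^ 'd" and p f and R :: "'d wiener \<Rightarrow> 'd wiener" and K +
  fixes \<Psi> :: "(real ^ 'd \<Rightarrow> complex) \<Rightarrow> real" and Q :: "nat \<Rightarrow> complex \<Rightarrow> 'd wiener \<Rightarrow> real" and r Kq :: real
  assumes mono: "\<And>T u. nls_solution \<omega> p f {0..T} u \<Longrightarrow> 0 \<le> T \<Longrightarrow> \<Psi> (u T) \<le> \<Psi> (u 0)"
    and r: "r > 0"
    and expand: "\<And>c z \<epsilon>. norm c + norm z < r \<Longrightarrow> \<bar>\<epsilon>\<bar> \<le> 1 \<Longrightarrow>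
      (\<lambda>D. \<epsilon> ^ D * Q D c z) sums \<Psi> (wev \<omega> (wconst (of_real \<epsilon> * c) + \<epsilon> ^ p *\<^sub>R z))"
    and Q_sum: "\<And>c z. norm c + norm z < r \<Longrightarrow> summable (\<lambda>D. norm (Q D c z)) \<and> (\<Sum>D. norm (Q D c z)) \<le> Kq"
    and Q_scale: "\<And>D \<epsilon> c z. Q D (of_real \<epsilon> * c) (\<epsilon> ^ p *\<^sub>R z) = \<epsilon> ^ D * Q D c z"
    and \<Psi>_cont: "continuous_on UNIV (\<lambda>v. \<Psi> (wev \<omega> v))"
    and f0: "f 0 \<noteq> 0"
begin

definition \<Phi> :: "complex \<Rightarrow> 'd wiener \<Rightarrow> real \<Rightarrow> real"
  where "\<Phi> c z \<epsilon> = \<Psi> (wev \<omega> (wconst (of_real \<epsilon> * c) + \<epsilon> ^ p *\<^sub>R z))"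

text \<open>
  If all terms between the constant one and the one of weight \<open>D\<close> vanish, then \<open>Q D\<close> is the limit of a
  difference quotient of order \<open>D\<close>, uniformly on bounded sets. The series converges only for small arguments, so a bounded pair \<open>(c, z)\<close> is first shrunk by the fixed
  factor \<open>s\<close>, with \<open>\<epsilon> = s t\<close>.
\<close>

lemma leading_term:
  assumes D: "D \<ge> 1" and low: "\<And>D' c z. 0 < D' \<Longrightarrow> D' < D \<Longrightarrow> Q D' c z = 0"
  shows "\<exists>C s. 0 < s \<and> 0 \<le> C \<and> (\<forall>c z \<epsilon>. norm c + norm z \<le> m \<longrightarrow> 0 < \<epsilon> \<longrightarrow> \<epsilon> \<le> s \<longrightarrow>
    \<bar>(\<Phi> c z \<epsilon> - \<Psi> (wev \<omega> 0)) / \<epsilon> ^ D - Q D c z\<bar> \<le> C * \<epsilon>)"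
proof -
  define s where "s = min 1 (r / (2 * (\<bar>m\<bar> + 1)))"
  have s: "0 < s" "s \<le> 1" unfolding s_def using r by auto
  have sm: "s * (\<bar>m\<bar> + 1) < r"
  proof -
    have "s * (\<bar>m\<bar> + 1) \<le> r / (2 * (\<bar>m\<bar> + 1)) * (\<bar>m\<bar> + 1)"
      unfolding s_def by (intro mult_right_mono) auto
    also have "\<dots> = r / 2" by (simp add: field_simps)
    finally show ?thesis using r by simp
  qed
  have Kq: "Kq \<ge> 0"
    using Q_sum[of 0 0] r suminf_nonneg[of "\<lambda>D. norm (Q D 0 0)"] by auto
  have main: "\<bar>(\<Phi> c z \<epsilon> - \<Psi> (wev \<omega> 0)) / \<epsilon> ^ D - Q D c z\<bar> \<le> Kq / s ^ Suc D * \<epsilon>"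
    if m: "norm c + norm z \<le> m" and \<epsilon>: "0 < \<epsilon>" "\<epsilon> \<le> s" for c z \<epsilon>
  proof -
    define t where "t = \<epsilon> / s"
    have t: "0 < t" "t \<le> 1" using \<epsilon> s by (auto simp: t_def)
    define c1 z1 where "c1 = of_real s * c" and "z1 = s ^ p *\<^sub>R z"
    have "s ^ p \<le> s" using power_decreasing[of 1 p s] s p by simp
    then have "norm c1 + norm z1 \<le> s * norm c + s * norm z"
      using s by (simp add: c1_def z1_def norm_mult mult_right_mono)
    also have "\<dots> \<le> s * (\<bar>m\<bar> + 1)"
      using m s by (simp flip: distrib_left)
    finally have small: "norm c1 + norm z1 < r" using sm by simp
    have arg: "of_real t * c1 = of_real \<epsilon> * c" "t ^ p *\<^sub>R z1 = \<epsilon> ^ p *\<^sub>R z"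
      using s by (simp_all add: t_def c1_def z1_def power_divide)
    have s1: "(\<lambda>D. t ^ D * Q D c1 z1) sums \<Phi> c z \<epsilon>"
      using expand[OF small, of t] t by (simp add: \<Phi>_def arg)
    have s0: "(\<lambda>D. 0 ^ D * Q D c1 z1) sums \<Psi> (wev \<omega> 0)"
      using expand[OF small, of 0] p by (simp add: wconst_simps power_0_left)
    define b where "b n = t ^ n * Q n c1 z1 - 0 ^ n * Q n c1 z1 - (if n = D then t ^ D * Q D c1 z1 else 0)" for n
    have b: "b sums (\<Phi> c z \<epsilon> - \<Psi> (wev \<omega> 0) - t ^ D * Q D c1 z1)"
      unfolding b_def by (intro sums_diff s1 s0) (use sums_single[of D "\<lambda>_. t ^ D * Q D c1 z1"] in simp)
    have Qs: "summable (\<lambda>D. norm (Q D c1 z1))" "(\<Sum>D. norm (Q D c1 z1)) \<le> Kq"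
      using Q_sum[OF small] by auto
    have le: "norm (b n) \<le> t ^ Suc D * norm (Q n c1 z1)" for n
    proof (cases "n \<le> D")
      case True
      then have "b n = 0"
        using low[of n c1 z1] D by (cases "n = 0"; cases "n = D") (auto simp: b_def)
      then show ?thesis using t by simp
    next
      case False
      then have "norm (b n) = t ^ n * norm (Q n c1 z1)"
        using t by (simp add: b_def abs_mult power_0_left)
      also have "\<dots> \<le> t ^ Suc D * norm (Q n c1 z1)"
        using False t by (intro mult_right_mono power_decreasing) auto
      finally show ?thesis .
    qed
    have "\<bar>\<Phi> c z \<epsilon> - \<Psi> (wev \<omega> 0) - t ^ D * Q D c1 z1\<bar> \<le> (\<Sum>n. t ^ Suc D * norm (Q n c1 z1))"
      using norm_suminf_le[OF le summable_mult[OF Qs(1)]] sums_unique[OF b] by simp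
    also have "\<dots> = t ^ Suc D * (\<Sum>n. norm (Q n c1 z1))" by (rule suminf_mult[OF Qs(1)])
    also have "\<dots> \<le> t ^ Suc D * Kq" using t Qs by (intro mult_left_mono) auto
    finally have 1: "\<bar>\<Phi> c z \<epsilon> - \<Psi> (wev \<omega> 0) - t ^ D * Q D c1 z1\<bar> \<le> t ^ Suc D * Kq" .
    have tD: "t ^ D * Q D c1 z1 = \<epsilon> ^ D * Q D c z"
      using s by (simp add: c1_def z1_def Q_scale t_def power_divide)
    have "\<bar>(\<Phi> c z \<epsilon> - \<Psi> (wev \<omega> 0)) / \<epsilon> ^ D - Q D c z\<bar> = \<bar>\<Phi> c z \<epsilon> - \<Psi> (wev \<omega> 0) - t ^ D * Q D c1 z1\<bar> / \<epsilon> ^ D"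
    proof -
      have "(\<Phi> c z \<epsilon> - \<Psi> (wev \<omega> 0)) / \<epsilon> ^ D - Q D c z = (\<Phi> c z \<epsilon> - \<Psi> (wev \<omega> 0) - \<epsilon> ^ D * Q D c z) / \<epsilon> ^ D"
        using \<epsilon> by (simp add: diff_divide_distrib)
      then show ?thesis
        unfolding tD using \<epsilon> by (simp add: abs_divide)
    qed
    also have "\<dots> \<le> (t ^ Suc D * Kq) / \<epsilon> ^ D"
      using 1 \<epsilon> by (intro divide_right_mono) auto
    also have "\<dots> = Kq / s ^ Suc D * \<epsilon>"
      using \<epsilon> s by (simp add: t_def power_divide field_simps)
    finally show ?thesis .
  qed
  show ?thesis
    by (intro exI[of _ "Kq / s ^ Suc D"] exI[of _ s]) (use main s Kq in auto)
qed

text \<open>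
  Continuity of the leading term: it is a locally uniform limit of difference quotients of a continuous functional.
\<close>

lemma leading_term_tendsto:
  assumes D: "D \<ge> 1" and low: "\<And>D' c z. 0 < D' \<Longrightarrow> D' < D \<Longrightarrow> Q D' c z = 0"
    and c: "(c \<longlongrightarrow> c0) F" and z: "(z \<longlongrightarrow> z0) F"
  shows "((\<lambda>n. Q D (c n) (z n)) \<longlongrightarrow> Q D c0 z0) F"
proof (rule tendstoI)
  fix e :: real assume e: "e > 0"
  define m where "m = norm c0 + norm z0 + 1"
  obtain C s where s: "0 < s" and C: "0 \<le> C" and
    lead: "\<And>c z \<epsilon>. norm c + norm z \<le> m \<Longrightarrow> 0 < \<epsilon> \<Longrightarrow> \<epsilon> \<le> s \<Longrightarrow>
      \<bar>(\<Phi> c z \<epsilon> - \<Psi> (wev \<omega> 0)) / \<epsilon> ^ D - Q D c z\<bar> \<le> C * \<epsilon>"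
    using leading_term[OF D low, of m] by blast
  define \<epsilon> where "\<epsilon> = min s (e / (4 * (C + 1)))"
  have \<epsilon>: "0 < \<epsilon>" "\<epsilon> \<le> s" using s C e by (auto simp: \<epsilon>_def)
  have C\<epsilon>: "C * \<epsilon> \<le> e / 4"
  proof -
    have "C * \<epsilon> \<le> (C + 1) * (e / (4 * (C + 1)))"
      using C \<epsilon> by (intro mult_mono) (auto simp: \<epsilon>_def)
    also have "\<dots> = e / 4" using C by (simp add: field_simps)
    finally show ?thesis .
  qed
  have "((\<lambda>n. wconst (of_real \<epsilon> * c n) + \<epsilon> ^ p *\<^sub>R z n) \<longlongrightarrow> wconst (of_real \<epsilon> * c0) + \<epsilon> ^ p *\<^sub>R z0) F"
    by (intro tendsto_intros bounded_linear.tendsto[OF bounded_linear_wconst] c z)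
  moreover have "isCont (\<lambda>v. \<Psi> (wev \<omega> v)) v" for v
    using \<Psi>_cont by (simp add: continuous_on_eq_continuous_at)
  ultimately have "((\<lambda>n. \<Phi> (c n) (z n) \<epsilon>) \<longlongrightarrow> \<Phi> c0 z0 \<epsilon>) F"
    unfolding \<Phi>_def by (rule isCont_tendsto_compose[rotated])
  then have lim: "((\<lambda>n. (\<Phi> (c n) (z n) \<epsilon> - \<Psi> (wev \<omega> 0)) / \<epsilon> ^ D) \<longlongrightarrow> (\<Phi> c0 z0 \<epsilon> - \<Psi> (wev \<omega> 0)) / \<epsilon> ^ D) F"
    by (intro tendsto_intros) (use \<epsilon> in auto)
  have "((\<lambda>n. norm (c n) + norm (z n)) \<longlongrightarrow> norm c0 + norm z0) F"
    by (intro tendsto_intros c z)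
  then have "\<forall>\<^sub>F n in F. norm (c n) + norm (z n) < m"
    by (rule order_tendstoD) (simp add: m_def)
  moreover have "\<forall>\<^sub>F n in F. dist ((\<Phi> (c n) (z n) \<epsilon> - \<Psi> (wev \<omega> 0)) / \<epsilon> ^ D) ((\<Phi> c0 z0 \<epsilon> - \<Psi> (wev \<omega> 0)) / \<epsilon> ^ D) < e / 2"
    by (rule tendstoD[OF lim]) (use e in simp)
  ultimately show "\<forall>\<^sub>F n in F. dist (Q D (c n) (z n)) (Q D c0 z0) < e"
  proof eventually_elim
    case (elim n)
    have "\<bar>(\<Phi> (c n) (z n) \<epsilon> - \<Psi> (wev \<omega> 0)) / \<epsilon> ^ D - Q D (c n) (z n)\<bar> \<le> e / 4"
      using lead[of "c n" "z n" \<epsilon>] elim(1) \<epsilon> C\<epsilon> by simp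
    moreover have "\<bar>(\<Phi> c0 z0 \<epsilon> - \<Psi> (wev \<omega> 0)) / \<epsilon> ^ D - Q D c0 z0\<bar> \<le> e / 4"
      using lead[of c0 z0 \<epsilon>] \<epsilon> C\<epsilon> by (simp add: m_def)
    ultimately show ?case using elim(2) unfolding dist_real_def by linarith
  qed
qed

text \<open>
  The monotonicity hypothesis compares \<open>F\<close> at \<open>\<epsilon> c(0) + \<epsilon>\<^sup>p z(0)\<close> and at the end of the solution of
  \<open>slow_time_solution\<close>; dividing by \<open>\<epsilon>\<^sup>D\<close> and letting \<open>\<epsilon> \<rightarrow> 0\<close> compares \<open>Q D\<close> at the two ends of the slow
  flow, except that the free flow at time \<open>t = T / \<epsilon>\<^sup>p\<^sup>-\<^sup>1\<close> still acts on \<open>z(T)\<close>. Therefore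
  \<open>t\<close> is chosen first, as a large recurrence time of the trigonometric polynomial \<open>z(T)\<close>, and \<open>\<epsilon>\<close> is determined by \<open>t\<close>.
\<close>

lemma leading_term_decreases:
  assumes D: "D \<ge> 1" and low: "\<And>D' c z. 0 < D' \<Longrightarrow> D' < D \<Longrightarrow> Q D' c z = 0"
    and M: "M > 0" and T: "T > 0" "lip (4 * M) * T \<le> 1 / 2"
    and c: "\<And>s. s \<in> {0..T} \<Longrightarrow> norm (c s) \<le> M"
      "\<And>s. s \<in> {0..T} \<Longrightarrow> (c has_vector_derivative \<i> * a * c s ^ p) (at s within {0..T})"
    and z: "\<And>s. s \<in> {0..T} \<Longrightarrow> norm (z s) \<le> M"
      "\<And>s. s \<in> {0..T} \<Longrightarrow> (z has_vector_derivative wconst (\<i> * a * of_nat p * c s ^ (p - 1)) * z s) (at s within {0..T})"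
    and fin: "finite A" "\<And>k. k \<notin> A \<Longrightarrow> wcoeff (z T) k = 0"
  shows "Q D (c T) (z T) \<le> Q D (c 0) (z 0)"
proof -
  obtain C where C0: "C \<ge> 0" and C: "\<And>\<epsilon>. 0 < \<epsilon> \<Longrightarrow> \<epsilon> \<le> 1 \<Longrightarrow> \<epsilon> * (4 * M) \<le> 1 \<Longrightarrow>
    (\<exists>u c' z'. nls_solution \<omega> p f {0..T / \<epsilon> ^ (p - 1)} u \<and> u 0 = wev \<omega> (wconst (of_real \<epsilon> * c 0) + \<epsilon> ^ p *\<^sub>R z 0) \<and>
      u (T / \<epsilon> ^ (p - 1)) = wev \<omega> (wconst (of_real \<epsilon> * c') + \<epsilon> ^ p *\<^sub>R wflow \<omega> (T / \<epsilon> ^ (p - 1)) z') \<and>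
      norm (c' - c T) \<le> C * \<epsilon> \<and> norm (z' - z T) \<le> C * \<epsilon>)"
    using slow_time_solution[OF M less_imp_le[OF T(1)] T(2) c z] by blast
  define m where "m = 2 * M + 2 * C + norm (c 0) + norm (z 0)"
  obtain C1 s where s: "0 < s" and C1: "0 \<le> C1" and
    lead: "\<And>c z \<epsilon>. norm c + norm z \<le> m \<Longrightarrow> 0 < \<epsilon> \<Longrightarrow> \<epsilon> \<le> s \<Longrightarrow>
      \<bar>(\<Phi> c z \<epsilon> - \<Psi> (wev \<omega> 0)) / \<epsilon> ^ D - Q D c z\<bar> \<le> C1 * \<epsilon>"
    using leading_term[OF D low, of m] by blast
  have pk: "p - 1 > 0" using p by simp
  have step: "\<exists>c' w. norm (c' - c T) \<le> e \<and> norm (w - z T) \<le> e \<and> Q D c' w \<le> Q D (c 0) (z 0) + e" if e: "e > 0" for e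
  proof -
    \<comment> \<open>any \<open>\<epsilon> \<le> \<eta>\<close> is admissible and keeps all errors below \<open>e / 2\<close>\<close>
    define \<eta> where "\<eta> = min (min 1 (1 / (4 * M))) (min s (min (e / (2 * (C + 1))) (e / (2 * (C1 + 1)))))"
    have \<eta>: "\<eta> > 0" using M s e C0 C1 by (simp add: \<eta>_def)
    obtain t where t: "t \<ge> T / \<eta> ^ (p - 1)" "norm (wflow \<omega> t (z T) - z T) < e / 2"
      by (rule wflow_recurrence[OF fin, of "T / \<eta> ^ (p - 1)" "e / 2" \<omega>]) (use T e \<eta> in auto)
    have t0: "t > 0" using t(1) T \<eta> by (meson divide_pos_pos less_le_trans zero_less_power)
    define \<epsilon> where "\<epsilon> = root (p - 1) (T / t)"
    have \<epsilon>0: "\<epsilon> > 0" using T t0 pk by (simp add: \<epsilon>_def real_root_gt_zero)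
    have \<epsilon>k: "\<epsilon> ^ (p - 1) = T / t" using T t0 pk by (simp add: \<epsilon>_def)
    then have time: "T / \<epsilon> ^ (p - 1) = t" using T t0 by simp
    have "\<epsilon> ^ (p - 1) \<le> \<eta> ^ (p - 1)"
      unfolding \<epsilon>k using t(1) t0 \<eta> by (simp add: field_simps)
    then have "\<epsilon> \<le> \<eta>"
      using \<eta> \<epsilon>0 pk power_mono_iff[of \<epsilon> \<eta> "p - 1"] by simp
    then have \<epsilon>: "\<epsilon> \<le> 1" "\<epsilon> \<le> 1 / (4 * M)" "\<epsilon> \<le> s" "\<epsilon> \<le> e / (2 * (C + 1))" "\<epsilon> \<le> e / (2 * (C1 + 1))"
      by (simp_all add: \<eta>_def)
    have "\<epsilon> * (4 * M) \<le> 1" using \<epsilon>(2) M by (simp add: field_simps)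
    from C[OF \<epsilon>0 \<epsilon>(1) this] obtain u c' z' where u: "nls_solution \<omega> p f {0..t} u"
      "u 0 = wev \<omega> (wconst (of_real \<epsilon> * c 0) + \<epsilon> ^ p *\<^sub>R z 0)"
      "u t = wev \<omega> (wconst (of_real \<epsilon> * c') + \<epsilon> ^ p *\<^sub>R wflow \<omega> t z')"
      "norm (c' - c T) \<le> C * \<epsilon>" "norm (z' - z T) \<le> C * \<epsilon>"
      unfolding time by blast
    have C\<epsilon>: "C * \<epsilon> \<le> e / 2" "C1 * \<epsilon> \<le> e / 2" "C * \<epsilon> \<le> C"
    proof -
      have "C * \<epsilon> \<le> (C + 1) * (e / (2 * (C + 1)))" using C0 \<epsilon> \<epsilon>0 by (intro mult_mono) auto
      also have "\<dots> = e / 2" using C0 by (simp add: field_simps)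
      finally show "C * \<epsilon> \<le> e / 2" .
      have "C1 * \<epsilon> \<le> (C1 + 1) * (e / (2 * (C1 + 1)))" using C1 \<epsilon> \<epsilon>0 by (intro mult_mono) auto
      also have "\<dots> = e / 2" using C1 by (simp add: field_simps)
      finally show "C1 * \<epsilon> \<le> e / 2" .
      show "C * \<epsilon> \<le> C" using C0 \<epsilon>(1) by (simp add: mult_left_le)
    qed
    define w where "w = wflow \<omega> t z'"
    have "w - z T = wflow \<omega> t (z' - z T) + (wflow \<omega> t (z T) - z T)"
      by (simp add: w_def wflow_simps)
    then have "norm (w - z T) \<le> norm (z' - z T) + norm (wflow \<omega> t (z T) - z T)"
      by (metis norm_triangle_ineq norm_wflow)
    then have wz: "norm (w - z T) \<le> e" using u(5) C\<epsilon> t(2) by linarith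
    have cc: "norm (c' - c T) \<le> e" using u(4) C\<epsilon> e by linarith
    have mB: "norm c' + norm w \<le> m"
    proof -
      have "norm c' \<le> norm (c T) + C" using norm_triangle_sub[of c' "c T"] u(4) C\<epsilon>(3) by linarith
      moreover have "norm w \<le> norm (z T) + C"
        using norm_triangle_sub[of z' "z T"] u(5) C\<epsilon>(3) by (simp add: w_def)
      moreover have "norm (c T) \<le> M" "norm (z T) \<le> M"
        using c(1)[of T] z(1)[of T] T(1) by simp_all
      ultimately show ?thesis
        using norm_ge_zero[of "c 0"] norm_ge_zero[of "z 0"] unfolding m_def by linarith
    qed
    have "\<Phi> c' w \<epsilon> \<le> \<Phi> (c 0) (z 0) \<epsilon>"
      using mono[OF u(1)] t0 by (simp add: u(2,3) \<Phi>_def w_def)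
    then have "(\<Phi> c' w \<epsilon> - \<Psi> (wev \<omega> 0)) / \<epsilon> ^ D \<le> (\<Phi> (c 0) (z 0) \<epsilon> - \<Psi> (wev \<omega> 0)) / \<epsilon> ^ D"
      using \<epsilon>0 by (intro divide_right_mono) auto
    moreover have "\<bar>(\<Phi> c' w \<epsilon> - \<Psi> (wev \<omega> 0)) / \<epsilon> ^ D - Q D c' w\<bar> \<le> C1 * \<epsilon>"
      by (rule lead[OF mB \<epsilon>0 \<epsilon>(3)])
    moreover have "\<bar>(\<Phi> (c 0) (z 0) \<epsilon> - \<Psi> (wev \<omega> 0)) / \<epsilon> ^ D - Q D (c 0) (z 0)\<bar> \<le> C1 * \<epsilon>"
      by (rule lead[OF _ \<epsilon>0 \<epsilon>(3)]) (use M C0 in \<open>simp add: m_def\<close>)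
    ultimately have "Q D c' w \<le> Q D (c 0) (z 0) + e"
      using C\<epsilon>(2) by linarith
    then show ?thesis using wz cc by blast
  qed
  have "\<exists>c' w. norm (c' - c T) \<le> inverse (real (Suc n)) \<and> norm (w - z T) \<le> inverse (real (Suc n)) \<and>
      Q D c' w \<le> Q D (c 0) (z 0) + inverse (real (Suc n))" for n
    by (rule step) simp
  then obtain c' w where cw: "\<And>n. norm (c' n - c T) \<le> inverse (real (Suc n))"
    "\<And>n. norm (w n - z T) \<le> inverse (real (Suc n))"
    "\<And>n. Q D (c' n) (w n) \<le> Q D (c 0) (z 0) + inverse (real (Suc n))"
    by metis
  have "c' \<longlonglongrightarrow> c T"
    by (rule Lim_transform_bound[OF _ LIMSEQ_inverse_real_of_nat, THEN LIM_zero_cancel])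
      (use cw(1) in \<open>auto intro!: always_eventually\<close>)
  moreover have "w \<longlonglongrightarrow> z T"
    by (rule Lim_transform_bound[OF _ LIMSEQ_inverse_real_of_nat, THEN LIM_zero_cancel])
      (use cw(2) in \<open>auto intro!: always_eventually\<close>)
  ultimately have "(\<lambda>n. Q D (c' n) (w n)) \<longlonglongrightarrow> Q D (c T) (z T)"
    using low by (intro leading_term_tendsto[OF D]) blast+
  moreover have "(\<lambda>n. Q D (c 0) (z 0) + inverse (real (Suc n))) \<longlonglongrightarrow> Q D (c 0) (z 0) + 0"
    by (intro tendsto_intros LIMSEQ_inverse_real_of_nat)
  ultimately show ?thesis
    using cw(3) by (auto intro: LIMSEQ_le)
qed

end

section \<open>Orbits tending to zero in both time directions\<close>

text \<open>
  The solution of \<open>c' = \<i> a c\<^sup>k\<^sup>+\<^sup>1\<close> obtained by separation of variables: \<open>(c / \<kappa>)\<^sup>-\<^sup>k = b - \<i> \<sigma> k s\<close>. The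
  condition \<open>Re b > 0\<close> keeps this line in the right half-plane, so the principal branch of the root is smooth for all real \<open>s\<close>.
\<close>

lemma root_orbit_derivative:
  fixes b \<kappa> a :: complex and \<sigma> :: real and k :: nat
  assumes b: "Re b > 0" and k: "k > 0" and \<kappa>: "a * \<kappa> ^ k = of_real \<sigma>"
  defines "c \<equiv> \<lambda>s. \<kappa> * exp (- (Ln (b - \<i> * of_real (\<sigma> * real k * s)) / of_nat k))"
  shows "(c has_vector_derivative \<i> * a * c s ^ Suc k) (at s)"
proof -
  define g where "g s = b - \<i> * of_real (\<sigma> * real k * s)" for s
  have g: "Re (g s) > 0" for s using b by (simp add: g_def)
  then have g0: "g s \<noteq> 0" "g s \<notin> \<real>\<^sub>\<le>\<^sub>0" for s
    by (auto simp: complex_nonpos_Reals_iff not_le) (metis less_irrefl zero_complex.sel(1))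
  define H where "H w = \<kappa> * exp (- (Ln (b - \<i> * (of_real \<sigma> * of_nat k * w)) / of_nat k))" for w
  have "(H has_field_derivative H (of_real s) * (\<i> * of_real \<sigma> / g s)) (at (of_real s))"
    unfolding H_def[abs_def]
    by (rule derivative_eq_intros refl | (use g0[of s] k in \<open>simp add: g_def mult.assoc\<close>; fail))+
      (use g0[of s] k in \<open>simp add: g_def mult.assoc field_simps\<close>)
  then have "((\<lambda>s. H (of_real s)) has_vector_derivative H (of_real s) * (\<i> * of_real \<sigma> / g s)) (at s)"
    by (rule has_vector_derivative_real_field)
  moreover have "(\<lambda>s. H (of_real s)) = c"
    by (auto simp: H_def c_def)
  moreover have "\<i> * a * c s ^ Suc k = c s * (\<i> * of_real \<sigma> / g s)"
  proof -
    have "exp (- (Ln (g s) / of_nat k)) ^ k = exp (of_nat k * - (Ln (g s) / of_nat k))"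
      by (rule exp_of_nat_mult[symmetric])
    also have "of_nat k * - (Ln (g s) / of_nat k) = - Ln (g s)" using k by simp
    also have "exp (- Ln (g s)) = 1 / g s" using g0 by (simp add: exp_minus inverse_eq_divide)
    finally have "a * c s ^ k = of_real \<sigma> / g s"
      using \<kappa> by (simp add: c_def power_mult_distrib g_def mult.assoc[symmetric])
    then show ?thesis by (simp add: mult_ac)
  qed
  ultimately show ?thesis by (metis (no_types, lifting))
qed

lemma root_orbit_bounds:
  fixes b \<kappa> :: complex and \<sigma> :: real and k :: nat
  assumes b: "Re b > 0" and k: "k > 0" and \<sigma>: "\<sigma> \<noteq> 0"
  defines "c \<equiv> \<lambda>s. \<kappa> * exp (- (Ln (b - \<i> * of_real (\<sigma> * real k * s)) / of_nat k))"
  shows "norm (c s) \<le> norm \<kappa> * exp (- (ln (Re b) / real k))" "(c \<longlongrightarrow> 0) at_infinity"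
proof -
  define g where "g s = b - \<i> * of_real (\<sigma> * real k * s)" for s
  have g: "Re (g s) = Re b" for s by (simp add: g_def)
  then have g0: "g s \<noteq> 0" for s using b by (metis less_irrefl zero_complex.sel(1))
  have nc: "norm (c s) = norm \<kappa> * exp (- (ln (norm (g s)) / real k))" for s
  proof -
    have "c s = \<kappa> * exp (- (Ln (g s) / of_nat k))"
      by (simp only: c_def g_def)
    then show ?thesis
      using g0[of s] by (simp add: norm_mult Re_Ln)
  qed
  have "Re b \<le> norm (g s)" using complex_Re_le_cmod[of "g s"] by (simp add: g)
  then have "ln (Re b) / real k \<le> ln (norm (g s)) / real k"
    using b g0[of s] by (intro divide_right_mono) auto
  then show "norm (c s) \<le> norm \<kappa> * exp (- (ln (Re b) / real k))"
    unfolding nc by (intro mult_left_mono) auto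
  have "filterlim (\<lambda>s. norm (g s)) at_top at_infinity"
  proof (rule filterlim_at_top_mono)
    show "filterlim (\<lambda>s. - \<bar>Im b\<bar> + (\<bar>\<sigma>\<bar> * real k) * norm s) at_top at_infinity"
      by (intro filterlim_tendsto_add_at_top[OF tendsto_const] filterlim_tendsto_pos_mult_at_top[OF tendsto_const]
          filterlim_norm_at_top) (use k \<sigma> in simp)
    show "\<forall>\<^sub>F s in at_infinity. - \<bar>Im b\<bar> + (\<bar>\<sigma>\<bar> * real k) * norm s \<le> norm (g s)"
    proof (intro always_eventually allI)
      fix s :: real
      have "(\<bar>\<sigma>\<bar> * real k) * norm s = \<bar>\<sigma> * real k * s\<bar>"
        by (simp add: abs_mult)
      moreover have "Im (g s) = Im b - \<sigma> * real k * s"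
        by (simp add: g_def)
      moreover note abs_Im_le_cmod[of "g s"]
      ultimately show "- \<bar>Im b\<bar> + (\<bar>\<sigma>\<bar> * real k) * norm s \<le> norm (g s)" by linarith
    qed
  qed
  moreover have "((\<lambda>x. exp (- (ln x / real k))) \<longlongrightarrow> 0) at_top"
  proof (rule filterlim_compose[OF exp_at_bot])
    have "filterlim (\<lambda>x. (1 / real k) * ln x) at_top at_top"
      by (rule filterlim_tendsto_pos_mult_at_top[OF tendsto_const _ ln_at_top]) (use k in simp)
    then show "filterlim (\<lambda>x. - (ln x / real k)) at_bot at_top"
      by (simp add: filterlim_uminus_at_top)
  qed
  ultimately have "((\<lambda>s. exp (- (ln (norm (g s)) / real k))) \<longlongrightarrow> 0) at_infinity"
    by (rule filterlim_compose[rotated])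
  then have "((\<lambda>s. norm (c s)) \<longlongrightarrow> norm \<kappa> * 0) at_infinity"
    unfolding nc by (intro tendsto_intros)
  then show "(c \<longlongrightarrow> 0) at_infinity"
    by (simp add: tendsto_norm_zero_iff)
qed

text \<open>
  Steps of length at most \<open>\<tau>\<close> reach any later time.
\<close>

lemma antimono_if_locally_decreasing:
  fixes h :: "real \<Rightarrow> real"
  assumes \<tau>: "\<tau> > 0" and h: "\<And>s T. 0 < T \<Longrightarrow> T \<le> \<tau> \<Longrightarrow> h (s + T) \<le> h s" and xy: "x \<le> y"
  shows "h y \<le> h x"
proof -
  have "x \<le> y \<Longrightarrow> y \<le> x + real n * \<tau> \<Longrightarrow> h y \<le> h x" for n x y
  proof (induction n arbitrary: y)
    case (Suc n)
    show ?case
    proof (cases "y \<le> x + real n * \<tau>")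
      case False
      have "h (x + real n * \<tau> + (y - (x + real n * \<tau>))) \<le> h (x + real n * \<tau>)"
        using False Suc.prems by (intro h) (auto simp: algebra_simps)
      also have "\<dots> \<le> h x" using \<tau> by (intro Suc.IH) auto
      finally show ?thesis by simp
    qed (use Suc in auto)
  qed simp
  moreover obtain n where "(y - x) / \<tau> \<le> real n" using real_arch_simple by blast
  ultimately show ?thesis using xy \<tau> by (simp add: field_simps)
qed

context monotone_functional
begin

text \<open>
  Along the orbit, \<open>c\<^sup>p \<zeta>\<close> solves the linearized equation, because \<open>c\<^sup>p\<close> is up to a constant factor the derivative of \<open>c\<close>,
  hence a variation of the orbit by time translation. Both components tend to zero at both ends, so the nonincreasing function \<open>h\<close> has the limit \<open>Q D 0 0 = 0\<close> at both ends.
  A uniform bound \<open>M\<close> on the orbit makes the step \<open>\<tau>\<close> uniform.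
\<close>

lemma leading_term_zero_on_orbit:
  assumes D: "D \<ge> 1" and low: "\<And>D' c z. 0 < D' \<Longrightarrow> D' < D \<Longrightarrow> Q D' c z = 0"
    and b: "Re b > 0" and \<sigma>: "\<sigma> \<noteq> 0" and \<kappa>: "a * \<kappa> ^ (p - 1) = of_real \<sigma>"
    and fin: "finite A" "\<And>k. k \<notin> A \<Longrightarrow> wcoeff \<zeta> k = 0"
  defines "c \<equiv> \<lambda>s. \<kappa> * exp (- (Ln (b - \<i> * of_real (\<sigma> * real (p - 1) * s)) / of_nat (p - 1)))"
  shows "Q D (c s) (wconst (c s ^ p) * \<zeta>) = 0"
proof -
  have pk: "p - 1 > 0" "Suc (p - 1) = p" using p by auto
  define z where "z s = wconst (c s ^ p) * \<zeta>" for s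
  define m where "m = norm \<kappa> * exp (- (ln (Re b) / real (p - 1)))"
  have cm: "norm (c s) \<le> m" for s
    unfolding c_def m_def by (rule root_orbit_bounds(1)[OF b pk(1) \<sigma>])
  have c0: "(c \<longlongrightarrow> 0) at_infinity"
    unfolding c_def by (rule root_orbit_bounds(2)[OF b pk(1) \<sigma>])
  have c': "(c has_vector_derivative \<i> * a * c s ^ p) (at s)" for s
    using root_orbit_derivative[OF b pk(1) \<kappa>, of s] unfolding c_def pk(2) .
  have z': "(z has_vector_derivative wconst (\<i> * a * of_nat p * c s ^ (p - 1)) * z s) (at s)" for s
  proof -
    have "((\<lambda>w. w ^ p) has_field_derivative of_nat p * c s ^ (p - 1)) (at (c s))"
      by (auto intro!: derivative_eq_intros)
    from field_vector_diff_chain_at[OF c' this]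
    have "((\<lambda>s. c s ^ p) has_vector_derivative (\<i> * a * c s ^ p) * (of_nat p * c s ^ (p - 1))) (at s)"
      by (simp add: o_def)
    from bounded_linear.has_vector_derivative[OF bounded_linear_compose[OF bounded_linear_mult_left[of \<zeta>] bounded_linear_wconst] this]
    show ?thesis
      unfolding z_def[abs_def] by (simp add: wconst_simps mult_ac)
  qed
  define M where "M = m + m ^ p * norm \<zeta> + 1"
  have m0: "m \<ge> 0" using cm[of 0] norm_ge_zero[of "c 0"] by linarith
  have M: "M > 0" using m0 by (auto simp: M_def intro!: add_nonneg_pos)
  have cM: "norm (c s) \<le> M" for s
    using cm[of s] m0 zero_le_power[OF m0, of p] by (auto simp: M_def intro!: add_nonneg_nonneg add_increasing2)
  have zM: "norm (z s) \<le> M" for s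
  proof -
    have "norm (z s) = norm (c s) ^ p * norm \<zeta>"
      unfolding z_def wconst_simps(9) norm_power ..
    also have "\<dots> \<le> m ^ p * norm \<zeta>"
      using cm[of s] by (intro mult_right_mono power_mono) auto
    finally have "norm (z s) \<le> m ^ p * norm \<zeta>" .
    then show ?thesis using m0 by (simp add: M_def)
  qed
  define \<tau> where "\<tau> = 1 / (2 * (lip (4 * M) + 1))"
  have L: "lip (4 * M) \<ge> 0" using M by (intro lip_nonneg) simp
  have \<tau>: "\<tau> > 0" using L by (simp add: \<tau>_def)
  define h where "h s = Q D (c s) (z s)" for s
  have dec: "h (s + T) \<le> h s" if T: "0 < T" "T \<le> \<tau>" for s T
  proof -
    have shift: "((\<lambda>x. y (s + x)) has_vector_derivative y') (at x within {0..T})"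
      if "(y has_vector_derivative y') (at (s + x))" for y :: "real \<Rightarrow> 'b::real_normed_vector" and y' x
    proof -
      have "(y \<circ> (\<lambda>x. s + x) has_vector_derivative 1 *\<^sub>R y') (at x)"
        by (rule vector_diff_chain_at) (use that in \<open>auto intro!: derivative_eq_intros\<close>)
      then show ?thesis by (simp add: o_def has_vector_derivative_at_within)
    qed
    have "lip (4 * M) * T \<le> (lip (4 * M) + 1) * \<tau>"
      using T L \<tau> by (intro mult_mono) auto
    also have "\<dots> = 1 / 2" using L by (simp add: \<tau>_def)
    finally have LT: "lip (4 * M) * T \<le> 1 / 2" .
    have "Q D (c (s + T)) (z (s + T)) \<le> Q D (c (s + 0)) (z (s + 0))"
    proof (rule leading_term_decreases[OF D _ M T(1) LT, where A = A and c = "\<lambda>x. c (s + x)" and z = "\<lambda>x. z (s + x)"])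
      show "((\<lambda>x. c (s + x)) has_vector_derivative \<i> * a * c (s + x) ^ p) (at x within {0..T})" for x
        by (rule shift[OF c'])
      show "((\<lambda>x. z (s + x)) has_vector_derivative wconst (\<i> * a * of_nat p * c (s + x) ^ (p - 1)) * z (s + x)) (at x within {0..T})" for x
        by (rule shift[OF z'])
      show "Q D' c z = 0" if "0 < D'" "D' < D" for D' c z by (rule low[OF that])
      show "wcoeff (z (s + T)) k = 0" if "k \<notin> A" for k using fin(2)[OF that] by (simp add: z_def)
    qed (use cM zM fin in auto)
    then show ?thesis by (simp add: h_def)
  qed
  have anti: "x \<le> y \<Longrightarrow> h y \<le> h x" for x y
    by (rule antimono_if_locally_decreasing[OF \<tau> dec])
  have "(z \<longlongrightarrow> wconst (0 ^ p) * \<zeta>) at_infinity"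
    unfolding z_def[abs_def] by (intro tendsto_intros bounded_linear.tendsto[OF bounded_linear_wconst] c0)
  then have z0: "(z \<longlongrightarrow> 0) at_infinity" using p by (simp add: power_0_left wconst_simps)
  have "Q D 0 0 = 0"
    using Q_scale[of D 0 0 0] D p by (simp add: power_0_left)
  then have h0: "(h \<longlongrightarrow> 0) at_infinity"
    unfolding h_def[abs_def] using leading_term_tendsto[OF D _ c0 z0] low by fastforce
  have "0 \<le> h s"
  proof (rule tendsto_upperbound[OF tendsto_mono[OF at_top_le_at_infinity h0]])
    show "\<forall>\<^sub>F x in at_top. h x \<le> h s"
      using eventually_ge_at_top[of s] by eventually_elim (rule anti)
  qed simp
  moreover have "h s \<le> 0"
  proof (rule tendsto_lowerbound[OF tendsto_mono[OF at_bot_le_at_infinity h0]])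
    show "\<forall>\<^sub>F x in at_bot. h s \<le> h x"
      using eventually_le_at_bot[of s] by eventually_elim (rule anti)
  qed simp
  ultimately show ?thesis by (simp add: h_def z_def)
qed

text \<open>
  Every \<open>(c, z)\<close> with \<open>Re (a c\<^sup>p\<^sup>-\<^sup>1) \<noteq> 0\<close> and \<open>z\<close> a trigonometric polynomial lies on an orbit of the previous lemma at \<open>s = 0\<close>, for
  \<open>b = \<sigma> / (a c\<^sup>p\<^sup>-\<^sup>1)\<close> with \<open>\<sigma>\<close> the sign of that real part. These pairs are dense, and the leading term is continuous.
\<close>

lemma leading_term_vanishes:
  assumes D: "D \<ge> 1" and low: "\<And>D' c z. 0 < D' \<Longrightarrow> D' < D \<Longrightarrow> Q D' c z = 0"
  shows "Q D c z = 0"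
proof -
  define k where "k = p - 1"
  have k: "k > 0" using p by (simp add: k_def)
  have a: "a \<noteq> 0" using f0 by (simp add: a_def)
  note tendsto = leading_term_tendsto[OF D, OF low]
  have generic: "Q D c z = 0"
    if re: "Re (a * c ^ k) \<noteq> 0" and fin: "finite A" "\<And>k. k \<notin> A \<Longrightarrow> wcoeff z k = 0" for c z A
  proof -
    have w: "a * c ^ k \<noteq> 0" using re by auto
    then have c: "c \<noteq> 0" using k by auto
    define \<sigma> where "\<sigma> = sgn (Re (a * c ^ k))"
    define b where "b = of_real \<sigma> / (a * c ^ k)"
    have \<sigma>: "\<sigma> \<noteq> 0" using re by (simp add: \<sigma>_def sgn_zero_iff)
    have "Re b = \<bar>Re (a * c ^ k)\<bar> / (norm (a * c ^ k))\<^sup>2"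
    proof -
      have "Re b = \<sigma> * Re (1 / (a * c ^ k))" by (simp add: b_def divide_inverse)
      also have "Re (1 / (a * c ^ k)) = Re (a * c ^ k) / (norm (a * c ^ k))\<^sup>2"
        by (simp only: Re_divide cmod_power2) simp
      finally show ?thesis by (simp add: \<sigma>_def sgn_if)
    qed
    then have b: "Re b > 0" using re w by (metis divide_pos_pos zero_less_abs_iff zero_less_norm_iff zero_less_power)
    then have b0: "b \<noteq> 0" by auto
    define \<kappa> where "\<kappa> = c * exp (Ln b / of_nat k)"
    have "exp (Ln b / of_nat k) ^ k = exp (of_nat k * (Ln b / of_nat k))"
      by (rule exp_of_nat_mult[symmetric])
    also have "\<dots> = b" using k b0 by simp
    finally have \<kappa>: "a * \<kappa> ^ k = of_real \<sigma>"
      using w by (simp add: \<kappa>_def power_mult_distrib b_def)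
    have c0: "\<kappa> * exp (- (Ln (b - \<i> * of_real (\<sigma> * real k * 0)) / of_nat k)) = c"
      by (simp add: \<kappa>_def exp_minus)
    define \<zeta> where "\<zeta> = wconst (1 / c ^ p) * z"
    have z: "wconst (c ^ p) * \<zeta> = z"
      unfolding \<zeta>_def mult.assoc[symmetric] wconst_simps(5)[symmetric] using c by (simp add: wconst_simps)
    have "wcoeff \<zeta> j = 0" if "j \<notin> A" for j using fin(2)[OF that] by (simp add: \<zeta>_def)
    from leading_term_zero_on_orbit[OF D _ b \<sigma> \<kappa>[unfolded k_def] fin(1) this, of 0, folded k_def, unfolded c0 z]
    show ?thesis using low by blast
  qed
  have fin_nz: "Q D c z = 0" if c: "c \<noteq> 0" and fin: "finite A" "\<And>k. k \<notin> A \<Longrightarrow> wcoeff z k = 0" for c z A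
  proof (cases "Re (a * c ^ k) = 0")
    case True
    define w where "w = a * c ^ k"
    have w: "Re w = 0" "w \<noteq> 0" using True a c by (auto simp: w_def)
    then have Imw: "Im w \<noteq> 0" by (auto simp: complex_eq_iff)
    \<comment> \<open>rotating \<open>c\<close> by a small angle moves \<open>a c\<^sup>k\<close> off the imaginary axis\<close>
    define \<theta> where "\<theta> n = pi / 2 * inverse (real (Suc n)) / real k" for n
    define cn where "cn n = c * cis (\<theta> n)" for n
    have "Re (a * cn n ^ k) \<noteq> 0" for n
    proof -
      have "a * cn n ^ k = w * cis (real k * \<theta> n)"
        by (simp only: cn_def w_def power_mult_distrib Complex.DeMoivre mult.assoc)
      then have "Re (a * cn n ^ k) = - (Im w * sin (real k * \<theta> n))"
        using w(1) by simp
      moreover have "real k * \<theta> n = pi / 2 * inverse (real (Suc n))"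
        using k by (simp add: \<theta>_def)
      moreover have "sin (pi / 2 * inverse (real (Suc n))) > 0"
      proof (rule sin_gt_zero)
        show "0 < pi / 2 * inverse (real (Suc n))" by simp
        have "inverse (real (Suc n)) \<le> 1" by (simp add: inverse_le_1_iff)
        then have "pi / 2 * inverse (real (Suc n)) \<le> pi / 2 * 1" by (intro mult_left_mono) auto
        then show "pi / 2 * inverse (real (Suc n)) < pi" using pi_gt_zero by linarith
      qed
      ultimately show ?thesis using Imw by simp
    qed
    then have Q0: "Q D (cn n) z = 0" for n using fin by (rule generic)
    have "cn \<longlonglongrightarrow> c * cis (pi / 2 * 0 / real k)"
      unfolding cn_def \<theta>_def by (intro tendsto_intros LIMSEQ_inverse_real_of_nat) (use k in auto)
    then have "(\<lambda>n. Q D (cn n) z) \<longlonglongrightarrow> Q D c z"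
      by (intro tendsto tendsto_const) auto
    then show ?thesis unfolding Q0 by (simp add: LIMSEQ_const_iff)
  qed (use generic fin in blast)
  have nz: "Q D c z = 0" if c: "c \<noteq> 0" for c z
  proof -
    have "\<exists>A. finite A \<and> norm (z - wtrunc A z) < inverse (real (Suc n))" for n
      by (rule wtrunc_approx[of "inverse (real (Suc n))" z]) auto
    then obtain A where A: "\<And>n. finite (A n)" "\<And>n. norm (z - wtrunc (A n) z) < inverse (real (Suc n))" by metis
    have Q0: "Q D c (wtrunc (A n) z) = 0" for n
      by (rule fin_nz[OF c A(1)[of n]]) (simp add: wcoeff_wtrunc A(1))
    have "(\<lambda>n. wtrunc (A n) z) \<longlonglongrightarrow> z"
      by (rule Lim_transform_bound[OF _ LIMSEQ_inverse_real_of_nat, THEN LIM_zero_cancel])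
        (use A(2) in \<open>auto intro!: always_eventually simp: norm_minus_commute less_imp_le\<close>)
    then have "(\<lambda>n. Q D c (wtrunc (A n) z)) \<longlonglongrightarrow> Q D c z"
      by (intro tendsto tendsto_const) auto
    then show ?thesis unfolding Q0 by (simp add: LIMSEQ_const_iff)
  qed
  show ?thesis
  proof (cases "c = 0")
    case True
    have "(\<lambda>n. complex_of_real (inverse (real (Suc n)))) \<longlonglongrightarrow> of_real 0"
      by (intro tendsto_intros LIMSEQ_inverse_real_of_nat)
    then have "(\<lambda>n. Q D (complex_of_real (inverse (real (Suc n)))) z) \<longlonglongrightarrow> Q D c z"
      unfolding True by (intro tendsto tendsto_const) auto
    moreover have "Q D (complex_of_real (inverse (real (Suc n)))) z = 0" for n
      by (rule nz) (simp del: of_nat_Suc)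
    ultimately show ?thesis by (simp add: LIMSEQ_const_iff)
  qed (rule nz)
qed

theorem all_terms_vanish: "D \<ge> 1 \<Longrightarrow> Q D c z = 0"
proof (induction D arbitrary: c z rule: less_induct)
  case (less D)
  show ?case by (rule leading_term_vanishes) (use less in auto)
qed

end

section \<open>Uniqueness of Fourier coefficients\<close>

lemma torus_fun_axis_multiple:
  assumes u: "torus_fun \<omega> u"
  shows "u (x + axis j (of_int n * (2 * pi / \<omega> $ j))) = u x"
proof (induction n arbitrary: x rule: int_induct[where k = 0])
  case base
  then show ?case by (simp add: axis_def vec_eq_iff[symmetric] zero_vec_def[symmetric] flip: vec_lambda_unique)
next
  case (step1 n)
  have "x + axis j (of_int (n + 1) * (2 * pi / \<omega> $ j)) = (x + axis j (of_int n * (2 * pi / \<omega> $ j))) + axis j (2 * pi / \<omega> $ j)"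
    by (simp add: vec_eq_iff axis_def algebra_simps add_divide_distrib)
  then show ?case using u step1 by (simp only: torus_fun_def)
next
  case (step2 n)
  have "u (x + axis j (of_int (n - 1) * (2 * pi / \<omega> $ j))) = u ((x + axis j (of_int (n - 1) * (2 * pi / \<omega> $ j))) + axis j (2 * pi / \<omega> $ j))"
    using u by (simp only: torus_fun_def)
  also have "(x + axis j (of_int (n - 1) * (2 * pi / \<omega> $ j))) + axis j (2 * pi / \<omega> $ j) = x + axis j (of_int n * (2 * pi / \<omega> $ j))"
    by (simp add: vec_eq_iff axis_def algebra_simps diff_divide_distrib)
  finally show ?case using step2 by simp
qed

lemma torus_fun_lattice:
  assumes u: "torus_fun \<omega> u"
  shows "u (x + (\<chi> j. of_int (n $ j) * (2 * pi / \<omega> $ j))) = u x"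
proof -
  have "u (x + (\<Sum>j\<in>J. axis j (of_int (n $ j) * (2 * pi / \<omega> $ j)))) = u x" if "finite J" for J
    using that
  proof (induction J arbitrary: x rule: finite_induct)
    case (insert j J)
    have "u (x + (\<Sum>j\<in>insert j J. axis j (of_int (n $ j) * (2 * pi / \<omega> $ j)))) =
        u ((x + axis j (of_int (n $ j) * (2 * pi / \<omega> $ j))) + (\<Sum>j\<in>J. axis j (of_int (n $ j) * (2 * pi / \<omega> $ j))))"
      using insert by (simp add: add.assoc)
    also have "\<dots> = u x"
      unfolding insert.IH by (rule torus_fun_axis_multiple[OF u])
    finally show ?case .
  qed simp
  from this[of UNIV] have "u (x + (\<Sum>j\<in>UNIV. axis j (of_int (n $ j) * (2 * pi / \<omega> $ j)))) = u x" by simp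
  moreover have "(\<Sum>j\<in>UNIV. axis j (of_int (n $ j) * (2 * pi / \<omega> $ j))) = (\<chi> j. of_int (n $ j) * (2 * pi / \<omega> $ j))"
    by (simp add: vec_eq_iff axis_def sum.delta)
  ultimately show ?thesis by simp
qed

text \<open>
  Every point is a point of the cell plus a lattice vector. The lattice vector \<open>d\<close> is described
  by its action on periodic functions, which is how it is used.
\<close>

lemma torus_cell_representative:
  fixes x :: "real ^ 'd"
  assumes \<omega>: "\<And>j. \<omega> $ j \<noteq> 0"
  shows "\<exists>y d. y \<in> torus_cell \<omega> \<and> x = y + d \<and> (\<forall>(u :: real ^ 'd \<Rightarrow> complex) z. torus_fun \<omega> u \<longrightarrow> u (z + d) = u z)"
proof -
  define m where "m j = \<lfloor>x $ j * \<bar>\<omega> $ j\<bar> / (2 * pi)\<rfloor>" for j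
  define n where "n = (\<chi> j. (if \<omega> $ j > 0 then m j else - m j))"
  define d where "d = (\<chi> j. of_int (n $ j) * (2 * pi / \<omega> $ j))"
  have dj: "d $ j = of_int (m j) * (2 * pi / \<bar>\<omega> $ j\<bar>)" for j
    using \<omega>[of j] by (auto simp: d_def n_def)
  show ?thesis
  proof (rule exI[of _ "x - d"], rule exI[of _ d], intro conjI allI impI)
    show "x - d \<in> torus_cell \<omega>"
      unfolding torus_cell_def mem_box_cart
    proof (intro allI conjI)
      fix j
      have w: "\<bar>\<omega> $ j\<bar> > 0" using \<omega>[of j] by simp
      have "of_int (m j) \<le> x $ j * \<bar>\<omega> $ j\<bar> / (2 * pi)" "x $ j * \<bar>\<omega> $ j\<bar> / (2 * pi) \<le> of_int (m j) + 1"
        unfolding m_def by linarith+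
      then have "d $ j \<le> x $ j" "x $ j \<le> d $ j + 2 * pi / \<bar>\<omega> $ j\<bar>"
        unfolding dj using w pi_gt_zero by (simp_all add: field_simps)
      then show "0 $ j \<le> (x - d) $ j" "(x - d) $ j \<le> (\<chi> j. 2 * pi / \<bar>\<omega> $ j\<bar>) $ j" by simp_all
    qed
    show "x = x - d + d" by simp
    show "u (z + d) = u z" if "torus_fun \<omega> u" for u :: "real ^ 'd \<Rightarrow> complex" and z
      unfolding d_def by (rule torus_fun_lattice[OF that])
  qed
qed

text \<open>
  The torus as a compact subset of \<open>\<complex>\<^sup>d\<close>, in order to apply the Stone--Weierstrass theorem.
\<close>

definition torus_circle :: "real ^ 'd \<Rightarrow> real ^ 'd \<Rightarrow> complex ^ 'd"
  where "torus_circle \<omega> x = (\<chi> j. cis (\<omega> $ j * x $ j))"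

lemma torus_fun_eq_if_circle_eq:
  assumes \<omega>: "\<And>j. \<omega> $ j \<noteq> 0" and u: "torus_fun \<omega> u" and eq: "torus_circle \<omega> x = torus_circle \<omega> y"
  shows "u x = u y"
proof -
  have "\<exists>n::int. \<omega> $ j * x $ j = \<omega> $ j * y $ j + 2 * of_int n * pi" for j
  proof -
    have "cis (\<omega> $ j * x $ j) = cis (\<omega> $ j * y $ j)"
      using arg_cong[OF eq, of "\<lambda>v. v $ j"] by (simp add: torus_circle_def)
    then show ?thesis
      unfolding cis_conv_exp exp_eq by (auto simp: complex_eq_iff)
  qed
  then obtain n where n: "\<And>j. \<omega> $ j * x $ j = \<omega> $ j * y $ j + 2 * of_int (n j) * pi" by metis
  have "x = y + (\<chi> j. of_int ((\<chi> j. n j) $ j) * (2 * pi / \<omega> $ j))"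
  proof (simp add: vec_eq_iff, intro allI)
    fix j
    show "x $ j = y $ j + of_int (n j) * (2 * pi) / \<omega> $ j"
      using n[of j] \<omega>[of j] by (simp add: field_simps)
  qed
  then show ?thesis by (simp only: torus_fun_lattice[OF u])
qed

text \<open>
  Real and imaginary parts of the coordinates are cosines and sines, that is, combinations of two characters.
\<close>

lemma real_polynomial_on_torus:
  fixes g :: "complex ^ 'd \<Rightarrow> real" and \<omega> :: "real ^ 'd"
  assumes "real_polynomial_function g"
  shows "\<exists>v. \<forall>x. of_real (g (torus_circle \<omega> x)) = wev \<omega> v x"
  using assms
proof (induction g rule: real_polynomial_function.induct)
  case (linear g)
  interpret bounded_linear g by fact
  define v where "v = (\<Sum>j\<in>UNIV.
    wconst (of_real (g (axis j 1) / 2)) * (wmono (axis j 1) 1 + wmono (- axis j 1) 1) +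
    wconst (- (\<i> * of_real (g (axis j \<i>) / 2))) * (wmono (axis j 1) 1 - wmono (- axis j 1) 1))"
  have mono: "wev \<omega> (wmono l 1) x = cis (phase \<omega> l x)" for l x
  proof (rule has_sum_unique[OF wev_has_sum])
    show "((\<lambda>k. wcoeff (wmono l 1) k * cis (phase \<omega> k x)) has_sum cis (phase \<omega> l x)) UNIV"
      by (rule has_sum_finite_neutralI[of "{l}"]) (auto simp: wmono.rep_eq)
  qed
  have wsum: "wev \<omega> (sum h J) x = (\<Sum>j\<in>J. wev \<omega> (h j) x)" for h :: "'d \<Rightarrow> 'd wiener" and J x
    by (induction J rule: infinite_finite_induct) (auto simp: wev_linear)
  have ph: "phase \<omega> (axis j 1) x = \<omega> $ j * x $ j" for j x
  proof -
    have "phase \<omega> (axis j 1) x = (\<Sum>i\<in>{j}. \<omega> $ i * x $ i)"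
      unfolding phase_def by (rule sum.mono_neutral_cong_right) (auto simp: axis_def)
    then show ?thesis by simp
  qed
  show ?case
  proof (intro exI[of _ v] allI)
    fix x
    have "torus_circle \<omega> x = (\<Sum>j\<in>UNIV. cos (\<omega> $ j * x $ j) *\<^sub>R axis j 1 + sin (\<omega> $ j * x $ j) *\<^sub>R axis j \<i>)"
      by (simp add: vec_eq_iff torus_circle_def axis_def if_distrib[of "(*\<^sub>R) _"] sum.distrib cong: if_cong)
        (simp add: complex_eq_iff)
    then have "g (torus_circle \<omega> x) = (\<Sum>j\<in>UNIV. cos (\<omega> $ j * x $ j) * g (axis j 1) + sin (\<omega> $ j * x $ j) * g (axis j \<i>))"
      by (simp add: sum add scaleR)
    moreover have "wev \<omega> v x = (\<Sum>j\<in>UNIV. of_real (cos (\<omega> $ j * x $ j) * g (axis j 1) + sin (\<omega> $ j * x $ j) * g (axis j \<i>)))"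
      unfolding v_def wsum wev_linear wev_mult wev_wconst mono phase_simps(4) ph
      by (intro sum.cong refl) (simp add: complex_eq_iff field_simps)
    ultimately show "of_real (g (torus_circle \<omega> x)) = wev \<omega> v x" by simp
  qed
next
  case (const c)
  show ?case by (intro exI[of _ "wconst (of_real c)"]) (simp add: wev_wconst)
next
  case (add f g)
  then obtain v w where "\<forall>x. of_real (f (torus_circle \<omega> x)) = wev \<omega> v x" "\<forall>x. of_real (g (torus_circle \<omega> x)) = wev \<omega> w x" by blast
  then show ?case by (intro exI[of _ "v + w"]) (simp add: wev_linear)
next
  case (mult f g)
  then obtain v w where "\<forall>x. of_real (f (torus_circle \<omega> x)) = wev \<omega> v x" "\<forall>x. of_real (g (torus_circle \<omega> x)) = wev \<omega> w x" by blast
  then show ?case by (intro exI[of _ "v * w"]) (simp add: wev_mult)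
qed

text \<open>
  A continuous periodic function is a continuous function \<open>U\<close> on the image of the cell under \<open>torus_circle\<close>: the map from the compact
  cell onto its image is closed, so continuity descends to the quotient.
\<close>

theorem wiener_dense_in_continuous:
  fixes u :: "real ^ 'd \<Rightarrow> complex"
  assumes \<omega>: "\<And>j. \<omega> $ j \<noteq> 0" and cont: "continuous_on UNIV u" and tor: "torus_fun \<omega> u" and e: "e > 0"
  shows "\<exists>v. \<forall>x. norm (u x - wev \<omega> v x) < e"
proof -
  define E where "E = torus_circle \<omega>"
  have contE: "continuous_on A E" for A
    unfolding E_def torus_circle_def[abs_def] by (intro continuous_intros)
  define T where "T = E ` torus_cell \<omega>"
  have cell: "compact (torus_cell \<omega>)" by (simp add: torus_cell_def compact_cbox)
  have T: "compact T" unfolding T_def by (rule compact_continuous_image[OF contE cell])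
  define U where "U z = u (SOME x. x \<in> torus_cell \<omega> \<and> E x = z)" for z
  have U: "U (E x) = u x" if "x \<in> torus_cell \<omega>" for x
  proof -
    have "E (SOME y. y \<in> torus_cell \<omega> \<and> E y = E x) = E x"
      by (rule someI2[of "\<lambda>y. y \<in> torus_cell \<omega> \<and> E y = E x" x]) (use that in auto)
    then show ?thesis
      unfolding U_def by (intro torus_fun_eq_if_circle_eq[OF \<omega> tor]) (simp add: E_def)
  qed
  have "continuous_on T U"
    unfolding continuous_on_closed_invariant
  proof (intro allI impI)
    fix B :: "complex set" assume B: "closed B"
    have "closed (torus_cell \<omega> \<inter> u -` B)"
      using continuous_closed_preimage[OF continuous_on_subset[OF cont] compact_imp_closed[OF cell] B] by simp
    then have "compact (torus_cell \<omega> \<inter> u -` B)"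
      using compact_Int_closed[OF cell, of "torus_cell \<omega> \<inter> u -` B"] by (simp add: Int_absorb1)
    then have "closed (E ` (torus_cell \<omega> \<inter> u -` B))"
      by (intro compact_imp_closed compact_continuous_image contE)
    moreover have "E ` (torus_cell \<omega> \<inter> u -` B) \<inter> T = U -` B \<inter> T"
      using U by (auto simp: T_def)
    ultimately show "\<exists>A. closed A \<and> A \<inter> T = U -` B \<inter> T" by blast
  qed
  from Stone_Weierstrass_polynomial_function[OF T this e] obtain g where
    g: "polynomial_function g" "\<And>z. z \<in> T \<Longrightarrow> norm (U z - g z) < e" by blast
  have "real_polynomial_function (\<lambda>z. Re (g z))" "real_polynomial_function (\<lambda>z. Im (g z))"
    using g(1) bounded_linear_Re bounded_linear_Im unfolding polynomial_function_def o_def by blast+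
  then obtain v w where vw: "\<And>x. of_real (Re (g (E x))) = wev \<omega> v x" "\<And>x. of_real (Im (g (E x))) = wev \<omega> w x"
    unfolding E_def using real_polynomial_on_torus by metis
  have gE: "g (E x) = wev \<omega> (v + wconst \<i> * w) x" for x
    using complex_eq[of "g (E x)"] by (simp add: wev_linear wev_mult wev_wconst vw)
  have wev_tor: "torus_fun \<omega> (wev \<omega> y)" for y
    unfolding wev_def by (rule torus_fun_trig_series[OF \<omega>])
  show ?thesis
  proof (intro exI[of _ "v + wconst \<i> * w"] allI)
    fix x
    obtain y d where y: "y \<in> torus_cell \<omega>" "x = y + d" "\<And>(u :: real ^ 'd \<Rightarrow> complex) z. torus_fun \<omega> u \<Longrightarrow> u (z + d) = u z"
      using torus_cell_representative[where \<omega> = \<omega> and x = x] \<omega> by blast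
    have "norm (U (E y) - g (E y)) < e" by (rule g(2)) (use y in \<open>simp add: T_def\<close>)
    then show "norm (u x - wev \<omega> (v + wconst \<i> * w) x) < e"
      by (simp only: U[OF y(1)] gE y(2) y(3)[OF tor] y(3)[OF wev_tor])
  qed
qed

text \<open>
  A continuous function with vanishing coefficients is orthogonal to all trigonometric polynomials, and by
  density to itself.
\<close>

theorem fourier_coeff_unique:
  fixes u :: "real ^ 'd \<Rightarrow> complex"
  assumes \<omega>: "\<And>j. \<omega> $ j \<noteq> 0" and cont: "continuous_on UNIV u" and tor: "torus_fun \<omega> u"
    and zero: "\<And>k. fourier_coeff \<omega> u k = 0"
  shows "u x = 0"
proof -
  have cell: "compact (torus_cell \<omega>)" by (simp add: torus_cell_def compact_cbox)
  have m: "measure lborel (torus_cell \<omega>) > 0" by (rule measure_torus_cell_pos[OF \<omega>])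
  have int0: "integral (torus_cell \<omega>) (\<lambda>x. u x * cis (- phase \<omega> k x)) = 0" for k
    using zero[of k] m by (simp add: fourier_coeff_continuous[OF cont])
  have "bounded (u ` torus_cell \<omega>)"
    by (rule compact_imp_bounded[OF compact_continuous_image[OF continuous_on_subset[OF cont] cell]]) simp
  then obtain B where B: "B > 0" "\<And>x. x \<in> torus_cell \<omega> \<Longrightarrow> norm (u x) \<le> B"
    unfolding bounded_pos by auto
  have intg: "h integrable_on torus_cell \<omega>" if "continuous_on UNIV h" for h :: "real ^ 'd \<Rightarrow> complex"
    unfolding torus_cell_def by (rule integrable_continuous[OF continuous_on_subset[OF that]]) simp
  have "norm (integral (torus_cell \<omega>) (\<lambda>x. u x * cnj (u x))) \<le> 0 + e" if e: "e > 0" for e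
  proof -
    define e' where "e' = e / (2 * B * measure lborel (torus_cell \<omega>))"
    have e': "e' > 0" using e B m by (simp add: e'_def)
    obtain v where v: "\<And>x. norm (u x - wev \<omega> v x) < e'"
      using wiener_dense_in_continuous[OF \<omega> cont tor e'] by blast
    obtain K where K: "finite K" "norm (v - wtrunc K v) < e'"
      by (rule wtrunc_approx[OF e'])
    define q where "q x = (\<Sum>k\<in>K. wcoeff v k * cis (phase \<omega> k x))" for x
    have q: "wev \<omega> (wtrunc K v) x = q x" for x
    proof (rule has_sum_unique[OF wev_has_sum])
      show "((\<lambda>k. wcoeff (wtrunc K v) k * cis (phase \<omega> k x)) has_sum q x) UNIV"
        unfolding q_def by (rule has_sum_finite_neutralI[OF K(1)]) (auto simp: wcoeff_wtrunc K(1))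
    qed
    have uq: "norm (u x - q x) \<le> 2 * e'" for x
    proof -
      have "norm (wev \<omega> (v - wtrunc K v) x) \<le> norm (v - wtrunc K v)" by (rule norm_wev_le)
      then have "norm (wev \<omega> v x - q x) < e'" using K(2) by (simp add: wev_linear q)
      with v[of x] show ?thesis using norm_triangle_ineq[of "u x - wev \<omega> v x" "wev \<omega> v x - q x"] by simp
    qed
    have contq: "continuous_on UNIV q" unfolding q_def[abs_def] by (intro continuous_intros)
    have "integral (torus_cell \<omega>) (\<lambda>x. u x * cnj (q x)) =
        integral (torus_cell \<omega>) (\<lambda>x. \<Sum>k\<in>K. cnj (wcoeff v k) * (u x * cis (- phase \<omega> k x)))"
      by (simp add: q_def sum_distrib_left cis_cnj mult_ac)
    also have "\<dots> = (\<Sum>k\<in>K. integral (torus_cell \<omega>) (\<lambda>x. cnj (wcoeff v k) * (u x * cis (- phase \<omega> k x))))"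
      by (intro integral_sum K(1) integrable_on_mult_right cell_integrable cont)
    also have "\<dots> = 0" by (simp add: int0)
    finally have "integral (torus_cell \<omega>) (\<lambda>x. u x * cnj (u x)) =
        integral (torus_cell \<omega>) (\<lambda>x. u x * cnj (u x)) - integral (torus_cell \<omega>) (\<lambda>x. u x * cnj (q x))" by simp
    also have "\<dots> = integral (torus_cell \<omega>) (\<lambda>x. u x * cnj (u x) - u x * cnj (q x))"
      by (intro integral_diff[symmetric] intg continuous_intros cont contq)
    also have "\<dots> = integral (torus_cell \<omega>) (\<lambda>x. u x * cnj (u x - q x))"
      by (simp add: algebra_simps)
    finally have eq: "integral (torus_cell \<omega>) (\<lambda>x. u x * cnj (u x)) = integral (torus_cell \<omega>) (\<lambda>x. u x * cnj (u x - q x))" .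
    have "norm (integral (torus_cell \<omega>) (\<lambda>x. u x * cnj (u x - q x))) \<le> (B * (2 * e')) * measure lborel (torus_cell \<omega>)"
      unfolding torus_cell_def
    proof (rule has_integral_bound)
      show "((\<lambda>x. u x * cnj (u x - q x)) has_integral integral (cbox 0 (\<chi> j. 2 * pi / \<bar>\<omega> $ j\<bar>)) (\<lambda>x. u x * cnj (u x - q x)))
          (cbox 0 (\<chi> j. 2 * pi / \<bar>\<omega> $ j\<bar>))"
        unfolding torus_cell_def[symmetric]
        by (intro integrable_integral intg continuous_intros cont contq)
      fix x assume "x \<in> cbox 0 (\<chi> j. 2 * pi / \<bar>\<omega> $ j\<bar>)"
      then have "x \<in> torus_cell \<omega>" by (simp add: torus_cell_def)
      then show "norm (u x * cnj (u x - q x)) \<le> B * (2 * e')"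
        using B(1) B(2)[of x] uq[of x] by (simp only: norm_mult complex_mod_cnj) (intro mult_mono; simp)
    qed (use B e' in simp)
    also have "\<dots> = e" using B m by (simp add: e'_def)
    finally show ?thesis by (simp add: eq)
  qed
  then have "norm (integral (torus_cell \<omega>) (\<lambda>x. u x * cnj (u x))) \<le> 0"
    by (rule field_le_epsilon)
  then have "integral (torus_cell \<omega>) (\<lambda>x. u x * cnj (u x)) = 0" by simp
  then have hi: "((\<lambda>x. u x * cnj (u x)) has_integral 0) (torus_cell \<omega>)"
    using integrable_integral[OF intg[of "\<lambda>x. u x * cnj (u x)"]] by (simp add: continuous_intros cont)
  have "((\<lambda>x. Re (u x * cnj (u x))) has_integral Re 0) (torus_cell \<omega>)"
    using has_integral_linear[OF hi bounded_linear_Re] by (simp add: o_def)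
  then have hi': "((\<lambda>x. (norm (u x))\<^sup>2) has_integral 0) (torus_cell \<omega>)"
    by (simp only: complex_norm_square[symmetric] Re_complex_of_real zero_complex.sel)
  have on_cell: "u y = 0" if "y \<in> torus_cell \<omega>" for y
  proof -
    have "(norm (u y))\<^sup>2 = 0"
    proof (rule has_integral_0_cbox_imp_0[OF _ _ hi'[unfolded torus_cell_def]])
      show "continuous_on (cbox 0 (\<chi> j. 2 * pi / \<bar>\<omega> $ j\<bar>)) (\<lambda>x. (norm (u x))\<^sup>2)"
        by (intro continuous_intros continuous_on_subset[OF cont]) auto
      have "(\<chi> j. pi / \<bar>\<omega> $ j\<bar>) \<in> box 0 (\<chi> j. 2 * pi / \<bar>\<omega> $ j\<bar>)"
        using \<omega> by (simp add: mem_box_cart divide_strict_right_mono)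
      then show "box 0 (\<chi> j. 2 * pi / \<bar>\<omega> $ j\<bar>) \<noteq> {}" by blast
    qed (use that in \<open>auto simp: torus_cell_def\<close>)
    then show ?thesis by simp
  qed
  obtain y d where y: "y \<in> torus_cell \<omega>" "x = y + d" "\<And>(u :: real ^ 'd \<Rightarrow> complex) z. torus_fun \<omega> u \<Longrightarrow> u (z + d) = u z"
    using torus_cell_representative[where \<omega> = \<omega> and x = x] \<omega> by blast
  show ?thesis using on_cell[OF y(1)] by (simp only: y(2) y(3)[OF tor])
qed

section \<open>Analytic functions have exponentially decaying coefficients\<close>

text \<open>
  The sequence \<open>c\<close> consists of the Taylor coefficients of \<open>u\<close> at \<open>y\<close> in the \<open>j\<close>-th coordinate direction, with a Cauchy estimate at radius \<open>\<rho>\<close>.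
\<close>

definition taylor_along :: "'d::finite \<Rightarrow> (real ^ 'd \<Rightarrow> complex) \<Rightarrow> real \<Rightarrow> real \<Rightarrow> real ^ 'd \<Rightarrow> (nat \<Rightarrow> complex) \<Rightarrow> bool"
  where "taylor_along j u \<rho> K y c \<longleftrightarrow> (\<forall>h. \<bar>h\<bar> \<le> \<rho> \<longrightarrow> (\<lambda>n. h ^ n *\<^sub>R c n) sums u (y + axis j h)) \<and>
    (\<forall>n. norm (c n) * \<rho> ^ n \<le> K)"

lemma taylor_along_mono:
  assumes "taylor_along j u \<rho> K y c" "0 \<le> \<rho>'" "\<rho>' \<le> \<rho>" "K \<le> K'"
  shows "taylor_along j u \<rho>' K' y c"
  unfolding taylor_along_def
proof (intro conjI allI impI)
  fix n
  have "norm (c n) * \<rho>' ^ n \<le> norm (c n) * \<rho> ^ n"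
    using assms(2,3) by (intro mult_left_mono power_mono) auto
  also have "\<dots> \<le> K" using assms(1) by (simp add: taylor_along_def)
  finally show "norm (c n) * \<rho>' ^ n \<le> K'" using assms(4) by simp
next
  fix h :: real assume "\<bar>h\<bar> \<le> \<rho>'"
  then show "(\<lambda>n. h ^ n *\<^sub>R c n) sums u (y + axis j h)"
    using assms(1,3) by (simp add: taylor_along_def)
qed

text \<open>
  The local expansion at \<open>x\<close> with weight \<open>0\<close> for the displacement of the centre and weight \<open>1\<close> for the increment is a Taylor series at
  every centre \<open>y\<close> near \<open>x\<close>, with uniform radius and bound. Compactness of the cell and periodicity make radius and bound global.
\<close>

lemma uniform_taylor_along:
  fixes u :: "real ^ 'd \<Rightarrow> complex"
  assumes \<omega>: "\<And>j. \<omega> $ j \<noteq> 0" and u: "u \<in> analytic_torus \<omega>"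
  shows "\<exists>\<rho>>0. \<exists>K\<ge>0. \<exists>b. \<forall>y. taylor_along j u \<rho> K y (b y)"
proof -
  have an: "real_analytic u" and tor: "torus_fun \<omega> u" using u by (auto simp: analytic_torus_def)
  have local: "\<exists>r \<rho> K. r > 0 \<and> \<rho> > 0 \<and> (\<forall>y\<in>ball x r. \<exists>c. taylor_along j u \<rho> K y c)" for x
  proof (rule real_analytic_graded_expansion[OF an, of x 0 1])
    fix r :: real and Q :: "nat \<Rightarrow> real ^ 'd \<Rightarrow> real ^ 'd \<Rightarrow> complex" and K :: real
    assume r: "r > 0"
      and Q: "\<And>\<xi> \<eta> a. norm \<xi> + norm \<eta> < r \<Longrightarrow> \<bar>a\<bar> \<le> 1 \<Longrightarrow>
         (\<lambda>D. a ^ D *\<^sub>R Q D \<xi> \<eta>) sums u (x + a ^ 0 *\<^sub>R \<xi> + a ^ 1 *\<^sub>R \<eta>)"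
      and K: "\<And>\<xi> \<eta>. norm \<xi> + norm \<eta> < r \<Longrightarrow> summable (\<lambda>D. norm (Q D \<xi> \<eta>)) \<and> (\<Sum>D. norm (Q D \<xi> \<eta>)) \<le> K"
    define \<eta> :: "real ^ 'd" where "\<eta> = (r / 3) *\<^sub>R axis j 1"
    have "\<exists>c. taylor_along j u (r / 3) K y c" if y: "y \<in> ball x (r / 2)" for y
    proof -
      have small: "norm (y - x) + norm \<eta> < r"
        using y r by (simp add: \<eta>_def dist_norm norm_minus_commute norm_axis_1)
      have "taylor_along j u (r / 3) K y (\<lambda>n. (3 / r) ^ n *\<^sub>R Q n (y - x) \<eta>)"
        unfolding taylor_along_def
      proof (intro conjI allI impI)
        fix h :: real assume h: "\<bar>h\<bar> \<le> r / 3"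
        have "(3 * h / r) *\<^sub>R \<eta> = axis j h"
          using r by (simp add: \<eta>_def vec_eq_iff axis_def)
        then show "(\<lambda>n. h ^ n *\<^sub>R (3 / r) ^ n *\<^sub>R Q n (y - x) \<eta>) sums u (y + axis j h)"
          using Q[OF small, of "3 * h / r"] h r
          by (simp add: power_mult_distrib[symmetric] abs_mult mult.commute)
      next
        fix n
        have "norm (Q n (y - x) \<eta>) \<le> (\<Sum>D. norm (Q D (y - x) \<eta>))"
          using sum_le_suminf[of "\<lambda>D. norm (Q D (y - x) \<eta>)" "{n}"] K[OF small] by simp
        then show "norm ((3 / r) ^ n *\<^sub>R Q n (y - x) \<eta>) * (r / 3) ^ n \<le> K"
          using K[OF small] r by (simp add: power_divide field_simps)
      qed
      then show ?thesis by blast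
    qed
    then show ?thesis using r by (intro exI[of _ "r / 2"] exI[of _ "r / 3"] exI[of _ K]) simp
  qed
  then obtain r \<rho> K where rho: "\<And>x. r x > 0" "\<And>x. \<rho> x > 0"
    and tay: "\<And>x y. y \<in> ball x (r x) \<Longrightarrow> \<exists>c. taylor_along j u (\<rho> x) (K x) y c"
    by metis
  have "compact (torus_cell \<omega>)" by (simp add: torus_cell_def)
  moreover have "torus_cell \<omega> \<subseteq> (\<Union>x\<in>UNIV. ball x (r x))"
    using rho(1) centre_in_ball by blast
  moreover have "\<And>x. x \<in> UNIV \<Longrightarrow> open (ball x (r x))" by simp
  ultimately obtain X where "X \<subseteq> UNIV" and X: "finite X" "torus_cell \<omega> \<subseteq> (\<Union>x\<in>X. ball x (r x))"
    by (elim compactE_image[of "torus_cell \<omega>" UNIV "\<lambda>x. ball x (r x)"]) blast+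
  define \<rho>0 where "\<rho>0 = Min (insert 1 (\<rho> ` X))"
  define K0 where "K0 = Max (insert 0 (K ` X))"
  have \<rho>0: "\<rho>0 > 0" unfolding \<rho>0_def using X(1) rho(2) by (subst Min_gr_iff) auto
  have K0: "K0 \<ge> 0" unfolding K0_def using X(1) by (intro Max_ge) auto
  have "\<exists>c. taylor_along j u \<rho>0 K0 y c" for y
  proof -
    obtain y' d where y': "y' \<in> torus_cell \<omega>" "y = y' + d" "\<And>(u :: real ^ 'd \<Rightarrow> complex) z. torus_fun \<omega> u \<Longrightarrow> u (z + d) = u z"
      using torus_cell_representative[where \<omega> = \<omega> and x = y] \<omega> by blast
    obtain x where x: "x \<in> X" "y' \<in> ball x (r x)" using X(2) y'(1) by blast
    obtain c where "taylor_along j u (\<rho> x) (K x) y' c" using tay[OF x(2)] by blast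
    then have "taylor_along j u \<rho>0 K0 y' c"
      by (rule taylor_along_mono) (use \<rho>0 x(1) X(1) in \<open>auto simp: \<rho>0_def K0_def\<close>)
    moreover have "u (y + axis j h) = u (y' + axis j h)" for h
      using y'(3)[OF tor, of "y' + axis j h"] by (simp add: y'(2) add_ac)
    ultimately have "taylor_along j u \<rho>0 K0 y c"
      by (simp add: taylor_along_def)
    then show ?thesis by blast
  qed
  then obtain b where "\<And>y. taylor_along j u \<rho>0 K0 y (b y)" by metis
  then show ?thesis using \<rho>0 K0 by blast
qed

text \<open>
  By induction, each coefficient is a uniform limit of difference quotients formed from \<open>u\<close> and the lower coefficients.
\<close>

lemma taylor_coefficient_continuous:
  fixes u :: "real ^ 'd \<Rightarrow> complex"
  assumes cont: "continuous_on UNIV u" and \<rho>: "\<rho> > 0" and b: "\<And>y. taylor_along j u \<rho> K y (b y)"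
  shows "continuous_on UNIV (\<lambda>y. b y n)"
proof (induction n rule: less_induct)
  case (less n)
  define q where "q t y = (1 / t ^ n) *\<^sub>R (u (y + axis j t) - (\<Sum>m<n. t ^ m *\<^sub>R b y m))" for t y
  have K0: "K \<ge> 0" using b[of 0] by (auto simp: taylor_along_def intro: order_trans[OF norm_ge_zero, of "b 0 0"] dest!: spec[of _ "0::nat"])
  define M where "M = 2 * K / \<rho> ^ Suc n"
  have err: "norm (q t y - b y n) \<le> t * M" if t: "0 < t" "t \<le> \<rho> / 2" for t y
  proof -
    have s: "(\<lambda>m. t ^ m *\<^sub>R b y m) sums u (y + axis j t)"
      using b[of y] t \<rho> by (simp add: taylor_along_def)
    have "(\<lambda>m. t ^ (m + n) *\<^sub>R b y (m + n)) sums (u (y + axis j t) - (\<Sum>m<n. t ^ m *\<^sub>R b y m))"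
      by (rule sums_split_initial_segment[OF s])
    from sums_scaleR_right[OF this, of "1 / t ^ n"]
    have "(\<lambda>m. t ^ m *\<^sub>R b y (m + n)) sums q t y"
      using t by (simp add: q_def power_add)
    then have "(\<lambda>m. t ^ Suc m *\<^sub>R b y (Suc m + n)) sums (q t y - b y n)"
      using sums_Suc_iff[of "\<lambda>m. t ^ m *\<^sub>R b y (m + n)" "q t y - b y n"] by simp
    moreover have "(\<lambda>m. t * (K / \<rho> ^ Suc n) * (1 / 2) ^ m) sums (t * (K / \<rho> ^ Suc n) * 2)"
      using geometric_sums[of "1 / 2 :: real"] by (intro sums_mult) simp
    moreover have "norm (t ^ Suc m *\<^sub>R b y (Suc m + n)) \<le> t * (K / \<rho> ^ Suc n) * (1 / 2) ^ m" for m
    proof -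
      have "norm (b y (Suc m + n)) \<le> K / \<rho> ^ (Suc m + n)"
        using b[of y] \<rho> by (simp add: taylor_along_def pos_le_divide_eq del: power_Suc)
      then have "norm (t ^ Suc m *\<^sub>R b y (Suc m + n)) \<le> t ^ Suc m * (K / \<rho> ^ (Suc m + n))"
        unfolding norm_scaleR using t by (intro mult_mono) auto
      also have "\<dots> = t * (K / \<rho> ^ Suc n) * (t / \<rho>) ^ m"
        by (simp add: power_add power_divide mult_ac)
      also have "\<dots> \<le> t * (K / \<rho> ^ Suc n) * (1 / 2) ^ m"
        using t \<rho> K0 by (intro mult_left_mono power_mono) (auto simp: field_simps)
      finally show ?thesis .
    qed
    ultimately have "norm (q t y - b y n) \<le> t * (K / \<rho> ^ Suc n) * 2" by (rule norm_sums_le)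
    then show ?thesis by (simp add: M_def mult_ac)
  qed
  have M0: "M \<ge> 0" using K0 \<rho> by (simp add: M_def)
  have "uniform_limit UNIV q (\<lambda>y. b y n) (at_right 0)"
  proof (rule uniform_limitI)
    fix e :: real assume e: "e > 0"
    define t0 where "t0 = min (\<rho> / 2) (e / (M + 1))"
    have t0: "t0 > 0" using e M0 \<rho> by (simp add: t0_def)
    have "\<forall>y\<in>UNIV. dist (q t y) (b y n) < e" if t: "0 < t" "t < t0" for t
    proof
      fix y
      have "t * M < e"
      proof -
        have "t * M \<le> t * (M + 1)" using t by (intro mult_left_mono) auto
        also have "\<dots> < e" using t M0 by (simp add: t0_def pos_less_divide_eq)
        finally show ?thesis .
      qed
      then show "dist (q t y) (b y n) < e"
        using err[of t y] t by (simp add: dist_norm t0_def)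
    qed
    then show "\<forall>\<^sub>F t in at_right 0. \<forall>y\<in>UNIV. dist (q t y) (b y n) < e"
      using t0 by (auto simp: eventually_at_right_field)
  qed
  moreover have "continuous_on UNIV (q t)" for t
    unfolding q_def[abs_def]
    by (intro continuous_intros less.IH continuous_on_compose2[OF cont]) auto
  ultimately show ?case
    by (intro uniform_limit_theorem[where f = q and F = "at_right 0"]) (auto intro: always_eventually)
qed

text \<open>
  Translating by \<open>h\<close> in direction \<open>j\<close> multiplies the integral \<open>I u\<close> defining the coefficient by
  \<open>exp (\<i> \<theta> h)\<close>, with \<open>\<theta> = \<omega>\<^sub>j k\<^sub>j\<close>. Integrating the Taylor series in \<open>h\<close> termwise and comparing powers of \<open>h\<close>
  gives \<open>(\<i> \<theta>)\<^sup>n I u / n! = I b\<^sub>n\<close>, where \<open>b\<^sub>n\<close> is bounded by \<open>K / \<rho>\<^sup>n\<close>; multiplying by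
  \<open>(\<rho> / 2)\<^sup>n\<close> and summing over \<open>n\<close> bounds \<open>exp (\<rho> \<bar>\<theta>\<bar> / 2) \<bar>I u\<bar>\<close>.
\<close>

lemma fourier_coeff_decay_along:
  fixes u :: "real ^ 'd \<Rightarrow> complex"
  assumes \<omega>: "\<And>j. \<omega> $ j \<noteq> 0" and u: "u \<in> analytic_torus \<omega>"
  shows "\<exists>s>0. \<exists>C. \<forall>k. norm (fourier_coeff \<omega> u k) * exp (s * \<bar>of_int (k $ j)\<bar>) \<le> C"
proof -
  have tor: "torus_fun \<omega> u" and cont: "continuous_on UNIV u"
    using u by (auto simp: analytic_torus_def intro!: continuous_at_imp_continuous_on real_analytic_imp_continuous)
  obtain \<rho> K b where \<rho>: "\<rho> > 0" and K: "K \<ge> 0" and b: "\<And>y. taylor_along j u \<rho> K y (b y)"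
    using uniform_taylor_along[where \<omega> = \<omega> and u = u and j = j] \<omega> u by blast
  note contb = taylor_coefficient_continuous[OF cont \<rho> b]
  define V where "V = measure lborel (torus_cell \<omega>)"
  have V: "V > 0" unfolding V_def by (rule measure_torus_cell_pos[OF \<omega>])
  have main: "norm (fourier_coeff \<omega> u k) * exp ((\<rho> / 2 * \<bar>\<omega> $ j\<bar>) * \<bar>of_int (k $ j)\<bar>) \<le> 2 * K" for k
  proof -
    define I where "I v = integral (torus_cell \<omega>) (\<lambda>x. v x * cis (- phase \<omega> k x))" for v :: "real ^ 'd \<Rightarrow> complex"
    define \<theta> where "\<theta> = \<omega> $ j * of_int (k $ j)"
    have bn: "norm (b y n) \<le> K / \<rho> ^ n" for y n
      using b[of y] \<rho> by (simp add: taylor_along_def pos_le_divide_eq)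
    have Ib: "norm (I (\<lambda>y. b y n)) \<le> K / \<rho> ^ n * V" for n
      unfolding I_def V_def torus_cell_def
      by (rule has_integral_bound[of _ "\<lambda>x. b x n * cis (- phase \<omega> k x)"])
        (use cell_integrable[OF contb[of n], of \<omega> k] K \<rho> bn in \<open>auto simp: torus_cell_def norm_mult integrable_integral\<close>)
    have shift: "I (\<lambda>x. u (x + axis j h)) = cis (\<theta> * h) * I u"
      if h: "0 \<le> h" "h \<le> 2 * pi / \<bar>\<omega> $ j\<bar>" for h
    proof -
      have "integral (torus_cell \<omega>) (\<lambda>x. u (x + axis j h) * cis (- phase \<omega> k (x + axis j h))) = I u"
        unfolding I_def
      proof (rule cell_integral_shift[OF _ _ \<omega> h, of "\<lambda>x. u x * cis (- phase \<omega> k x)"])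
        show "continuous_on UNIV (\<lambda>x. u x * cis (- phase \<omega> k x))"
          by (intro continuous_intros cont)
        have "cis (phase \<omega> (- k) (x + axis i (2 * pi / \<omega> $ i))) = cis (phase \<omega> (- k) x)" for x i
          using torus_fun_character[of \<omega> "- k"] \<omega> by (simp add: torus_fun_def)
        then show "torus_fun \<omega> (\<lambda>x. u x * cis (- phase \<omega> k x))"
          using tor by (simp only: torus_fun_def phase_simps(4)) simp
      qed
      moreover have "u (x + axis j h) * cis (- phase \<omega> k (x + axis j h)) =
          cis (- (\<theta> * h)) * (u (x + axis j h) * cis (- phase \<omega> k x))" for x
        by (simp add: phase_simps(1,8) \<theta>_def cis_mult mult_ac)
      ultimately have "cis (- (\<theta> * h)) * I (\<lambda>x. u (x + axis j h)) = I u"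
        unfolding I_def by simp
      then have "cis (\<theta> * h) * I u = (cis (\<theta> * h) * cis (- (\<theta> * h))) * I (\<lambda>x. u (x + axis j h))"
        by (simp only: mult.assoc)
      then show ?thesis by (simp add: cis_mult)
    qed
    have series: "(\<lambda>n. h ^ n *\<^sub>R I (\<lambda>y. b y n)) sums I (\<lambda>x. u (x + axis j h))" if h: "0 < h" "h \<le> \<rho> / 2" for h
    proof -
      let ?f = "\<lambda>n x. (h ^ n *\<^sub>R b x n) * cis (- phase \<omega> k x)"
      have us: "(\<lambda>n. ?f n x) sums (u (x + axis j h) * cis (- phase \<omega> k x))" for x
        using b[of x] h \<rho> by (intro sums_mult2) (simp add: taylor_along_def)
      have "uniform_limit (torus_cell \<omega>) (\<lambda>N x. \<Sum>n<N. ?f n x) (\<lambda>x. suminf (\<lambda>n. ?f n x)) sequentially"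
      proof (rule Weierstrass_m_test)
        fix n x
        have "norm (?f n x) \<le> h ^ n * (K / \<rho> ^ n)"
          using h bn[of x n] unfolding norm_mult norm_scaleR norm_cis mult_1_right by (intro mult_mono) auto
        also have "\<dots> = K * (h / \<rho>) ^ n" by (simp add: power_divide)
        also have "\<dots> \<le> K * (1 / 2) ^ n"
          using h \<rho> K by (intro mult_left_mono power_mono) (auto simp: field_simps)
        finally show "norm (?f n x) \<le> K * (1 / 2) ^ n" .
      qed (intro summable_mult summable_geometric, simp)
      then have "uniform_limit (torus_cell \<omega>) (\<lambda>N x. \<Sum>n<N. ?f n x) (\<lambda>x. u (x + axis j h) * cis (- phase \<omega> k x)) sequentially"
        by (simp only: sums_unique[OF us, symmetric])
      moreover have "continuous_on (torus_cell \<omega>) (\<lambda>x. \<Sum>n<N. ?f n x)" for N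
        by (intro continuous_intros continuous_on_subset[OF contb]) auto
      ultimately obtain S T where ST: "\<And>N. ((\<lambda>x. \<Sum>n<N. ?f n x) has_integral S N) (torus_cell \<omega>)"
        "((\<lambda>x. u (x + axis j h) * cis (- phase \<omega> k x)) has_integral T) (torus_cell \<omega>)" "S \<longlonglongrightarrow> T"
        unfolding torus_cell_def by (rule uniform_limit_integral_cbox) auto
      have "integral (torus_cell \<omega>) (\<lambda>x. \<Sum>n<N. ?f n x) = S N" for N by (rule integral_unique[OF ST(1)])
      then have "(\<lambda>N. integral (torus_cell \<omega>) (\<lambda>x. \<Sum>n<N. ?f n x)) \<longlonglongrightarrow> I (\<lambda>x. u (x + axis j h))"
        using ST(3) unfolding I_def integral_unique[OF ST(2)] by simp
      moreover have "integral (torus_cell \<omega>) (\<lambda>x. \<Sum>n<N. ?f n x) = (\<Sum>n<N. h ^ n *\<^sub>R I (\<lambda>y. b y n))" for N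
      proof -
        have "integral (torus_cell \<omega>) (\<lambda>x. \<Sum>n<N. ?f n x) = integral (torus_cell \<omega>) (\<lambda>x. \<Sum>n<N. h ^ n *\<^sub>R (b x n * cis (- phase \<omega> k x)))"
          by simp
        also have "\<dots> = (\<Sum>n<N. h ^ n *\<^sub>R I (\<lambda>y. b y n))"
          unfolding I_def
          by (subst integral_sum) (auto intro!: integrable_cmul cell_integrable contb)
        finally show ?thesis .
      qed
      ultimately show ?thesis unfolding sums_def by simp
    qed
    define a where "a n = I (\<lambda>y. b y n) - ((\<i> * of_real \<theta>) ^ n /\<^sub>R fact n) * I u" for n
    have a0: "a n = 0" for n
    proof (rule real_power_series_eq_0[of "\<rho> / 2" a])
      show "\<rho> / 2 > 0" using \<rho> by simp
      show "summable (\<lambda>n. (\<rho> / 2) ^ n * norm (a n))"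
      proof (rule summable_comparison_test')
        show "summable (\<lambda>n. K * V * (1 / 2) ^ n + (\<rho> / 2 * \<bar>\<theta>\<bar>) ^ n /\<^sub>R fact n * norm (I u))"
          by (intro summable_add summable_mult summable_mult2 summable_geometric sums_summable[OF exp_converges]) simp
        fix n
        have "norm (a n) \<le> K / \<rho> ^ n * V + (\<bar>\<theta>\<bar> ^ n /\<^sub>R fact n) * norm (I u)"
          unfolding a_def using Ib[of n]
          by (intro order_trans[OF norm_triangle_ineq4] add_mono) (simp_all add: norm_mult norm_power)
        then have "(\<rho> / 2) ^ n * norm (a n) \<le> (\<rho> / 2) ^ n * (K / \<rho> ^ n * V + (\<bar>\<theta>\<bar> ^ n /\<^sub>R fact n) * norm (I u))"
          using \<rho> by (intro mult_left_mono) auto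
        also have "\<dots> = K * V * (1 / 2) ^ n + (\<rho> / 2 * \<bar>\<theta>\<bar>) ^ n /\<^sub>R fact n * norm (I u)"
          using \<rho> by (simp add: power_divide power_mult_distrib field_simps)
        finally show "norm ((\<rho> / 2) ^ n * norm (a n)) \<le> K * V * (1 / 2) ^ n + (\<rho> / 2 * \<bar>\<theta>\<bar>) ^ n /\<^sub>R fact n * norm (I u)"
          using \<rho> by simp
      qed
      fix e :: real assume e: "e > 0"
      define h where "h = min (e / 2) (min (\<rho> / 2) (2 * pi / \<bar>\<omega> $ j\<bar>))"
      have h: "0 < h" "h < e" "h \<le> \<rho> / 2" "h \<le> 2 * pi / \<bar>\<omega> $ j\<bar>"
        using e \<rho> \<omega>[of j] by (auto simp: h_def)
      have "(\<lambda>n. (\<i> * of_real (\<theta> * h)) ^ n /\<^sub>R fact n * I u) sums (cis (\<theta> * h) * I u)"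
        unfolding cis_conv_exp by (intro sums_mult2 exp_converges)
      from sums_diff[OF series[OF h(1,3)] this]
      have "(\<lambda>n. h ^ n *\<^sub>R I (\<lambda>y. b y n) - (\<i> * of_real (\<theta> * h)) ^ n /\<^sub>R fact n * I u) sums 0"
        using shift[of h] h by simp
      moreover have "h ^ n *\<^sub>R I (\<lambda>y. b y n) - (\<i> * of_real (\<theta> * h)) ^ n /\<^sub>R fact n * I u = h ^ n *\<^sub>R a n" for n
        by (simp add: a_def scaleR_conv_of_real[where 'a = complex] power_mult_distrib algebra_simps)
      ultimately have "(\<lambda>n. h ^ n *\<^sub>R a n) sums 0" by simp
      then show "\<exists>z. z \<noteq> 0 \<and> \<bar>z\<bar> < e \<and> (\<lambda>n. z ^ n *\<^sub>R a n) sums 0"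
        using h by (intro exI[of _ h]) auto
    qed
    have le: "(\<rho> / 2 * \<bar>\<theta>\<bar>) ^ n /\<^sub>R fact n * norm (I u) \<le> (K * V) * (1 / 2) ^ n" for n
    proof -
      have "(\<rho> / 2 * \<bar>\<theta>\<bar>) ^ n /\<^sub>R fact n * norm (I u) = (\<rho> / 2) ^ n * norm (((\<i> * of_real \<theta>) ^ n /\<^sub>R fact n) * I u)"
        by (simp only: norm_mult norm_power power_mult_distrib norm_scaleR norm_ii norm_of_real) simp
      also have "\<dots> = (\<rho> / 2) ^ n * norm (I (\<lambda>y. b y n))"
        using a0[of n] by (simp add: a_def)
      also have "\<dots> \<le> (\<rho> / 2) ^ n * (K / \<rho> ^ n * V)"
        using \<rho> by (intro mult_left_mono Ib) simp
      also have "\<dots> = (K * V) * (1 / 2) ^ n"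
        using \<rho> by (simp add: power_divide)
      finally show ?thesis .
    qed
    have "exp (\<rho> / 2 * \<bar>\<theta>\<bar>) * norm (I u) \<le> (K * V) * 2"
      by (rule sums_le[OF le sums_mult2[OF exp_converges] sums_mult]) (use geometric_sums[of "1 / 2 :: real"] in simp)
    then have "norm (I u) / V * exp (\<rho> / 2 * \<bar>\<theta>\<bar>) \<le> 2 * K"
      using V by (simp add: field_simps)
    then show ?thesis
      using V by (simp add: fourier_coeff_continuous[OF cont] norm_divide I_def V_def \<theta>_def abs_mult mult_ac)
  qed
  show ?thesis
    by (intro exI[of _ "\<rho> / 2 * \<bar>\<omega> $ j\<bar>"] conjI exI[of _ "2 * K"] allI main) (use \<rho> \<omega>[of j] in auto)
qed

text \<open>
  The sum over a box is a product of one-dimensional geometric sums.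
\<close>

lemma exp_l1_deg_summable:
  assumes s: "s > 0"
  shows "(\<lambda>k :: int ^ 'd. exp (- (s * l1_deg k))) summable_on UNIV"
proof (rule nonneg_bdd_above_summable_on)
  define q where "q = exp (- s)"
  have q: "0 < q" "q < 1" using s by (auto simp: q_def)
  define B where "B = 2 / (1 - q)"
  have one: "(\<Sum>m\<in>{-int N..int N}. q ^ nat \<bar>m\<bar>) \<le> B" for N
  proof -
    have geo: "(\<Sum>n\<le>N. q ^ n) \<le> 1 / (1 - q)"
      using sum_le_suminf[OF summable_geometric[of q], of "{..N}"] q by (simp add: suminf_geometric)
    have "{-int N..int N} = int ` {..N} \<union> (\<lambda>n. - int n) ` {..N}"
    proof (intro equalityI subsetI)
      fix m assume "m \<in> {-int N..int N}"
      then have "m = int (nat m) \<and> nat m \<le> N \<or> m = - int (nat (- m)) \<and> nat (- m) \<le> N" by auto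
      then show "m \<in> int ` {..N} \<union> (\<lambda>n. - int n) ` {..N}" by blast
    qed auto
    then have "(\<Sum>m\<in>{-int N..int N}. q ^ nat \<bar>m\<bar>) \<le>
        (\<Sum>m\<in>int ` {..N}. q ^ nat \<bar>m\<bar>) + (\<Sum>m\<in>(\<lambda>n. - int n) ` {..N}. q ^ nat \<bar>m\<bar>)"
      using q by (simp add: sum_Un sum_nonneg)
    also have "\<dots> = (\<Sum>n\<le>N. q ^ n) + (\<Sum>n\<le>N. q ^ n)"
      by (subst (1 2) sum.reindex) (auto simp: inj_on_def)
    also have "\<dots> \<le> B" using geo by (simp add: B_def)
    finally show ?thesis .
  qed
  have prod: "exp (- (s * l1_deg k)) = (\<Prod>j\<in>UNIV. q ^ nat \<bar>k $ j\<bar>)" for k :: "int ^ 'd"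
    by (simp add: q_def l1_deg_def exp_of_nat2_mult[symmetric] sum_distrib_left sum_negf[symmetric] exp_sum)
  have "(\<Sum>k\<in>F. exp (- (s * l1_deg k))) \<le> B ^ CARD('d)" if F: "finite F" for F :: "(int ^ 'd) set"
  proof -
    define N where "N = (\<Sum>k\<in>F. \<Sum>j\<in>UNIV. nat \<bar>k $ j\<bar>)"
    have N: "nat \<bar>k $ j\<bar> \<le> N" if "k \<in> F" for k j
    proof -
      have "nat \<bar>k $ j\<bar> \<le> (\<Sum>j\<in>UNIV. nat \<bar>k $ j\<bar>)" by (rule member_le_sum) auto
      also have "\<dots> \<le> N" unfolding N_def by (rule member_le_sum) (use that F in auto)
      finally show ?thesis .
    qed
    let ?P = "PiE (UNIV :: 'd set) (\<lambda>_. {-int N..int N})"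
    have "(\<Sum>k\<in>F. exp (- (s * l1_deg k))) = (\<Sum>g\<in>($) ` F. \<Prod>j\<in>UNIV. q ^ nat \<bar>g j\<bar>)"
      by (subst sum.reindex) (auto simp: prod inj_on_def vec_eq_iff fun_eq_iff)
    also have "\<dots> \<le> (\<Sum>g\<in>?P. \<Prod>j\<in>UNIV. q ^ nat \<bar>g j\<bar>)"
    proof (rule sum_mono2)
      show "finite ?P" by (rule finite_PiE) auto
      show "($) ` F \<subseteq> ?P"
      proof clarify
        fix k assume "k \<in> F"
        then have "nat \<bar>k $ j\<bar> \<le> N" for j by (rule N)
        then have "- int N \<le> k $ j \<and> k $ j \<le> int N" for j
          using \<open>nat \<bar>k $ j\<bar> \<le> N\<close> unfolding nat_le_iff abs_le_iff by linarith
        then show "($) k \<in> ?P" by auto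
      qed
      show "0 \<le> (\<Prod>j\<in>UNIV. q ^ nat \<bar>g j\<bar>)" for g using q by (intro prod_nonneg) auto
    qed
    also have "\<dots> = (\<Prod>j\<in>(UNIV :: 'd set). \<Sum>m\<in>{-int N..int N}. q ^ nat \<bar>m\<bar>)"
      by (rule prod_sum_PiE[symmetric]) auto
    also have "\<dots> = (\<Sum>m\<in>{-int N..int N}. q ^ nat \<bar>m\<bar>) ^ CARD('d)" by simp
    also have "\<dots> \<le> B ^ CARD('d)"
      using q by (intro power_mono one sum_nonneg) auto
    finally show ?thesis .
  qed
  then show "bdd_above (sum (\<lambda>k :: int ^ 'd. exp (- (s * l1_deg k))) ` {F. F \<subseteq> UNIV \<and> finite F})"
    by (intro bdd_aboveI[of _ "B ^ CARD('d)"]) auto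
qed simp

text \<open>
  The largest component \<open>\<bar>k\<^sub>j\<bar>\<close> is at least \<open>\<bar>k\<bar> / d\<close>, so decay in each single component gives decay in
  \<open>\<bar>k\<bar>\<close>. Half of the rate is spent on the weight, and the other half makes the sum finite.
\<close>

lemma fourier_coeff_weighted_summable:
  fixes u :: "real ^ 'd \<Rightarrow> complex"
  assumes \<omega>: "\<And>j. \<omega> $ j \<noteq> 0" and u: "u \<in> analytic_torus \<omega>"
  shows "\<exists>\<nu>>1. (\<lambda>k. norm (fourier_coeff \<omega> u k) * l1_weight \<nu> k) summable_on UNIV"
proof -
  have "\<forall>j. \<exists>s C. s > 0 \<and> (\<forall>k. norm (fourier_coeff \<omega> u k) * exp (s * \<bar>of_int (k $ j)\<bar>) \<le> C)"
    using fourier_coeff_decay_along[where \<omega> = \<omega> and u = u] \<omega> u by blast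
  then obtain s C where s: "\<And>j. s j > 0"
    and C: "\<And>j k. norm (fourier_coeff \<omega> u k) * exp (s j * \<bar>of_int (k $ j)\<bar>) \<le> C j"
    by metis
  define s0 where "s0 = Min (range s)"
  define C0 where "C0 = Max (range C)"
  define \<sigma> where "\<sigma> = s0 / (2 * real CARD('d))"
  have s0: "s0 > 0" unfolding s0_def using s by (subst Min_gr_iff) auto
  have \<sigma>: "\<sigma> > 0" using s0 by (simp add: \<sigma>_def)
  have bound: "norm (fourier_coeff \<omega> u k) * exp (2 * \<sigma> * l1_deg k) \<le> C0" for k
  proof -
    obtain j where j: "\<And>i. nat \<bar>k $ i\<bar> \<le> nat \<bar>k $ j\<bar>"
    proof -
      have "Max (range (\<lambda>i. nat \<bar>k $ i\<bar>)) \<in> range (\<lambda>i. nat \<bar>k $ i\<bar>)" by (rule Max_in) auto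
      then obtain j where "Max (range (\<lambda>i. nat \<bar>k $ i\<bar>)) = nat \<bar>k $ j\<bar>" by blast
      then have "nat \<bar>k $ i\<bar> \<le> nat \<bar>k $ j\<bar>" for i
        using Max_ge[of "range (\<lambda>i. nat \<bar>k $ i\<bar>)" "nat \<bar>k $ i\<bar>"] by auto
      then show ?thesis by (rule that)
    qed
    have "(\<Sum>i\<in>UNIV. nat \<bar>k $ i\<bar>) \<le> (\<Sum>i\<in>(UNIV :: 'd set). nat \<bar>k $ j\<bar>)" by (intro sum_mono j)
    then have "real (\<Sum>i\<in>UNIV. nat \<bar>k $ i\<bar>) \<le> real (CARD('d) * nat \<bar>k $ j\<bar>)" by (simp only: of_nat_le_iff sum_constant of_nat_id)
    then have "l1_deg k \<le> real CARD('d) * \<bar>of_int (k $ j)\<bar>" by (simp add: l1_deg_def del: of_nat_sum)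
    then have "2 * \<sigma> * l1_deg k \<le> 2 * \<sigma> * (real CARD('d) * \<bar>of_int (k $ j)\<bar>)"
      using \<sigma> by (intro mult_left_mono) auto
    also have "\<dots> = s0 * \<bar>of_int (k $ j)\<bar>" by (simp add: \<sigma>_def)
    also have "\<dots> \<le> s j * \<bar>of_int (k $ j)\<bar>" by (intro mult_right_mono) (auto simp: s0_def)
    finally have "norm (fourier_coeff \<omega> u k) * exp (2 * \<sigma> * l1_deg k) \<le> norm (fourier_coeff \<omega> u k) * exp (s j * \<bar>of_int (k $ j)\<bar>)"
      by (intro mult_left_mono) auto
    also have "\<dots> \<le> C0" unfolding C0_def by (intro order_trans[OF C Max_ge]) auto
    finally show ?thesis .
  qed
  have "(\<lambda>k. norm (fourier_coeff \<omega> u k) * l1_weight (exp \<sigma>) k) summable_on UNIV"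
  proof (rule summable_on_comparison_test[OF summable_on_cmult_right[OF exp_l1_deg_summable[OF \<sigma>], of C0]])
    fix k :: "int ^ 'd"
    have "norm (fourier_coeff \<omega> u k) * l1_weight (exp \<sigma>) k = (norm (fourier_coeff \<omega> u k) * exp (2 * \<sigma> * l1_deg k)) * exp (- (\<sigma> * l1_deg k))"
      by (simp add: l1_weight_exp mult.assoc exp_add[symmetric])
    also have "\<dots> \<le> C0 * exp (- (\<sigma> * l1_deg k))" by (intro mult_right_mono bound) simp
    finally show "norm (fourier_coeff \<omega> u k) * l1_weight (exp \<sigma>) k \<le> C0 * exp (- (\<sigma> * l1_deg k))" .
  qed (simp add: l1_weight_exp)
  then show ?thesis using \<sigma> by (intro exI[of _ "exp \<sigma>"]) simp
qed

theorem fourier_series_of_analytic: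
  fixes u :: "real ^ 'd \<Rightarrow> complex"
  assumes \<omega>: "\<And>j. \<omega> $ j \<noteq> 0" and u: "u \<in> analytic_torus \<omega>"
  shows "u = trig_series \<omega> (fourier_coeff \<omega> u)"
proof
  fix x
  have tor: "torus_fun \<omega> u" and cont: "continuous_on UNIV u"
    using u by (auto simp: analytic_torus_def intro!: continuous_at_imp_continuous_on real_analytic_imp_continuous)
  obtain \<nu> where \<nu>: "\<nu> > 1" "(\<lambda>k. norm (fourier_coeff \<omega> u k) * l1_weight \<nu> k) summable_on UNIV"
    using fourier_coeff_weighted_summable[where \<omega> = \<omega> and u = u] \<omega> u by blast
  have abs: "(\<lambda>k. norm (fourier_coeff \<omega> u k)) summable_on UNIV"
    by (rule summable_imp_abs_summable_weight[OF _ \<nu>(2)]) (use \<nu>(1) in simp)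
  let ?w = "trig_series \<omega> (fourier_coeff \<omega> u)"
  have cw: "continuous_on UNIV ?w" by (rule continuous_on_trig_series[OF abs])
  have "u x - ?w x = 0"
  proof (rule fourier_coeff_unique[where \<omega> = \<omega> and u = "\<lambda>x. u x - ?w x"])
    show "continuous_on UNIV (\<lambda>x. u x - ?w x)" by (intro continuous_intros cont cw)
    show "torus_fun \<omega> (\<lambda>x. u x - ?w x)"
      using tor torus_fun_trig_series[OF \<omega>, of "fourier_coeff \<omega> u"] by (simp add: torus_fun_def)
    show "fourier_coeff \<omega> (\<lambda>x. u x - ?w x) k = 0" for k
      by (simp add: fourier_coeff_diff[OF cont cw] fourier_coeff_trig_series[OF \<omega> abs])
  qed (rule \<omega>)
  then show "u x = ?w x" by simp
qed

text \<open>
  Truncating the Fourier series leaves a tail that is small in a weighted norm, hence small on a fixed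
  strip. The strip may depend on \<open>u\<close>, as is to be expected from an inductive limit.
\<close>

theorem wiener_dense_in_analytic:
  fixes u :: "real ^ 'd \<Rightarrow> complex"
  assumes \<omega>: "\<And>j. \<omega> $ j \<noteq> 0" and u: "u \<in> analytic_torus \<omega>"
  shows "\<exists>\<rho>>0. \<forall>e>0. \<exists>v :: 'd wiener. (\<lambda>x. wev \<omega> v x - u x) \<in> strip_ball \<omega> \<rho> e"
proof -
  let ?c = "fourier_coeff \<omega> u"
  obtain \<nu> where \<nu>: "\<nu> > 1" "(\<lambda>k. norm (?c k) * l1_weight \<nu> k) summable_on UNIV"
    using fourier_coeff_weighted_summable[where \<omega> = \<omega> and u = u] \<omega> u by blast
  have abs: "(\<lambda>k. norm (?c k)) summable_on UNIV"
    by (rule summable_imp_abs_summable_weight[OF _ \<nu>(2)]) (use \<nu>(1) in simp)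
  show ?thesis
  proof (rule trig_series_in_strip_ball[OF \<omega> \<nu>(1)])
    fix \<rho> :: real
    assume \<rho>: "\<rho> > 0" and ball: "\<And>c \<epsilon>. (\<lambda>k. norm (c k) * l1_weight \<nu> k) summable_on UNIV \<Longrightarrow>
      (\<Sum>\<^sub>\<infinity>k. norm (c k) * l1_weight \<nu> k) \<le> \<epsilon> \<Longrightarrow> trig_series \<omega> c \<in> strip_ball \<omega> \<rho> \<epsilon>"
    have "\<exists>v :: 'd wiener. (\<lambda>x. wev \<omega> v x - u x) \<in> strip_ball \<omega> \<rho> e" if e: "e > 0" for e
    proof -
      obtain A where A: "finite A" "(\<lambda>k. norm (?c k - cutoff A ?c k) * l1_weight \<nu> k) summable_on UNIV"
        "(\<Sum>\<^sub>\<infinity>k. norm (?c k - cutoff A ?c k) * l1_weight \<nu> k) < e"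
        by (rule cutoff_tail_small[OF \<nu>(2) e])
      define v :: "'d wiener" where "v = (\<Sum>k\<in>A. wmono k (?c k))"
      have "wcoeff v = cutoff A ?c"
        using A(1) by (auto simp: fun_eq_iff v_def wcoeff_sum wmono.rep_eq cutoff_def)
      then have v: "wev \<omega> v x = trig_series \<omega> (cutoff A ?c) x" for x by (simp add: wev_def)
      have cA: "(\<lambda>k. norm (cutoff A ?c k)) summable_on UNIV"
        by (rule finite_nonzero_values_imp_summable_on) (auto intro: finite_subset[OF _ A(1)] simp: cutoff_def)
      have "wev \<omega> v x - u x = trig_series \<omega> (\<lambda>k. cutoff A ?c k - ?c k) x" for x
        unfolding v trig_series_diff[OF cA abs] fourier_series_of_analytic[OF \<omega> u, symmetric] ..
      then have "(\<lambda>x. wev \<omega> v x - u x) = trig_series \<omega> (\<lambda>k. cutoff A ?c k - ?c k)" by auto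
      moreover have "trig_series \<omega> (\<lambda>k. cutoff A ?c k - ?c k) \<in> strip_ball \<omega> \<rho> e"
        by (rule ball) (use A(2,3) in \<open>simp_all add: norm_minus_commute\<close>)
      ultimately show ?thesis by (intro exI[of _ v]) simp
    qed
    then show ?thesis using \<rho> by blast
  qed
qed

section \<open>From the Wiener algebra to the Banach space\<close>

lemma wev_in_analytic_torus:
  assumes "\<And>j. \<omega> $ j \<noteq> 0"
  shows "wev \<omega> v \<in> analytic_torus \<omega>"
  using real_analytic_trig_series[OF _ wcoeff_summable, of \<omega> v] torus_fun_trig_series[OF assms, of "wcoeff v"]
  by (simp add: analytic_torus_def wev_def)

text \<open>
  What continuity of the embedding means for differences with a holomorphic extension to a fixed strip: every neighbourhood of zero contains a ball of the space of that strip.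
\<close>

lemma embedding_continuous_on_strips:
  fixes fn :: "'x::banach \<Rightarrow> real ^ 'd \<Rightarrow> complex"
  assumes emb: "analytic_dense_embedded \<omega> fn" and u0: "u0 \<in> analytic_torus \<omega>" and \<rho>: "\<rho> > 0" and e: "e > 0"
  shows "\<exists>\<delta>>0. \<forall>u\<in>analytic_torus \<omega>. (\<lambda>x. u x - u0 x) \<in> strip_ball \<omega> \<rho> \<delta> \<longrightarrow> norm (inv fn u - inv fn u0) < e"
proof -
  define W where "W = {u \<in> topspace (analytic_topology \<omega>). inv fn u \<in> ball (inv fn u0) e}"
  have "continuous_map (analytic_topology \<omega>) euclidean (inv fn)"
    using emb by (simp add: analytic_dense_embedded_def)
  then have "openin (analytic_topology \<omega>) W"
    unfolding W_def by (rule openin_continuous_map_preimage) simp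
  then have "analytic_open \<omega> W" by (simp add: openin_analytic_topology)
  moreover have "u0 \<in> W" using u0 e by (simp add: W_def topspace_analytic_topology)
  ultimately obtain V where V: "analytic_nbhd_zero \<omega> V" "{v \<in> analytic_torus \<omega>. (\<lambda>x. v x - u0 x) \<in> V} \<subseteq> W"
    unfolding analytic_open_def by blast
  obtain \<delta> where \<delta>: "\<delta> > 0" "strip_ball \<omega> \<rho> \<delta> \<subseteq> V"
    using V(1) \<rho> unfolding analytic_nbhd_zero_def by blast
  have "norm (inv fn u - inv fn u0) < e" if "u \<in> analytic_torus \<omega>" "(\<lambda>x. u x - u0 x) \<in> strip_ball \<omega> \<rho> \<delta>" for u
  proof -
    have "u \<in> W" using V(2) \<delta>(2) that by blast
    then show ?thesis by (simp add: W_def dist_norm norm_minus_commute)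
  qed
  then show ?thesis using \<delta>(1) by blast
qed

text \<open>
  The unit ball of the Wiener algebra is bounded on a fixed strip, so a neighbourhood of zero absorbs it. Linearity is inherited from the evaluation at points, by injectivity.
\<close>

lemma wiener_embedding_bounded_linear:
  fixes fn :: "'x::banach \<Rightarrow> real ^ 'd \<Rightarrow> complex"
  assumes \<omega>: "\<And>j. \<omega> $ j \<noteq> 0" and fs: "torus_function_space \<omega> fn" and emb: "analytic_dense_embedded \<omega> fn"
  shows "bounded_linear (\<lambda>v :: 'd wiener. inv fn (wev \<omega> v))"
proof -
  define \<iota> where "\<iota> v = inv fn (wev \<omega> v)" for v :: "'d wiener"
  have lin: "\<And>x. linear (\<lambda>\<xi>. fn \<xi> x)" and inj: "inj fn"
    using fs by (auto simp: torus_function_space_def)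
  have fn\<iota>: "fn (\<iota> v) = wev \<omega> v" for v
  proof -
    have "wev \<omega> v \<in> range fn"
      using wev_in_analytic_torus[OF \<omega>, of v] emb by (auto simp: analytic_dense_embedded_def)
    then show ?thesis unfolding \<iota>_def by (rule f_inv_into_f)
  qed
  have add: "\<iota> (v + w) = \<iota> v + \<iota> w" for v w
    by (rule injD[OF inj]) (simp add: fun_eq_iff fn\<iota> linear_add[OF lin] wev_linear)
  have scale: "\<iota> (c *\<^sub>R v) = c *\<^sub>R \<iota> v" for c v
    by (rule injD[OF inj]) (simp add: fun_eq_iff fn\<iota> linear_scale[OF lin] wev_linear)
  have \<iota>0: "\<iota> 0 = 0" using scale[of 0 0] by simp
  have "\<exists>\<delta>>0. \<forall>v. norm v \<le> \<delta> \<longrightarrow> norm (\<iota> v) < 1"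
  proof (rule trig_series_in_strip_ball[OF \<omega>, of 2])
    fix \<rho> :: real
    assume \<rho>: "\<rho> > 0" and ball: "\<And>c \<epsilon>. (\<lambda>k. norm (c k) * l1_weight 2 k) summable_on UNIV \<Longrightarrow>
      (\<Sum>\<^sub>\<infinity>k. norm (c k) * l1_weight 2 k) \<le> \<epsilon> \<Longrightarrow> trig_series \<omega> c \<in> strip_ball \<omega> \<rho> \<epsilon>"
    obtain \<delta> where \<delta>: "\<delta> > 0" "\<And>u. u \<in> analytic_torus \<omega> \<Longrightarrow> (\<lambda>x. u x - wev \<omega> 0 x) \<in> strip_ball \<omega> \<rho> \<delta> \<Longrightarrow>
        norm (inv fn u - inv fn (wev \<omega> (0 :: 'd wiener))) < 1"
      using embedding_continuous_on_strips[OF emb wev_in_analytic_torus[OF \<omega>, of 0] \<rho>, of 1] by auto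
    have "norm (\<iota> v) < 1" if "norm v \<le> \<delta>" for v
    proof -
      have "wev \<omega> v \<in> strip_ball \<omega> \<rho> \<delta>"
        unfolding wev_def by (rule ball[OF wcoeff_summable]) (use that in \<open>simp add: norm_wiener.rep_eq\<close>)
      then have "norm (\<iota> v - \<iota> 0) < 1"
        unfolding \<iota>_def by (intro \<delta>(2) wev_in_analytic_torus[OF \<omega>]) (simp add: wev_linear)
      then show ?thesis by (simp add: \<iota>0)
    qed
    then show ?thesis using \<delta>(1) by blast
  qed simp
  then obtain \<delta> where \<delta>: "\<delta> > 0" "\<And>v. norm v \<le> \<delta> \<Longrightarrow> norm (\<iota> v) < 1" by blast
  have "bounded_linear \<iota>"
  proof (rule bounded_linear_intro[of _ "1 / \<delta>"])
    fix v
    show "norm (\<iota> v) \<le> norm v * (1 / \<delta>)"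
    proof (cases "v = 0")
      case False
      then have "norm (\<iota> ((\<delta> / norm v) *\<^sub>R v)) < 1" using \<delta> by simp
      then show ?thesis using False \<delta>(1) by (simp add: scale field_simps)
    qed (simp add: \<iota>0)
  qed (simp_all add: add scale)
  then show ?thesis by (simp add: \<iota>_def[abs_def])
qed

lemma wiener_dense_in_embedding:
  fixes fn :: "'x::banach \<Rightarrow> real ^ 'd \<Rightarrow> complex" and \<xi> :: 'x
  assumes \<omega>: "\<And>j. \<omega> $ j \<noteq> 0" and emb: "analytic_dense_embedded \<omega> fn" and e: "e > 0"
  shows "\<exists>v :: 'd wiener. norm (inv fn (wev \<omega> v) - \<xi>) < e"
proof -
  have "\<xi> \<in> closure (inv fn ` analytic_torus \<omega>)"
    using emb by (simp add: analytic_dense_embedded_def)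
  then obtain u where u: "u \<in> analytic_torus \<omega>" "norm (inv fn u - \<xi>) < e / 2"
    using e by (auto simp: closure_approachable dist_norm dest: spec[of _ "e / 2"])
  obtain \<rho> where \<rho>: "\<rho> > 0" and dense: "\<And>d. d > 0 \<Longrightarrow> \<exists>v :: 'd wiener. (\<lambda>x. wev \<omega> v x - u x) \<in> strip_ball \<omega> \<rho> d"
    using wiener_dense_in_analytic[where \<omega> = \<omega> and u = u] \<omega> u(1) by blast
  obtain \<delta> where \<delta>: "\<delta> > 0" and near: "\<And>w. w \<in> analytic_torus \<omega> \<Longrightarrow>
      (\<lambda>x. w x - u x) \<in> strip_ball \<omega> \<rho> \<delta> \<Longrightarrow> norm (inv fn w - inv fn u) < e / 2"
    using embedding_continuous_on_strips[OF emb u(1) \<rho>, of "e / 2"] e by auto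
  obtain v :: "'d wiener" where "(\<lambda>x. wev \<omega> v x - u x) \<in> strip_ball \<omega> \<rho> \<delta>" using dense[OF \<delta>] by blast
  then have "norm (inv fn (wev \<omega> v) - inv fn u) < e / 2" by (rule near[OF wev_in_analytic_torus[OF \<omega>]])
  then have "norm (inv fn (wev \<omega> v) - \<xi>) < e"
    using u(2) norm_triangle_ineq[of "inv fn (wev \<omega> v) - inv fn u" "inv fn u - \<xi>"] by simp
  then show ?thesis ..
qed

text \<open>
  The expansion of \<open>F\<close> at zero, with weights \<open>1\<close> for constants and \<open>p\<close> for perturbations, is pulled back to the Wiener algebra along the
  embedding \<open>\<iota>\<close>. Since all terms of positive weight vanish on the whole range of \<open>\<iota>\<close>, and not only
  for arguments with small Wiener norm, \<open>F\<close> is constant on all elements of this range with small norm in \<open>X\<close>, and these are dense in a ball of \<open>X\<close>.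
\<close>

theorem theorem1p6:
  fixes \<omega> :: "real ^ 'd"
    and p :: nat
    and f :: "complex \<Rightarrow> complex"
    and fn :: "'x::banach \<Rightarrow> real ^ 'd \<Rightarrow> complex"
    and F :: "'x \<Rightarrow> real"
  assumes "\<And>j. \<omega> $ j \<noteq> 0"
    and "p \<ge> 2"
    and "power_series_conj f"
    and "f 0 \<noteq> 0"
    and "torus_function_space \<omega> fn"
    and "analytic_dense_embedded \<omega> fn"
    and "real_analytic F"
    and "\<And>J u t s. nls_solution \<omega> p f J u \<Longrightarrow> s \<ge> 0 \<Longrightarrow> t \<in> J \<Longrightarrow> t + s \<in> J \<Longrightarrow>
           F (inv fn (u t)) \<ge> F (inv fn (u (t + s)))"
  shows "F constant_on UNIV"
proof -
  note \<omega> = assms(1) and p = assms(2) and emb = assms(6) and F = assms(7) and mono = assms(8)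
  define \<iota> where "\<iota> v = inv fn (wev \<omega> v)" for v :: "'d wiener"
  interpret \<iota>: bounded_linear \<iota>
    unfolding \<iota>_def[abs_def] by (rule wiener_embedding_bounded_linear[OF \<omega> assms(5,6)])
  have contF: "continuous_on UNIV F"
    by (intro continuous_at_imp_continuous_on ballI real_analytic_imp_continuous[OF F])
  have "\<exists>r>0. \<forall>v. norm (\<iota> v) < r \<longrightarrow> F (\<iota> v) = F 0"
  proof (rule real_analytic_graded_expansion[OF F, of 0 1 p])
    fix r :: real and Q :: "nat \<Rightarrow> 'x \<Rightarrow> 'x \<Rightarrow> real" and Kq :: real
    assume r: "r > 0"
      and Q: "\<And>\<xi> \<eta> a. norm \<xi> + norm \<eta> < r \<Longrightarrow> \<bar>a\<bar> \<le> 1 \<Longrightarrow>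
         (\<lambda>D. a ^ D *\<^sub>R Q D \<xi> \<eta>) sums F (0 + a ^ 1 *\<^sub>R \<xi> + a ^ p *\<^sub>R \<eta>)"
      and Kq: "\<And>\<xi> \<eta>. norm \<xi> + norm \<eta> < r \<Longrightarrow> summable (\<lambda>D. norm (Q D \<xi> \<eta>)) \<and> (\<Sum>D. norm (Q D \<xi> \<eta>)) \<le> Kq"
      and scale: "\<And>D a \<xi> \<eta>. Q D (a ^ 1 *\<^sub>R \<xi>) (a ^ p *\<^sub>R \<eta>) = a ^ D *\<^sub>R Q D \<xi> \<eta>"
    obtain L where L: "L > 0" "\<And>v. norm (\<iota> v) \<le> norm v * L" using \<iota>.pos_bounded by blast
    have \<iota>_const: "\<iota> (wconst (of_real \<epsilon> * c)) = \<epsilon> *\<^sub>R \<iota> (wconst c)" for \<epsilon> c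
      by (simp add: wconst_simps \<iota>.scaleR)
    have small: "norm (\<iota> (wconst c)) + norm (\<iota> z) < r" if "norm c + norm z < r / L" for c z
    proof -
      have "norm (\<iota> (wconst c)) + norm (\<iota> z) \<le> (norm c + norm z) * L"
        using L(2)[of "wconst c"] L(2)[of z] by (simp add: wconst_simps distrib_right)
      also have "\<dots> < r" using that L(1) by (simp add: pos_less_divide_eq)
      finally show ?thesis .
    qed
    have vanish: "Q D (\<iota> (wconst c)) (\<iota> z) = 0" if D: "D \<ge> 1" for D c z
    proof (rule wiener_nonlinearity[of f p \<omega>, OF assms(3)])
      show "p \<ge> 1" using p by simp
      fix R :: "'d wiener \<Rightarrow> 'd wiener" and K
      assume R: "K \<ge> 0" "\<And>w x. wev \<omega> (wconst (f 0) * w ^ p + R w) x = wev \<omega> w x ^ p * f (wev \<omega> w x)"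
        "\<And>b. R (wconst b) = wconst (b ^ p * f b - f 0 * b ^ p)"
        "\<And>\<rho> u v. norm u \<le> \<rho> \<Longrightarrow> norm v \<le> \<rho> \<Longrightarrow> \<rho> \<le> 1 \<Longrightarrow> norm (R u - R v) \<le> K * \<rho> ^ p * norm (u - v)"
        "R 0 = 0"
      interpret monotone_functional \<omega> p f R K "\<lambda>u. F (inv fn u)" "\<lambda>D c z. Q D (\<iota> (wconst c)) (\<iota> z)" "r / L" Kq
      proof
        fix T u assume "nls_solution \<omega> p f {0..T} u" "(0::real) \<le> T"
        then show "F (inv fn (u T)) \<le> F (inv fn (u 0))" using mono[of "{0..T}" u T 0] by simp
      next
        fix c :: complex and z :: "'d wiener" and \<epsilon> :: real assume "norm c + norm z < r / L" "\<bar>\<epsilon>\<bar> \<le> 1"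
        then show "(\<lambda>D. \<epsilon> ^ D * Q D (\<iota> (wconst c)) (\<iota> z)) sums F (inv fn (wev \<omega> (wconst (of_real \<epsilon> * c) + \<epsilon> ^ p *\<^sub>R z)))"
          using Q[OF small, of c z \<epsilon>] unfolding \<iota>_def[symmetric] by (simp add: \<iota>.add \<iota>.scaleR \<iota>_const)
      next
        fix c :: complex and z :: "'d wiener" assume "norm c + norm z < r / L"
        then show "summable (\<lambda>D. norm (Q D (\<iota> (wconst c)) (\<iota> z))) \<and> (\<Sum>D. norm (Q D (\<iota> (wconst c)) (\<iota> z))) \<le> Kq"
          by (rule Kq[OF small])
      next
        show "Q D (\<iota> (wconst (of_real \<epsilon> * c))) (\<iota> (\<epsilon> ^ p *\<^sub>R z)) = \<epsilon> ^ D * Q D (\<iota> (wconst c)) (\<iota> z)" for D \<epsilon> c z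
          using scale[of D \<epsilon> "\<iota> (wconst c)" "\<iota> z"] by (simp add: \<iota>.scaleR \<iota>_const)
      next
        show "continuous_on UNIV (\<lambda>v :: 'd wiener. F (inv fn (wev \<omega> v)))"
          unfolding \<iota>_def[symmetric] by (intro continuous_on_compose2[OF contF] \<iota>.continuous_on continuous_on_id) auto
      qed (use \<omega> p R r L(1) assms(4) in simp_all)
      show ?thesis by (rule all_terms_vanish[OF D])
    qed
    have "F (\<iota> v) = F 0" if v: "norm (\<iota> v) < r" for v
    proof -
      have "(\<lambda>D. 1 ^ D * Q D 0 (\<iota> v)) sums F (\<iota> v)" "(\<lambda>D. 0 ^ D * Q D 0 (\<iota> v)) sums F 0"
        using Q[of 0 "\<iota> v" 1] Q[of 0 "\<iota> v" 0] v p by (simp_all add: power_0_left)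
      moreover have "(\<lambda>D. 1 ^ D * Q D 0 (\<iota> v)) = (\<lambda>D. 0 ^ D * Q D 0 (\<iota> v))"
        using vanish[of _ 0 v] by (auto simp: power_0_left fun_eq_iff wconst_simps \<iota>.zero)
      ultimately show ?thesis using sums_unique2 by metis
    qed
    then show ?thesis using r by blast
  qed
  then obtain r where r: "r > 0" and loc: "\<And>v. norm (\<iota> v) < r \<Longrightarrow> F (\<iota> v) = F 0" by blast
  have "F \<xi> = F 0" if \<xi>: "norm \<xi> < r" for \<xi>
  proof -
    have "norm (F \<xi> - F 0) \<le> 0 + e" if e: "e > 0" for e
    proof -
      obtain d where d: "d > 0" "\<And>\<eta>. dist \<eta> \<xi> < d \<Longrightarrow> dist (F \<eta>) (F \<xi>) < e"
        using real_analytic_imp_continuous[OF F, of \<xi>] e unfolding continuous_at_eps_delta dist_norm by blast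
      obtain v :: "'d wiener" where v: "norm (\<iota> v - \<xi>) < min d (r - norm \<xi>)"
        using wiener_dense_in_embedding[where \<omega> = \<omega> and fn = fn and \<xi> = \<xi> and e = "min d (r - norm \<xi>)"] \<omega> emb d(1) \<xi>
        unfolding \<iota>_def by auto
      have "norm (\<iota> v) < r"
        using v norm_triangle_ineq[of "\<iota> v - \<xi>" \<xi>] by simp
      then show ?thesis
        using d(2)[of "\<iota> v"] v loc[of v] by (simp add: dist_norm abs_minus_commute)
    qed
    then have "norm (F \<xi> - F 0) \<le> 0" by (rule field_le_epsilon)
    then show ?thesis by simp
  qed
  then have "F \<xi> = F 0" for \<xi> by (rule real_analytic_constant_if_locally_constant[OF F r])
  then show ?thesis by (auto simp: constant_on_def)
qed

end
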